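(* Let $\beta\in i\mathfrak u$. The number of compact $(U^{\mathbb C})^{\beta+}$-orbits in $Z$ is equal to the number of compact $U^{\mathbb C}$-orbits in $Z$. Moreover, any closed $(U^{\mathbb C})^{\beta+}$-orbit arises as $\max_{\tilde{\mathcal O}}(\beta)$, where $\tilde{\mathcal O}$ is a compact $U^{\mathbb C}$-orbit and $\max_{\tilde{\mathcal O}}(\beta)=\{p\in\tilde{\mathcal O}:\ \mu^{-i\beta}(p)=\max_{z\in\tilde{\mathcal O}}\mu^{-i\beta}(z)\}$.
   Context: Let $U$ be a compact connected Lie group with Lie algebra $\mathfrak u$ and let $U^{\mathbb C}$ be its complexification, with Lie algebra $\mathfrak u^{\mathbb C}=\mathfrak u\oplus i\mathfrak u$. Let $(Z,\omega)$ be a Kähler manifold with complex structure $J$ and Kähler metric $(v,w)=\omega(v,Jw)$, with a holomorphic action of $U^{\mathbb C}$ such that $\omega$ is $U$-invariant, and let $\mu:Z\to\mathfrak u^*$ be a $U$-equivariant momentum map: $d\mu^\xi=i_{\xi_Z}\omega$ for all $\xi\in\mathfrak u$, where $\mu^\xi(z)=\langle\mu(z),\xi\rangle$ and $\xi_Z(z)=\frac{d}{dt}\big|_{t=0}\exp(t\xi)\cdot z$. For $\beta\in i\mathfrak u$, $(U^{\mathbb C})^{\beta+}:=\{g\in U^{\mathbb C}:\ \lim_{t\to-\infty}\exp(t\beta)\,g\,\exp(-t\beta)\text{ exists (in }U^{\mathbb C})\}$, a parabolic subgroup of $U^{\mathbb C}$. The number of orbits means the cardinality of the set of such orbits.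
   Formalization: In the second sentence "closed orbit" is taken to mean "compact orbit"; for orbits closed as subsets of a non-compact Z the claim fails, e.g. for the circle acting on Z = C^*, where the single orbit is closed but no compact orbit exists. *)

theory Defs
  imports "HOL-Analysis.Analysis" "HOL-Algebra.Group_Action" "HOL-Library.Equipollence"
begin

section \<open>Smooth and complex manifolds\<close>

text \<open>Continuous differentiability of order \<open>k\<close>, to be used on open sets of
  finite-dimensional spaces, where the condition on all directional derivatives is
  equivalent to the one on the total derivative.\<close>

fun Ck_on :: "nat \<Rightarrow> 'a::real_normed_vector set \<Rightarrow> ('a \<Rightarrow> 'b::real_normed_vector) \<Rightarrow> bool" where
  "Ck_on 0 S f \<longleftrightarrow> continuous_on S f"
| "Ck_on (Suc k) S f \<longleftrightarrow> (\<forall>x\<in>S. f differentiable (at x)) \<and>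
     (\<forall>v. Ck_on k S (\<lambda>x. frechet_derivative f (at x) v))"

definition smooth_on :: "'a::real_normed_vector set \<Rightarrow> ('a \<Rightarrow> 'b::real_normed_vector) \<Rightarrow> bool" where
  "smooth_on S f \<longleftrightarrow> (\<forall>k. Ck_on k S f)"

text \<open>A chart is a pair of its domain and its coordinate map; only the values of the
  coordinate map on the domain matter. The model space is a finite-dimensional normed space
  (rather than a type of class \<open>euclidean_space\<close>), so that dimension 0 is not excluded.
  The topology of the manifold is the one of its type.\<close>

type_synonym ('p, 'e) chart = "'p set \<times> ('p \<Rightarrow> 'e)"

definition chart_inv :: "('p, 'e) chart \<Rightarrow> 'e \<Rightarrow> 'p" where
  "chart_inv c = inv_into (fst c) (snd c)"

definition smooth_atlas ::
  "('p::{t2_space, second_countable_topology}, 'e::real_normed_vector) chart set \<Rightarrow> bool" where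
  "smooth_atlas A \<longleftrightarrow>
     (\<exists>B::'e set. finite B \<and> span B = UNIV) \<and>
     (\<forall>c\<in>A. open (fst c) \<and> open (snd c ` fst c) \<and>
        homeomorphism (fst c) (snd c ` fst c) (snd c) (chart_inv c)) \<and>
     (\<Union>c\<in>A. fst c) = UNIV \<and>
     (\<forall>c\<in>A. \<forall>d\<in>A. smooth_on (snd c ` (fst c \<inter> fst d)) (snd d \<circ> chart_inv c))"

text \<open>The tangent space at \<open>p\<close> is identified with the model space by means of a
  preferred chart at \<open>p\<close>. All tangent vectors at \<open>p\<close> below are expressed in this chart.\<close>

definition chart_at :: "('p, 'e) chart set \<Rightarrow> 'p \<Rightarrow> ('p, 'e) chart" where
  "chart_at A p = (SOME c. c \<in> A \<and> p \<in> fst c)"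

definition smooth_map ::
  "('p::topological_space, 'e::real_normed_vector) chart set \<Rightarrow>
   ('q::topological_space, 'f::real_normed_vector) chart set \<Rightarrow> ('p \<Rightarrow> 'q) \<Rightarrow> bool" where
  "smooth_map A B f \<longleftrightarrow> continuous_on UNIV f \<and>
     (\<forall>c\<in>A. \<forall>d\<in>B. smooth_on (snd c ` (fst c \<inter> f -` fst d)) (snd d \<circ> f \<circ> chart_inv c))"

definition tangent_map ::
  "('p, 'e::real_normed_vector) chart set \<Rightarrow> ('q, 'f::real_normed_vector) chart set \<Rightarrow>
   ('p \<Rightarrow> 'q) \<Rightarrow> 'p \<Rightarrow> 'e \<Rightarrow> 'f" where
  "tangent_map A B f p =
     frechet_derivative (snd (chart_at B (f p)) \<circ> f \<circ> chart_inv (chart_at A p))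
       (at (snd (chart_at A p) p))"

definition vector_atlas :: "('e, 'e) chart set" where
  "vector_atlas = {(UNIV, \<lambda>x. x)}"

definition prod_atlas ::
  "('p, 'e) chart set \<Rightarrow> ('q, 'f) chart set \<Rightarrow> ('p \<times> 'q, 'e \<times> 'f) chart set" where
  "prod_atlas A B = {(fst c \<times> fst d, map_prod (snd c) (snd d)) | c d. c \<in> A \<and> d \<in> B}"

text \<open>The model space of a complex manifold is a complex vector space, given as a real one
  together with the multiplication \<open>j\<close> by the imaginary unit. As the transition maps are
  holomorphic, \<open>j\<close> also represents the complex structure on every tangent space.\<close>

definition complex_structure :: "('e::real_vector \<Rightarrow> 'e) \<Rightarrow> bool" where
  "complex_structure j \<longleftrightarrow> linear j \<and> (\<forall>v. j (j v) = - v)"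

definition complex_atlas ::
  "('e::real_normed_vector \<Rightarrow> 'e) \<Rightarrow>
   ('p::{t2_space, second_countable_topology}, 'e) chart set \<Rightarrow> bool" where
  "complex_atlas j A \<longleftrightarrow> smooth_atlas A \<and> complex_structure j \<and>
     (\<forall>c\<in>A. \<forall>d\<in>A. \<forall>x \<in> snd c ` (fst c \<inter> fst d). \<forall>v.
        frechet_derivative (snd d \<circ> chart_inv c) (at x) (j v) =
        j (frechet_derivative (snd d \<circ> chart_inv c) (at x) v))"

definition holomorphic_map ::
  "('e::real_normed_vector \<Rightarrow> 'e) \<Rightarrow> ('p::topological_space, 'e) chart set \<Rightarrow>
   ('f::real_normed_vector \<Rightarrow> 'f) \<Rightarrow> ('q::topological_space, 'f) chart set \<Rightarrow>
   ('p \<Rightarrow> 'q) \<Rightarrow> bool" where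
  "holomorphic_map j A i B f \<longleftrightarrow> smooth_map A B f \<and>
     (\<forall>p v. tangent_map A B f p (j v) = i (tangent_map A B f p v))"


section \<open>Complex Lie groups and complexifications of compact groups\<close>

definition complex_lie_group ::
  "'g::{t2_space, second_countable_topology} monoid \<Rightarrow> ('e::real_normed_vector \<Rightarrow> 'e) \<Rightarrow>
   ('g, 'e) chart set \<Rightarrow> bool" where
  "complex_lie_group G j A \<longleftrightarrow> group G \<and> carrier G = UNIV \<and> complex_atlas j A \<and>
     holomorphic_map (map_prod j j) (prod_atlas A A) j A (\<lambda>(g, h). g \<otimes>\<^bsub>G\<^esub> h) \<and>
     holomorphic_map j A j A (\<lambda>g. inv\<^bsub>G\<^esub> g)"

text \<open>The Lie algebra is the tangent space at the unit, i.e. the whole model space.\<close>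

definition one_parameter_subgroup ::
  "('g::topological_space, 'x) monoid_scheme \<Rightarrow> ('g, 'e::real_normed_vector) chart set \<Rightarrow>
   'e \<Rightarrow> (real \<Rightarrow> 'g) \<Rightarrow> bool" where
  "one_parameter_subgroup G A \<xi> \<gamma> \<longleftrightarrow> smooth_map vector_atlas A \<gamma> \<and>
     (\<forall>s t. \<gamma> (s + t) = \<gamma> s \<otimes>\<^bsub>G\<^esub> \<gamma> t) \<and> tangent_map vector_atlas A \<gamma> 0 1 = \<xi>"

definition lie_exp ::
  "('g::topological_space, 'x) monoid_scheme \<Rightarrow> ('g, 'e::real_normed_vector) chart set \<Rightarrow>
   'e \<Rightarrow> 'g" where
  "lie_exp G A \<xi> = (THE \<gamma>. one_parameter_subgroup G A \<xi> \<gamma>) 1"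

definition lie_Ad ::
  "('g, 'x) monoid_scheme \<Rightarrow> ('g, 'e::real_normed_vector) chart set \<Rightarrow> 'g \<Rightarrow> 'e \<Rightarrow> 'e" where
  "lie_Ad G A g = tangent_map A A (\<lambda>h. g \<otimes>\<^bsub>G\<^esub> h \<otimes>\<^bsub>G\<^esub> inv\<^bsub>G\<^esub> g) \<one>\<^bsub>G\<^esub>"

definition lie_algebra_of ::
  "('g::topological_space, 'x) monoid_scheme \<Rightarrow> ('g, 'e::real_normed_vector) chart set \<Rightarrow>
   'g set \<Rightarrow> 'e set" where
  "lie_algebra_of G A U = {\<xi>. \<forall>t::real. lie_exp G A (t *\<^sub>R \<xi>) \<in> U}"

text \<open>\<open>G\<close> is the complexification of its compact connected subgroup \<open>U\<close>: the Lie algebra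
  of \<open>G\<close> is the direct sum of \<open>\<uu>\<close> and \<open>i\<uu>\<close>, and the polar map
  \<open>U \<times> \<uu> \<rightarrow> G\<close>, \<open>(k, \<xi>) \<mapsto> k exp(i\<xi>)\<close>, is a homeomorphism (it is then automatically a
  diffeomorphism). The decomposition of the Lie algebra alone would not suffice: it also holds
  for a circle subgroup of an elliptic curve. A compact subgroup of a Lie group is a Lie
  subgroup, with Lie algebra \<open>lie_algebra_of\<close>, and the embedding of a compact Lie group into
  its complexification is an isomorphism onto such a subgroup.\<close>

definition complexification ::
  "'g::{t2_space, second_countable_topology} monoid \<Rightarrow> ('e::real_normed_vector \<Rightarrow> 'e) \<Rightarrow>
   ('g, 'e) chart set \<Rightarrow> 'g set \<Rightarrow> bool" where
  "complexification G j A U \<longleftrightarrow>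
     complex_lie_group G j A \<and> subgroup U G \<and> compact U \<and> connected U \<and>
     (\<forall>v. \<exists>!(\<xi>, \<eta>). \<xi> \<in> lie_algebra_of G A U \<and> \<eta> \<in> lie_algebra_of G A U \<and> v = \<xi> + j \<eta>) \<and>
     (\<exists>polar_inv. homeomorphism (U \<times> lie_algebra_of G A U) UNIV
        (\<lambda>(k, \<xi>). k \<otimes>\<^bsub>G\<^esub> lie_exp G A (j \<xi>)) polar_inv)"

definition parabolic_plus ::
  "('g::topological_space, 'x) monoid_scheme \<Rightarrow> ('g, 'e::real_normed_vector) chart set \<Rightarrow>
   'e \<Rightarrow> 'g set" where
  "parabolic_plus G A \<beta> = {g \<in> carrier G. \<exists>l \<in> carrier G.
     ((\<lambda>t::real. lie_exp G A (t *\<^sub>R \<beta>) \<otimes>\<^bsub>G\<^esub> g \<otimes>\<^bsub>G\<^esub> lie_exp G A (- t *\<^sub>R \<beta>)) \<longlongrightarrow> l) at_bot}"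


section \<open>Kaehler manifolds and momentum maps\<close>

text \<open>A 2-form assigns to \<open>p\<close> a form on the tangent space at \<open>p\<close>, i.e. on the model space
  via \<open>chart_at\<close>. \<open>form_in_chart\<close> is its pullback to the image of the chart \<open>c\<close>.\<close>

definition form_in_chart ::
  "('p, 'e::real_normed_vector) chart set \<Rightarrow> ('p \<Rightarrow> 'e \<Rightarrow> 'e \<Rightarrow> real) \<Rightarrow>
   ('p, 'e) chart \<Rightarrow> 'e \<Rightarrow> 'e \<Rightarrow> 'e \<Rightarrow> real" where
  "form_in_chart A \<omega> c x v w =
     (let p = chart_inv c x;
          T = frechet_derivative (snd (chart_at A p) \<circ> chart_inv c) (at x)
      in \<omega> p (T v) (T w))"

definition smooth_2form ::
  "('p, 'e::real_normed_vector) chart set \<Rightarrow> ('p \<Rightarrow> 'e \<Rightarrow> 'e \<Rightarrow> real) \<Rightarrow> bool" where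
  "smooth_2form A \<omega> \<longleftrightarrow>
     (\<forall>p. bilinear (\<omega> p) \<and> (\<forall>v. \<omega> p v v = 0)) \<and>
     (\<forall>c\<in>A. \<forall>v w. smooth_on (snd c ` fst c) (\<lambda>x. form_in_chart A \<omega> c x v w))"

definition closed_2form ::
  "('p, 'e::real_normed_vector) chart set \<Rightarrow> ('p \<Rightarrow> 'e \<Rightarrow> 'e \<Rightarrow> real) \<Rightarrow> bool" where
  "closed_2form A \<omega> \<longleftrightarrow>
     (\<forall>c\<in>A. \<forall>x \<in> snd c ` fst c. \<forall>u v w.
        frechet_derivative (\<lambda>x. form_in_chart A \<omega> c x v w) (at x) u +
        frechet_derivative (\<lambda>x. form_in_chart A \<omega> c x w u) (at x) v +
        frechet_derivative (\<lambda>x. form_in_chart A \<omega> c x u v) (at x) w = 0)"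

definition kaehler_manifold ::
  "('e::real_normed_vector \<Rightarrow> 'e) \<Rightarrow>
   ('p::{t2_space, second_countable_topology}, 'e) chart set \<Rightarrow>
   ('p \<Rightarrow> 'e \<Rightarrow> 'e \<Rightarrow> real) \<Rightarrow> bool" where
  "kaehler_manifold j A \<omega> \<longleftrightarrow> complex_atlas j A \<and> smooth_2form A \<omega> \<and> closed_2form A \<omega> \<and>
     (\<forall>p v w. \<omega> p v (j w) = \<omega> p w (j v)) \<and>
     (\<forall>p v. v \<noteq> 0 \<longrightarrow> \<omega> p v (j v) > 0)"

definition holomorphic_action ::
  "'g::topological_space monoid \<Rightarrow> ('e::real_normed_vector \<Rightarrow> 'e) \<Rightarrow> ('g, 'e) chart set \<Rightarrow>
   ('f::real_normed_vector \<Rightarrow> 'f) \<Rightarrow> ('p::topological_space, 'f) chart set \<Rightarrow>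
   ('g \<Rightarrow> 'p \<Rightarrow> 'p) \<Rightarrow> bool" where
  "holomorphic_action G j A i B \<phi> \<longleftrightarrow> group_action G UNIV \<phi> \<and>
     holomorphic_map (map_prod j i) (prod_atlas A B) i B (\<lambda>(g, z). \<phi> g z)"

definition fundamental_field ::
  "'g::topological_space monoid \<Rightarrow> ('g, 'e::real_normed_vector) chart set \<Rightarrow>
   ('p, 'f::real_normed_vector) chart set \<Rightarrow> ('g \<Rightarrow> 'p \<Rightarrow> 'p) \<Rightarrow> 'e \<Rightarrow> 'p \<Rightarrow> 'f" where
  "fundamental_field G A B \<phi> \<xi> z =
     tangent_map vector_atlas B (\<lambda>t::real. \<phi> (lie_exp G A (t *\<^sub>R \<xi>)) z) 0 1"

definition invariant_form ::
  "'g set \<Rightarrow> ('p, 'f::real_normed_vector) chart set \<Rightarrow> ('g \<Rightarrow> 'p \<Rightarrow> 'p) \<Rightarrow>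
   ('p \<Rightarrow> 'f \<Rightarrow> 'f \<Rightarrow> real) \<Rightarrow> bool" where
  "invariant_form U B \<phi> \<omega> \<longleftrightarrow>
     (\<forall>k\<in>U. \<forall>z v w.
        \<omega> (\<phi> k z) (tangent_map B B (\<phi> k) z v) (tangent_map B B (\<phi> k) z w) = \<omega> z v w)"

text \<open>\<open>\<mu> z \<xi>\<close> is the pairing of \<open>\<mu>(z) \<in> \<uu>*\<close> with \<open>\<xi> \<in> \<uu>\<close>; values for \<open>\<xi> \<notin> \<uu>\<close> are
  irrelevant. Equivariance refers to the coadjoint action.\<close>

definition momentum_map ::
  "'g::topological_space monoid \<Rightarrow> ('g, 'e::real_normed_vector) chart set \<Rightarrow> 'g set \<Rightarrow>
   ('p::topological_space, 'f::real_normed_vector) chart set \<Rightarrow> ('g \<Rightarrow> 'p \<Rightarrow> 'p) \<Rightarrow>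
   ('p \<Rightarrow> 'f \<Rightarrow> 'f \<Rightarrow> real) \<Rightarrow> ('p \<Rightarrow> 'e \<Rightarrow> real) \<Rightarrow> bool" where
  "momentum_map G A U B \<phi> \<omega> \<mu> \<longleftrightarrow>
     (let \<uu> = lie_algebra_of G A U in
       (\<forall>z. \<forall>\<xi>\<in>\<uu>. \<forall>\<eta>\<in>\<uu>. \<forall>a b. \<mu> z (a *\<^sub>R \<xi> + b *\<^sub>R \<eta>) = a * \<mu> z \<xi> + b * \<mu> z \<eta>) \<and>
       (\<forall>\<xi>\<in>\<uu>. smooth_map B vector_atlas (\<lambda>z. \<mu> z \<xi>)) \<and>
       (\<forall>k\<in>U. \<forall>z. \<forall>\<xi>\<in>\<uu>. \<mu> (\<phi> k z) \<xi> = \<mu> z (lie_Ad G A (inv\<^bsub>G\<^esub> k) \<xi>)) \<and>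
       (\<forall>\<xi>\<in>\<uu>. \<forall>z v. tangent_map B vector_atlas (\<lambda>z. \<mu> z \<xi>) z v =
          \<omega> z (fundamental_field G A B \<phi> \<xi> z) v))"

text \<open>The set \<open>max\<^sub>S(\<beta>)\<close>; it is empty if the maximum is not attained.\<close>

definition max_set ::
  "('e::real_vector \<Rightarrow> 'e) \<Rightarrow> ('p \<Rightarrow> 'e \<Rightarrow> real) \<Rightarrow> 'p set \<Rightarrow> 'e \<Rightarrow> 'p set" where
  "max_set j \<mu> S \<beta> = {p \<in> S. \<forall>z\<in>S. \<mu> z (- j \<beta>) \<le> \<mu> p (- j \<beta>)}"

definition compact_orbits ::
  "('g, 'x) monoid_scheme \<Rightarrow> ('g \<Rightarrow> 'p::topological_space \<Rightarrow> 'p) \<Rightarrow> 'p set set" where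
  "compact_orbits G \<phi> = {S \<in> orbits G UNIV \<phi>. compact S}"

end

theory Submission
  imports Defs "HOL-Computational_Algebra.Fundamental_Theorem_Algebra"
begin

text \<open>Write \<open>\<beta> = i\<eta>\<close> with \<open>\<eta> \<in> \<uu>\<close>, let \<open>P\<close> be the parabolic subgroup of \<open>\<beta>\<close> and \<open>P\<^sup>-\<close> the opposite one, and
  let \<open>m\<close> be the component of the momentum map along \<open>\<eta>\<close>. It increases strictly along the flow of
  \<open>exp (t \<beta>)\<close> outside the fixed points, and the centralizer of \<open>\<beta>\<close> preserves its values at the fixed
  points. Since \<open>ad \<eta>\<close> is diagonalizable with imaginary eigenvalues, the
  products \<open>P\<^sup>- P\<close> and \<open>U P\<close> contain neighbourhoods of the unit.

  A compact \<open>P\<close>-orbit \<open>S\<close> consists of fixed points of the flow, and \<open>m\<close> is constant on it. The set \<open>U S\<close> is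
  compact and, as \<open>U P\<close> is a neighbourhood of the unit, invariant under the whole group, so the orbit
  \<open>T\<close> of the group through \<open>S\<close> is compact. As \<open>P\<^sup>- P\<close> is a neighbourhood of the unit, \<open>S\<close> is an isolated set of
  local maxima of \<open>m\<close> on \<open>T\<close>. It is the set of global maxima, since the set of points flowing into a
  neighbourhood of \<open>S\<close> is dense along every holomorphic curve in \<open>T\<close> through \<open>S\<close>: the Laplacian of
  \<open>\<integral>\<^sub>0\<^sup>t m(exp (s \<beta>) z) ds\<close> is bounded below along the curve uniformly in \<open>t\<close>, and the maximum principle
  compares it with \<open>t\<close> times the value of \<open>m\<close> on \<open>S\<close>. Conversely, the maximum set of \<open>m\<close> on a compact orbit is \<open>P\<close>-invariant, and
  each \<open>P\<close>-orbit in it is relatively open, hence compact.\<close>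

section \<open>Smooth functions on finite-dimensional spaces\<close>

text \<open>Compact orbits are handled as mere subsets of \<open>Z\<close>. Two tools stand in for a
  submanifold structure and for Morse theory on them: Baire's theorem, which makes the orbit map of
  a compact orbit open, and the maximum principle, applied in the plane that parametrizes a
  holomorphic curve. The uniform lower bound on the Laplacian has a simple source. The pullback of
  the Kaehler form to the curve, transported by the flow, has the Laplacian of \<open>m\<close> as
  its time derivative; so the Laplacian of the time integral is the density at time \<open>t\<close>
  minus the density at time \<open>0\<close>, and the former is nonnegative. The comparison function
  has a logarithmic pole at the centre of a disc supposed to miss the basin, which lifts its value
  at a point of \<open>S\<close> above all boundary values once \<open>t\<close> is large. Limits of
  the flow enter at points \<open>g p\<close> with \<open>p\<close> fixed and \<open>g\<close> in
  one of the two parabolic subgroups: there \<open>exp (t \<beta>) g p\<close> is the conjugate of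
  \<open>g\<close> applied to \<open>p\<close>, so convergence in the group replaces a convergence
  theorem for gradient flows. The exponential map is constructed by iterated squaring in one chart
  at the unit.\<close>

definition findim :: "'a::real_vector itself \<Rightarrow> bool" where
  "findim T \<longleftrightarrow> (\<exists>B::'a set. finite B \<and> span B = UNIV)"

lemma findim_basis:
  assumes "findim TYPE('a::real_vector)"
  obtains B :: "'a::real_vector set" where "finite B" "independent B" "span B = UNIV"
proof -
  obtain C :: "'a set" where C: "finite C" "span C = UNIV"
    using assms by (auto simp: findim_def)
  obtain B where "B \<subseteq> C" "independent B" "C \<subseteq> span B"
    using maximal_independent_subset[of C] by blast
  then show ?thesis
    using that C by (metis finite_subset span_mono span_span top.extremum_uniqueI)
qed

lemma findim_real: "findim TYPE(real)"
  unfolding findim_def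
proof (intro exI conjI)
  show "span {1::real} = UNIV"
  proof -
    have "x \<in> span {1}" for x :: real
      using span_scale[OF span_base, of 1 "{1::real}" x] by simp
    then show ?thesis by auto
  qed
qed simp

lemma findim_prod:
  assumes "findim TYPE('a::real_vector)" "findim TYPE('b::real_vector)"
  shows "findim TYPE('a \<times> 'b)"
proof -
  obtain A :: "'a set" and B :: "'b set" where A: "finite A" "span A = UNIV" and B: "finite B" "span B = UNIV"
    using assms by (auto simp: findim_def)
  let ?C = "(\<lambda>a. (a, 0::'b)) ` A \<union> (\<lambda>b. (0::'a, b)) ` B"
  have 1: "linear (\<lambda>a. (a, 0::'b))" "linear (\<lambda>b. (0::'a, b))"
    by (auto intro!: linearI)
  have "(x, y) \<in> span ?C" for x y
  proof -
    have "(x, 0) \<in> span ((\<lambda>a. (a, 0::'b)) ` A)"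
      using linear_span_image[OF 1(1), of A] A(2) by auto
    moreover have "(0, y) \<in> span ((\<lambda>b. (0::'a, b)) ` B)"
      using linear_span_image[OF 1(2), of B] B(2) by auto
    ultimately have "(x, 0) + (0, y) \<in> span ?C"
      by (intro span_add) (meson Un_upper1 Un_upper2 span_mono subsetD)+
    then show ?thesis by simp
  qed
  then have "span ?C = UNIV" by auto
  moreover have "finite ?C" using A B by auto
  ultimately show ?thesis unfolding findim_def by blast
qed

text \<open>Equivalence of norms in coordinates: \<open>S\<close> is the unit sphere of the sup norm
  on coordinate vectors supported in \<open>B\<close>, compact as a closed subset of a product of
  intervals. The norm of the linear combination is continuous there and nonzero by independence; the
  inverse of its minimum is the constant.\<close>

lemma representation_bounded:
  fixes B :: "'a::real_normed_vector set"
  assumes B: "finite B" "independent B" "span B = UNIV"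
  obtains K where "K > 0" "\<And>v b. \<bar>representation B v b\<bar> \<le> K * norm v"
proof (cases "B = {}")
  case True
  then have "v = 0" for v :: 'a using B(3) by auto
  then have "\<bar>representation B v b\<bar> \<le> 1 * norm v" for v b
    by (metis B(2) abs_zero norm_zero mult_zero_right order_refl representation_zero)
  then show ?thesis using that[of 1] by auto
next
  case False
  define L where "L = (\<lambda>a::'a \<Rightarrow> real. \<Sum>b\<in>B. a b *\<^sub>R b)"
  define Q where "Q = (PiE UNIV (\<lambda>b. if b \<in> B then {-1..1::real} else {0}))"
  define S where "S = Q \<inter> (\<Union>b\<in>B. {a. \<bar>a b\<bar> = 1})"
  have "compactin (product_topology (\<lambda>_. euclidean) UNIV) Q"
    unfolding Q_def by (auto simp: compactin_PiE)
  then have Qc: "compact Q" by (simp add: euclidean_product_topology)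
  have ev: "continuous_on UNIV (\<lambda>a::'a \<Rightarrow> real. a b)" for b
    by (rule continuous_on_product_coordinates)
  have "closed {a::'a \<Rightarrow> real. \<bar>a b\<bar> = 1}" for b
    by (intro closed_Collect_eq continuous_intros ev)
  then have "closed (\<Union>b\<in>B. {a::'a \<Rightarrow> real. \<bar>a b\<bar> = 1})" using B by auto
  then have Sc: "compact S" unfolding S_def using Qc by (simp add: compact_Int_closed)
  have "\<exists>a. a \<in> S"
  proof -
    obtain b where "b \<in> B" using False by auto
    then show ?thesis by (intro exI[of _ "\<lambda>c. if c = b then 1 else 0"]) (auto simp: S_def Q_def)
  qed
  then have Sne: "S \<noteq> {}" by auto
  have Lc: "continuous_on S L" unfolding L_def
    by (intro continuous_intros continuous_on_subset[OF ev]) auto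
  have "continuous_on S (\<lambda>a. norm (L a))" by (intro continuous_intros Lc)
  from continuous_attains_inf[OF Sc Sne this] obtain a0 where a0: "a0 \<in> S" "\<And>a. a \<in> S \<Longrightarrow> norm (L a0) \<le> norm (L a)"
    by auto
  have "L a0 \<noteq> 0"
  proof
    assume "L a0 = 0"
    then have "\<forall>b\<in>B. a0 b = 0" using independentD[OF B(2,1) subset_refl, of a0] unfolding L_def by blast
    then show False using a0(1) by (auto simp: S_def)
  qed
  then have pos: "norm (L a0) > 0" by simp
  have main: "\<bar>representation B v b\<bar> \<le> 1 / norm (L a0) * norm v" for v b
  proof -
    define M where "M = Max ((\<lambda>b. \<bar>representation B v b\<bar>) ` B)"
    have M: "\<bar>representation B v b\<bar> \<le> M" if "b \<in> B" for b
      unfolding M_def using B that by auto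
    have rv: "v = (\<Sum>b\<in>B. representation B v b *\<^sub>R b)"
      using sum_representation_eq[OF B(2), of v B] B by auto
    have out: "representation B v b = 0" if "b \<notin> B" for b
      using that representation_ne_zero by blast
    show ?thesis
    proof (cases "M = 0")
      case True
      then show ?thesis using M out pos by (cases "b \<in> B") force+
    next
      case False
      obtain b0 where b0: "b0 \<in> B" "M = \<bar>representation B v b0\<bar>"
        unfolding M_def using B \<open>B \<noteq> {}\<close> Max_in[of "(\<lambda>b. \<bar>representation B v b\<bar>) ` B"]
        by (metis (no_types, lifting) finite_imageI image_iff image_is_empty)
      with False have Mpos: "M > 0" by auto
      define a where "a = (\<lambda>b. representation B v b / M)"
      have "\<bar>a c\<bar> \<le> 1" if "c \<in> B" for c
        using M[OF that] Mpos by (simp add: a_def)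
      then have "- 1 \<le> a c \<and> a c \<le> 1" if "c \<in> B" for c
        using that by (simp add: abs_le_iff minus_le_iff)
      moreover have "a c = 0" if "c \<notin> B" for c using out that by (simp add: a_def)
      ultimately have "a \<in> Q" unfolding Q_def by (auto simp: PiE_iff)
      moreover have "\<bar>a b0\<bar> = 1" using b0(2) Mpos by (simp add: a_def)
      ultimately have "a \<in> S" unfolding S_def using b0(1) by auto
      then have "norm (L a0) \<le> norm (L a)" by (rule a0(2))
      also have "L a = (1 / M) *\<^sub>R v"
        unfolding L_def a_def by (subst (2) rv) (simp add: scaleR_sum_right)
      finally have "norm (L a0) * M \<le> norm v" using Mpos by (simp add: field_simps)
      then have "M \<le> 1 / norm (L a0) * norm v" using pos by (simp add: field_simps)
      then show ?thesis using M[of b] out[of b] Mpos by (cases "b \<in> B") auto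
    qed
  qed
  show ?thesis by (rule that[OF _ main]) (use pos in auto)
qed

lemma representation_bounded_linear:
  fixes B :: "'a::real_normed_vector set"
  assumes B: "finite B" "independent B" "span B = UNIV"
  shows "bounded_linear (\<lambda>v. representation B v b)"
proof -
  obtain K where "\<And>v b. \<bar>representation B v b\<bar> \<le> K * norm v"
    using representation_bounded[OF B] by blast
  then show ?thesis
    using B by (intro bounded_linear_intro[where K=K])
      (auto simp: representation_add representation_scale mult.commute)
qed

lemma linear_findim_bounded_linear:
  fixes f :: "'a::real_normed_vector \<Rightarrow> 'b::real_normed_vector"
  assumes "findim TYPE('a)" "linear f"
  shows "bounded_linear f"
proof -
  obtain B :: "'a set" where B: "finite B" "independent B" "span B = UNIV"
    using findim_basis[OF assms(1)] .
  have "f v = (\<Sum>b\<in>B. representation B v b *\<^sub>R f b)" for v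
  proof -
    have "v = (\<Sum>b\<in>B. representation B v b *\<^sub>R b)"
      using sum_representation_eq[OF B(2), of v B] B by auto
    then have "f v = f (\<Sum>b\<in>B. representation B v b *\<^sub>R b)" by simp
    then show ?thesis using assms(2) by (simp add: linear_sum linear_cmul)
  qed
  then have "f = (\<lambda>v. \<Sum>b\<in>B. representation B v b *\<^sub>R f b)" by (rule ext)
  moreover have "bounded_linear (\<lambda>v. \<Sum>b\<in>B. representation B v b *\<^sub>R f b)"
    by (intro bounded_linear_sum bounded_linear_scaleR_const representation_bounded_linear B)
  ultimately show ?thesis by simp
qed

text \<open>By the bound on coordinates a ball lies in the continuous image of a compact cube, and
  it is closed there.\<close>

lemma compact_cball_findim:
  assumes "findim TYPE('a::real_normed_vector)"
  shows "compact (cball (x::'a) r)"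
proof -
  obtain B :: "'a set" where B: "finite B" "independent B" "span B = UNIV"
    using findim_basis[OF assms(1)] .
  obtain K where K: "K > 0" "\<And>v b. \<bar>representation B v b\<bar> \<le> K * norm v"
    using representation_bounded[OF B] by blast
  define R where "R = K * (norm x + \<bar>r\<bar>)"
  define L where "L = (\<lambda>a::'a \<Rightarrow> real. \<Sum>b\<in>B. a b *\<^sub>R b)"
  define Q where "Q = (PiE UNIV (\<lambda>b::'a. {-R..R}))"
  have "compactin (product_topology (\<lambda>_. euclidean) UNIV) Q"
    unfolding Q_def by (auto simp: compactin_PiE)
  then have Qc: "compact Q" by (simp add: euclidean_product_topology)
  have "continuous_on Q L" unfolding L_def
    by (intro continuous_intros continuous_on_subset[OF continuous_on_product_coordinates]) auto
  then have LQ: "compact (L ` Q)" using Qc by (rule compact_continuous_image)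
  have "cball x r \<subseteq> L ` Q"
  proof
    fix v assume v: "v \<in> cball x r"
    then have "norm v \<le> norm x + \<bar>r\<bar>"
      by (smt (verit, best) dist_norm mem_cball norm_minus_commute norm_triangle_sub)
    then have "\<bar>representation B v b\<bar> \<le> R" for b
      using K(2)[of v b] K(1) unfolding R_def by (smt (verit, best) mult_left_mono)
    then have "- R \<le> representation B v b \<and> representation B v b \<le> R" for b
      by (metis abs_le_iff minus_le_iff)
    then have "representation B v \<in> Q" unfolding Q_def by (simp add: PiE_iff)
    moreover have "v = L (representation B v)"
      using sum_representation_eq[OF B(2), of v B] B unfolding L_def by auto
    ultimately show "v \<in> L ` Q" by blast
  qed
  then have "cball x r = L ` Q \<inter> cball x r" by auto
  then show ?thesis using LQ by (metis closed_cball compact_Int_closed)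
qed

section \<open>Closure properties of continuously differentiable maps\<close>

lemma frechet_derivative_cong_open:
  assumes "open S" "x \<in> S" "\<And>y. y \<in> S \<Longrightarrow> f y = g y"
  shows "frechet_derivative f (at x) = frechet_derivative g (at x)"
proof -
  have "(f has_derivative f') (at x) \<longleftrightarrow> (g has_derivative f') (at x)" for f'
    using assms has_derivative_transform_within_open[of f f' x UNIV S g]
      has_derivative_transform_within_open[of g f' x UNIV S f] by auto
  then show ?thesis by (simp add: frechet_derivative_def)
qed

lemma has_derivative_frechet:
  "f differentiable at x \<Longrightarrow> (f has_derivative frechet_derivative f (at x)) (at x)"
  using frechet_derivative_works by blast

lemma frechet_derivative_eqI:
  "(f has_derivative f') (at x) \<Longrightarrow> frechet_derivative f (at x) = f'"
  using frechet_derivative_at by metis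

lemma Ck_on_subset: "Ck_on k S f \<Longrightarrow> T \<subseteq> S \<Longrightarrow> Ck_on k T f"
  by (induction k arbitrary: f) (auto intro: continuous_on_subset)

lemma Ck_on_cong:
  assumes "open S" "\<And>x. x \<in> S \<Longrightarrow> f x = g x" "Ck_on k S f"
  shows "Ck_on k S g"
  using assms(2,3)
proof (induction k arbitrary: f g)
  case 0
  then show ?case by (auto cong: continuous_on_cong)
next
  case (Suc k)
  have "g differentiable at x" if "x \<in> S" for x
  proof -
    have "f differentiable at x" using Suc that by auto
    then show ?thesis
      using has_derivative_transform_within_open[OF _ \<open>open S\<close> that, of f _ UNIV g] Suc(2)
      unfolding differentiable_def by blast
  qed
  moreover have "Ck_on k S (\<lambda>x. frechet_derivative g (at x) v)" for v
    by (rule Suc.IH[of "\<lambda>x. frechet_derivative f (at x) v"])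
      (use Suc frechet_derivative_cong_open[OF \<open>open S\<close>, of _ f g] in auto)
  ultimately show ?case by simp
qed

lemma Ck_on_SucD: "Ck_on (Suc k) S f \<Longrightarrow> Ck_on k S f"
proof (induction k arbitrary: f)
  case 0
  then show ?case
    by (auto intro!: continuous_at_imp_continuous_on differentiable_imp_continuous_within)
next
  case (Suc k)
  have "Ck_on (Suc k) S (\<lambda>x. frechet_derivative f (at x) v)" for v
    using Suc.prems by (subst (asm) Ck_on.simps) blast
  then have "Ck_on k S (\<lambda>x. frechet_derivative f (at x) v)" for v
    by (rule Suc.IH)
  moreover have "\<forall>x\<in>S. f differentiable (at x)"
    using Suc.prems by (subst (asm) Ck_on.simps) blast
  ultimately show ?case by simp
qed

lemma Ck_on_local:
  assumes "\<And>x. x \<in> S \<Longrightarrow> \<exists>T. open T \<and> x \<in> T \<and> Ck_on k T f"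
  shows "Ck_on k S f"
  using assms
proof (induction k arbitrary: f)
  case 0
  have "isCont f x" if "x \<in> S" for x
  proof -
    from 0[OF that] obtain T where "open T" "x \<in> T" "continuous_on T f" by auto
    then show ?thesis using continuous_on_eq_continuous_at by blast
  qed
  then show ?case by (auto intro: continuous_at_imp_continuous_on)
next
  case (Suc k)
  have "Ck_on k S (\<lambda>x. frechet_derivative f (at x) v)" for v
  proof (rule Suc.IH)
    fix x assume "x \<in> S"
    from Suc.prems[OF this] obtain T where "open T" "x \<in> T" "Ck_on (Suc k) T f" by (elim exE conjE)
    moreover from this(3) have "Ck_on k T (\<lambda>x. frechet_derivative f (at x) v)" by simp
    ultimately show "\<exists>T. open T \<and> x \<in> T \<and> Ck_on k T (\<lambda>x. frechet_derivative f (at x) v)"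
      by blast
  qed
  moreover have "f differentiable at x" if "x \<in> S" for x
  proof -
    from Suc.prems[OF that] obtain T where "x \<in> T" "Ck_on (Suc k) T f" by (elim exE conjE)
    then show ?thesis by simp
  qed
  ultimately show ?case by simp
qed

lemma Ck_on_const: "Ck_on k S (\<lambda>x. c)"
  by (induction k arbitrary: c) auto

lemma Ck_on_linear_compose:
  assumes L: "bounded_linear L" and S: "open S" and f: "Ck_on k S f"
  shows "Ck_on k S (\<lambda>x. L (f x))"
  using f
proof (induction k arbitrary: f)
  case 0
  then show ?case using L by (simp add: bounded_linear.continuous_on)
next
  case (Suc k)
  have D: "((\<lambda>x. L (f x)) has_derivative (\<lambda>v. L (frechet_derivative f (at x) v))) (at x)" if "x \<in> S" for x
    using Suc.prems that by (intro bounded_linear.has_derivative[OF L] has_derivative_frechet) auto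
  have "Ck_on k S (\<lambda>x. L (frechet_derivative f (at x) v))" for v
    using Suc by simp
  then have "Ck_on k S (\<lambda>x. frechet_derivative (\<lambda>x. L (f x)) (at x) v)" for v
    by (rule Ck_on_cong[OF S, rotated]) (simp add: frechet_derivative_eqI[OF D])
  then show ?case using D by (auto simp: differentiable_def)
qed

lemma Ck_on_id: "Ck_on k S (\<lambda>x. x)"
  by (cases k) (auto simp: frechet_derivative_ident intro: Ck_on_const differentiable_ident)

lemma Ck_on_linear: "bounded_linear L \<Longrightarrow> Ck_on k S L"
  using Ck_on_linear_compose[of L UNIV k "\<lambda>x. x"] Ck_on_id Ck_on_subset by fastforce

lemma Ck_on_Pair:
  assumes S: "open S" and "Ck_on k S f" "Ck_on k S g"
  shows "Ck_on k S (\<lambda>x. (f x, g x))"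
  using assms(2,3)
proof (induction k arbitrary: f g)
  case 0
  then show ?case by (simp add: continuous_on_Pair)
next
  case (Suc k)
  have D: "((\<lambda>x. (f x, g x)) has_derivative
      (\<lambda>v. (frechet_derivative f (at x) v, frechet_derivative g (at x) v))) (at x)" if "x \<in> S" for x
    using Suc.prems that by (intro has_derivative_Pair has_derivative_frechet) auto
  have "Ck_on k S (\<lambda>x. (frechet_derivative f (at x) v, frechet_derivative g (at x) v))" for v
    using Suc by simp
  then have "Ck_on k S (\<lambda>x. frechet_derivative (\<lambda>x. (f x, g x)) (at x) v)" for v
    by (rule Ck_on_cong[OF S, rotated]) (simp add: frechet_derivative_eqI[OF D])
  then show ?case using D by (auto simp: differentiable_def)
qed

lemma Ck_on_add:
  assumes "open S" "Ck_on k S f" "Ck_on k S g"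
  shows "Ck_on k S (\<lambda>x. f x + g x)"
  using Ck_on_linear_compose[OF bounded_linear_add[OF bounded_linear_fst bounded_linear_snd] assms(1)
      Ck_on_Pair[OF assms]] by simp

lemma Ck_on_sum:
  assumes "open S" "\<And>i. i \<in> I \<Longrightarrow> Ck_on k S (f i)"
  shows "Ck_on k S (\<lambda>x. \<Sum>i\<in>I. f i x)"
  using assms(2)
  by (induction I rule: infinite_finite_induct) (auto intro: Ck_on_const Ck_on_add[OF assms(1)])

lemma Ck_on_scaleR:
  assumes S: "open S" and "Ck_on k S a" "Ck_on k S f"
  shows "Ck_on k S (\<lambda>x. a x *\<^sub>R f x)"
  using assms(2,3)
proof (induction k arbitrary: a f)
  case 0
  then show ?case by (simp add: continuous_on_scaleR)
next
  case (Suc k)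
  have D: "((\<lambda>x. a x *\<^sub>R f x) has_derivative
      (\<lambda>v. a x *\<^sub>R frechet_derivative f (at x) v + frechet_derivative a (at x) v *\<^sub>R f x)) (at x)"
    if "x \<in> S" for x
    using Suc.prems that by (intro has_derivative_scaleR has_derivative_frechet) auto
  have "Ck_on k S (\<lambda>x. a x *\<^sub>R frechet_derivative f (at x) v + frechet_derivative a (at x) v *\<^sub>R f x)" for v
    using Suc.prems Ck_on_SucD[OF Suc.prems(1)] Ck_on_SucD[OF Suc.prems(2)]
    by (intro Ck_on_add[OF S] Suc.IH) auto
  then have "Ck_on k S (\<lambda>x. frechet_derivative (\<lambda>x. a x *\<^sub>R f x) (at x) v)" for v
    by (rule Ck_on_cong[OF S, rotated]) (simp add: frechet_derivative_eqI[OF D])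
  then show ?case using D by (auto simp: differentiable_def)
qed

lemma linear_eq_sum_representation:
  fixes f :: "'a::real_vector \<Rightarrow> 'b::real_vector"
  assumes "finite B" "independent B" "span B = UNIV" "linear f"
  shows "f v = (\<Sum>b\<in>B. representation B v b *\<^sub>R f b)"
proof -
  have "v = (\<Sum>b\<in>B. representation B v b *\<^sub>R b)"
    using sum_representation_eq[OF assms(2), of v B] assms(1,3) by auto
  then have "f v = f (\<Sum>b\<in>B. representation B v b *\<^sub>R b)" by simp
  then show ?thesis using assms(4) by (simp add: linear_sum linear_cmul)
qed

text \<open>The chain rule produces a derivative of \<open>g\<close> at \<open>f x\<close> in a
  direction that itself varies with \<open>x\<close>. Expanding this direction in a basis of the
  middle space leaves finitely many products of a scalar function with a derivative of
  \<open>g\<close> in a fixed direction, to which the induction hypothesis applies.\<close>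

lemma Ck_on_compose:
  fixes f :: "'a::real_normed_vector \<Rightarrow> 'b::real_normed_vector"
    and g :: "'b \<Rightarrow> 'c::real_normed_vector"
  assumes fd: "findim TYPE('b)" and S: "open S" and T: "open T"
    and "Ck_on k S f" "Ck_on k T g" and fST: "f ` S \<subseteq> T"
  shows "Ck_on k S (\<lambda>x. g (f x))"
proof -
  obtain B :: "'b set" where B: "finite B" "independent B" "span B = UNIV"
    using findim_basis[OF fd] .
  show ?thesis using assms(4,5)
  proof (induction k arbitrary: g)
    case 0
    then show ?case using fST
      by (auto intro: continuous_on_compose2[of T g S f])
  next
    case (Suc k)
    have fx: "f x \<in> T" if "x \<in> S" for x using fST that by auto
    have D: "((\<lambda>x. g (f x)) has_derivative
        (\<lambda>v. frechet_derivative g (at (f x)) (frechet_derivative f (at x) v))) (at x)" if "x \<in> S" for x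
      using Suc.prems that fx[OF that]
      by (intro has_derivative_compose[of f _ x UNIV g] has_derivative_frechet) auto
    have fk: "Ck_on k S f" using Suc.prems(1) by (rule Ck_on_SucD)
    have "Ck_on k S (\<lambda>x. \<Sum>b\<in>B. representation B (frechet_derivative f (at x) v) b *\<^sub>R
        frechet_derivative g (at (f x)) b)" for v
    proof (intro Ck_on_sum[OF S] Ck_on_scaleR[OF S])
      fix b assume "b \<in> B"
      show "Ck_on k S (\<lambda>x. representation B (frechet_derivative f (at x) v) b)"
        by (rule Ck_on_linear_compose[OF representation_bounded_linear[OF B] S])
          (use Suc.prems in auto)
      show "Ck_on k S (\<lambda>x. frechet_derivative g (at (f x)) b)"
        by (rule Suc.IH[of "\<lambda>y. frechet_derivative g (at y) b"]) (use Suc.prems fk in auto)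
    qed
    then have "Ck_on k S (\<lambda>x. frechet_derivative (\<lambda>x. g (f x)) (at x) v)" for v
    proof (rule Ck_on_cong[OF S, rotated])
      fix x assume x: "x \<in> S"
      have "linear (frechet_derivative g (at (f x)))"
        using Suc.prems(2) fx[OF x] by (intro linear_frechet_derivative) auto
      then show "(\<Sum>b\<in>B. representation B (frechet_derivative f (at x) v) b *\<^sub>R
          frechet_derivative g (at (f x)) b) = frechet_derivative (\<lambda>x. g (f x)) (at x) v"
        by (simp add: frechet_derivative_eqI[OF D[OF x]] linear_eq_sum_representation[OF B, symmetric])
    qed
    then show ?case using D by (auto simp: differentiable_def)
  qed
qed

lemma smooth_on_subset: "smooth_on S f \<Longrightarrow> T \<subseteq> S \<Longrightarrow> smooth_on T f"
  by (auto simp: smooth_on_def intro: Ck_on_subset)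

lemma smooth_on_cong:
  "open S \<Longrightarrow> (\<And>x. x \<in> S \<Longrightarrow> f x = g x) \<Longrightarrow> smooth_on S f \<Longrightarrow> smooth_on S g"
  unfolding smooth_on_def using Ck_on_cong[of S f g] by blast

lemma smooth_on_local:
  "(\<And>x. x \<in> S \<Longrightarrow> \<exists>T. open T \<and> x \<in> T \<and> smooth_on T f) \<Longrightarrow> smooth_on S f"
  unfolding smooth_on_def by (meson Ck_on_local)

lemma smooth_on_linear: "bounded_linear L \<Longrightarrow> smooth_on S L"
  by (simp add: smooth_on_def Ck_on_linear)

lemma smooth_on_const: "smooth_on S (\<lambda>x. c)"
  by (simp add: smooth_on_def Ck_on_const)

lemma smooth_on_Pair: "open S \<Longrightarrow> smooth_on S f \<Longrightarrow> smooth_on S g \<Longrightarrow> smooth_on S (\<lambda>x. (f x, g x))"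
  by (simp add: smooth_on_def Ck_on_Pair)

lemma smooth_on_add: "open S \<Longrightarrow> smooth_on S f \<Longrightarrow> smooth_on S g \<Longrightarrow> smooth_on S (\<lambda>x. f x + g x)"
  by (simp add: smooth_on_def Ck_on_add)

lemma smooth_on_scaleR: "open S \<Longrightarrow> smooth_on S f \<Longrightarrow> smooth_on S g \<Longrightarrow> smooth_on S (\<lambda>x. f x *\<^sub>R g x)"
  by (simp add: smooth_on_def Ck_on_scaleR)

lemma smooth_on_sum:
  "open S \<Longrightarrow> (\<And>i. i \<in> I \<Longrightarrow> smooth_on S (f i)) \<Longrightarrow> smooth_on S (\<lambda>x. \<Sum>i\<in>I. f i x)"
  by (simp add: smooth_on_def Ck_on_sum)

lemma smooth_on_compose:
  fixes f :: "'a::real_normed_vector \<Rightarrow> 'b::real_normed_vector"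
  assumes "findim TYPE('b)" "open S" "open T" "smooth_on S f" "smooth_on T g" "f ` S \<subseteq> T"
  shows "smooth_on S (\<lambda>x. g (f x))"
  using assms(4,5) unfolding smooth_on_def by (auto intro: Ck_on_compose[OF assms(1,2,3) _ _ assms(6)])

lemma smooth_on_differentiable: "smooth_on S f \<Longrightarrow> x \<in> S \<Longrightarrow> f differentiable at x"
  unfolding smooth_on_def using Ck_on.simps(2)[of 0 S f] by blast

lemma smooth_on_has_derivative:
  "smooth_on S f \<Longrightarrow> x \<in> S \<Longrightarrow> (f has_derivative frechet_derivative f (at x)) (at x)"
  by (simp add: has_derivative_frechet smooth_on_differentiable)

lemma smooth_on_continuous: "smooth_on S f \<Longrightarrow> continuous_on S f"
  unfolding smooth_on_def using Ck_on.simps(1) by blast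

lemma smooth_on_frechet: "smooth_on S f \<Longrightarrow> smooth_on S (\<lambda>x. frechet_derivative f (at x) v)"
  unfolding smooth_on_def using Ck_on.simps(2) by blast

section \<open>Second derivatives, second order estimates and local surjectivity\<close>

lemma real_curve_bound:
  fixes g :: "real \<Rightarrow> 'b::real_normed_vector"
  assumes "0 \<le> h" "\<And>t. t \<in> {0..h} \<Longrightarrow> (g has_vector_derivative g' t) (at t)"
    "\<And>t. t \<in> {0..h} \<Longrightarrow> norm (g' t) \<le> B"
  shows "norm (g h - g 0) \<le> B * h"
proof -
  have "norm (g h - g 0) \<le> B * norm (h - 0)"
  proof (rule differentiable_bound[of "{0..h}" g "\<lambda>t s. s *\<^sub>R g' t"])
    fix t assume t: "t \<in> {0..h}"
    show "(g has_derivative (\<lambda>s. s *\<^sub>R g' t)) (at t within {0..h})"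
      using assms(2)[OF t] unfolding has_vector_derivative_def
      by (rule has_derivative_at_withinI)
    have "0 \<le> B" using assms(3)[OF t] norm_ge_zero order_trans by blast
    then show "onorm (\<lambda>s. s *\<^sub>R g' t) \<le> B"
      using assms(3)[OF t] by (intro onorm_bound) (auto simp: mult.commute[of B] mult_left_mono)
  qed (use assms(1) in auto)
  then show ?thesis using assms(1) by simp
qed

lemma has_vector_derivative_line:
  assumes "(f has_derivative f') (at (a + t *\<^sub>R v))"
  shows "((\<lambda>t. f (a + t *\<^sub>R v)) has_vector_derivative f' v) (at t)"
proof -
  have l: "linear f'" using assms has_derivative_linear by blast
  have "((\<lambda>t. a + t *\<^sub>R v) has_derivative (\<lambda>s. s *\<^sub>R v)) (at t)"
    by (auto intro!: derivative_eq_intros)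
  from has_derivative_compose[OF this assms] show ?thesis
    unfolding has_vector_derivative_def using linear_cmul[OF l] by simp
qed

text \<open>The mean value inequality is used twice, along \<open>v\<close> for the derivative in
  direction \<open>u\<close> and then along \<open>u\<close> for the difference of two parallel
  sides, each time after subtracting the linear term that \<open>A\<close> predicts.\<close>

lemma second_difference_bound:
  fixes f :: "'a::real_normed_vector \<Rightarrow> 'b::real_normed_vector"
  assumes sm: "smooth_on S f" and h: "h > 0" and S: "\<And>s t. s \<in> {0..h} \<Longrightarrow> t \<in> {0..h} \<Longrightarrow> x + s *\<^sub>R u + t *\<^sub>R v \<in> S"
    and eps: "\<And>s t. s \<in> {0..h} \<Longrightarrow> t \<in> {0..h} \<Longrightarrow>
      norm (frechet_derivative (\<lambda>y. frechet_derivative f (at y) u) (at (x + s *\<^sub>R u + t *\<^sub>R v)) v - A) \<le> \<epsilon>"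
  shows "norm ((f (x + h *\<^sub>R u + h *\<^sub>R v) - f (x + h *\<^sub>R u) - (f (x + h *\<^sub>R v) - f x)) - (h * h) *\<^sub>R A) \<le> \<epsilon> * h * h"
proof -
  define Du where "Du = (\<lambda>y. frechet_derivative f (at y) u)"
  have smD: "smooth_on S Du" unfolding Du_def by (rule smooth_on_frechet[OF sm])
  have inner: "norm (Du (x + s *\<^sub>R u + h *\<^sub>R v) - Du (x + s *\<^sub>R u) - h *\<^sub>R A) \<le> \<epsilon> * h" if s: "s \<in> {0..h}" for s
  proof -
    have "norm ((Du (x + s *\<^sub>R u + h *\<^sub>R v) - h *\<^sub>R A) - (Du (x + s *\<^sub>R u + 0 *\<^sub>R v) - 0 *\<^sub>R A)) \<le> \<epsilon> * h"
    proof (rule real_curve_bound[where g = "\<lambda>t. Du (x + s *\<^sub>R u + t *\<^sub>R v) - t *\<^sub>R A"])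
      fix t assume t: "t \<in> {0..h}"
      show "((\<lambda>t. Du (x + s *\<^sub>R u + t *\<^sub>R v) - t *\<^sub>R A) has_vector_derivative
          frechet_derivative Du (at (x + s *\<^sub>R u + t *\<^sub>R v)) v - A) (at t)"
        by (intro has_vector_derivative_diff has_vector_derivative_line smooth_on_has_derivative[OF smD] S s t)
          (auto intro!: derivative_eq_intros)
      show "norm (frechet_derivative Du (at (x + s *\<^sub>R u + t *\<^sub>R v)) v - A) \<le> \<epsilon>"
        using eps[OF s t] by (simp add: Du_def)
    qed (use h in auto)
    then show ?thesis by (simp add: algebra_simps)
  qed
  have "norm ((f ((x + h *\<^sub>R v) + h *\<^sub>R u) - f (x + h *\<^sub>R u) - (h * h) *\<^sub>R A) -
      (f ((x + h *\<^sub>R v) + 0 *\<^sub>R u) - f (x + 0 *\<^sub>R u) - (0 * h) *\<^sub>R A)) \<le> (\<epsilon> * h) * h"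
  proof (rule real_curve_bound[where g = "\<lambda>s. f ((x + h *\<^sub>R v) + s *\<^sub>R u) - f (x + s *\<^sub>R u) - (s * h) *\<^sub>R A"])
    fix s assume s: "s \<in> {0..h}"
    have 1: "x + h *\<^sub>R v + s *\<^sub>R u \<in> S" "x + s *\<^sub>R u \<in> S"
      using S[OF s, of h] S[OF s, of 0] h by (simp_all add: algebra_simps)
    show "((\<lambda>s. f ((x + h *\<^sub>R v) + s *\<^sub>R u) - f (x + s *\<^sub>R u) - (s * h) *\<^sub>R A) has_vector_derivative
        Du (x + h *\<^sub>R v + s *\<^sub>R u) - Du (x + s *\<^sub>R u) - h *\<^sub>R A) (at s)"
      unfolding Du_def
      by (intro has_vector_derivative_diff has_vector_derivative_line smooth_on_has_derivative[OF sm] 1)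
        (auto intro!: derivative_eq_intros)
    show "norm (Du (x + h *\<^sub>R v + s *\<^sub>R u) - Du (x + s *\<^sub>R u) - h *\<^sub>R A) \<le> \<epsilon> * h"
      using inner[OF s] by (simp add: algebra_simps)
  qed (use h in auto)
  then show ?thesis by (simp add: algebra_simps)
qed

text \<open>The second difference over a small parallelogram is symmetric in \<open>u\<close> and
  \<open>v\<close>, and by continuity it approximates both mixed derivatives. With \<epsilon> a
  third of their distance, that distance would be at most two thirds of itself.\<close>

lemma symmetric_second_derivative:
  fixes f :: "'a::real_normed_vector \<Rightarrow> 'b::real_normed_vector"
  assumes S: "open S" and sm: "smooth_on S f" and x: "x \<in> S"
  shows "frechet_derivative (\<lambda>y. frechet_derivative f (at y) u) (at x) v =
    frechet_derivative (\<lambda>y. frechet_derivative f (at y) v) (at x) u" (is "?A = ?B")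
proof (rule ccontr)
  assume "?A \<noteq> ?B"
  define \<epsilon> where "\<epsilon> = norm (?A - ?B) / 3"
  have e: "\<epsilon> > 0" using \<open>?A \<noteq> ?B\<close> by (simp add: \<epsilon>_def)
  have cont: "continuous_on S (\<lambda>y. frechet_derivative (\<lambda>y. frechet_derivative f (at y) u) (at y) v)" for u v
    by (intro smooth_on_continuous smooth_on_frechet sm)
  have ex: "\<exists>r>0. \<forall>y. dist y x < r \<longrightarrow>
    norm (frechet_derivative (\<lambda>y. frechet_derivative f (at y) u) (at y) v -
      frechet_derivative (\<lambda>y. frechet_derivative f (at y) u) (at x) v) \<le> \<epsilon>" for u v
    using cont[of u v] e S x unfolding continuous_on_eq_continuous_at[OF S] continuous_at_eps_delta
    by (metis dist_norm less_imp_le)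
  obtain r1 where r1: "r1 > 0" "\<And>y. dist y x < r1 \<Longrightarrow>
    norm (frechet_derivative (\<lambda>y. frechet_derivative f (at y) u) (at y) v - ?A) \<le> \<epsilon>"
    using ex[of u v] by blast
  obtain r2 where r2: "r2 > 0" "\<And>y. dist y x < r2 \<Longrightarrow>
    norm (frechet_derivative (\<lambda>y. frechet_derivative f (at y) v) (at y) u - ?B) \<le> \<epsilon>"
    using ex[of v u] by blast
  obtain r3 where r3: "r3 > 0" "ball x r3 \<subseteq> S" using S x openE by blast
  define r where "r = Min {r1, r2, r3}"
  have r: "r > 0" "r \<le> r1" "r \<le> r2" "r \<le> r3" using r1(1) r2(1) r3(1) by (auto simp: r_def)
  \<comment> \<open>The whole parallelogram with sides \<open>h u\<close> and \<open>h v\<close>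
    stays within distance \<open>r\<close> of \<open>x\<close>; the summand \<open>1\<close> covers
    \<open>u = v = 0\<close>.\<close>
  define h where "h = r / (norm u + norm v + 1)"
  have np: "norm u + norm v + 1 > 0" by (smt (verit) norm_ge_zero)
  have h: "h > 0" using r np by (simp add: h_def)
  have "h * (norm u + norm v + 1) = r" using np by (simp add: h_def)
  then have hr: "h * norm u + h * norm v < r" using h by (simp add: algebra_simps)
  have near: "dist (x + s *\<^sub>R u + t *\<^sub>R v) x < r" if "s \<in> {0..h}" "t \<in> {0..h}" for s t
  proof -
    have "norm (s *\<^sub>R u + t *\<^sub>R v) \<le> s * norm u + t * norm v"
      using norm_triangle_ineq[of "s *\<^sub>R u" "t *\<^sub>R v"] that by simp
    also have "\<dots> \<le> h * norm u + h * norm v"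
      using that by (intro add_mono mult_right_mono) auto
    finally have "norm (s *\<^sub>R u + t *\<^sub>R v) < r" using hr by linarith
    moreover have "x + s *\<^sub>R u + t *\<^sub>R v - x = s *\<^sub>R u + t *\<^sub>R v" by simp
    ultimately show ?thesis unfolding dist_norm by metis
  qed
  define \<Delta> where "\<Delta> = f (x + h *\<^sub>R u + h *\<^sub>R v) - f (x + h *\<^sub>R u) - (f (x + h *\<^sub>R v) - f x)"
  have 1: "norm (\<Delta> - (h * h) *\<^sub>R ?A) \<le> \<epsilon> * h * h"
    unfolding \<Delta>_def
  proof (rule second_difference_bound[OF sm h])
    fix s t assume st: "s \<in> {0..h}" "t \<in> {0..h}"
    show "x + s *\<^sub>R u + t *\<^sub>R v \<in> S" using near[OF st] r r3(2) by (force simp: dist_commute)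
    show "norm (frechet_derivative (\<lambda>y. frechet_derivative f (at y) u) (at (x + s *\<^sub>R u + t *\<^sub>R v)) v - ?A) \<le> \<epsilon>"
      by (rule r1(2)) (use near[OF st] r in linarith)
  qed
  have "norm ((f (x + h *\<^sub>R v + h *\<^sub>R u) - f (x + h *\<^sub>R v) - (f (x + h *\<^sub>R u) - f x)) - (h * h) *\<^sub>R ?B) \<le> \<epsilon> * h * h"
  proof (rule second_difference_bound[OF sm h])
    fix s t assume st: "s \<in> {0..h}" "t \<in> {0..h}"
    have n: "dist (x + s *\<^sub>R v + t *\<^sub>R u) x < r" using near[OF st(2,1)] by (simp add: algebra_simps)
    show "x + s *\<^sub>R v + t *\<^sub>R u \<in> S" using n r r3(2) by (force simp: dist_commute)
    show "norm (frechet_derivative (\<lambda>y. frechet_derivative f (at y) v) (at (x + s *\<^sub>R v + t *\<^sub>R u)) u - ?B) \<le> \<epsilon>"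
      by (rule r2(2)) (use n r in linarith)
  qed
  moreover have "f (x + h *\<^sub>R v + h *\<^sub>R u) - f (x + h *\<^sub>R v) - (f (x + h *\<^sub>R u) - f x) = \<Delta>"
    by (simp add: \<Delta>_def algebra_simps)
  ultimately have 2: "norm (\<Delta> - (h * h) *\<^sub>R ?B) \<le> \<epsilon> * h * h" by simp
  have "(h * h) * norm (?A - ?B) = norm ((\<Delta> - (h * h) *\<^sub>R ?B) - (\<Delta> - (h * h) *\<^sub>R ?A))"
    using h by (simp add: scaleR_diff_right[symmetric])
  also have "\<dots> \<le> \<epsilon> * h * h + \<epsilon> * h * h" using norm_triangle_ineq4 1 2 by (smt (verit))
  finally have "(h * h) * norm (?A - ?B) \<le> (h * h) * (2 * \<epsilon>)" by (simp add: algebra_simps)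
  then have "norm (?A - ?B) \<le> 2 * \<epsilon>" using h by simp
  then show False using e by (simp add: \<epsilon>_def)
qed

text \<open>The derivative is itself differentiable at \<open>a\<close>, hence deviates from its
  value at \<open>a\<close> by at most a multiple of the distance to \<open>a\<close>. The free
  radius \<rho> makes the error quadratic near \<open>a\<close>; this is the common input for local
  surjectivity, for the coordinate estimates of the group operations and for the convergence of
  iterated squaring.\<close>

lemma second_order_estimate:
  fixes f :: "'a::real_normed_vector \<Rightarrow> 'b::real_normed_vector"
  assumes fd: "findim TYPE('a)" and S: "open S" and sm: "smooth_on S f" and a: "a \<in> S"
  obtains r K where "r > 0" "K > 0" "ball a r \<subseteq> S"
    "\<And>x y \<rho>. x \<in> ball a r \<Longrightarrow> y \<in> ball a r \<Longrightarrow> norm (x - a) \<le> \<rho> \<Longrightarrow> norm (y - a) \<le> \<rho> \<Longrightarrow>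
      norm (f x - f y - frechet_derivative f (at a) (x - y)) \<le> K * \<rho> * norm (x - y)"
proof -
  obtain B :: "'a set" where B: "finite B" "independent B" "span B = UNIV"
    using findim_basis[OF fd] .
  obtain C where C: "C > 0" "\<And>v b. \<bar>representation B v b\<bar> \<le> C * norm v"
    using representation_bounded[OF B] by blast
  define D where "D = (\<lambda>x. frechet_derivative f (at x))"
  have "\<exists>r>0. \<exists>L>0. \<forall>x. norm (x - a) < r \<longrightarrow> norm (D x b - D a b) \<le> L * norm (x - a)" for b
  proof -
    have der: "((\<lambda>x. D x b) has_derivative frechet_derivative (\<lambda>x. D x b) (at a)) (at a)"
      unfolding D_def by (rule smooth_on_has_derivative[OF smooth_on_frechet[OF sm] a])
    let ?g = "frechet_derivative (\<lambda>x. D x b) (at a)"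
    obtain L where L: "L > 0" "\<And>v. norm (?g v) \<le> norm v * L"
      using bounded_linear.pos_bounded[OF has_derivative_bounded_linear[OF der]] by blast
    obtain d where d: "d > 0" "\<And>y. norm (y - a) < d \<Longrightarrow> norm (D y b - D a b - ?g (y - a)) \<le> 1 * norm (y - a)"
      using der unfolding has_derivative_at_alt using zero_less_one by blast
    have "norm (D y b - D a b) \<le> (L + 1) * norm (y - a)" if "norm (y - a) < d" for y
    proof -
      have "norm (D y b - D a b) \<le> norm (D y b - D a b - ?g (y - a)) + norm (?g (y - a))"
        using norm_triangle_sub by (metis add.commute)
      also have "\<dots> \<le> 1 * norm (y - a) + norm (y - a) * L" using d(2)[OF that] L(2) by (intro add_mono) auto
      finally show ?thesis by (simp add: algebra_simps)
    qed
    then show ?thesis using d(1) L(1) by (intro exI[of _ d] conjI exI[of _ "L+1"]) auto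
  qed
  then obtain r L where rL: "\<And>b. r b > 0" "\<And>b. L b > 0"
    "\<And>b x. norm (x - a) < r b \<Longrightarrow> norm (D x b - D a b) \<le> L b * norm (x - a)" by metis
  obtain r0 where r0: "r0 > 0" "ball a r0 \<subseteq> S" using S a openE by blast
  define R where "R = Min (insert r0 (r ` B))"
  have R: "R > 0" "R \<le> r0" "\<And>b. b \<in> B \<Longrightarrow> R \<le> r b" using B(1) rL(1) r0(1) by (auto simp: R_def)
  \<comment> \<open>The summand \<open>1\<close> keeps \<open>K\<close> positive when the basis is
    empty, that is in dimension 0.\<close>
  define K where "K = 1 + (\<Sum>b\<in>B. C * L b)"
  have K: "K > 0" unfolding K_def using C(1) rL(2) by (intro add_pos_nonneg sum_nonneg) (auto simp: less_imp_le)
  have subS: "ball a R \<subseteq> S" using r0(2) R(2) by (auto simp: ball_def)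
  have lin: "linear (D x)" if "x \<in> S" for x
    unfolding D_def by (rule linear_frechet_derivative[OF smooth_on_differentiable[OF sm that]])
  have op: "norm (D x v - D a v) \<le> K * norm (x - a) * norm v" if x: "x \<in> ball a R" for x v
  proof -
    have xn: "norm (x - a) < R" using x by (simp add: dist_norm norm_minus_commute)
    have "D x v - D a v = (\<Sum>b\<in>B. representation B v b *\<^sub>R (D x b - D a b))"
      using linear_eq_sum_representation[OF B lin, of x v] linear_eq_sum_representation[OF B lin[OF a], of v]
        subS x by (auto simp: scaleR_diff_right sum_subtractf)
    also have "norm \<dots> \<le> (\<Sum>b\<in>B. (C * norm v) * (L b * norm (x - a)))"
    proof (rule sum_norm_le)
      fix b assume "b \<in> B"
      then have "norm (D x b - D a b) \<le> L b * norm (x - a)" using rL(3) xn R(3) by fastforce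
      then show "norm (representation B v b *\<^sub>R (D x b - D a b)) \<le> (C * norm v) * (L b * norm (x - a))"
        using C by (simp add: mult_mono)
    qed
    also have "\<dots> = (\<Sum>b\<in>B. C * L b) * norm (x - a) * norm v"
      by (simp add: sum_distrib_right sum_distrib_left algebra_simps)
    also have "\<dots> \<le> K * norm (x - a) * norm v" unfolding K_def by (intro mult_right_mono) auto
    finally show ?thesis .
  qed
  have main: "norm (f x - f y - D a (x - y)) \<le> K * \<rho> * norm (x - y)"
    if xy: "x \<in> ball a R" "y \<in> ball a R" "norm (x - a) \<le> \<rho>" "norm (y - a) \<le> \<rho>" for x y \<rho>
  proof -
    have "norm ((f x - D a x) - (f y - D a y)) \<le> (K * \<rho>) * norm (x - y)"
    \<comment> \<open>The mean value inequality is applied on the intersection with the ball of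
      radius \<rho>, so that \<rho> and not the fixed radius \<open>R\<close> appears in the
      bound.\<close>
    proof (rule differentiable_bound[of "ball a R \<inter> cball a \<rho>" "\<lambda>x. f x - D a x" "\<lambda>x v. D x v - D a v"])
      show "convex (ball a R \<inter> cball a \<rho>)" by (intro convex_Int convex_ball convex_cball)
      fix z assume z: "z \<in> ball a R \<inter> cball a \<rho>"
      have "(f has_derivative D z) (at z)" unfolding D_def
        by (rule smooth_on_has_derivative[OF sm]) (use z subS in auto)
      moreover have "bounded_linear (D a)" unfolding D_def
        using smooth_on_has_derivative[OF sm a] has_derivative_bounded_linear by blast
      ultimately have "((\<lambda>x. f x - D a x) has_derivative (\<lambda>v. D z v - D a v)) (at z)"
        by (intro has_derivative_diff) (auto intro: bounded_linear_imp_has_derivative)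
      then show "((\<lambda>x. f x - D a x) has_derivative (\<lambda>v. D z v - D a v)) (at z within ball a R \<inter> cball a \<rho>)"
        by (rule has_derivative_at_withinI)
      have zr: "norm (z - a) \<le> \<rho>" using z by (auto simp: dist_norm norm_minus_commute)
      then have "0 \<le> \<rho>" using norm_ge_zero order_trans by blast
      show "onorm (\<lambda>v. D z v - D a v) \<le> K * \<rho>"
      proof (rule onorm_bound)
        show "0 \<le> K * \<rho>" using K \<open>0 \<le> \<rho>\<close> by simp
        fix v
        have "norm (D z v - D a v) \<le> K * norm (z - a) * norm v" using op z by auto
        also have "\<dots> \<le> K * \<rho> * norm v" using zr K by (intro mult_right_mono mult_left_mono) auto
        finally show "norm (D z v - D a v) \<le> K * \<rho> * norm v" .
      qed
    qed (use xy in \<open>auto simp: dist_norm norm_minus_commute\<close>)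
    moreover have "D a x - D a y = D a (x - y)" using lin[OF a] by (simp add: linear_diff)
    ultimately show ?thesis by (simp add: algebra_simps)
  qed
  show ?thesis by (rule that[OF R(1) K subS]) (use main in \<open>auto simp: D_def\<close>)
qed

text \<open>The surjective half of the inverse function theorem: solutions of \<open>f x = y\<close>
  are the fixed points of \<open>x \<mapsto> y - (f x - x)\<close>, a contraction of a small closed
  ball because the derivative of \<open>f\<close> at \<open>a\<close> is the identity.\<close>

lemma local_surjectivity:
  fixes f :: "'a::real_normed_vector \<Rightarrow> 'a"
  assumes fd: "findim TYPE('a)" and S: "open S" and sm: "smooth_on S f" and a: "a \<in> S"
    and id: "\<And>v. frechet_derivative f (at a) v = v"
  obtains d where "d > 0" "ball (f a) d \<subseteq> f ` S"
proof -
  obtain r K where rK: "r > 0" "K > 0" "ball a r \<subseteq> S"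
    "\<And>x y \<rho>. x \<in> ball a r \<Longrightarrow> y \<in> ball a r \<Longrightarrow> norm (x - a) \<le> \<rho> \<Longrightarrow> norm (y - a) \<le> \<rho> \<Longrightarrow>
      norm (f x - f y - (x - y)) \<le> K * \<rho> * norm (x - y)"
    using second_order_estimate[OF fd S sm a] unfolding id by metis
  \<comment> \<open>\<open>K * \<rho> \<le> 1 / 2\<close> is the contraction factor, and
    \<open>r / 2\<close> keeps the closed ball inside the open one.\<close>
  define \<rho> where "\<rho> = min (r / 2) (1 / (2 * K))"
  have rho: "\<rho> > 0" "\<rho> < r" "K * \<rho> \<le> 1 / 2"
    using rK(1,2) by (auto simp: \<rho>_def min_def field_simps)
  have lip: "norm (f x - f y - (x - y)) \<le> 1 / 2 * norm (x - y)" if "x \<in> cball a \<rho>" "y \<in> cball a \<rho>" for x y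
  proof -
    have "norm (f x - f y - (x - y)) \<le> K * \<rho> * norm (x - y)"
      using that rho(2) by (intro rK(4)) (auto simp: dist_norm norm_minus_commute)
    also have "\<dots> \<le> 1 / 2 * norm (x - y)" using rho(3) by (intro mult_right_mono) auto
    finally show ?thesis .
  qed
  have "y \<in> f ` S" if y: "y \<in> ball (f a) (\<rho> / 2)" for y
  proof -
    define T where "T = (\<lambda>x. y - (f x - x))"
    have "\<exists>!x\<in>cball a \<rho>. T x = x"
    proof (rule Banach_fix[where c = "1/2"])
      show "complete (cball a \<rho>)" using compact_cball_findim[OF fd] by (rule compact_imp_complete)
      show "cball a \<rho> \<noteq> {}" using rho by auto
      show "T ` cball a \<rho> \<subseteq> cball a \<rho>"
      proof clarify
        fix x assume x: "x \<in> cball a \<rho>"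
        have "T x - a = (y - f a) - (f x - f a - (x - a))" by (simp add: T_def)
        also have "norm \<dots> \<le> norm (y - f a) + norm (f x - f a - (x - a))" by (rule norm_triangle_ineq4)
        also have "\<dots> \<le> \<rho> / 2 + 1 / 2 * \<rho>"
        proof (rule add_mono)
          show "norm (y - f a) \<le> \<rho> / 2" using y by (simp add: dist_norm norm_minus_commute)
          have "norm (f x - f a - (x - a)) \<le> 1 / 2 * norm (x - a)" using x rho by (intro lip) auto
          also have "\<dots> \<le> 1 / 2 * \<rho>" using x by (simp add: dist_norm norm_minus_commute)
          finally show "norm (f x - f a - (x - a)) \<le> 1 / 2 * \<rho>" .
        qed
        finally show "T x \<in> cball a \<rho>" by (simp add: dist_norm norm_minus_commute)
      qed
      fix x z assume "x \<in> cball a \<rho>" "z \<in> cball a \<rho>"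
      from lip[OF this] show "dist (T x) (T z) \<le> 1 / 2 * dist x z"
        by (simp add: T_def dist_norm algebra_simps norm_minus_commute)
    qed auto
    then obtain x where "x \<in> cball a \<rho>" "T x = x" by blast
    moreover from this have "x \<in> S" using rK(3) rho by (auto simp: ball_def)
    ultimately show ?thesis by (auto simp: T_def)
  qed
  then have "ball (f a) (\<rho> / 2) \<subseteq> f ` S" by blast
  then show ?thesis using that[of "\<rho> / 2"] rho(1) by simp
qed

section \<open>Maps between manifolds\<close>

lemma smooth_atlas_findim:
  fixes A :: "('p::{t2_space, second_countable_topology}, 'e::real_normed_vector) chart set"
  shows "smooth_atlas A \<Longrightarrow> findim TYPE('e)"
  by (auto simp: smooth_atlas_def findim_def)

lemma smooth_atlasD:
  assumes "smooth_atlas A" "c \<in> A"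
  shows "open (fst c)" "open (snd c ` fst c)" "continuous_on (fst c) (snd c)"
    "continuous_on (snd c ` fst c) (chart_inv c)"
    "p \<in> fst c \<Longrightarrow> chart_inv c (snd c p) = p"
    "x \<in> snd c ` fst c \<Longrightarrow> snd c (chart_inv c x) = x"
    "x \<in> snd c ` fst c \<Longrightarrow> chart_inv c x \<in> fst c"
  using assms unfolding smooth_atlas_def homeomorphism_def by auto

lemma smooth_atlas_transition:
  "smooth_atlas A \<Longrightarrow> c \<in> A \<Longrightarrow> d \<in> A \<Longrightarrow>
    smooth_on (snd c ` (fst c \<inter> fst d)) (snd d \<circ> chart_inv c)"
  by (auto simp: smooth_atlas_def)

lemma chart_image_Int:
  assumes "smooth_atlas A" "c \<in> A"
  shows "snd c ` (fst c \<inter> W) = snd c ` fst c \<inter> chart_inv c -` W"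
proof -
  note d = smooth_atlasD[OF assms]
  show ?thesis
  proof (intro equalityI subsetI)
    fix x assume "x \<in> snd c ` fst c \<inter> chart_inv c -` W"
    then show "x \<in> snd c ` (fst c \<inter> W)"
      using d(6,7)[of x] by (metis IntD1 IntD2 IntI imageI vimageD)
  qed (use d(5) in auto)
qed

lemma open_chart_image:
  assumes "smooth_atlas A" "c \<in> A" "open W"
  shows "open (snd c ` (fst c \<inter> W))"
  unfolding chart_image_Int[OF assms(1,2)]
  using smooth_atlasD[OF assms(1,2)] continuous_open_preimage assms(3) by blast

lemma chart_at:
  assumes "smooth_atlas A"
  shows "chart_at A p \<in> A" "p \<in> fst (chart_at A p)"
proof -
  have "p \<in> (\<Union>c\<in>A. fst c)" using assms by (simp add: smooth_atlas_def)
  then have "\<exists>c. c \<in> A \<and> p \<in> fst c" by blast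
  then have "chart_at A p \<in> A \<and> p \<in> fst (chart_at A p)"
    unfolding chart_at_def by (rule someI_ex)
  then show "chart_at A p \<in> A" "p \<in> fst (chart_at A p)" by auto
qed

lemma smooth_map_continuous: "smooth_map A B f \<Longrightarrow> continuous_on UNIV f"
  by (simp add: smooth_map_def)

lemma smooth_map_open_vimage: "smooth_map A B f \<Longrightarrow> open W \<Longrightarrow> open (f -` W)"
  using smooth_map_continuous open_vimage by blast

lemma smooth_map_chart:
  "smooth_map A B f \<Longrightarrow> c \<in> A \<Longrightarrow> d \<in> B \<Longrightarrow>
    smooth_on (snd c ` (fst c \<inter> f -` fst d)) (snd d \<circ> f \<circ> chart_inv c)"
  by (simp add: smooth_map_def)

lemma open_chart_domain:
  assumes "smooth_atlas A" "smooth_atlas B" "smooth_map A B f" "c \<in> A" "d \<in> B"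
  shows "open (snd c ` (fst c \<inter> f -` fst d))"
  using open_chart_image[OF assms(1,4)] smooth_map_open_vimage[OF assms(3)] smooth_atlasD(1)[OF assms(2,5)]
  by blast

text \<open>\<open>tangent_map\<close> is the special case of the preferred charts. These may jump
  from point to point, so every argument that differentiates over a neighbourhood has to work with a
  fixed pair of charts instead.\<close>

definition chart_deriv ::
  "('p, 'e::real_normed_vector) chart \<Rightarrow> ('q, 'f::real_normed_vector) chart \<Rightarrow> ('p \<Rightarrow> 'q) \<Rightarrow> 'p \<Rightarrow> 'e \<Rightarrow> 'f"
  where "chart_deriv c d f p = frechet_derivative (snd d \<circ> f \<circ> chart_inv c) (at (snd c p))"

lemma tangent_map_chart_deriv:
  "tangent_map A B f p = chart_deriv (chart_at A p) (chart_at B (f p)) f p"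
  by (simp add: tangent_map_def chart_deriv_def)

lemma chart_deriv:
  assumes "smooth_map A B f" "c \<in> A" "d \<in> B" "p \<in> fst c" "f p \<in> fst d"
  shows "((snd d \<circ> f \<circ> chart_inv c) has_derivative chart_deriv c d f p) (at (snd c p))"
  unfolding chart_deriv_def
  by (rule smooth_on_has_derivative[OF smooth_map_chart[OF assms(1-3)]]) (use assms in auto)

lemma chart_deriv_linear:
  assumes "smooth_map A B f" "c \<in> A" "d \<in> B" "p \<in> fst c" "f p \<in> fst d"
  shows "linear (chart_deriv c d f p)"
  using chart_deriv[OF assms] has_derivative_linear by blast

lemma smooth_map_id: "smooth_atlas A \<Longrightarrow> smooth_map A A (\<lambda>p. p)"
  using smooth_atlas_transition[of A] by (auto simp: smooth_map_def comp_def vimage_def)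

lemma smooth_map_const: "smooth_map A B (\<lambda>p. q)"
  by (auto simp: smooth_map_def comp_def intro: smooth_on_const)

lemma smooth_map_compose:
  assumes A: "smooth_atlas A" and B: "smooth_atlas B" and C: "smooth_atlas C"
    and f: "smooth_map A B f" and g: "smooth_map B C g"
  shows "smooth_map A C (\<lambda>p. g (f p))"
  unfolding smooth_map_def
proof (intro conjI ballI)
  show "continuous_on UNIV (\<lambda>p. g (f p))"
    using smooth_map_continuous[OF f] smooth_map_continuous[OF g]
      continuous_on_compose2[of UNIV g UNIV f] by auto
  fix c e assume c: "c \<in> A" and e: "e \<in> C"
  note cD = smooth_atlasD[OF A c]
  show "smooth_on (snd c ` (fst c \<inter> (\<lambda>p. g (f p)) -` fst e)) (snd e \<circ> (\<lambda>p. g (f p)) \<circ> chart_inv c)"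
  proof (rule smooth_on_local)
    fix x assume "x \<in> snd c ` (fst c \<inter> (\<lambda>p. g (f p)) -` fst e)"
    then obtain p where p: "p \<in> fst c" "g (f p) \<in> fst e" "x = snd c p" by auto
    define d where "d = chart_at B (f p)"
    have d: "d \<in> B" "f p \<in> fst d" using chart_at[OF B] by (auto simp: d_def)
    note dD = smooth_atlasD[OF B d(1)]
    define W where "W = f -` (fst d \<inter> g -` fst e)"
    have "open (fst d \<inter> g -` fst e)"
      using smooth_atlasD(1)[OF C e] smooth_map_open_vimage[OF g] dD(1) by auto
    then have W: "open W" unfolding W_def by (rule smooth_map_open_vimage[OF f])
    define T where "T = snd c ` (fst c \<inter> W)"
    have T: "open T" unfolding T_def by (rule open_chart_image[OF A c W])
    have TW: "T \<subseteq> snd c ` (fst c \<inter> f -` fst d)" by (auto simp: T_def W_def)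
    have inT: "chart_inv c y \<in> fst c \<and> f (chart_inv c y) \<in> fst d \<and> g (f (chart_inv c y)) \<in> fst e" if "y \<in> T" for y
      using that cD(5) by (auto simp: T_def W_def)
    have "smooth_on T (\<lambda>y. (snd e \<circ> g \<circ> chart_inv d) ((snd d \<circ> f \<circ> chart_inv c) y))"
    proof (rule smooth_on_compose[OF smooth_atlas_findim[OF B] T open_chart_domain[OF B C g d(1) e]])
      show "smooth_on T (snd d \<circ> f \<circ> chart_inv c)"
        by (rule smooth_on_subset[OF smooth_map_chart[OF f c d(1)] TW])
      show "smooth_on (snd d ` (fst d \<inter> g -` fst e)) (snd e \<circ> g \<circ> chart_inv d)"
        by (rule smooth_map_chart[OF g d(1) e])
      show "(snd d \<circ> f \<circ> chart_inv c) ` T \<subseteq> snd d ` (fst d \<inter> g -` fst e)"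
        using inT by auto
    qed
    then have "smooth_on T (snd e \<circ> (\<lambda>p. g (f p)) \<circ> chart_inv c)"
      by (rule smooth_on_cong[OF T, rotated]) (use inT dD(5) in auto)
    then show "\<exists>T. open T \<and> x \<in> T \<and> smooth_on T (snd e \<circ> (\<lambda>p. g (f p)) \<circ> chart_inv c)"
      using T p d by (intro exI[of _ T]) (auto simp: T_def W_def)
  qed
qed

lemma chart_deriv_compose:
  assumes A: "smooth_atlas A" and B: "smooth_atlas B" and C: "smooth_atlas C"
    and f: "smooth_map A B f" and g: "smooth_map B C g"
    and "c \<in> A" "d \<in> B" "e \<in> C" "p \<in> fst c" "f p \<in> fst d" "g (f p) \<in> fst e"
  shows "chart_deriv c e (\<lambda>p. g (f p)) p v = chart_deriv d e g (f p) (chart_deriv c d f p v)"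
proof -
  note cD = smooth_atlasD[OF A assms(6)] and dD = smooth_atlasD[OF B assms(7)]
  have 1: "((snd d \<circ> f \<circ> chart_inv c) has_derivative chart_deriv c d f p) (at (snd c p))"
    by (rule chart_deriv[OF f]) (use assms in auto)
  have 2: "((snd e \<circ> g \<circ> chart_inv d) has_derivative chart_deriv d e g (f p)) (at ((snd d \<circ> f \<circ> chart_inv c) (snd c p)))"
    using chart_deriv[OF g assms(7,8,10,11)] assms cD(5) by simp
  have "((\<lambda>y. (snd e \<circ> g \<circ> chart_inv d) ((snd d \<circ> f \<circ> chart_inv c) y)) has_derivative
      (\<lambda>v. chart_deriv d e g (f p) (chart_deriv c d f p v))) (at (snd c p))"
    by (rule has_derivative_compose[OF 1 2])
  then have "((snd e \<circ> (\<lambda>p. g (f p)) \<circ> chart_inv c) has_derivative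
      (\<lambda>v. chart_deriv d e g (f p) (chart_deriv c d f p v))) (at (snd c p))"
  proof (rule has_derivative_transform_within_open)
    show "open (snd c ` (fst c \<inter> f -` fst d))" by (rule open_chart_domain[OF A B f assms(6,7)])
  qed (use assms cD(5) dD(5) in auto)
  then show ?thesis unfolding chart_deriv_def[of c e] using frechet_derivative_eqI by metis
qed

lemma tangent_map_compose:
  assumes "smooth_atlas A" "smooth_atlas B" "smooth_atlas C" "smooth_map A B f" "smooth_map B C g"
  shows "tangent_map A C (\<lambda>p. g (f p)) p v = tangent_map B C g (f p) (tangent_map A B f p v)"
  unfolding tangent_map_chart_deriv by (rule chart_deriv_compose[OF assms]) (simp_all add: chart_at assms)

text \<open>The passage between a fixed pair of charts and the preferred ones: the two outer factors
  are derivatives of transition maps. Properties of \<open>tangent_map\<close>, such as vanishing or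
  complex linearity, are transferred to arbitrary charts in this way.\<close>

lemma chart_deriv_change:
  assumes "smooth_atlas A" "smooth_atlas B" "smooth_map A B f" "c \<in> A" "d \<in> B" "p \<in> fst c" "f p \<in> fst d"
  shows "chart_deriv c d f p v = chart_deriv (chart_at B (f p)) d (\<lambda>p. p) (f p)
    (tangent_map A B f p (chart_deriv c (chart_at A p) (\<lambda>p. p) p v))"
proof -
  note ch = chart_at[OF assms(1)] chart_at[OF assms(2)]
  have "chart_deriv c d f p v = chart_deriv (chart_at A p) d f p (chart_deriv c (chart_at A p) (\<lambda>p. p) p v)"
    by (rule chart_deriv_compose[OF assms(1,1,2) smooth_map_id[OF assms(1)] assms(3)]) (use assms ch in auto)
  also have "chart_deriv (chart_at A p) d f p w =
      chart_deriv (chart_at B (f p)) d (\<lambda>p. p) (f p) (tangent_map A B f p w)" for w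
    unfolding tangent_map_chart_deriv
    by (rule chart_deriv_compose[OF assms(1,2,2,3) smooth_map_id[OF assms(2)]]) (use assms ch in auto)
  finally show ?thesis .
qed

lemma tangent_map_linear:
  assumes "smooth_atlas A" "smooth_atlas B" "smooth_map A B f"
  shows "linear (tangent_map A B f p)"
  unfolding tangent_map_chart_deriv
  by (rule chart_deriv_linear[OF assms(3)]) (simp_all add: chart_at assms)

lemma chart_deriv_id:
  assumes "smooth_atlas A" "c \<in> A" "p \<in> fst c"
  shows "chart_deriv c c (\<lambda>p. p) p v = v"
proof -
  note cD = smooth_atlasD[OF assms(1,2)]
  have "((snd c \<circ> (\<lambda>p. p) \<circ> chart_inv c) has_derivative (\<lambda>v. v)) (at (snd c p))"
    by (rule has_derivative_transform_within_open[OF has_derivative_ident cD(2)]) (use cD assms in auto)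
  then show ?thesis unfolding chart_deriv_def using frechet_derivative_eqI by metis
qed

lemma tangent_map_id: "smooth_atlas A \<Longrightarrow> tangent_map A A (\<lambda>p. p) p v = v"
  unfolding tangent_map_chart_deriv by (simp add: chart_at chart_deriv_id)

lemma tangent_map_const: "tangent_map A B (\<lambda>p. q) p v = 0"
  unfolding tangent_map_def by (simp add: comp_def frechet_derivative_const)

section \<open>Normed spaces as manifolds with one chart\<close>

lemma chart_inv_vector [simp]: "chart_inv (UNIV, \<lambda>x. x) = (\<lambda>x. x)"
  by (simp add: chart_inv_def)

lemma vector_atlas_mem: "c \<in> vector_atlas \<longleftrightarrow> c = (UNIV, \<lambda>x. x)"
  by (simp add: vector_atlas_def)

lemma chart_at_vector [simp]: "chart_at vector_atlas x = (UNIV, \<lambda>x. x)"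
  unfolding chart_at_def vector_atlas_def by (rule some_equality) auto

lemma smooth_atlas_vector:
  assumes "findim TYPE('e::{real_normed_vector, second_countable_topology})"
  shows "smooth_atlas (vector_atlas :: ('e, 'e) chart set)"
  using assms unfolding smooth_atlas_def findim_def
  by (auto simp: vector_atlas_def homeomorphism_def comp_def intro: smooth_on_linear bounded_linear_ident)

lemma tangent_map_vector: "tangent_map vector_atlas vector_atlas f x = frechet_derivative f (at x)"
  by (simp add: tangent_map_def comp_def)

lemma smooth_map_vector: "smooth_map vector_atlas vector_atlas f \<longleftrightarrow> smooth_on UNIV f"
  by (auto simp: smooth_map_def vector_atlas_def comp_def intro: smooth_on_continuous)

lemma smooth_map_linear: "bounded_linear f \<Longrightarrow> smooth_map vector_atlas vector_atlas f"
  by (simp add: smooth_map_vector smooth_on_linear)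

lemma smooth_shift: "smooth_map vector_atlas vector_atlas (\<lambda>h::real. h - s)"
  unfolding smooth_map_vector
  using smooth_on_add[OF open_UNIV smooth_on_linear[OF bounded_linear_ident] smooth_on_const[of UNIV "- s"]] by simp

lemma frechet_shift: "frechet_derivative (\<lambda>h::real. h - s) (at t) = (\<lambda>h. h)"
  by (rule frechet_derivative_eqI) (auto intro!: derivative_eq_intros)

section \<open>Products of manifolds\<close>

lemma prod_atlasE:
  assumes "e \<in> prod_atlas A B"
  obtains c d where "c \<in> A" "d \<in> B" "e = (fst c \<times> fst d, map_prod (snd c) (snd d))"
  using assms by (auto simp: prod_atlas_def)

abbreviation prod_chart :: "('p, 'e) chart \<Rightarrow> ('q, 'f) chart \<Rightarrow> ('p \<times> 'q, 'e \<times> 'f) chart" where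
  "prod_chart c d \<equiv> (fst c \<times> fst d, map_prod (snd c) (snd d))"

lemma prod_chart_inv:
  assumes A: "smooth_atlas A" "c \<in> A" and B: "smooth_atlas B" "d \<in> B"
    and "x \<in> snd c ` fst c" "y \<in> snd d ` fst d"
  shows "chart_inv (prod_chart c d) (x, y) = (chart_inv c x, chart_inv d y)"
proof -
  note cD = smooth_atlasD[OF A] and dD = smooth_atlasD[OF B]
  have "inj_on (map_prod (snd c) (snd d)) (fst c \<times> fst d)"
    by (intro map_prod_inj_on inj_on_inverseI[of _ "chart_inv c"] inj_on_inverseI[of _ "chart_inv d"])
      (simp_all add: cD dD)
  then show ?thesis unfolding chart_inv_def[of "prod_chart c d"]
    by (intro inv_into_f_eq) (use assms cD dD in auto)
qed

lemma map_prod_image_Times: "map_prod f g ` (A \<times> B) = f ` A \<times> g ` B"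
  by force

lemma smooth_on_fst: "smooth_on S fst" and smooth_on_snd: "smooth_on S snd"
  by (simp_all add: smooth_on_linear bounded_linear_fst bounded_linear_snd)

lemma smooth_atlas_prod:
  fixes A :: "('p::{t2_space, second_countable_topology}, 'e::real_normed_vector) chart set"
    and B :: "('q::{t2_space, second_countable_topology}, 'f::real_normed_vector) chart set"
  assumes A: "smooth_atlas A" and B: "smooth_atlas B"
  shows "smooth_atlas (prod_atlas A B)"
  unfolding smooth_atlas_def
proof (intro conjI ballI)
  show "\<exists>B::('e \<times> 'f) set. finite B \<and> span B = UNIV"
    using findim_prod[OF smooth_atlas_findim[OF A] smooth_atlas_findim[OF B]] by (simp add: findim_def)
next
  fix e assume "e \<in> prod_atlas A B"
  then obtain c d where c: "c \<in> A" and d: "d \<in> B" and e: "e = prod_chart c d" by (rule prod_atlasE)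
  note cD = smooth_atlasD[OF A c] and dD = smooth_atlasD[OF B d]
  show "open (fst e)" using cD dD by (simp add: e open_Times)
  have im: "snd e ` fst e = snd c ` fst c \<times> snd d ` fst d" by (simp add: e map_prod_image_Times)
  show "open (snd e ` fst e)" using cD dD by (simp add: im open_Times)
  have inv: "chart_inv e z = (chart_inv c (fst z), chart_inv d (snd z))" if "z \<in> snd e ` fst e" for z
    using prod_chart_inv[OF A c B d, of "fst z" "snd z"] that by (auto simp: e im)
  have img: "chart_inv e ` (snd e ` fst e) = fst e"
  proof -
    have "chart_inv e ` (snd e ` fst e) = (\<lambda>z. (chart_inv c (fst z), chart_inv d (snd z))) ` (snd e ` fst e)"
      by (rule image_cong[OF refl inv])
    also have "\<dots> = (\<lambda>z. (chart_inv c (fst z), chart_inv d (snd z))) ` (snd c ` fst c \<times> snd d ` fst d)"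
      by (simp only: im)
    also have "\<dots> = fst c \<times> fst d" using cD dD by (force simp: image_iff)
    finally show ?thesis by (simp add: e)
  qed
  show "homeomorphism (fst e) (snd e ` fst e) (snd e) (chart_inv e)"
  proof (rule homeomorphismI)
    show "continuous_on (fst e) (snd e)" unfolding e map_prod_def
      by (auto intro!: continuous_on_Pair continuous_on_compose2[OF cD(3)] continuous_on_compose2[OF dD(3)]
          continuous_intros simp: split_beta)
    have "continuous_on (snd e ` fst e) (\<lambda>z. (chart_inv c (fst z), chart_inv d (snd z)))"
      unfolding im by (auto intro!: continuous_on_Pair continuous_on_compose2[OF cD(4)] continuous_on_compose2[OF dD(4)]
          continuous_intros)
    then show "continuous_on (snd e ` fst e) (chart_inv e)" using inv by (simp cong: continuous_on_cong)
    show "chart_inv e ` (snd e ` fst e) \<subseteq> fst e" using img by simp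
    show "chart_inv e (snd e z) = z" if "z \<in> fst e" for z
      using inv[of "snd e z"] that cD(5) dD(5) by (auto simp: e)
    show "snd e (chart_inv e z) = z" if "z \<in> snd e ` fst e" for z
      using inv[OF that] that cD(6) dD(6) unfolding im by (auto simp: e)
  qed auto
next
  show "(\<Union>e\<in>prod_atlas A B. fst e) = UNIV"
  proof -
    have "(p, q) \<in> (\<Union>e\<in>prod_atlas A B. fst e)" for p q
    proof -
      have "prod_chart (chart_at A p) (chart_at B q) \<in> prod_atlas A B"
        using chart_at[OF A] chart_at[OF B] unfolding prod_atlas_def by blast
      moreover have "(p, q) \<in> fst (prod_chart (chart_at A p) (chart_at B q))"
        using chart_at[OF A] chart_at[OF B] by simp
      ultimately show ?thesis by blast
    qed
    then show ?thesis by auto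
  qed
next
  fix e e' assume "e \<in> prod_atlas A B" "e' \<in> prod_atlas A B"
  then obtain c d c' d' where c: "c \<in> A" and d: "d \<in> B" and e: "e = prod_chart c d"
    and c': "c' \<in> A" and d': "d' \<in> B" and e': "e' = prod_chart c' d'"
    by (elim prod_atlasE)
  note cD = smooth_atlasD[OF A c] and dD = smooth_atlasD[OF B d]
  let ?S = "snd c ` (fst c \<inter> fst c')" and ?T = "snd d ` (fst d \<inter> fst d')"
  have S: "open ?S" "open ?T"
    by (intro open_chart_image[OF A c] open_chart_image[OF B d] smooth_atlasD(1)[OF A c'] smooth_atlasD(1)[OF B d'])+
  then have ST: "open (?S \<times> ?T)" by (rule open_Times)
  have im: "snd e ` (fst e \<inter> fst e') = ?S \<times> ?T"
    by (simp add: e e' Times_Int_Times map_prod_image_Times)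
  have "smooth_on (?S \<times> ?T) (\<lambda>z. ((snd c' \<circ> chart_inv c) (fst z), (snd d' \<circ> chart_inv d) (snd z)))"
    by (intro smooth_on_Pair ST smooth_on_compose[OF smooth_atlas_findim[OF A] ST S(1) smooth_on_fst smooth_atlas_transition[OF A c c']]
        smooth_on_compose[OF smooth_atlas_findim[OF B] ST S(2) smooth_on_snd smooth_atlas_transition[OF B d d']]) auto
  then have "smooth_on (?S \<times> ?T) (snd e' \<circ> chart_inv e)"
  proof (rule smooth_on_cong[OF ST, rotated])
    fix z assume "z \<in> ?S \<times> ?T"
    then have "chart_inv (prod_chart c d) (fst z, snd z) = (chart_inv c (fst z), chart_inv d (snd z))"
      by (intro prod_chart_inv[OF A c B d]) auto
    then show "((snd c' \<circ> chart_inv c) (fst z), (snd d' \<circ> chart_inv d) (snd z)) = (snd e' \<circ> chart_inv e) z"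
      by (simp add: e e')
  qed
  then show "smooth_on (snd e ` (fst e \<inter> fst e')) (snd e' \<circ> chart_inv e)" by (simp add: im)
qed

lemma smooth_map_Pair:
  assumes A: "smooth_atlas A" and B: "smooth_atlas B" and C: "smooth_atlas C"
    and f: "smooth_map A B f" and g: "smooth_map A C g"
  shows "smooth_map A (prod_atlas B C) (\<lambda>p. (f p, g p))"
  unfolding smooth_map_def
proof (intro conjI ballI)
  show "continuous_on UNIV (\<lambda>p. (f p, g p))"
    using smooth_map_continuous[OF f] smooth_map_continuous[OF g] by (intro continuous_on_Pair)
  fix c e assume c: "c \<in> A" and "e \<in> prod_atlas B C"
  then obtain d d' where d: "d \<in> B" "d' \<in> C" and e: "e = prod_chart d d'" by (elim prod_atlasE)
  let ?S = "snd c ` (fst c \<inter> (\<lambda>p. (f p, g p)) -` fst e)"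
  have "open ((\<lambda>p. (f p, g p)) -` fst e)"
    using \<open>continuous_on UNIV (\<lambda>p. (f p, g p))\<close> smooth_atlasD(1)[OF B d(1)] smooth_atlasD(1)[OF C d(2)]
    by (intro open_vimage) (auto simp: e open_Times)
  then have S: "open ?S" by (rule open_chart_image[OF A c])
  have "smooth_on ?S (\<lambda>x. ((snd d \<circ> f \<circ> chart_inv c) x, (snd d' \<circ> g \<circ> chart_inv c) x))"
    by (intro smooth_on_Pair S smooth_on_subset[OF smooth_map_chart[OF f c d(1)]]
        smooth_on_subset[OF smooth_map_chart[OF g c d(2)]]) (auto simp: e)
  then show "smooth_on ?S (snd e \<circ> (\<lambda>p. (f p, g p)) \<circ> chart_inv c)"
    by (simp add: e comp_def)
qed

text \<open>The preferred chart of the product at \<open>(f p, g p)\<close> is some product chart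
  whose factors may differ from the preferred charts at \<open>f p\<close> and \<open>g p\<close>.
  Writing the velocity as a sum of two partial velocities avoids naming its components.\<close>

lemma tangent_map_Pair:
  assumes A: "smooth_atlas A" and B: "smooth_atlas B" and C: "smooth_atlas C"
    and f: "smooth_map A B f" and g: "smooth_map A C g"
  shows "tangent_map A (prod_atlas B C) (\<lambda>p. (f p, g p)) p v =
    tangent_map A (prod_atlas B C) (\<lambda>p'. (f p', g p)) p v + tangent_map A (prod_atlas B C) (\<lambda>p'. (f p, g p')) p v"
proof -
  obtain c where c: "c \<in> A" "p \<in> fst c" "c = chart_at A p" using chart_at[OF A] by blast
  have "chart_at (prod_atlas B C) (f p, g p) \<in> prod_atlas B C"
    by (rule chart_at[OF smooth_atlas_prod[OF B C]])
  then obtain d e where d: "d \<in> B" and e: "e \<in> C" and de: "chart_at (prod_atlas B C) (f p, g p) = prod_chart d e"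
    by (rule prod_atlasE)
  have fg: "f p \<in> fst d" "g p \<in> fst e"
    using chart_at(2)[OF smooth_atlas_prod[OF B C], of "(f p, g p)"] by (auto simp: de)
  note D1 = chart_deriv[OF f c(1) d c(2) fg(1)]
  note D2 = chart_deriv[OF g c(1) e c(2) fg(2)]
  have 1: "((snd (prod_chart d e) \<circ> (\<lambda>p'. (f p', g p')) \<circ> chart_inv c) has_derivative
      (\<lambda>v. (chart_deriv c d f p v, chart_deriv c e g p v))) (at (snd c p))"
    using has_derivative_Pair[OF D1 D2] by (simp add: comp_def)
  have 2: "((snd (prod_chart d e) \<circ> (\<lambda>p'. (f p', g p)) \<circ> chart_inv c) has_derivative
      (\<lambda>v. (chart_deriv c d f p v, 0))) (at (snd c p))"
    using has_derivative_Pair[OF D1 has_derivative_const[of "snd e (g p)"]] by (simp add: comp_def)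
  have 3: "((snd (prod_chart d e) \<circ> (\<lambda>p'. (f p, g p')) \<circ> chart_inv c) has_derivative
      (\<lambda>v. (0, chart_deriv c e g p v))) (at (snd c p))"
    using has_derivative_Pair[OF has_derivative_const[of "snd d (f p)"] D2] by (simp add: comp_def)
  show ?thesis
    unfolding tangent_map_def de c(3)[symmetric]
    by (simp only: frechet_derivative_eqI[OF 1] frechet_derivative_eqI[OF 2] frechet_derivative_eqI[OF 3]) simp
qed

lemma smooth_map_Pair_left:
  "smooth_atlas A \<Longrightarrow> smooth_atlas B \<Longrightarrow> smooth_map A (prod_atlas A B) (\<lambda>p. (p, q))"
  by (intro smooth_map_Pair smooth_map_id smooth_map_const)

lemma smooth_map_Pair_right:
  "smooth_atlas A \<Longrightarrow> smooth_atlas B \<Longrightarrow> smooth_map B (prod_atlas A B) (\<lambda>q. (p, q))"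
  by (intro smooth_map_Pair smooth_map_id smooth_map_const)

text \<open>Chain rule through the pair map, whose velocity splits into the two partial ones. For
  the group multiplication it becomes the product rule for maps into the group.\<close>

lemma tangent_map_Leibniz:
  assumes A: "smooth_atlas A" and B: "smooth_atlas B" and C: "smooth_atlas C" and E: "smooth_atlas E"
    and f: "smooth_map A B f" and g: "smooth_map A C g" and F: "smooth_map (prod_atlas B C) E F"
  shows "tangent_map A E (\<lambda>p. F (f p, g p)) p v =
    tangent_map B E (\<lambda>q. F (q, g p)) (f p) (tangent_map A B f p v) +
    tangent_map C E (\<lambda>r. F (f p, r)) (g p) (tangent_map A C g p v)"
proof -
  note BC = smooth_atlas_prod[OF B C]
  have sF1: "smooth_map B E (\<lambda>q. F (q, r))" for r
    by (rule smooth_map_compose[OF B BC E smooth_map_Pair_left[OF B C] F])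
  have sF2: "smooth_map C E (\<lambda>r. F (q, r))" for q
    by (rule smooth_map_compose[OF C BC E smooth_map_Pair_right[OF B C] F])
  note s1 = smooth_map_Pair[OF A B C f g]
    and s2 = smooth_map_Pair[OF A B C f smooth_map_const[of A C "g p"]]
    and s3 = smooth_map_Pair[OF A B C smooth_map_const[of A B "f p"] g]
  have "tangent_map A E (\<lambda>p. F (f p, g p)) p v =
      tangent_map (prod_atlas B C) E F (f p, g p) (tangent_map A (prod_atlas B C) (\<lambda>p. (f p, g p)) p v)"
    by (rule tangent_map_compose[OF A BC E s1 F])
  also have "\<dots> = tangent_map (prod_atlas B C) E F (f p, g p) (tangent_map A (prod_atlas B C) (\<lambda>p'. (f p', g p)) p v) +
      tangent_map (prod_atlas B C) E F (f p, g p) (tangent_map A (prod_atlas B C) (\<lambda>p'. (f p, g p')) p v)"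
    by (subst tangent_map_Pair[OF A B C f g]) (rule linear_add[OF tangent_map_linear[OF BC E F]])
  also have "\<dots> = tangent_map A E (\<lambda>p'. F (f p', g p)) p v + tangent_map A E (\<lambda>p'. F (f p, g p')) p v"
    using tangent_map_compose[OF A BC E s2 F, of p v] tangent_map_compose[OF A BC E s3 F, of p v] by simp
  also have "tangent_map A E (\<lambda>p'. F (f p', g p)) p v = tangent_map B E (\<lambda>q. F (q, g p)) (f p) (tangent_map A B f p v)"
    by (rule tangent_map_compose[OF A B E f sF1])
  also have "tangent_map A E (\<lambda>p'. F (f p, g p')) p v = tangent_map C E (\<lambda>r. F (f p, r)) (g p) (tangent_map A C g p v)"
    by (rule tangent_map_compose[OF A C E g sF2])
  finally show ?thesis .
qed

section \<open>Holomorphic maps\<close>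

lemma complex_atlas_smooth: "complex_atlas j A \<Longrightarrow> smooth_atlas A"
  by (simp add: complex_atlas_def)

lemma complex_structureD:
  assumes "complex_structure j"
  shows "linear j" "j (j v) = - v" "j 0 = 0" "j (- v) = - j v" "j (u + v) = j u + j v"
    "j (u - v) = j u - j v" "j (a *\<^sub>R v) = a *\<^sub>R j v" "j v = 0 \<longleftrightarrow> v = 0"
proof -
  show l: "linear j" using assms by (simp add: complex_structure_def)
  show jj: "j (j v) = - v" for v using assms by (simp add: complex_structure_def)
  show "j 0 = 0" "j (- v) = - j v" "j (u + v) = j u + j v" "j (u - v) = j u - j v" "j (a *\<^sub>R v) = a *\<^sub>R j v"
    using l by (simp_all add: linear_0 linear_neg linear_add linear_diff linear_cmul)
  then show "j v = 0 \<longleftrightarrow> v = 0" using jj by (metis neg_equal_0_iff_equal)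
qed

lemma complex_atlas_structure: "complex_atlas j A \<Longrightarrow> complex_structure j"
  by (simp add: complex_atlas_def)

lemma chart_deriv_transition_complex:
  assumes "complex_atlas j A" "c \<in> A" "d \<in> A" "p \<in> fst c" "p \<in> fst d"
  shows "chart_deriv c d (\<lambda>p. p) p (j v) = j (chart_deriv c d (\<lambda>p. p) p v)"
proof -
  have "(snd d \<circ> (\<lambda>p. p) \<circ> chart_inv c) = snd d \<circ> chart_inv c" by auto
  moreover have "snd c p \<in> snd c ` (fst c \<inter> fst d)" using assms by auto
  ultimately show ?thesis using assms unfolding chart_deriv_def complex_atlas_def by metis
qed

lemma holomorphic_chart_deriv:
  assumes "complex_atlas j A" "complex_atlas i B" "holomorphic_map j A i B f"
    "c \<in> A" "d \<in> B" "p \<in> fst c" "f p \<in> fst d"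
  shows "chart_deriv c d f p (j v) = i (chart_deriv c d f p v)"
proof -
  note s = complex_atlas_smooth[OF assms(1)] complex_atlas_smooth[OF assms(2)]
  have f: "smooth_map A B f" and T: "\<And>p v. tangent_map A B f p (j v) = i (tangent_map A B f p v)"
    using assms(3) by (auto simp: holomorphic_map_def)
  show ?thesis
    unfolding chart_deriv_change[OF s f assms(4-7)]
    using chart_deriv_transition_complex[OF assms(1,4) chart_at(1)[OF s(1)] assms(6) chart_at(2)[OF s(1)]]
      chart_deriv_transition_complex[OF assms(2) chart_at(1)[OF s(2)] assms(5) chart_at(2)[OF s(2)] assms(7)] T
    by simp
qed

lemma holomorphic_map_compose:
  assumes "smooth_atlas A" "smooth_atlas B" "smooth_atlas C"
    "holomorphic_map j A i B f" "holomorphic_map i B k C g"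
  shows "holomorphic_map j A k C (\<lambda>p. g (f p))"
  using assms smooth_map_compose[OF assms(1-3)] tangent_map_compose[OF assms(1-3)]
  unfolding holomorphic_map_def by metis

text \<open>Composition with the multiplication or with the action turns this into the holomorphy of
  right translations and of orbit maps.\<close>

lemma holomorphic_map_Pair_left:
  assumes "complex_atlas j A" "complex_atlas i B"
  shows "holomorphic_map j A (map_prod j i) (prod_atlas A B) (\<lambda>p. (p, q))"
  unfolding holomorphic_map_def
proof (intro conjI allI)
  note A = complex_atlas_smooth[OF assms(1)] and B = complex_atlas_smooth[OF assms(2)]
  show "smooth_map A (prod_atlas A B) (\<lambda>p. (p, q))" by (rule smooth_map_Pair_left[OF A B])
  fix p v
  obtain c where c: "c \<in> A" "p \<in> fst c" "c = chart_at A p" using chart_at[OF A] by blast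
  have "chart_at (prod_atlas A B) (p, q) \<in> prod_atlas A B" by (rule chart_at[OF smooth_atlas_prod[OF A B]])
  then obtain d e where d: "d \<in> A" and e: "e \<in> B" and de: "chart_at (prod_atlas A B) (p, q) = prod_chart d e"
    by (rule prod_atlasE)
  have pd: "p \<in> fst d" using chart_at(2)[OF smooth_atlas_prod[OF A B], of "(p, q)"] by (auto simp: de)
  note D1 = chart_deriv[OF smooth_map_id[OF A] c(1) d c(2) pd]
  have 2: "((snd (prod_chart d e) \<circ> (\<lambda>p. (p, q)) \<circ> chart_inv c) has_derivative
      (\<lambda>v. (chart_deriv c d (\<lambda>p. p) p v, 0))) (at (snd c p))"
    using has_derivative_Pair[OF D1 has_derivative_const[of "snd e q"]] by (simp add: comp_def)
  show "tangent_map A (prod_atlas A B) (\<lambda>p. (p, q)) p (j v) =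
      map_prod j i (tangent_map A (prod_atlas A B) (\<lambda>p. (p, q)) p v)"
    unfolding tangent_map_def de c(3)[symmetric]
    using chart_deriv_transition_complex[OF assms(1) c(1) d c(2) pd]
      complex_structureD(3)[OF complex_atlas_structure[OF assms(2)]]
    by (simp only: frechet_derivative_eqI[OF 2]) simp
qed

lemma holomorphic_map_Pair_right:
  assumes "complex_atlas j A" "complex_atlas i B"
  shows "holomorphic_map i B (map_prod j i) (prod_atlas A B) (\<lambda>q. (p, q))"
  unfolding holomorphic_map_def
proof (intro conjI allI)
  note A = complex_atlas_smooth[OF assms(1)] and B = complex_atlas_smooth[OF assms(2)]
  show "smooth_map B (prod_atlas A B) (\<lambda>q. (p, q))" by (rule smooth_map_Pair_right[OF A B])
  fix q v
  obtain c where c: "c \<in> B" "q \<in> fst c" "c = chart_at B q" using chart_at[OF B] by blast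
  have "chart_at (prod_atlas A B) (p, q) \<in> prod_atlas A B" by (rule chart_at[OF smooth_atlas_prod[OF A B]])
  then obtain d e where d: "d \<in> A" and e: "e \<in> B" and de: "chart_at (prod_atlas A B) (p, q) = prod_chart d e"
    by (rule prod_atlasE)
  have pd: "q \<in> fst e" using chart_at(2)[OF smooth_atlas_prod[OF A B], of "(p, q)"] by (auto simp: de)
  note D1 = chart_deriv[OF smooth_map_id[OF B] c(1) e c(2) pd]
  have 2: "((snd (prod_chart d e) \<circ> (\<lambda>q. (p, q)) \<circ> chart_inv c) has_derivative
      (\<lambda>v. (0, chart_deriv c e (\<lambda>p. p) q v))) (at (snd c q))"
    using has_derivative_Pair[OF has_derivative_const[of "snd d p"] D1] by (simp add: comp_def)
  show "tangent_map B (prod_atlas A B) (\<lambda>q. (p, q)) q (i v) =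
      map_prod j i (tangent_map B (prod_atlas A B) (\<lambda>q. (p, q)) q v)"
    unfolding tangent_map_def de c(3)[symmetric]
    using chart_deriv_transition_complex[OF assms(2) c(1) e c(2) pd]
      complex_structureD(3)[OF complex_atlas_structure[OF assms(1)]]
    by (simp only: frechet_derivative_eqI[OF 2]) simp
qed

text \<open>Vanishing velocity makes the coordinates constant on a small interval, so the curve is
  locally constant, and the connectedness of \<open>I\<close> does the rest.\<close>

lemma smooth_curve_constant:
  fixes \<gamma> :: "real \<Rightarrow> 'p::{t2_space, second_countable_topology}"
  assumes B: "smooth_atlas B" and g: "smooth_map vector_atlas B \<gamma>" and I: "open I" "connected I"
    and z: "\<And>t. t \<in> I \<Longrightarrow> tangent_map vector_atlas B \<gamma> t 1 = 0" and ab: "a \<in> I" "b \<in> I"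
  shows "\<gamma> a = \<gamma> b"
proof (rule connected_local_const[OF I(2) ab], intro ballI)
  note V = smooth_atlas_vector[OF findim_real]
  fix s assume s: "s \<in> I"
  define d where "d = chart_at B (\<gamma> s)"
  have d: "d \<in> B" "\<gamma> s \<in> fst d" using chart_at[OF B] by (auto simp: d_def)
  have "open (I \<inter> \<gamma> -` fst d)" using I(1) smooth_map_open_vimage[OF g] smooth_atlasD(1)[OF B d(1)] by auto
  then obtain r where r: "r > 0" "ball s r \<subseteq> I \<inter> \<gamma> -` fst d" using openE[of "I \<inter> \<gamma> -` fst d" s] s d by auto
  have "((snd d \<circ> \<gamma>) has_derivative (\<lambda>h. 0)) (at t within ball s r)" if t: "t \<in> ball s r" for t
  proof -
    have t': "t \<in> I" "\<gamma> t \<in> fst d" using r t by auto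
    have vc: "(UNIV, \<lambda>x. x) \<in> vector_atlas" by (simp add: vector_atlas_mem)
    have "tangent_map vector_atlas B \<gamma> t h = h *\<^sub>R tangent_map vector_atlas B \<gamma> t 1" for h
      using linear_cmul[OF tangent_map_linear[OF V B g], of t h 1] by simp
    then have "tangent_map vector_atlas B \<gamma> t h = 0" for h using z[OF t'(1)] by simp
    moreover have "linear (chart_deriv (chart_at B (\<gamma> t)) d (\<lambda>p. p) (\<gamma> t))"
      by (rule chart_deriv_linear[OF smooth_map_id[OF B]]) (use chart_at[OF B] d t' in auto)
    \<comment> \<open>The hypothesis concerns the preferred chart at each \<open>\<gamma> t\<close>;
      the derivative of a transition map carries the zero velocity over to the fixed chart
      \<open>d\<close>.\<close>
    ultimately have "chart_deriv (UNIV, \<lambda>x. x) d \<gamma> t h = 0" for h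
      using chart_deriv_change[OF V B g vc d(1), of t h] t' by (simp add: linear_0)
    then have "chart_deriv (UNIV, \<lambda>x. x) d \<gamma> t = (\<lambda>h. 0)" by auto
    moreover have "((snd d \<circ> \<gamma> \<circ> chart_inv (UNIV, \<lambda>x. x)) has_derivative chart_deriv (UNIV, \<lambda>x. x) d \<gamma> t) (at (snd (UNIV, \<lambda>x. x) t))"
      using chart_deriv[OF g vc d(1), of t] t' by simp
    ultimately have "((snd d \<circ> \<gamma>) has_derivative (\<lambda>h. 0)) (at t)" by (simp add: comp_def)
    then show ?thesis by (rule has_derivative_at_withinI)
  qed
  then obtain k where k: "\<And>t. t \<in> ball s r \<Longrightarrow> (snd d \<circ> \<gamma>) t = k"
    using has_derivative_zero_constant[of "ball s r"] by (metis convex_ball)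
  have "\<gamma> s = \<gamma> t" if t: "t \<in> ball s r" for t
  proof -
    have "snd d (\<gamma> t) = snd d (\<gamma> s)" using k[OF t] k[of s] r by simp
    moreover have "\<gamma> t \<in> fst d" using r t by auto
    ultimately show ?thesis using smooth_atlasD(5)[OF B d(1)] d(2) by metis
  qed
  then show "\<forall>\<^sub>F t in at s within I. \<gamma> s = \<gamma> t"
    unfolding eventually_at using r(1) by (metis dist_commute mem_ball)
qed

text \<open>\<open>smooth_map\<close> speaks of globally defined maps. Inverse charts, and whatever
  is built from them, live on open subsets of a normed space, and this is the matching local
  notion.\<close>

definition smooth_into ::
  "'a::real_normed_vector set \<Rightarrow> ('p::topological_space, 'e::real_normed_vector) chart set \<Rightarrow> ('a \<Rightarrow> 'p) \<Rightarrow> bool" where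
  "smooth_into S B f \<longleftrightarrow> open S \<and> continuous_on S f \<and>
    (\<forall>d\<in>B. smooth_on (S \<inter> f -` fst d) (snd d \<circ> f))"

lemma smooth_into_chart:
  "smooth_into S B f \<Longrightarrow> d \<in> B \<Longrightarrow> T \<subseteq> S \<inter> f -` fst d \<Longrightarrow> smooth_on T (snd d \<circ> f)"
  unfolding smooth_into_def using smooth_on_subset by blast

lemma smooth_into_vector: "smooth_into UNIV B f \<longleftrightarrow> smooth_map vector_atlas B f"
  by (auto simp: smooth_into_def smooth_map_def vector_atlas_def comp_def)

lemma smooth_into_open_vimage: "smooth_into S B f \<Longrightarrow> open W \<Longrightarrow> open (S \<inter> f -` W)"
  unfolding smooth_into_def using continuous_open_preimage by blast

lemma smooth_into_local:
  assumes B: "smooth_atlas B" and S: "open S"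
    and loc: "\<And>x. x \<in> S \<Longrightarrow> \<exists>T. x \<in> T \<and> smooth_into T B f"
  shows "smooth_into S B f"
  unfolding smooth_into_def
proof (intro conjI ballI S)
  show "continuous_on S f"
  proof (rule continuous_at_imp_continuous_on, rule ballI)
    fix x assume "x \<in> S"
    then obtain T where "x \<in> T" "open T" "continuous_on T f" using loc unfolding smooth_into_def by blast
    then show "isCont f x" using continuous_on_eq_continuous_at by blast
  qed
  fix d assume d: "d \<in> B"
  show "smooth_on (S \<inter> f -` fst d) (snd d \<circ> f)"
  proof (rule smooth_on_local)
    fix x assume x: "x \<in> S \<inter> f -` fst d"
    then obtain T where T: "x \<in> T" "smooth_into T B f" using loc by blast
    have "open (T \<inter> f -` fst d)" "smooth_on (T \<inter> f -` fst d) (snd d \<circ> f)"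
      using smooth_into_open_vimage[OF T(2) smooth_atlasD(1)[OF B d]] smooth_into_chart[OF T(2) d] by auto
    then show "\<exists>T. open T \<and> x \<in> T \<and> smooth_on T (snd d \<circ> f)" using T x by blast
  qed
qed

lemma smooth_into_cong:
  assumes B: "smooth_atlas B" and f: "smooth_into S B f" and eq: "\<And>x. x \<in> S \<Longrightarrow> f x = g x"
  shows "smooth_into S B g"
  unfolding smooth_into_def
proof (intro conjI ballI)
  show S: "open S" using f by (simp add: smooth_into_def)
  show "continuous_on S g" using f eq by (auto simp: smooth_into_def cong: continuous_on_cong)
  fix d assume d: "d \<in> B"
  have "S \<inter> g -` fst d = S \<inter> f -` fst d" using eq by auto
  moreover have "smooth_on (S \<inter> f -` fst d) (snd d \<circ> g)"
  proof (rule smooth_on_cong[OF smooth_into_open_vimage[OF f smooth_atlasD(1)[OF B d]]])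
    show "smooth_on (S \<inter> f -` fst d) (snd d \<circ> f)" by (rule smooth_into_chart[OF f d]) auto
  qed (use eq in auto)
  ultimately show "smooth_on (S \<inter> g -` fst d) (snd d \<circ> g)" by simp
qed

lemma smooth_into_precompose:
  fixes w :: "'a::real_normed_vector \<Rightarrow> 'b::real_normed_vector"
  assumes B: "smooth_atlas B" and f: "smooth_into T B f" and fd: "findim TYPE('b)"
    and S: "open S" and w: "smooth_on S w" and ST: "w ` S \<subseteq> T"
  shows "smooth_into S B (\<lambda>x. f (w x))"
  unfolding smooth_into_def
proof (intro conjI ballI S)
  show "continuous_on S (\<lambda>x. f (w x))"
    using f ST smooth_on_continuous[OF w] by (auto simp: smooth_into_def intro: continuous_on_compose2[of T f S w])
  fix d assume d: "d \<in> B"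
  have T: "open (T \<inter> f -` fst d)" by (rule smooth_into_open_vimage[OF f smooth_atlasD(1)[OF B d]])
  have "open (S \<inter> w -` (T \<inter> f -` fst d))"
    using continuous_open_preimage[OF smooth_on_continuous[OF w] S T] .
  moreover have "S \<inter> w -` (T \<inter> f -` fst d) = S \<inter> (\<lambda>x. f (w x)) -` fst d" using ST by auto
  ultimately have S': "open (S \<inter> (\<lambda>x. f (w x)) -` fst d)" by simp
  have "smooth_on (S \<inter> (\<lambda>x. f (w x)) -` fst d) (\<lambda>x. (snd d \<circ> f) (w x))"
  proof (rule smooth_on_compose[OF fd S' T smooth_on_subset[OF w]])
    show "smooth_on (T \<inter> f -` fst d) (snd d \<circ> f)" by (rule smooth_into_chart[OF f d]) auto
  qed (use ST in auto)
  then show "smooth_on (S \<inter> (\<lambda>x. f (w x)) -` fst d) (snd d \<circ> (\<lambda>x. f (w x)))" by (simp add: comp_def)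
qed

lemma smooth_into_compose:
  assumes B: "smooth_atlas B" and C: "smooth_atlas C" and f: "smooth_into S B f" and g: "smooth_map B C g"
  shows "smooth_into S C (\<lambda>x. g (f x))"
proof (rule smooth_into_local[OF C])
  show S: "open S" using f by (simp add: smooth_into_def)
  fix x assume x: "x \<in> S"
  define d where "d = chart_at B (f x)"
  have d: "d \<in> B" "f x \<in> fst d" using chart_at[OF B] by (auto simp: d_def)
  note dD = smooth_atlasD[OF B d(1)]
  let ?T = "S \<inter> f -` fst d"
  have T: "open ?T" by (rule smooth_into_open_vimage[OF f dD(1)])
  have "smooth_into ?T C (\<lambda>x. g (f x))"
    unfolding smooth_into_def
  proof (intro conjI ballI T)
    have "continuous_on S f" using f by (simp add: smooth_into_def)
    then show "continuous_on ?T (\<lambda>x. g (f x))"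
      using smooth_map_continuous[OF g] by (intro continuous_on_compose2[of UNIV g _ f]) (auto intro: continuous_on_subset)
    fix e assume e: "e \<in> C"
    have "open (fst d \<inter> g -` fst e)" using dD(1) smooth_map_open_vimage[OF g smooth_atlasD(1)[OF C e]] by auto
    then have "open (S \<inter> f -` (fst d \<inter> g -` fst e))" by (rule smooth_into_open_vimage[OF f])
    moreover have "S \<inter> f -` (fst d \<inter> g -` fst e) = ?T \<inter> (\<lambda>x. g (f x)) -` fst e" by auto
    ultimately have S': "open (?T \<inter> (\<lambda>x. g (f x)) -` fst e)" by simp
    have "smooth_on (?T \<inter> (\<lambda>x. g (f x)) -` fst e) (\<lambda>x. (snd e \<circ> g \<circ> chart_inv d) ((snd d \<circ> f) x))"
    proof (rule smooth_on_compose[OF smooth_atlas_findim[OF B] S' open_chart_domain[OF B C g d(1) e]])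
      show "smooth_on (?T \<inter> (\<lambda>x. g (f x)) -` fst e) (snd d \<circ> f)"
        by (rule smooth_into_chart[OF f d(1)]) auto
      show "smooth_on (snd d ` (fst d \<inter> g -` fst e)) (snd e \<circ> g \<circ> chart_inv d)"
        by (rule smooth_map_chart[OF g d(1) e])
    qed auto
    then show "smooth_on (?T \<inter> (\<lambda>x. g (f x)) -` fst e) (snd e \<circ> (\<lambda>x. g (f x)))"
      by (rule smooth_on_cong[OF S', rotated]) (use dD(5) in auto)
  qed
  moreover have "x \<in> ?T" using x d by simp
  ultimately show "\<exists>T. x \<in> T \<and> smooth_into T C (\<lambda>x. g (f x))" by (intro exI[of _ ?T] conjI)
qed

lemma smooth_into_Pair:
  assumes B: "smooth_atlas B" and C: "smooth_atlas C"
    and f: "smooth_into S B f" and g: "smooth_into S C g"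
  shows "smooth_into S (prod_atlas B C) (\<lambda>p. (f p, g p))"
  unfolding smooth_into_def
proof (intro conjI ballI)
  show S: "open S" using f by (simp add: smooth_into_def)
  show cont: "continuous_on S (\<lambda>p. (f p, g p))"
    using f g by (auto simp: smooth_into_def intro: continuous_on_Pair)
  fix e assume "e \<in> prod_atlas B C"
  then obtain d d' where d: "d \<in> B" "d' \<in> C" and e: "e = prod_chart d d'" by (elim prod_atlasE)
  let ?S = "S \<inter> (\<lambda>p. (f p, g p)) -` fst e"
  have S': "open ?S"
    using continuous_open_preimage[OF cont S, of "fst e"] smooth_atlasD(1)[OF B d(1)] smooth_atlasD(1)[OF C d(2)]
    by (simp add: e open_Times)
  have "smooth_on ?S (\<lambda>x. ((snd d \<circ> f) x, (snd d' \<circ> g) x))"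
  proof (rule smooth_on_Pair[OF S'])
    show "smooth_on ?S (snd d \<circ> f)"
      by (rule smooth_into_chart[OF f d(1)]) (auto simp: e)
    show "smooth_on ?S (snd d' \<circ> g)"
      by (rule smooth_into_chart[OF g d(2)]) (auto simp: e)
  qed
  then show "smooth_on ?S (snd e \<circ> (\<lambda>p. (f p, g p)))" by (simp add: e comp_def)
qed

lemma smooth_into_const: "open S \<Longrightarrow> smooth_into S B (\<lambda>x. q)"
  by (simp add: smooth_into_def comp_def smooth_on_const)

lemma smooth_into_chart_inv:
  assumes B: "smooth_atlas B" and c: "c \<in> B"
  shows "smooth_into (snd c ` fst c) B (chart_inv c)"
  unfolding smooth_into_def
proof (intro conjI ballI)
  note cD = smooth_atlasD[OF B c]
  show "open (snd c ` fst c)" "continuous_on (snd c ` fst c) (chart_inv c)" using cD by auto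
  fix d assume "d \<in> B"
  then have "smooth_on (snd c ` (fst c \<inter> fst d)) (snd d \<circ> chart_inv c)" by (rule smooth_atlas_transition[OF B c])
  then show "smooth_on (snd c ` fst c \<inter> chart_inv c -` fst d) (snd d \<circ> chart_inv c)"
    by (simp add: chart_image_Int[OF B c])
qed

lemma divide_le_half: "0 < b \<Longrightarrow> 2 * a \<le> b \<Longrightarrow> a / b \<le> (1 / 2 :: real)"
  by (simp add: field_simps)

section \<open>The exponential map of a complex Lie group\<close>

lemma four_power: "(4::real) ^ n = 2 ^ n * 2 ^ n"
  by (simp add: power_mult_distrib[symmetric])

lemma norm_scale_pow2: "norm (a /\<^sub>R 2 ^ n) = norm (a::'a::real_normed_vector) / 2 ^ n"
  by (simp add: field_simps)

text \<open>\<open>S\<close> is the squaring map in a chart centred at the unit. Perturbing the starting point by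
  \<open>O(4\<^sup>-\<^sup>n)\<close> does not change the limit of the \<open>n\<close>-fold iterate, which yields both the existence of the
  exponential map and the Trotter formula.\<close>

context
  fixes S :: "'a::real_normed_vector \<Rightarrow> 'a" and L R :: real
  assumes S0: "S 0 = 0" and R: "R > 0" and L: "L > 0" and LR: "L * R \<le> 1"
    and est: "\<And>x y \<rho>. \<rho> \<le> R \<Longrightarrow> norm x \<le> \<rho> \<Longrightarrow> norm y \<le> \<rho> \<Longrightarrow>
      norm (S x - S y - 2 *\<^sub>R (x - y)) \<le> L * \<rho> * norm (x - y)"
begin

lemma doubling_step:
  assumes "\<rho> \<le> R" "norm x \<le> \<rho>" "norm y \<le> \<rho>"
  shows "norm (S x - S y) \<le> (2 + L * \<rho>) * norm (x - y)"
proof -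
  have "norm (S x - S y) \<le> norm (S x - S y - 2 *\<^sub>R (x - y)) + norm (2 *\<^sub>R (x - y))"
    using norm_triangle_sub by (metis add.commute)
  also have "\<dots> \<le> L * \<rho> * norm (x - y) + 2 * norm (x - y)"
    using est[OF assms] by (intro add_mono) auto
  finally show ?thesis by (simp add: algebra_simps)
qed

text \<open>One induction step for the iterates: the correction factor \<open>1 + a\<close>,
  multiplied by the growth \<open>2 + a\<close>, is absorbed by doubling \<open>a\<close>, since
  \<open>a\<^sup>2 \<le> a\<close>.\<close>

lemma doubling_factor:
  fixes d :: real
  assumes a: "0 \<le> a" "a \<le> 1" and d: "0 \<le> d" and c: "0 \<le> c"
  shows "(2 + a) * (c * d * (1 + a)) \<le> 2 * c * d * (1 + 2 * a)"
proof -
  have "a * a \<le> a * 1" using a by (intro mult_left_mono) auto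
  then have "(2 + a) * (1 + a) \<le> 2 * (1 + 2 * a)" by (simp add: algebra_simps)
  then have "(c * d) * ((2 + a) * (1 + a)) \<le> (c * d) * (2 * (1 + 2 * a))"
    using c d by (intro mult_left_mono) auto
  then show ?thesis by (simp add: algebra_simps)
qed

text \<open>A step at radius \<rho> multiplies by at most \<open>2 + L * \<rho>\<close>, with \<rho>
  itself of size \<open>R * 2 ^ k / 2 ^ n\<close>, so the relative errors grow geometrically and are
  controlled by the last one. The two bounds are proved together: the second keeps the iterate in
  the range where the next step may be estimated.\<close>

lemma doubling_norm:
  assumes x: "norm x \<le> R / 2 / 2 ^ n" and k: "k \<le> n"
  shows "norm ((S ^^ k) x) \<le> 2 ^ k * norm x * (1 + L * R * 2 ^ k / 2 ^ n)"
    and "norm ((S ^^ k) x) \<le> R * 2 ^ k / 2 ^ n"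
proof -
  have "norm ((S ^^ k) x) \<le> 2 ^ k * norm x * (1 + L * R * 2 ^ k / 2 ^ n) \<and> norm ((S ^^ k) x) \<le> R * 2 ^ k / 2 ^ n"
    using k
  proof (induction k)
    case 0
    have "norm x * 1 \<le> norm x * (1 + L * R / 2 ^ n)" using L R by (intro mult_left_mono) auto
    moreover have "R / 2 / 2 ^ n \<le> R / 2 ^ n" using R by (intro divide_right_mono) auto
    ultimately show ?case using x by auto
  next
    case (Suc k)
    define a where "a = L * R * 2 ^ k / 2 ^ n"
    have pk: "2 * 2 ^ k \<le> (2::real) ^ n" by (rule power_increasing[OF Suc.prems, of "2::real", unfolded power_Suc]) simp
    have t: "2 ^ k / 2 ^ n \<le> (1 / 2 :: real)" by (rule divide_le_half[OF _ pk]) simp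
    have a: "0 \<le> a" "2 * a \<le> 1"
    proof -
      show "0 \<le> a" using L R by (simp add: a_def)
      have "a = (L * R) * (2 ^ k / 2 ^ n)" by (simp add: a_def)
      also have "\<dots> \<le> 1 * (1 / 2)" using LR t L R by (intro mult_mono) auto
      finally show "2 * a \<le> 1" by simp
    qed
    have IH: "norm ((S ^^ k) x) \<le> 2 ^ k * norm x * (1 + a)" "norm ((S ^^ k) x) \<le> R * 2 ^ k / 2 ^ n"
      using Suc by (auto simp: a_def)
    have "R * (2 ^ k / 2 ^ n) \<le> R * 1" by (rule mult_left_mono[OF order_trans[OF t]]) (use R in auto)
    then have rR: "R * 2 ^ k / 2 ^ n \<le> R" by simp
    have "norm ((S ^^ Suc k) x - S 0) \<le> (2 + L * (R * 2 ^ k / 2 ^ n)) * norm ((S ^^ k) x - 0)"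
      using doubling_step[OF rR IH(2), of 0] R by simp
    also have "\<dots> = (2 + a) * norm ((S ^^ k) x)" by (simp add: a_def algebra_simps)
    also have "\<dots> \<le> (2 + a) * (2 ^ k * norm x * (1 + a))" using IH(1) a by (intro mult_left_mono) auto
    also have "\<dots> \<le> 2 * 2 ^ k * norm x * (1 + 2 * a)" using a by (intro doubling_factor) auto
    finally have 1: "norm ((S ^^ Suc k) x) \<le> 2 ^ Suc k * norm x * (1 + 2 * a)" using S0 by simp
    also have "\<dots> \<le> 2 ^ Suc k * (R / 2 / 2 ^ n) * 2" using x a R by (intro mult_mono) auto
    also have "\<dots> = R * 2 ^ Suc k / 2 ^ n" by simp
    finally have 2: "norm ((S ^^ Suc k) x) \<le> R * 2 ^ Suc k / 2 ^ n" .
    have "2 * a = L * R * 2 ^ Suc k / 2 ^ n" by (simp add: a_def)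
    then show ?case using 1 2 by simp
  qed
  then show "norm ((S ^^ k) x) \<le> 2 ^ k * norm x * (1 + L * R * 2 ^ k / 2 ^ n)"
    "norm ((S ^^ k) x) \<le> R * 2 ^ k / 2 ^ n" by auto
qed

text \<open>The same geometric control for differences: up to a total factor 2, an initial error is
  just doubled at every step.\<close>

lemma doubling_diff:
  assumes x: "norm x \<le> R / 2 / 2 ^ n" "norm y \<le> R / 2 / 2 ^ n" and k: "k \<le> n"
  shows "norm ((S ^^ k) x - (S ^^ k) y) \<le> 2 * 2 ^ k * norm (x - y)"
proof -
  have "norm ((S ^^ k) x - (S ^^ k) y) \<le> 2 ^ k * norm (x - y) * (1 + L * R * 2 ^ k / 2 ^ n)"
    using k
  proof (induction k)
    case 0
    have "norm (x - y) * 1 \<le> norm (x - y) * (1 + L * R / 2 ^ n)" using L R by (intro mult_left_mono) auto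
    then show ?case by simp
  next
    case (Suc k)
    define a where "a = L * R * 2 ^ k / 2 ^ n"
    have pk: "2 * 2 ^ k \<le> (2::real) ^ n" by (rule power_increasing[OF Suc.prems, of "2::real", unfolded power_Suc]) simp
    have t: "2 ^ k / 2 ^ n \<le> (1 / 2 :: real)" by (rule divide_le_half[OF _ pk]) simp
    have a: "0 \<le> a" "a \<le> 1"
    proof -
      show "0 \<le> a" using L R by (simp add: a_def)
      have "a = (L * R) * (2 ^ k / 2 ^ n)" by (simp add: a_def)
      also have "\<dots> \<le> 1 * (1 / 2)" using LR t L R by (intro mult_mono) auto
      finally show "a \<le> 1" by simp
    qed
    have "R * (2 ^ k / 2 ^ n) \<le> R * 1" by (rule mult_left_mono[OF order_trans[OF t]]) (use R in auto)
    then have rR: "R * 2 ^ k / 2 ^ n \<le> R" by simp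
    have kn: "k \<le> n" using Suc.prems by linarith
    have "norm ((S ^^ Suc k) x - (S ^^ Suc k) y) \<le> (2 + L * (R * 2 ^ k / 2 ^ n)) * norm ((S ^^ k) x - (S ^^ k) y)"
      using doubling_step[OF rR doubling_norm(2)[OF x(1) kn] doubling_norm(2)[OF x(2) kn]] by simp
    also have "\<dots> = (2 + a) * norm ((S ^^ k) x - (S ^^ k) y)" by (simp add: a_def algebra_simps)
    also have "\<dots> \<le> (2 + a) * (2 ^ k * norm (x - y) * (1 + a))"
      using Suc a by (intro mult_left_mono) (auto simp: a_def)
    also have "\<dots> \<le> 2 * 2 ^ k * norm (x - y) * (1 + 2 * a)" using a by (intro doubling_factor) auto
    also have "2 * a = L * R * 2 ^ Suc k / 2 ^ n" by (simp add: a_def)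
    finally show ?case by (simp only: power_Suc)
  qed
  also have "\<dots> \<le> 2 ^ k * norm (x - y) * 2"
  proof (intro mult_left_mono)
    have "(2::real) ^ k \<le> 2 ^ n" using k by (intro power_increasing) auto
    then have "(L * R) * (2 ^ k / 2 ^ n) \<le> 1 * 1" using LR L R by (intro mult_mono) auto
    then show "1 + L * R * 2 ^ k / 2 ^ n \<le> 2" by simp
  qed auto
  finally show ?thesis by (simp add: algebra_simps)
qed

text \<open>The linear part of \<open>S\<close> is multiplication by 2, so one step from
  \<open>a\<close> scaled by \<open>2 ^ Suc n\<close> hits \<open>a\<close> scaled by
  \<open>2 ^ n\<close> up to a quadratic error, which has order \<open>4 ^ n\<close> in the
  denominator.\<close>

lemma doubling_small:
  assumes a: "norm a \<le> R / 4"
  shows "norm (S (a /\<^sub>R 2 ^ Suc n) - a /\<^sub>R 2 ^ n) \<le> L * (norm a)\<^sup>2 / 4 ^ Suc n"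
    and "norm (S (a /\<^sub>R 2 ^ Suc n)) \<le> R / 2 / 2 ^ n"
    and "norm (a /\<^sub>R 2 ^ n) \<le> R / 2 / 2 ^ n"
proof -
  let ?x = "a /\<^sub>R 2 ^ Suc n"
  have nx: "norm ?x = norm a / 2 ^ Suc n" by (rule norm_scale_pow2)
  have "norm a / 2 ^ Suc n \<le> norm a / 1"
    by (rule divide_left_mono[OF one_le_power]) auto
  then have "norm ?x \<le> R" using nx a R by simp
  then have "norm (S ?x - S 0 - 2 *\<^sub>R (?x - 0)) \<le> L * norm ?x * norm (?x - 0)"
    by (intro est) auto
  moreover have "2 *\<^sub>R ?x = a /\<^sub>R 2 ^ n" by simp
  moreover have "L * norm ?x * norm ?x = L * (norm a)\<^sup>2 / 4 ^ Suc n"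
    unfolding nx four_power by (simp add: power2_eq_square del: power_Suc)
  ultimately show 1: "norm (S ?x - a /\<^sub>R 2 ^ n) \<le> L * (norm a)\<^sup>2 / 4 ^ Suc n" using S0 by simp
  have na: "norm (a /\<^sub>R 2 ^ n) = norm a / 2 ^ n" by (rule norm_scale_pow2)
  have "norm (S ?x) \<le> norm (a /\<^sub>R 2 ^ n) + norm (S ?x - a /\<^sub>R 2 ^ n)" by (rule norm_triangle_sub)
  also have "\<dots> \<le> norm a / 2 ^ n + L * (norm a)\<^sup>2 / 4 ^ Suc n" using 1 na by simp
  also have "L * (norm a)\<^sup>2 / 4 ^ Suc n \<le> norm a / 2 ^ n"
  proof -
    have "L * norm a \<le> L * R" using a R L by (intro mult_left_mono) auto
    then have "L * norm a \<le> 1" using LR by simp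
    then have "(L * norm a) * norm a \<le> 1 * norm a" by (intro mult_right_mono) auto
    moreover have "(2::real) ^ n \<le> 4 ^ Suc n"
      by (rule order_trans[of _ "4 ^ n"]) (auto intro: power_mono)
    ultimately show ?thesis by (intro frac_le) (auto simp: power2_eq_square)
  qed
  also have "norm a / 2 ^ n + norm a / 2 ^ n \<le> R / 4 / 2 ^ n + R / 4 / 2 ^ n"
    using a by (intro add_mono divide_right_mono) auto
  finally show "norm (S ?x) \<le> R / 2 / 2 ^ n" by simp
  show "norm (a /\<^sub>R 2 ^ n) \<le> R / 2 / 2 ^ n" unfolding na using a R by (intro divide_right_mono) auto
qed

text \<open>An error of order \<open>1 / 4 ^ n\<close> at the start is amplified by at most
  \<open>2 * 2 ^ n\<close>. The bound is written as a difference so that it telescopes over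
  \<open>n\<close>.\<close>

lemma doubling_succ:
  assumes a: "norm a \<le> R / 4"
  shows "norm ((S ^^ Suc n) (a /\<^sub>R 2 ^ Suc n) - (S ^^ n) (a /\<^sub>R 2 ^ n)) \<le> L * (norm a)\<^sup>2 * (1 / 2 ^ n - 1 / 2 ^ Suc n)"
proof -
  have "norm ((S ^^ n) (S (a /\<^sub>R 2 ^ Suc n)) - (S ^^ n) (a /\<^sub>R 2 ^ n))
      \<le> 2 * 2 ^ n * norm (S (a /\<^sub>R 2 ^ Suc n) - a /\<^sub>R 2 ^ n)"
    by (rule doubling_diff[OF doubling_small(2,3)[OF a]]) simp
  also have "\<dots> \<le> 2 * 2 ^ n * (L * (norm a)\<^sup>2 / 4 ^ Suc n)"
    using doubling_small(1)[OF a] by (intro mult_left_mono) auto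
  also have "(4::real) ^ Suc n = 4 * (2 ^ n * 2 ^ n)" by (simp add: four_power)
  also have "2 * 2 ^ n * (L * (norm a)\<^sup>2 / (4 * (2 ^ n * 2 ^ n))) = L * (norm a)\<^sup>2 * (1 / 2 ^ n - 1 / 2 ^ Suc n)"
    by (simp add: field_simps)
  finally show ?thesis by (simp add: funpow_Suc_right del: funpow.simps)
qed

lemma doubling_far:
  assumes a: "norm a \<le> R / 4" and "n \<le> m"
  shows "norm ((S ^^ m) (a /\<^sub>R 2 ^ m) - (S ^^ n) (a /\<^sub>R 2 ^ n)) \<le> L * (norm a)\<^sup>2 * (1 / 2 ^ n - 1 / 2 ^ m)"
  using assms(2)
proof (induction m rule: dec_induct)
  case base
  then show ?case by simp
next
  case (step m)
  have "norm ((S ^^ Suc m) (a /\<^sub>R 2 ^ Suc m) - (S ^^ n) (a /\<^sub>R 2 ^ n)) \<le>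
    norm ((S ^^ Suc m) (a /\<^sub>R 2 ^ Suc m) - (S ^^ m) (a /\<^sub>R 2 ^ m)) +
    norm ((S ^^ m) (a /\<^sub>R 2 ^ m) - (S ^^ n) (a /\<^sub>R 2 ^ n))"
    by (rule norm_diff_triangle_le[OF order_refl order_refl])
  also have "\<dots> \<le> L * (norm a)\<^sup>2 * (1 / 2 ^ m - 1 / 2 ^ Suc m) + L * (norm a)\<^sup>2 * (1 / 2 ^ n - 1 / 2 ^ m)"
    by (rule add_mono[OF doubling_succ[OF a] step.IH])
  finally show ?case by (simp add: algebra_simps)
qed

text \<open>The telescoping bound gives a Cauchy sequence, and balls are complete in finite
  dimension. The first clause admits arbitrary starting points \<open>y n\<close>, because their
  deviation is amplified only to order \<open>1 / 2 ^ n\<close>; this freedom is what later makes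
  the exponential map compatible with products, inverses and powers.\<close>

lemma doubling_limit:
  assumes fd: "findim TYPE('a)"
  shows "\<exists>E. (\<forall>a y C. norm a \<le> R / 4 \<longrightarrow> (\<forall>\<^sub>F n in sequentially. norm (y n - a /\<^sub>R 2 ^ n) \<le> C / 4 ^ n) \<longrightarrow>
      (\<lambda>n. (S ^^ n) (y n)) \<longlonglongrightarrow> E a) \<and>
    (\<forall>a. norm a \<le> R / 4 \<longrightarrow> norm (E a - a) \<le> L * (norm a)\<^sup>2) \<and>
    (\<forall>a b. norm a \<le> R / 4 \<longrightarrow> norm b \<le> R / 4 \<longrightarrow> norm (E a - E b) \<le> 2 * norm (a - b))"
proof -
  define e where "e = (\<lambda>n a. (S ^^ n) (a /\<^sub>R 2 ^ n))"
  have half: "(\<lambda>n. c / 2 ^ n) \<longlonglongrightarrow> 0" for c :: real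
    using tendsto_mult[OF tendsto_const[of c] LIMSEQ_realpow_zero[of "1/2"]] by (simp add: power_divide)
  have ex: "\<exists>l. (\<lambda>n. e n a) \<longlonglongrightarrow> l" if a: "norm a \<le> R / 4" for a
  proof -
    have "Cauchy (\<lambda>n. e n a)"
    proof (rule metric_CauchyI)
      fix \<epsilon> :: real assume "\<epsilon> > 0"
      from order_tendstoD(2)[OF half[of "L * (norm a)\<^sup>2"] this]
      obtain M where M: "\<And>n. n \<ge> M \<Longrightarrow> L * (norm a)\<^sup>2 / 2 ^ n < \<epsilon>" by (auto simp: eventually_sequentially)
      have far: "dist (e m a) (e n a) < \<epsilon>" if "M \<le> n" "n \<le> m" for m n
      proof -
        have "dist (e m a) (e n a) \<le> L * (norm a)\<^sup>2 * (1 / 2 ^ n - 1 / 2 ^ m)"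
          using doubling_far[OF a that(2)] by (simp add: e_def dist_norm)
        also have "\<dots> \<le> L * (norm a)\<^sup>2 * (1 / 2 ^ n)" using L by (intro mult_left_mono) auto
        also have "\<dots> < \<epsilon>" using M[OF that(1)] by simp
        finally show ?thesis .
      qed
      show "\<exists>M. \<forall>m\<ge>M. \<forall>n\<ge>M. dist (e m a) (e n a) < \<epsilon>"
      proof (intro exI[of _ M] allI impI)
        fix m n assume "M \<le> m" "M \<le> n"
        then show "dist (e m a) (e n a) < \<epsilon>"
          using far[of n m] far[of m n] by (cases "n \<le> m") (auto simp: dist_commute)
      qed
    qed
    moreover have "e n a \<in> cball 0 R" for n
      using doubling_norm(2)[OF doubling_small(3)[OF a], of n n] by (simp add: e_def)
    moreover have "complete (cball (0::'a) R)" using compact_cball_findim[OF fd] by (rule compact_imp_complete)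
    ultimately show ?thesis by (metis (no_types) completeE[of "cball (0::'a) R" "\<lambda>n. e n a"])
  qed
  then obtain E where E: "\<And>a. norm a \<le> R / 4 \<Longrightarrow> (\<lambda>n. e n a) \<longlonglongrightarrow> E a" by metis
  show ?thesis
  proof (intro exI[of _ E] conjI allI impI)
    fix a :: 'a assume a: "norm a \<le> R / 4"
    have b: "norm (e n a - a) \<le> L * (norm a)\<^sup>2" for n
    proof -
      have "norm (e n a - a) \<le> L * (norm a)\<^sup>2 * (1 - 1 / 2 ^ n)"
        using doubling_far[OF a, of 0 n] by (simp add: e_def)
      also have "\<dots> \<le> L * (norm a)\<^sup>2 * 1" using L by (intro mult_left_mono) auto
      finally show ?thesis by simp
    qed
    show "norm (E a - a) \<le> L * (norm a)\<^sup>2"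
      by (rule tendsto_upperbound[OF tendsto_norm[OF tendsto_diff[OF E[OF a] tendsto_const]]]) (use b in auto)
  next
    fix a b :: 'a assume a: "norm a \<le> R / 4" and b: "norm b \<le> R / 4"
    have "norm (e n a - e n b) \<le> 2 * norm (a - b)" for n
    proof -
      have "norm (e n a - e n b) \<le> 2 * 2 ^ n * norm (a /\<^sub>R 2 ^ n - b /\<^sub>R 2 ^ n)"
        unfolding e_def by (rule doubling_diff[OF doubling_small(3)[OF a] doubling_small(3)[OF b]]) simp
      also have "a /\<^sub>R 2 ^ n - b /\<^sub>R 2 ^ n = (a - b) /\<^sub>R 2 ^ n" by (simp add: scaleR_diff_right)
      finally show ?thesis unfolding norm_scale_pow2 by simp
    qed
    then show "norm (E a - E b) \<le> 2 * norm (a - b)"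
      by (intro tendsto_upperbound[OF tendsto_norm[OF tendsto_diff[OF E[OF a] E[OF b]]]]) auto
  next
    fix a :: 'a and y C assume a: "norm a \<le> R / 4" and y: "\<forall>\<^sub>F n in sequentially. norm (y n - a /\<^sub>R 2 ^ n) \<le> C / 4 ^ n"
    have "\<forall>\<^sub>F n in sequentially. C / 2 ^ n < R / 4" by (rule order_tendstoD(2)[OF half[of C]]) (use R in simp)
    then have "\<forall>\<^sub>F n in sequentially. norm ((S ^^ n) (y n) - e n a) \<le> 2 * C / 2 ^ n"
      using y
    proof eventually_elim
      case (elim n)
      have "norm (y n) \<le> norm (a /\<^sub>R 2 ^ n) + norm (y n - a /\<^sub>R 2 ^ n)" by (rule norm_triangle_sub)
      also have "\<dots> \<le> norm a / 2 ^ n + (C / 2 ^ n) / 2 ^ n" using elim(2) unfolding norm_scale_pow2 four_power by simp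
      also have "\<dots> \<le> R / 4 / 2 ^ n + R / 4 / 2 ^ n"
        using a elim(1) by (intro add_mono divide_right_mono) auto
      finally have yn: "norm (y n) \<le> R / 2 / 2 ^ n" by simp
      have "norm ((S ^^ n) (y n) - e n a) \<le> 2 * 2 ^ n * norm (y n - a /\<^sub>R 2 ^ n)"
        unfolding e_def by (rule doubling_diff[OF yn doubling_small(3)[OF a]]) simp
      also have "\<dots> \<le> 2 * 2 ^ n * (C / 4 ^ n)" using elim(2) by (intro mult_left_mono) auto
      finally show ?case by (simp add: four_power)
    qed
    then have "(\<lambda>n. (S ^^ n) (y n) - e n a) \<longlonglongrightarrow> 0" by (rule Lim_null_comparison[OF _ half])
    from tendsto_add[OF this E[OF a]] show "(\<lambda>n. (S ^^ n) (y n)) \<longlonglongrightarrow> E a" by simp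
  qed
qed

end

section \<open>Complex Lie groups in coordinates centred at the unit\<close>

locale complex_lie =
  fixes G :: "'g::{t2_space, second_countable_topology} monoid" (structure)
    and j :: "'e::real_normed_vector \<Rightarrow> 'e" and A :: "('g, 'e) chart set"
  assumes clg: "complex_lie_group G j A"
begin

sublocale group G using clg by (simp add: complex_lie_group_def)

lemma carrier_UNIV [simp]: "carrier G = UNIV" using clg by (simp add: complex_lie_group_def)

lemma cA: "complex_atlas j A" using clg by (simp add: complex_lie_group_def)
lemma sA: "smooth_atlas A" by (rule complex_atlas_smooth[OF cA])
lemma cs: "complex_structure j" by (rule complex_atlas_structure[OF cA])
lemma sAA: "smooth_atlas (prod_atlas A A)" by (rule smooth_atlas_prod[OF sA sA])
lemma fdE: "findim TYPE('e)" by (rule smooth_atlas_findim[OF sA])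

lemma sV: "smooth_atlas (vector_atlas :: (real, real) chart set)"
  by (rule smooth_atlas_vector[OF findim_real])

lemma holomorphic_mult: "holomorphic_map (map_prod j j) (prod_atlas A A) j A (\<lambda>(g, h). g \<otimes> h)"
  using clg by (simp add: complex_lie_group_def)

lemma smooth_mult: "smooth_map (prod_atlas A A) A (\<lambda>(g, h). g \<otimes> h)"
  using holomorphic_mult by (simp add: holomorphic_map_def)

lemma smooth_inv: "smooth_map A A (\<lambda>g. inv g)"
  using clg by (simp add: complex_lie_group_def holomorphic_map_def)

lemma smooth_map_mult:
  assumes "smooth_atlas B" "smooth_map B A f" "smooth_map B A g"
  shows "smooth_map B A (\<lambda>p. f p \<otimes> g p)"
  using smooth_map_compose[OF assms(1) sAA sA smooth_map_Pair[OF assms(1) sA sA assms(2,3)] smooth_mult] by simp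

lemma tangent_map_mult:
  assumes "smooth_atlas B" "smooth_map B A f" "smooth_map B A g"
  shows "tangent_map B A (\<lambda>p. f p \<otimes> g p) p v =
    tangent_map A A (\<lambda>q. q \<otimes> g p) (f p) (tangent_map B A f p v) +
    tangent_map A A (\<lambda>r. f p \<otimes> r) (g p) (tangent_map B A g p v)"
  using tangent_map_Leibniz[OF assms(1) sA sA sA assms(2,3) smooth_mult] by simp

lemma smooth_into_mult:
  assumes "smooth_into S A f" "smooth_into S A g"
  shows "smooth_into S A (\<lambda>p. f p \<otimes> g p)"
  using smooth_into_compose[OF sAA sA smooth_into_Pair[OF sA sA assms] smooth_mult] by simp

lemma holomorphic_left: "holomorphic_map j A j A (\<lambda>h. g \<otimes> h)"
  using holomorphic_map_compose[OF sA sAA sA holomorphic_map_Pair_right[OF cA cA] holomorphic_mult] by simp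

lemma holomorphic_right: "holomorphic_map j A j A (\<lambda>h. h \<otimes> g)"
  using holomorphic_map_compose[OF sA sAA sA holomorphic_map_Pair_left[OF cA cA] holomorphic_mult] by simp

lemma smooth_left: "smooth_map A A (\<lambda>h. g \<otimes> h)" and smooth_right: "smooth_map A A (\<lambda>h. h \<otimes> g)"
  using holomorphic_left holomorphic_right by (simp_all add: holomorphic_map_def)

lemma continuous_mult: "continuous_on UNIV (\<lambda>z. fst z \<otimes> snd z)"
  using smooth_map_continuous[OF smooth_mult] by (simp add: split_beta)

lemma tendsto_mult_group:
  assumes "(f \<longlongrightarrow> a) F" "(g \<longlongrightarrow> b) F"
  shows "((\<lambda>x. f x \<otimes> g x) \<longlongrightarrow> a \<otimes> b) F"
proof -
  have "isCont (\<lambda>z. fst z \<otimes> snd z) (a, b)"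
    using continuous_mult by (simp add: continuous_on_eq_continuous_at)
  from isCont_tendsto_compose[OF this tendsto_Pair[OF assms]] show ?thesis by simp
qed

lemma tendsto_inv_group:
  assumes "(f \<longlongrightarrow> a) F"
  shows "((\<lambda>x. inv (f x)) \<longlongrightarrow> inv a) F"
proof -
  have "isCont (\<lambda>z. inv z) a"
    using smooth_map_continuous[OF smooth_inv] by (simp add: continuous_on_eq_continuous_at)
  from isCont_tendsto_compose[OF this assms] show ?thesis .
qed

lemma tendsto_pow_group:
  assumes "(f \<longlongrightarrow> a) F"
  shows "((\<lambda>x. f x [^] (n::nat)) \<longlongrightarrow> a [^] n) F"
  by (induction n) (auto intro: tendsto_mult_group assms)

lemma continuous_on_mult_group:
  "continuous_on S f \<Longrightarrow> continuous_on S g \<Longrightarrow> continuous_on S (\<lambda>x. f x \<otimes> g x)"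
  unfolding continuous_on_def by (auto intro: tendsto_mult_group)

lemma continuous_on_inv_group:
  "continuous_on S f \<Longrightarrow> continuous_on S (\<lambda>x. inv (f x))"
  unfolding continuous_on_def by (auto intro: tendsto_inv_group)

lemma one_parameter_subgroupD:
  assumes "one_parameter_subgroup G A \<xi> \<gamma>"
  shows "smooth_map vector_atlas A \<gamma>" "\<gamma> (s + t) = \<gamma> s \<otimes> \<gamma> t" "tangent_map vector_atlas A \<gamma> 0 1 = \<xi>"
    "\<gamma> 0 = \<one>" "\<gamma> (- t) = inv (\<gamma> t)"
proof -
  show 1: "smooth_map vector_atlas A \<gamma>" "\<gamma> (s + t) = \<gamma> s \<otimes> \<gamma> t" "tangent_map vector_atlas A \<gamma> 0 1 = \<xi>" for s t
    using assms by (auto simp: one_parameter_subgroup_def)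
  have "\<gamma> 0 = \<gamma> 0 \<otimes> \<gamma> 0" using 1(2)[of 0 0] by simp
  then show 0: "\<gamma> 0 = \<one>" by (metis UNIV_I carrier_UNIV l_cancel_one')
  have "\<gamma> (- t) \<otimes> \<gamma> t = \<one>" using 1(2)[of "- t" t] 0 by simp
  then show "\<gamma> (- t) = inv (\<gamma> t)" by (metis UNIV_I carrier_UNIV inv_equality)
qed

text \<open>The product of one curve with the inverse of the other is constant: its velocity at
  every time is the translate of its velocity at time 0, where the two contributions \<xi> and
  -\<xi> cancel.\<close>

lemma one_parameter_subgroup_unique:
  assumes a: "one_parameter_subgroup G A \<xi> \<gamma>" and b: "one_parameter_subgroup G A \<xi> \<gamma>'"
  shows "\<gamma> = \<gamma>'"
proof
  fix t :: real
  note aD = one_parameter_subgroupD[OF a] and bD = one_parameter_subgroupD[OF b]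
  have sm: "smooth_map vector_atlas vector_atlas (\<lambda>h::real. - h)"
    by (intro smooth_map_linear bounded_linear_minus bounded_linear_ident)
  have sb: "smooth_map vector_atlas A (\<lambda>h. \<gamma>' (- h))"
    by (rule smooth_map_compose[OF sV sV sA sm bD(1)])
  define \<epsilon> where "\<epsilon> = (\<lambda>h. \<gamma> h \<otimes> \<gamma>' (- h))"
  have se: "smooth_map vector_atlas A \<epsilon>" unfolding \<epsilon>_def by (rule smooth_map_mult[OF sV aD(1) sb])
  have "tangent_map vector_atlas A (\<lambda>h. \<gamma>' (- h)) 0 1 = tangent_map vector_atlas A \<gamma>' (- 0) (frechet_derivative (\<lambda>h::real. - h) (at 0) 1)"
    using tangent_map_compose[OF sV sV sA sm bD(1), of 0 1] by (simp add: tangent_map_vector)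
  also have "frechet_derivative (\<lambda>h::real. - h) (at 0) = (\<lambda>h. - h)"
    by (rule frechet_derivative_eqI) (auto intro!: derivative_eq_intros)
  finally have tb: "tangent_map vector_atlas A (\<lambda>h. \<gamma>' (- h)) 0 1 = - \<xi>"
    using linear_neg[OF tangent_map_linear[OF sV sA bD(1)], of 0 1] bD(3) by simp
  have "tangent_map vector_atlas A \<epsilon> 0 1 = 0"
    unfolding \<epsilon>_def by (simp add: tangent_map_mult[OF sV aD(1) sb] aD(3,4) bD(4) tb tangent_map_id[OF sA])
  have "\<epsilon> t = \<epsilon> 0"
  proof (rule smooth_curve_constant[OF sA se open_UNIV connected_UNIV])
    fix s :: real
    let ?L = "\<lambda>x. (\<gamma> s \<otimes> x) \<otimes> \<gamma>' (- s)"
    have sL: "smooth_map A A ?L"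
      by (rule smooth_map_compose[OF sA sA sA smooth_left smooth_right])
    note st = smooth_shift[of s]
    \<comment> \<open>The factors at time \<open>s\<close> are split off on the left from
      \<open>\<gamma>\<close> and on the right from \<open>\<gamma>'\<close>, which leaves the curve
      near 0 between them.\<close>
    have e: "\<epsilon> = (\<lambda>h. ?L (\<epsilon> (h - s)))"
    proof
      fix h
      have 1: "\<gamma> h = \<gamma> s \<otimes> \<gamma> (h - s)" using aD(2)[of s "h - s"] by simp
      have 2: "\<gamma>' (- h) = \<gamma>' (- (h - s)) \<otimes> \<gamma>' (- s)" using bD(2)[of "- (h - s)" "- s"] by simp
      show "\<epsilon> h = ?L (\<epsilon> (h - s))" unfolding \<epsilon>_def 1 2 by (simp add: m_assoc)
    qed
    have s1: "smooth_map vector_atlas A (\<lambda>h. \<epsilon> (h - s))" by (rule smooth_map_compose[OF sV sV sA st se])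
    have "tangent_map vector_atlas A (\<lambda>h. ?L (\<epsilon> (h - s))) s 1 =
        tangent_map A A ?L (\<epsilon> (s - s)) (tangent_map vector_atlas A (\<lambda>h. \<epsilon> (h - s)) s 1)"
      by (rule tangent_map_compose[OF sV sA sA s1 sL])
    also have "tangent_map vector_atlas A (\<lambda>h. \<epsilon> (h - s)) s 1 =
        tangent_map vector_atlas A \<epsilon> (s - s) (frechet_derivative (\<lambda>h. h - s) (at s) 1)"
      using tangent_map_compose[OF sV sV sA st se, of s 1] by (simp add: tangent_map_vector)
    also have "frechet_derivative (\<lambda>h. h - s) (at s) = (\<lambda>h. h)" by (rule frechet_shift)
    finally show "tangent_map vector_atlas A \<epsilon> s 1 = 0"
      using \<open>tangent_map vector_atlas A \<epsilon> 0 1 = 0\<close> linear_0[OF tangent_map_linear[OF sA sA sL]] e by simp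
  qed auto
  then have "\<gamma> t \<otimes> \<gamma>' (- t) = \<one>" by (simp add: \<epsilon>_def aD(4) bD(4))
  then show "\<gamma> t = \<gamma>' t" using bD(5) by (metis UNIV_I carrier_UNIV inv_equality inv_inv)
qed

lemma lie_exp_eqI: "one_parameter_subgroup G A \<xi> \<gamma> \<Longrightarrow> lie_exp G A \<xi> = \<gamma> 1"
  unfolding lie_exp_def using the_equality[of "one_parameter_subgroup G A \<xi>" \<gamma>] one_parameter_subgroup_unique
  by metis

text \<open>The preferred chart at the unit, translated so that the unit has coordinate 0.
  \<open>br\<close> parametrizes group elements by \<Omega> and \<open>\<kappa>\<close> is its
  inverse. Since tangent vectors at the unit are expressed in this same chart, no change of
  coordinates intervenes between \<Omega> and the Lie algebra.\<close>

definition "c0 = chart_at A \<one>"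
definition "x0 = snd c0 \<one>"
definition "br y = chart_inv c0 (x0 + y)"
definition "\<kappa> g = snd c0 g - x0"
definition "\<Omega> = {y. x0 + y \<in> snd c0 ` fst c0}"

lemma c0: "c0 \<in> A" "\<one> \<in> fst c0" unfolding c0_def by (rule chart_at[OF sA])+
lemmas c0D = smooth_atlasD[OF sA c0(1)]

lemma open_Omega: "open \<Omega>"
proof -
  have "\<Omega> = (\<lambda>y. x0 + y) -` (snd c0 ` fst c0)" by (auto simp: \<Omega>_def)
  then show ?thesis using open_vimage[OF c0D(2), of "\<lambda>y. x0 + y"] by (simp add: continuous_on_add)
qed

lemma zero_Omega: "0 \<in> \<Omega>" using c0 by (auto simp: \<Omega>_def x0_def)
lemma br_zero: "br 0 = \<one>" using c0D(5)[OF c0(2)] by (simp add: br_def x0_def)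
lemma kappa_one: "\<kappa> \<one> = 0" by (simp add: \<kappa>_def x0_def)
lemma br_chart: "y \<in> \<Omega> \<Longrightarrow> br y \<in> fst c0" using c0D(7) by (simp add: br_def \<Omega>_def)
lemma kappa_br: "y \<in> \<Omega> \<Longrightarrow> \<kappa> (br y) = y" using c0D(6) by (simp add: br_def \<Omega>_def \<kappa>_def)
lemma br_kappa: "g \<in> fst c0 \<Longrightarrow> br (\<kappa> g) = g" using c0D(5) by (simp add: br_def \<kappa>_def)
lemma kappa_Omega: "g \<in> fst c0 \<Longrightarrow> \<kappa> g \<in> \<Omega>" by (simp add: \<Omega>_def \<kappa>_def)

lemma smooth_into_br: "smooth_into \<Omega> A br"
proof -
  have w: "smooth_on \<Omega> (\<lambda>y. x0 + y)"
    by (rule smooth_on_add[OF open_Omega smooth_on_const smooth_on_linear[OF bounded_linear_ident]])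
  show ?thesis unfolding br_def
    by (rule smooth_into_precompose[OF sA smooth_into_chart_inv[OF sA c0(1)] fdE open_Omega w])
      (auto simp: \<Omega>_def)
qed

lemma continuous_on_br: "continuous_on \<Omega> br" using smooth_into_br by (simp add: smooth_into_def)

lemma open_kappa_vimage: "smooth_into S A f \<Longrightarrow> open (S \<inter> f -` fst c0)"
  by (rule smooth_into_open_vimage[OF _ c0D(1)])

lemma smooth_on_kappa:
  assumes "smooth_into S A f" "open T" "T \<subseteq> S \<inter> f -` fst c0"
  shows "smooth_on T (\<lambda>x. \<kappa> (f x))"
proof -
  have "smooth_on T (\<lambda>x. (snd c0 \<circ> f) x + (- x0))"
    by (rule smooth_on_add[OF assms(2) smooth_into_chart[OF assms(1) c0(1) assms(3)] smooth_on_const])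
  then show ?thesis by (simp add: \<kappa>_def)
qed

text \<open>The group law in coordinates, meaningful on the open set \<open>M\<close>. It has
  nothing to do with the momentum map, which is called \<open>mom\<close> in the locales
  below.\<close>

definition "\<mu> z = \<kappa> (br (fst z) \<otimes> br (snd z))"
definition "M = (\<Omega> \<times> \<Omega>) \<inter> (\<lambda>z. br (fst z) \<otimes> br (snd z)) -` fst c0"

lemma smooth_into_prod: "smooth_into (\<Omega> \<times> \<Omega>) A (\<lambda>z. br (fst z) \<otimes> br (snd z))"
  by (intro smooth_into_mult smooth_into_precompose[OF sA smooth_into_br fdE] open_Times open_Omega
      smooth_on_fst smooth_on_snd) auto

lemma open_M: "open M" unfolding M_def by (rule open_kappa_vimage[OF smooth_into_prod])
lemma smooth_mu: "smooth_on M \<mu>"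
  unfolding \<mu>_def[abs_def] by (rule smooth_on_kappa[OF smooth_into_prod open_M]) (simp add: M_def)

lemma M_left: "x \<in> \<Omega> \<Longrightarrow> (x, 0) \<in> M" and M_right: "x \<in> \<Omega> \<Longrightarrow> (0, x) \<in> M"
  by (auto simp: M_def zero_Omega br_zero br_chart)
lemma mu_left: "x \<in> \<Omega> \<Longrightarrow> \<mu> (x, 0) = x" and mu_right: "x \<in> \<Omega> \<Longrightarrow> \<mu> (0, x) = x"
  by (auto simp: \<mu>_def br_zero kappa_br)

lemma br_mu: "(x, y) \<in> M \<Longrightarrow> br (\<mu> (x, y)) = br x \<otimes> br y"
  by (simp add: M_def \<mu>_def br_kappa)

lemma eventually_line_Omega: "\<forall>\<^sub>F t in at 0. t *\<^sub>R u \<in> \<Omega>"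
proof -
  have "((\<lambda>t::real. t *\<^sub>R u) \<longlongrightarrow> 0 *\<^sub>R u) (at 0)" by (intro tendsto_intros)
  then show ?thesis using topological_tendstoD[OF _ open_Omega] zero_Omega by auto
qed

text \<open>Forced by the unit laws, which make \<open>\<mu>\<close> the identity on each of the two
  axes, together with linearity of the derivative.\<close>

lemma frechet_mu: "frechet_derivative \<mu> (at (0, 0)) (u, v) = u + v"
proof -
  have d: "(\<mu> has_derivative frechet_derivative \<mu> (at (0, 0))) (at (0, 0))"
    by (rule smooth_on_has_derivative[OF smooth_mu M_left[OF zero_Omega]])
  have lin: "linear (frechet_derivative \<mu> (at (0, 0)))" using d has_derivative_linear by blast
  have 1: "frechet_derivative \<mu> (at (0, 0)) w = w'"
    if eq: "\<And>t. t *\<^sub>R w' \<in> \<Omega> \<Longrightarrow> \<mu> (t *\<^sub>R w) = t *\<^sub>R w'" for w w'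
  proof -
    have "(\<mu> has_derivative frechet_derivative \<mu> (at (0, 0))) (at ((0, 0) + 0 *\<^sub>R w))"
      using d by (simp add: zero_prod_def)
    then have "((\<lambda>t. \<mu> ((0, 0) + t *\<^sub>R w)) has_vector_derivative frechet_derivative \<mu> (at (0, 0)) w) (at 0)"
      by (rule has_vector_derivative_line)
    moreover have "((\<lambda>t. t *\<^sub>R w') has_vector_derivative w') (at 0)" by (auto intro!: derivative_eq_intros)
    then have "((\<lambda>t. \<mu> ((0, 0) + t *\<^sub>R w)) has_vector_derivative w') (at 0)"
      unfolding has_vector_derivative_def
    proof (rule has_derivative_transform_eventually)
      show "\<forall>\<^sub>F t in at 0. t *\<^sub>R w' = \<mu> ((0, 0) + t *\<^sub>R w)"
        using eventually_line_Omega[of w'] by eventually_elim (simp add: eq zero_prod_def[symmetric])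
      show "0 *\<^sub>R w' = \<mu> ((0, 0) + 0 *\<^sub>R w)" using eq[of 0] zero_Omega by (simp add: zero_prod_def[symmetric])
    qed simp
    ultimately show ?thesis by (rule vector_derivative_unique_at)
  qed
  have "frechet_derivative \<mu> (at (0, 0)) ((u, 0) + (0, v)) = u + v"
    unfolding linear_add[OF lin] using 1[of u "(u, 0)"] 1[of v "(0, v)"] by (simp add: mu_left mu_right)
  then show ?thesis by simp
qed

text \<open>The second order estimate for the group law at the origin. Its restriction to the
  diagonal, the squaring map, is the hypothesis of the abstract doubling argument.\<close>

lemma mult_estimate:
  obtains r K where "r > 0" "K > 0" "\<And>x y. norm x + norm y < r \<Longrightarrow> (x, y) \<in> M"
    "\<And>x y. norm x + norm y < r \<Longrightarrow> norm (\<mu> (x, y) - (x + y)) \<le> K * (norm x + norm y)\<^sup>2"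
    "\<And>x y \<rho>. norm x \<le> \<rho> \<Longrightarrow> norm y \<le> \<rho> \<Longrightarrow> 2 * \<rho> < r \<Longrightarrow>
      norm (\<mu> (x, x) - \<mu> (y, y) - 2 *\<^sub>R (x - y)) \<le> K * \<rho> * norm (x - y)"
proof -
  have z: "((0::'e), (0::'e)) = 0" by (simp add: zero_prod_def)
  obtain r K where r: "r > 0" and K: "K > 0" and bM: "ball (0, 0) r \<subseteq> M" and est:
    "\<And>x y \<rho>. x \<in> ball (0, 0) r \<Longrightarrow> y \<in> ball (0, 0) r \<Longrightarrow> norm (x - (0, 0)) \<le> \<rho> \<Longrightarrow> norm (y - (0, 0)) \<le> \<rho> \<Longrightarrow>
      norm (\<mu> x - \<mu> y - frechet_derivative \<mu> (at (0, 0)) (x - y)) \<le> K * \<rho> * norm (x - y)"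
    using second_order_estimate[OF findim_prod[OF fdE fdE] open_M smooth_mu M_left[OF zero_Omega]] by blast
  have inb: "(x, y) \<in> ball (0, 0) r" if "norm x + norm y < r" for x y :: 'e
    using norm_Pair_le[of x y] that by (simp only: z mem_ball_0)
  show ?thesis
  proof (rule that[OF r])
    \<comment> \<open>On the diagonal both the distance to the origin and the distance of two points
      grow by a factor of at most 2, whence 4.\<close>
    show "4 * K > 0" using K by simp
    show "(x, y) \<in> M" if "norm x + norm y < r" for x y using inb[OF that] bM by blast
  next
    fix x y :: 'e assume a: "norm x + norm y < r"
    have n: "norm ((x, y) - (0, 0)) \<le> norm x + norm y" using norm_Pair_le[of x y] by (simp add: z)
    have "norm (\<mu> (x, y) - \<mu> (0, 0) - frechet_derivative \<mu> (at (0, 0)) ((x, y) - (0, 0))) \<le>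
        K * (norm x + norm y) * norm ((x, y) - (0, 0))"
      by (rule est[OF inb[OF a]]) (use r n in \<open>auto simp: z\<close>)
    also have "\<dots> \<le> K * (norm x + norm y) * (norm x + norm y)" using K n by (intro mult_left_mono) auto
    also have "\<dots> \<le> 4 * K * (norm x + norm y)\<^sup>2" using K by (simp add: power2_eq_square)
    finally show "norm (\<mu> (x, y) - (x + y)) \<le> 4 * K * (norm x + norm y)\<^sup>2"
      using mu_left[OF zero_Omega] by (simp add: frechet_mu)
  next
    fix x y :: 'e and \<rho> assume a: "norm x \<le> \<rho>" "norm y \<le> \<rho>" "2 * \<rho> < r"
    have n: "norm ((x, x) - (0, 0)) \<le> 2 * \<rho>" "norm ((y, y) - (0, 0)) \<le> 2 * \<rho>"
      using norm_Pair_le[of x x] norm_Pair_le[of y y] a by (simp_all add: z)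
    have rho: "0 \<le> \<rho>" using a(1) norm_ge_zero order_trans by blast
    have nd: "norm ((x, x) - (y, y)) \<le> 2 * norm (x - y)" using norm_Pair_le[of "x - y" "x - y"] by simp
    have "norm (\<mu> (x, x) - \<mu> (y, y) - frechet_derivative \<mu> (at (0, 0)) ((x, x) - (y, y))) \<le>
        K * (2 * \<rho>) * norm ((x, x) - (y, y))"
      by (rule est[OF inb inb n]) (use a in linarith)+
    also have "\<dots> \<le> K * (2 * \<rho>) * (2 * norm (x - y))" using K nd rho by (intro mult_left_mono) auto
    finally show "norm (\<mu> (x, x) - \<mu> (y, y) - 2 *\<^sub>R (x - y)) \<le> 4 * K * \<rho> * norm (x - y)"
      by (simp add: frechet_mu scaleR_2 algebra_simps)
  qed
qed

text \<open>The coordinate \<open>\<iota> x\<close> of the inverse solves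
  \<open>\<mu> (x, \<iota> x) = 0\<close>. Differentiability bounds it by a multiple of
  \<open>norm x\<close>, and then the quadratic estimate for \<open>\<mu>\<close> forces
  \<open>x + \<iota> x\<close> to be quadratic in \<open>x\<close>.\<close>

lemma inv_estimate:
  obtains r K where "r > 0" "K > 0" "\<And>x. norm x < r \<Longrightarrow> x \<in> \<Omega> \<and> inv (br x) \<in> fst c0"
    "\<And>x. norm x < r \<Longrightarrow> norm (\<kappa> (inv (br x)) - (- x)) \<le> K * (norm x)\<^sup>2"
proof -
  define \<iota> where "\<iota> = (\<lambda>x. \<kappa> (inv (br x)))"
  have si: "smooth_into \<Omega> A (\<lambda>x. inv (br x))" by (rule smooth_into_compose[OF sA sA smooth_into_br smooth_inv])
  let ?T = "\<Omega> \<inter> (\<lambda>x. inv (br x)) -` fst c0"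
  have T: "open ?T" by (rule open_kappa_vimage[OF si])
  have sm: "smooth_on ?T \<iota>" unfolding \<iota>_def by (rule smooth_on_kappa[OF si T]) simp
  have 0: "0 \<in> ?T" using zero_Omega c0 by (simp add: br_zero)
  have i0: "\<iota> 0 = 0" by (simp add: \<iota>_def br_zero kappa_one)
  obtain r K where r: "r > 0" and K: "K > 0" and bT: "ball 0 r \<subseteq> ?T" and est:
    "\<And>x y \<rho>. x \<in> ball 0 r \<Longrightarrow> y \<in> ball 0 r \<Longrightarrow> norm (x - 0) \<le> \<rho> \<Longrightarrow> norm (y - 0) \<le> \<rho> \<Longrightarrow>
      norm (\<iota> x - \<iota> y - frechet_derivative \<iota> (at 0) (x - y)) \<le> K * \<rho> * norm (x - y)"
    using second_order_estimate[OF fdE T sm 0] by blast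
  obtain B where B: "B > 0" "\<And>v. norm (frechet_derivative \<iota> (at 0) v) \<le> norm v * B"
    using bounded_linear.pos_bounded[OF has_derivative_bounded_linear[OF smooth_on_has_derivative[OF sm 0]]] by blast
  define C where "C = B + K * r"
  have C: "C > 0" using B K r by (simp add: C_def add_pos_pos)
  have lip: "norm (\<iota> x) \<le> C * norm x" if "norm x < r" for x
  proof -
    have "norm (\<iota> x) \<le> norm (frechet_derivative \<iota> (at 0) x) + norm (\<iota> x - frechet_derivative \<iota> (at 0) x)"
      by (rule norm_triangle_sub)
    also have "\<dots> \<le> norm x * B + K * norm x * norm x"
      using est[of x 0 "norm x"] B(2) that r i0 by (intro add_mono) auto
    also have "\<dots> \<le> norm x * B + K * norm x * r" using that K by (intro add_left_mono mult_left_mono) auto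
    finally show ?thesis by (simp add: C_def algebra_simps)
  qed
  obtain r' K' where r': "r' > 0" and K': "K' > 0" and
    est': "\<And>x y. norm x + norm y < r' \<Longrightarrow> norm (\<mu> (x, y) - (x + y)) \<le> K' * (norm x + norm y)\<^sup>2"
    using mult_estimate by metis
  define s where "s = min r (r' / (1 + C))"
  show ?thesis
  proof (rule that)
    show "s > 0" using r r' C by (simp add: s_def)
    show "K' * (1 + C)\<^sup>2 > 0" using K' C by simp
    show "x \<in> \<Omega> \<and> inv (br x) \<in> fst c0" if "norm x < s" for x
      using that bT by (auto simp: s_def)
    fix x :: 'e assume x: "norm x < s"
    then have xr: "norm x < r" and "norm x < r' / (1 + C)" by (auto simp: s_def)
    then have "norm x * (1 + C) < r'" using C by (simp add: pos_less_divide_eq)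
    moreover have le: "norm x + norm (\<iota> x) \<le> norm x * (1 + C)" using lip[OF xr] by (simp add: algebra_simps)
    ultimately have "norm (\<mu> (x, \<iota> x) - (x + \<iota> x)) \<le> K' * (norm x + norm (\<iota> x))\<^sup>2" by (intro est') auto
    also have "\<dots> \<le> K' * (norm x * (1 + C))\<^sup>2" using K' le by (intro mult_left_mono power_mono) auto
    also have "\<mu> (x, \<iota> x) = 0"
    proof -
      have "x \<in> ?T" using xr bT by auto
      then have "br (\<iota> x) = inv (br x)" by (simp add: \<iota>_def br_kappa)
      then show ?thesis by (simp add: \<mu>_def kappa_one)
    qed
    finally have "norm (x + \<iota> x) \<le> K' * (norm x * (1 + C))\<^sup>2" by (metis add.commute diff_0 norm_minus_cancel)
    also have "K' * (norm x * (1 + C))\<^sup>2 = K' * (1 + C)\<^sup>2 * (norm x)\<^sup>2" unfolding power_mult_distrib by simp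
    finally show "norm (\<kappa> (inv (br x)) - (- x)) \<le> K' * (1 + C)\<^sup>2 * (norm x)\<^sup>2"
      by (simp add: \<iota>_def add.commute)
  qed
qed

end

section \<open>The exponential map as a limit of powers\<close>

context complex_lie
begin

text \<open>Sequences with tangent vector \<open>a\<close> at scale \<open>2 ^ n\<close>, up to
  second order. Their powers of exponent \<open>2 ^ n\<close> all converge to the exponential of
  \<open>a\<close>, and the class is closed under the group operations, so identities for the
  exponential follow from identities for such sequences.\<close>

definition near_id :: "(nat \<Rightarrow> 'g) \<Rightarrow> 'e \<Rightarrow> bool" where
  "near_id y a \<longleftrightarrow> (\<exists>C. \<forall>\<^sub>F n in sequentially. y n \<in> fst c0 \<and> norm (\<kappa> (y n) - a /\<^sub>R 2 ^ n) \<le> C / 4 ^ n)"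

lemma half_tendsto_0: "(\<lambda>n. c / 2 ^ n) \<longlonglongrightarrow> (0::real)"
  using tendsto_mult[OF tendsto_const[of c] LIMSEQ_realpow_zero[of "1/2"]] by (simp add: power_divide)

lemma near_id_br: "near_id (\<lambda>n. br (a /\<^sub>R 2 ^ n)) a"
proof -
  have "(\<lambda>n. norm (a /\<^sub>R 2 ^ n)) \<longlonglongrightarrow> 0" unfolding norm_scale_pow2 by (rule half_tendsto_0)
  then have "(\<lambda>n. a /\<^sub>R 2 ^ n) \<longlonglongrightarrow> 0" by (rule tendsto_norm_zero_cancel)
  then have "\<forall>\<^sub>F n in sequentially. a /\<^sub>R 2 ^ n \<in> \<Omega>"
    using topological_tendstoD[OF _ open_Omega zero_Omega] by blast
  then have "\<forall>\<^sub>F n in sequentially. br (a /\<^sub>R 2 ^ n) \<in> fst c0 \<and> norm (\<kappa> (br (a /\<^sub>R 2 ^ n)) - a /\<^sub>R 2 ^ n) \<le> 0 / 4 ^ n"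
    by eventually_elim (simp add: br_chart kappa_br)
  then show ?thesis unfolding near_id_def by blast
qed

lemma near_id_norm:
  assumes "near_id y a"
  obtains C where "C \<ge> 0" "\<forall>\<^sub>F n in sequentially. y n \<in> fst c0 \<and> norm (\<kappa> (y n) - a /\<^sub>R 2 ^ n) \<le> C / 4 ^ n \<and>
    norm (\<kappa> (y n)) \<le> (norm a + C) / 2 ^ n"
proof -
  obtain C where C: "\<forall>\<^sub>F n in sequentially. y n \<in> fst c0 \<and> norm (\<kappa> (y n) - a /\<^sub>R 2 ^ n) \<le> C / 4 ^ n"
    using assms unfolding near_id_def by blast
  have "\<forall>\<^sub>F n in sequentially. y n \<in> fst c0 \<and> norm (\<kappa> (y n) - a /\<^sub>R 2 ^ n) \<le> \<bar>C\<bar> / 4 ^ n \<and>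
    norm (\<kappa> (y n)) \<le> (norm a + \<bar>C\<bar>) / 2 ^ n"
    using C
  proof eventually_elim
    case (elim n)
    have "C / 4 ^ n \<le> \<bar>C\<bar> / 4 ^ n" by (intro divide_right_mono) auto
    then have 1: "norm (\<kappa> (y n) - a /\<^sub>R 2 ^ n) \<le> \<bar>C\<bar> / 4 ^ n" using elim by linarith
    have p: "(2::real) ^ n \<le> 4 ^ n" by (intro power_mono) auto
    have "\<bar>C\<bar> / 4 ^ n \<le> \<bar>C\<bar> / 2 ^ n" by (rule divide_left_mono[OF p]) auto
    moreover have "norm (\<kappa> (y n)) \<le> norm (a /\<^sub>R 2 ^ n) + norm (\<kappa> (y n) - a /\<^sub>R 2 ^ n)"
      by (rule norm_triangle_sub)
    ultimately have "norm (\<kappa> (y n)) \<le> norm a / 2 ^ n + \<bar>C\<bar> / 2 ^ n"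
      using 1 unfolding norm_scale_pow2 by linarith
    then show ?case using elim 1 by (simp add: add_divide_distrib)
  qed
  then show ?thesis by (intro that[of "\<bar>C\<bar>"]) auto
qed

lemma eventually_half_less: "0 < r \<Longrightarrow> \<forall>\<^sub>F n in sequentially. D / 2 ^ n < (r::real)"
  using order_tendstoD(2)[OF half_tendsto_0[of D]] by blast

text \<open>Both coordinates are of order \<open>1 / 2 ^ n\<close>, so the quadratic error of the
  group law has exactly the admissible order \<open>1 / 4 ^ n\<close>.\<close>

lemma near_id_mult:
  assumes "near_id y a" "near_id z b"
  shows "near_id (\<lambda>n. y n \<otimes> z n) (a + b)"
proof -
  obtain C where C: "C \<ge> 0" "\<forall>\<^sub>F n in sequentially. y n \<in> fst c0 \<and> norm (\<kappa> (y n) - a /\<^sub>R 2 ^ n) \<le> C / 4 ^ n \<and>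
    norm (\<kappa> (y n)) \<le> (norm a + C) / 2 ^ n" using near_id_norm[OF assms(1)] .
  obtain D where D: "D \<ge> 0" "\<forall>\<^sub>F n in sequentially. z n \<in> fst c0 \<and> norm (\<kappa> (z n) - b /\<^sub>R 2 ^ n) \<le> D / 4 ^ n \<and>
    norm (\<kappa> (z n)) \<le> (norm b + D) / 2 ^ n" using near_id_norm[OF assms(2)] .
  obtain r K where r: "r > 0" and K: "K > 0" and M: "\<And>x y. norm x + norm y < r \<Longrightarrow> (x, y) \<in> M" and
    est: "\<And>x y. norm x + norm y < r \<Longrightarrow> norm (\<mu> (x, y) - (x + y)) \<le> K * (norm x + norm y)\<^sup>2"
    using mult_estimate by metis
  define N where "N = norm a + C + (norm b + D)"
  have "\<forall>\<^sub>F n in sequentially. y n \<otimes> z n \<in> fst c0 \<and>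
      norm (\<kappa> (y n \<otimes> z n) - (a + b) /\<^sub>R 2 ^ n) \<le> (K * N\<^sup>2 + C + D) / 4 ^ n"
    using C(2) D(2) eventually_half_less[OF r, of N]
  proof eventually_elim
    case (elim n)
    let ?x = "\<kappa> (y n)" and ?y = "\<kappa> (z n)"
    have s: "norm ?x + norm ?y \<le> N / 2 ^ n" using elim by (simp add: N_def add_divide_distrib)
    then have sr: "norm ?x + norm ?y < r" using elim by linarith
    have yz: "br ?x \<otimes> br ?y = y n \<otimes> z n" using elim by (simp add: br_kappa)
    have 1: "y n \<otimes> z n \<in> fst c0" using M[OF sr] yz by (simp add: M_def)
    have m: "\<kappa> (y n \<otimes> z n) = \<mu> (?x, ?y)" by (simp add: \<mu>_def yz)
    have "norm (\<mu> (?x, ?y) - (?x + ?y)) \<le> K * (norm ?x + norm ?y)\<^sup>2" by (rule est[OF sr])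
    also have "\<dots> \<le> K * (N / 2 ^ n)\<^sup>2" using K s by (intro mult_left_mono power_mono) auto
    also have "\<dots> = K * N\<^sup>2 / 4 ^ n" unfolding four_power by (simp add: power_divide power2_eq_square)
    finally have a1: "norm (\<mu> (?x, ?y) - (?x + ?y)) \<le> K * N\<^sup>2 / 4 ^ n" .
    have "\<mu> (?x, ?y) - (a + b) /\<^sub>R 2 ^ n =
        (\<mu> (?x, ?y) - (?x + ?y)) + ((?x - a /\<^sub>R 2 ^ n) + (?y - b /\<^sub>R 2 ^ n))"
      by (simp add: scaleR_add_right)
    also have "norm \<dots> \<le> K * N\<^sup>2 / 4 ^ n + (C / 4 ^ n + D / 4 ^ n)"
      using a1 elim by (intro norm_triangle_le add_mono norm_triangle_mono) auto
    finally show ?case using 1 m by (simp add: add_divide_distrib)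
  qed
  then show ?thesis unfolding near_id_def by blast
qed

lemma near_id_inv:
  assumes "near_id y a"
  shows "near_id (\<lambda>n. inv (y n)) (- a)"
proof -
  obtain C where C: "C \<ge> 0" "\<forall>\<^sub>F n in sequentially. y n \<in> fst c0 \<and> norm (\<kappa> (y n) - a /\<^sub>R 2 ^ n) \<le> C / 4 ^ n \<and>
    norm (\<kappa> (y n)) \<le> (norm a + C) / 2 ^ n" using near_id_norm[OF assms(1)] .
  obtain r K where r: "r > 0" and K: "K > 0" and M: "\<And>x. norm x < r \<Longrightarrow> x \<in> \<Omega> \<and> inv (br x) \<in> fst c0" and
    est: "\<And>x. norm x < r \<Longrightarrow> norm (\<kappa> (inv (br x)) - (- x)) \<le> K * (norm x)\<^sup>2"
    using inv_estimate by metis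
  define N where "N = norm a + C"
  have "\<forall>\<^sub>F n in sequentially. inv (y n) \<in> fst c0 \<and>
      norm (\<kappa> (inv (y n)) - (- a) /\<^sub>R 2 ^ n) \<le> (K * N\<^sup>2 + C) / 4 ^ n"
    using C(2) eventually_half_less[OF r, of N]
  proof eventually_elim
    case (elim n)
    let ?x = "\<kappa> (y n)"
    have s: "norm ?x \<le> N / 2 ^ n" using elim by (simp add: N_def)
    then have sr: "norm ?x < r" using elim by linarith
    have yz: "br ?x = y n" using elim by (simp add: br_kappa)
    have 1: "inv (y n) \<in> fst c0" using M[OF sr] yz by simp
    have "norm (\<kappa> (inv (y n)) - (- ?x)) \<le> K * (norm ?x)\<^sup>2" using est[OF sr] yz by simp
    also have "\<dots> \<le> K * (N / 2 ^ n)\<^sup>2" using K s by (intro mult_left_mono power_mono) auto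
    also have "\<dots> = K * N\<^sup>2 / 4 ^ n" unfolding four_power by (simp add: power_divide power2_eq_square)
    finally have a1: "norm (\<kappa> (inv (y n)) - (- ?x)) \<le> K * N\<^sup>2 / 4 ^ n" .
    have "\<kappa> (inv (y n)) - (- a) /\<^sub>R 2 ^ n = (\<kappa> (inv (y n)) - (- ?x)) - (?x - a /\<^sub>R 2 ^ n)" by simp
    also have "norm \<dots> \<le> K * N\<^sup>2 / 4 ^ n + C / 4 ^ n"
    proof -
      have a2: "norm (?x - a /\<^sub>R 2 ^ n) \<le> C / 4 ^ n" using elim by blast
      show ?thesis by (rule order_trans[OF norm_triangle_ineq4 add_mono[OF a1 a2]])
    qed
    finally show ?case using 1 by (simp add: add_divide_distrib)
  qed
  then show ?thesis unfolding near_id_def by blast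
qed

lemma near_id_one: "near_id (\<lambda>n. \<one>) 0"
  using near_id_br[of 0] by (simp add: br_zero)

lemma near_id_pow: "near_id y a \<Longrightarrow> near_id (\<lambda>n. y n [^] (k::nat)) (real k *\<^sub>R a)"
proof (induction k)
  case 0
  then show ?case by (simp add: near_id_one)
next
  case (Suc k)
  have "near_id (\<lambda>n. y n [^] k \<otimes> y n) (real k *\<^sub>R a + a)" by (rule near_id_mult[OF Suc.IH[OF Suc.prems] Suc.prems])
  then show ?case by (simp add: algebra_simps)
qed

text \<open>Dropping \<open>k\<close> terms divides the tangent vector by \<open>2 ^ k\<close>,
  which reduces large vectors to the range where the doubling argument converges.\<close>

lemma near_id_shift:
  assumes "near_id y a"
  shows "near_id (\<lambda>n. y (n + k)) (a /\<^sub>R 2 ^ k)"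
proof -
  obtain C where C: "C \<ge> 0" "\<forall>\<^sub>F n in sequentially. y n \<in> fst c0 \<and> norm (\<kappa> (y n) - a /\<^sub>R 2 ^ n) \<le> C / 4 ^ n \<and>
    norm (\<kappa> (y n)) \<le> (norm a + C) / 2 ^ n" using near_id_norm[OF assms(1)] .
  have "\<forall>\<^sub>F n in sequentially. y (n + k) \<in> fst c0 \<and>
      norm (\<kappa> (y (n + k)) - (a /\<^sub>R 2 ^ k) /\<^sub>R 2 ^ n) \<le> C / 4 ^ n"
    using eventually_all_ge_at_top[OF C(2)]
  proof eventually_elim
    case (elim n)
    have "(4::real) ^ n \<le> 4 ^ (n + k)" by (intro power_increasing) auto
    then have "C / 4 ^ (n + k) \<le> C / 4 ^ n" using C(1) by (intro divide_left_mono) auto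
    moreover have "(a /\<^sub>R 2 ^ k) /\<^sub>R 2 ^ n = a /\<^sub>R 2 ^ (n + k)" by (simp add: power_add mult.commute)
    ultimately show ?case using elim[rule_format, of "n + k"] by auto
  qed
  then show ?thesis unfolding near_id_def by blast
qed

text \<open>In coordinates the doubling map is squaring in the group, so its \<open>n\<close>-fold
  iterate is the power with exponent \<open>2 ^ n\<close>. \<open>E\<close> is the limit of these
  iterates.\<close>

lemma exp_small:
  obtains E \<rho> L where "\<rho> > 0" "L > 0" "\<And>a. norm a \<le> \<rho> \<Longrightarrow> E a \<in> \<Omega>"
    "\<And>a. norm a \<le> \<rho> \<Longrightarrow> norm (E a - a) \<le> L * (norm a)\<^sup>2"
    "\<And>a b. norm a \<le> \<rho> \<Longrightarrow> norm b \<le> \<rho> \<Longrightarrow> norm (E a - E b) \<le> 2 * norm (a - b)"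
    "\<And>a y. norm a \<le> \<rho> \<Longrightarrow> near_id y a \<Longrightarrow> (\<lambda>n. y n [^] (2 ^ n :: nat)) \<longlonglongrightarrow> br (E a)"
proof -
  obtain r L where r: "r > 0" and L: "L > 0" and M: "\<And>x y. norm x + norm y < r \<Longrightarrow> (x, y) \<in> M" and
    est: "\<And>x y \<rho>. norm x \<le> \<rho> \<Longrightarrow> norm y \<le> \<rho> \<Longrightarrow> 2 * \<rho> < r \<Longrightarrow>
      norm (\<mu> (x, x) - \<mu> (y, y) - 2 *\<^sub>R (x - y)) \<le> L * \<rho> * norm (x - y)"
    using mult_estimate by metis
  define S where "S = (\<lambda>x. \<mu> (x, x))"
  \<comment> \<open>\<open>r / 3\<close> makes \<open>2 * R < r\<close>, the range of the estimate
    on the diagonal; \<open>1 / L\<close> is the smallness condition \<open>L * R \<le> 1\<close> of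
    the doubling argument.\<close>
  define R where "R = min (r / 3) (1 / L)"
  have R: "R > 0" "L * R \<le> 1" "2 * R < r" using r L by (auto simp: R_def min_def field_simps)
  have S0: "S 0 = 0" using mu_left[OF zero_Omega] by (simp add: S_def)
  have estS: "norm (S x - S y - 2 *\<^sub>R (x - y)) \<le> L * \<rho> * norm (x - y)"
    if "\<rho> \<le> R" "norm x \<le> \<rho>" "norm y \<le> \<rho>" for x y \<rho>
    unfolding S_def by (rule est) (use that R in auto)
  have inO: "x \<in> \<Omega>" "br (S x) = br x \<otimes> br x" if "norm x \<le> R" for x
    using M[of x x] that R br_mu[of x x] by (auto simp: M_def S_def)
  have dn: "norm ((S ^^ k) x) \<le> R * 2 ^ k / 2 ^ n" if "norm x \<le> R / 2 / 2 ^ n" "k \<le> n" for x k n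
    by (rule doubling_norm(2)[where L = L], fact S0, fact R(1), fact L, fact R(2), erule (2) estS, fact that(1), fact that(2))
  obtain E where E1: "\<And>a y C. norm a \<le> R / 4 \<Longrightarrow> (\<forall>\<^sub>F n in sequentially. norm (y n - a /\<^sub>R 2 ^ n) \<le> C / 4 ^ n) \<Longrightarrow>
      (\<lambda>n. (S ^^ n) (y n)) \<longlonglongrightarrow> E a"
    and E2: "\<And>a. norm a \<le> R / 4 \<Longrightarrow> norm (E a - a) \<le> L * (norm a)\<^sup>2"
    and E3: "\<And>a b. norm a \<le> R / 4 \<Longrightarrow> norm b \<le> R / 4 \<Longrightarrow> norm (E a - E b) \<le> 2 * norm (a - b)"
  proof -
    have "\<exists>E. (\<forall>a y C. norm a \<le> R / 4 \<longrightarrow> (\<forall>\<^sub>F n in sequentially. norm (y n - a /\<^sub>R 2 ^ n) \<le> C / 4 ^ n) \<longrightarrow>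
        (\<lambda>n. (S ^^ n) (y n)) \<longlonglongrightarrow> E a) \<and>
      (\<forall>a. norm a \<le> R / 4 \<longrightarrow> norm (E a - a) \<le> L * (norm a)\<^sup>2) \<and>
      (\<forall>a b. norm a \<le> R / 4 \<longrightarrow> norm b \<le> R / 4 \<longrightarrow> norm (E a - E b) \<le> 2 * norm (a - b))"
      by (rule doubling_limit[where L = L], fact S0, fact R(1), fact L, fact R(2), erule (2) estS, fact fdE)
    then show thesis using that by blast
  qed
  have EO: "E a \<in> \<Omega>" if a: "norm a \<le> R / 4" for a
  proof (rule inO(1))
    have "L * norm a \<le> L * R" using a R L by (intro mult_left_mono) auto
    then have "(L * norm a) * norm a \<le> 1 * norm a" using R(2) by (intro mult_right_mono) auto
    then have "norm (E a - a) \<le> norm a" using E2[OF a] by (simp add: power2_eq_square)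
    moreover have "norm (E a) \<le> norm a + norm (E a - a)" by (rule norm_triangle_sub)
    ultimately show "norm (E a) \<le> R" using a R by linarith
  qed
  have it: "br ((S ^^ k) x) = br x [^] (2 ^ k :: nat)" if x: "norm x \<le> R / 2 / 2 ^ n" and "k \<le> n" for x k n
    using that(2)
  proof (induction k)
    case 0
    then show ?case by simp
  next
    case (Suc k)
    have kn: "k \<le> n" using Suc.prems by linarith
    have "(2::real) ^ k \<le> 2 ^ n" using kn by (intro power_increasing) auto
    then have "R * (2 ^ k / 2 ^ n) \<le> R * 1" using R by (intro mult_left_mono) (auto simp: divide_le_eq_1)
    then have "norm ((S ^^ k) x) \<le> R" using dn[OF x kn] by simp
    then have "br (S ((S ^^ k) x)) = br ((S ^^ k) x) \<otimes> br ((S ^^ k) x)" by (rule inO(2))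
    also have "\<dots> = br x [^] (2 ^ Suc k :: nat)"
      using Suc.IH[OF kn] by (simp add: nat_pow_mult mult_2)
    finally show ?case by simp
  qed
  show ?thesis
  proof (rule that[of "R / 4" L E])
    fix a :: 'e and y assume a: "norm a \<le> R / 4" and y: "near_id y a"
    obtain C where C: "C \<ge> 0" "\<forall>\<^sub>F n in sequentially. y n \<in> fst c0 \<and> norm (\<kappa> (y n) - a /\<^sub>R 2 ^ n) \<le> C / 4 ^ n \<and>
      norm (\<kappa> (y n)) \<le> (norm a + C) / 2 ^ n" using near_id_norm[OF y] .
    have R8: "0 < R / 4" using R by simp
    have ev: "\<forall>\<^sub>F n in sequentially. norm (\<kappa> (y n) - a /\<^sub>R 2 ^ n) \<le> C / 4 ^ n"
      using C(2) by eventually_elim auto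
    have "\<forall>\<^sub>F n in sequentially. br ((S ^^ n) (\<kappa> (y n))) = y n [^] (2 ^ n :: nat)"
      using C(2) eventually_half_less[OF R8, of C]
    proof eventually_elim
      case (elim n)
      have "norm (\<kappa> (y n)) \<le> norm (a /\<^sub>R 2 ^ n) + norm (\<kappa> (y n) - a /\<^sub>R 2 ^ n)" by (rule norm_triangle_sub)
      also have "\<dots> \<le> norm a / 2 ^ n + (C / 2 ^ n) / 2 ^ n"
        using elim unfolding norm_scale_pow2 four_power by simp
      also have "\<dots> \<le> R / 4 / 2 ^ n + R / 4 / 2 ^ n"
        using a elim by (intro add_mono divide_right_mono) auto
      finally have "norm (\<kappa> (y n)) \<le> R / 2 / 2 ^ n" by simp
      from it[OF this order_refl] show ?case using elim by (simp add: br_kappa)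
    qed
    moreover have "isCont br (E a)"
      using continuous_on_br EO[OF a] open_Omega by (simp add: continuous_on_eq_continuous_at)
    then have "(\<lambda>n. br ((S ^^ n) (\<kappa> (y n)))) \<longlonglongrightarrow> br (E a)"
      using E1[OF a ev] by (rule isCont_tendsto_compose)
    ultimately show "(\<lambda>n. y n [^] (2 ^ n :: nat)) \<longlonglongrightarrow> br (E a)" by (rule Lim_transform_eventually[rotated])
  qed (use R L E2 E3 EO in auto)
qed

text \<open>Euler's limit of \<open>(1 + a / N) ^ N\<close> along \<open>N = 2 ^ n\<close>, with
  \<open>br\<close> in place of adding 1. It is identified with \<open>lie_exp\<close> only once its
  curves are known to be smooth one-parameter subgroups.\<close>

definition ex :: "'e \<Rightarrow> 'g" where "ex a = lim (\<lambda>n. br (a /\<^sub>R 2 ^ n) [^] (2 ^ n :: nat))"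

lemma small_scale:
  assumes "\<rho> > 0"
  obtains k where "norm ((a::'e) /\<^sub>R 2 ^ k) < \<rho>"
  using eventually_happens'[OF sequentially_bot eventually_half_less[OF assms, of "norm a"]]
  by (auto simp: norm_scale_pow2 simp del: norm_scaleR)

text \<open>For large \<open>a\<close>, the limit for \<open>a\<close> divided by
  \<open>2 ^ k\<close> is raised to the power \<open>2 ^ k\<close>; powers are continuous and the
  exponents multiply to \<open>2 ^ (n + k)\<close>.\<close>

lemma tendsto_ex:
  assumes "near_id y a"
  shows "(\<lambda>n. y n [^] (2 ^ n :: nat)) \<longlonglongrightarrow> ex a"
proof -
  obtain E \<rho> where \<rho>: "\<rho> > 0" and
    E: "\<And>a y. norm a \<le> \<rho> \<Longrightarrow> near_id y a \<Longrightarrow> (\<lambda>n. y n [^] (2 ^ n :: nat)) \<longlonglongrightarrow> br (E a)"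
    using exp_small by metis
  obtain k where k: "norm (a /\<^sub>R 2 ^ k) < \<rho>" using small_scale[OF \<rho>] .
  have lm: "(\<lambda>n. y n [^] (2 ^ n :: nat)) \<longlonglongrightarrow> br (E (a /\<^sub>R 2 ^ k)) [^] (2 ^ k :: nat)" if y: "near_id y a" for y
  proof -
    have "(\<lambda>n. y (n + k) [^] (2 ^ n :: nat)) \<longlonglongrightarrow> br (E (a /\<^sub>R 2 ^ k))"
      using E[OF less_imp_le[OF k] near_id_shift[OF y]] .
    then have "(\<lambda>n. (y (n + k) [^] (2 ^ n :: nat)) [^] (2 ^ k :: nat)) \<longlonglongrightarrow> br (E (a /\<^sub>R 2 ^ k)) [^] (2 ^ k :: nat)"
      by (rule tendsto_pow_group)
    then have "(\<lambda>n. y (n + k) [^] (2 ^ (n + k) :: nat)) \<longlonglongrightarrow> br (E (a /\<^sub>R 2 ^ k)) [^] (2 ^ k :: nat)"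
      by (simp add: nat_pow_pow power_add)
    then show ?thesis by (rule LIMSEQ_offset)
  qed
  have "ex a = br (E (a /\<^sub>R 2 ^ k)) [^] (2 ^ k :: nat)"
    unfolding ex_def by (rule limI[OF lm[OF near_id_br]])
  then show ?thesis using lm[OF assms] by simp
qed

lemma ex_eqI: "near_id y a \<Longrightarrow> (\<lambda>n. y n [^] (2 ^ n :: nat)) \<longlonglongrightarrow> g \<Longrightarrow> ex a = g"
  using tendsto_ex LIMSEQ_unique by blast

lemma ex_zero: "ex 0 = \<one>"
  by (rule ex_eqI[OF near_id_one]) simp

lemma ex_nat: "ex (real k *\<^sub>R a) = ex a [^] k"
proof (rule ex_eqI[OF near_id_pow[OF near_id_br]])
  have "(\<lambda>n. (br (a /\<^sub>R 2 ^ n) [^] (2 ^ n :: nat)) [^] k) \<longlonglongrightarrow> ex a [^] k"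
    by (rule tendsto_pow_group[OF tendsto_ex[OF near_id_br]])
  then show "(\<lambda>n. (br (a /\<^sub>R 2 ^ n) [^] k) [^] (2 ^ n :: nat)) \<longlonglongrightarrow> ex a [^] k"
    by (simp add: nat_pow_pow mult.commute)
qed

lemma ex_minus: "ex (- a) = inv (ex a)"
proof (rule ex_eqI[OF near_id_inv[OF near_id_br]])
  have "(\<lambda>n. inv (br (a /\<^sub>R 2 ^ n) [^] (2 ^ n :: nat))) \<longlonglongrightarrow> inv (ex a)"
    by (rule tendsto_inv_group[OF tendsto_ex[OF near_id_br]])
  then show "(\<lambda>n. inv (br (a /\<^sub>R 2 ^ n)) [^] (2 ^ n :: nat)) \<longlonglongrightarrow> inv (ex a)"
    by (simp add: nat_pow_inv)
qed

lemma ex_int: "ex (of_int k *\<^sub>R a) = ex a [^] (k::int)"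
proof (cases "k \<ge> 0")
  case True
  then obtain n where "k = int n" using nonneg_int_cases by blast
  then show ?thesis by (simp add: ex_nat int_pow_int)
next
  case False
  then obtain n where "k = - int n" by (metis int_cases2 nle_le of_nat_0_le_iff)
  then show ?thesis by (simp add: ex_nat ex_minus int_pow_neg int_pow_int)
qed

text \<open>Near 0 continuity is the Lipschitz bound on \<open>E\<close>; a general point is divided
  by a power of two and the result is raised back to that power.\<close>

lemma isCont_ex: "isCont ex a"
proof -
  obtain E \<rho> where \<rho>: "\<rho> > 0" and EO: "\<And>a. norm a \<le> \<rho> \<Longrightarrow> E a \<in> \<Omega>" and
    lip: "\<And>a b. norm a \<le> \<rho> \<Longrightarrow> norm b \<le> \<rho> \<Longrightarrow> norm (E a - E b) \<le> 2 * norm (a - b)" and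
    E: "\<And>a y. norm a \<le> \<rho> \<Longrightarrow> near_id y a \<Longrightarrow> (\<lambda>n. y n [^] (2 ^ n :: nat)) \<longlonglongrightarrow> br (E a)"
    by (rule exp_small) blast
  have exEq: "ex a = br (E a)" if "norm a \<le> \<rho>" for a using ex_eqI[OF near_id_br E[OF that near_id_br]] .
  have cE: "continuous_on (ball 0 \<rho>) E"
    by (rule lipschitz_on_continuous_on[of 2]) (use lip in \<open>auto simp: lipschitz_on_def dist_norm\<close>)
  have "continuous_on (ball 0 \<rho>) (\<lambda>a. br (E a))"
    by (rule continuous_on_compose2[OF continuous_on_br cE]) (use EO in auto)
  then have cs: "continuous_on (ball 0 \<rho>) ex"
    by (rule continuous_on_eq) (use exEq in auto)
  obtain k where k: "norm (a /\<^sub>R 2 ^ k) < \<rho>" using small_scale[OF \<rho>] .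
  then have "isCont ex (a /\<^sub>R 2 ^ k)"
    using cs by (simp add: continuous_on_eq_continuous_at)
  moreover have "((\<lambda>x. x /\<^sub>R 2 ^ k) \<longlongrightarrow> a /\<^sub>R 2 ^ k) (at a)" by (intro tendsto_intros)
  ultimately have "((\<lambda>x. ex (x /\<^sub>R 2 ^ k)) \<longlongrightarrow> ex (a /\<^sub>R 2 ^ k)) (at a)"
    by (rule isCont_tendsto_compose)
  then have "((\<lambda>x. ex (x /\<^sub>R 2 ^ k) [^] (2 ^ k :: nat)) \<longlongrightarrow> ex (a /\<^sub>R 2 ^ k) [^] (2 ^ k :: nat)) (at a)"
    by (rule tendsto_pow_group)
  moreover have "ex (x /\<^sub>R 2 ^ k) [^] (2 ^ k :: nat) = ex x" for x
    using ex_nat[of "2 ^ k" "x /\<^sub>R 2 ^ k"] by simp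
  ultimately show ?thesis by (simp add: isCont_def)
qed

lemma tendsto_ex_compose: "(f \<longlongrightarrow> a) F \<Longrightarrow> ((\<lambda>x. ex (f x)) \<longlongrightarrow> ex a) F"
  by (rule isCont_tendsto_compose[OF isCont_ex])

text \<open>If \<open>s\<close> and \<open>t\<close> have a common denominator, both sides are
  integer powers of the exponential of one vector. The general case follows by density and
  continuity.\<close>

lemma ex_add: "ex ((s + t) *\<^sub>R a) = ex (s *\<^sub>R a) \<otimes> ex (t *\<^sub>R a)"
proof -
  \<comment> \<open>The largest multiple of \<open>1 / Suc n\<close> not above \<open>x\<close>: the
    denominator is the same for \<open>s\<close> and for \<open>t\<close>.\<close>
  define q where "q = (\<lambda>(x::real) n. of_int \<lfloor>x * real (Suc n)\<rfloor> / real (Suc n))"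
  have q: "q x \<longlonglongrightarrow> x" for x
  proof -
    have "norm (q x n - x) \<le> 1 * inverse (real (Suc n))" for n
    proof -
      have "q x n - x = (of_int \<lfloor>x * real (Suc n)\<rfloor> - x * real (Suc n)) * inverse (real (Suc n))"
        by (simp add: q_def field_simps)
      moreover have "\<bar>of_int \<lfloor>x * real (Suc n)\<rfloor> - x * real (Suc n)\<bar> \<le> 1" by linarith
      then have "\<bar>of_int \<lfloor>x * real (Suc n)\<rfloor> - x * real (Suc n)\<bar> * inverse (real (Suc n)) \<le> 1 * inverse (real (Suc n))"
        by (intro mult_right_mono) auto
      ultimately show ?thesis by (simp add: abs_mult)
    qed
    then have "(\<lambda>n. q x n - x) \<longlonglongrightarrow> 0"
      by (intro Lim_null_comparison[OF _ LIMSEQ_inverse_real_of_nat]) auto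
    from tendsto_add[OF this tendsto_const[of x]] show ?thesis by simp
  qed
  have eq: "ex ((q s n + q t n) *\<^sub>R a) = ex (q s n *\<^sub>R a) \<otimes> ex (q t n *\<^sub>R a)" for n
  proof -
    let ?b = "a /\<^sub>R real (Suc n)"
    have r: "q x n *\<^sub>R a = of_int \<lfloor>x * real (Suc n)\<rfloor> *\<^sub>R ?b" for x by (simp add: q_def divide_inverse)
    have "(q s n + q t n) *\<^sub>R a = of_int (\<lfloor>s * real (Suc n)\<rfloor> + \<lfloor>t * real (Suc n)\<rfloor>) *\<^sub>R ?b"
      by (simp only: scaleR_add_left r of_int_add)
    then have "ex ((q s n + q t n) *\<^sub>R a) = ex ?b [^] (\<lfloor>s * real (Suc n)\<rfloor> + \<lfloor>t * real (Suc n)\<rfloor>)"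
      by (simp only: ex_int)
    also have "\<dots> = ex (q s n *\<^sub>R a) \<otimes> ex (q t n *\<^sub>R a)"
      unfolding r ex_int by (rule int_pow_mult) simp
    finally show ?thesis .
  qed
  have "(\<lambda>n. ex ((q s n + q t n) *\<^sub>R a)) \<longlonglongrightarrow> ex ((s + t) *\<^sub>R a)"
    by (intro tendsto_ex_compose tendsto_intros q)
  moreover have "(\<lambda>n. ex ((q s n + q t n) *\<^sub>R a)) \<longlonglongrightarrow> ex (s *\<^sub>R a) \<otimes> ex (t *\<^sub>R a)"
    unfolding eq by (intro tendsto_mult_group tendsto_ex_compose tendsto_intros q)
  ultimately show ?thesis by (rule LIMSEQ_unique)
qed

end

text \<open>Bootstrapping: if the solution is \<open>k\<close> times continuously differentiable, so
  is the right-hand side along it, which is the derivative of the solution.\<close>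

lemma ode_smooth:
  fixes y :: "real \<Rightarrow> 'a::real_normed_vector"
  assumes fd: "findim TYPE('a)" and I: "open I" and W: "open W" and V: "smooth_on W V"
    and yW: "y ` I \<subseteq> W" and der: "\<And>t. t \<in> I \<Longrightarrow> (y has_vector_derivative V (y t)) (at t)"
  shows "smooth_on I y"
  unfolding smooth_on_def
proof
  fix k show "Ck_on k I y"
  proof (induction k)
    case 0
    have "isCont y t" if "t \<in> I" for t using der[OF that] has_vector_derivative_continuous by blast
    then show ?case by (auto intro: continuous_at_imp_continuous_on)
  next
    case (Suc k)
    have "Ck_on k I (\<lambda>t. V (y t))"
      by (rule Ck_on_compose[OF fd I W Suc _ yW]) (use V in \<open>simp add: smooth_on_def\<close>)
    then have *: "Ck_on k I (\<lambda>t. h *\<^sub>R V (y t))" for h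
      by (rule Ck_on_linear_compose[OF bounded_linear_scaleR_right I])
    have "frechet_derivative y (at t) h = h *\<^sub>R V (y t)" if "t \<in> I" for t h
      using frechet_derivative_eqI[OF der[OF that, unfolded has_vector_derivative_def]] by simp
    then have "Ck_on k I (\<lambda>t. frechet_derivative y (at t) h)" for h
      by (intro Ck_on_cong[OF I _ *]) auto
    moreover have "y differentiable at t" if "t \<in> I" for t
      using der[OF that] unfolding has_vector_derivative_def differentiable_def by blast
    ultimately show ?case by simp
  qed
qed

context complex_lie
begin

text \<open>The quadratic bound on \<open>E\<close> gives the derivative at 0. The addition law
  moves it to other times and shows that the coordinate curve solves an autonomous equation with
  smooth right-hand side, hence is smooth.\<close>

lemma exp_curve_local:
  obtains \<delta> y where "\<delta> > 0" "smooth_on (ball 0 \<delta>) y" "\<And>t. t \<in> ball 0 \<delta> \<Longrightarrow> y t \<in> \<Omega>"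
    "\<And>t. t \<in> ball 0 \<delta> \<Longrightarrow> ex (t *\<^sub>R a) = br (y t)" "(y has_vector_derivative a) (at 0)"
proof -
  obtain E \<rho> L where \<rho>: "\<rho> > 0" and L: "L > 0" and EO: "\<And>a. norm a \<le> \<rho> \<Longrightarrow> E a \<in> \<Omega>" and
    E2: "\<And>a. norm a \<le> \<rho> \<Longrightarrow> norm (E a - a) \<le> L * (norm a)\<^sup>2" and
    E: "\<And>a y. norm a \<le> \<rho> \<Longrightarrow> near_id y a \<Longrightarrow> (\<lambda>n. y n [^] (2 ^ n :: nat)) \<longlonglongrightarrow> br (E a)"
    by (rule exp_small) blast
  have exEq: "ex a = br (E a)" if "norm a \<le> \<rho>" for a using ex_eqI[OF near_id_br E[OF that near_id_br]] .
  define \<delta> where "\<delta> = \<rho> / (norm a + 1)"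
  have na: "norm a + 1 > 0" by (smt (verit) norm_ge_zero)
  have d: "\<delta> > 0" using \<rho> na by (simp add: \<delta>_def)
  have small: "norm (t *\<^sub>R a) \<le> \<rho>" if "t \<in> ball 0 \<delta>" for t
  proof -
    have "\<bar>t\<bar> * (norm a + 1) \<le> \<delta> * (norm a + 1)" using that na by (intro mult_right_mono) auto
    also have "\<dots> = \<rho>" using na by (simp add: \<delta>_def)
    finally show ?thesis by (simp add: algebra_simps)
  qed
  define y where "y = (\<lambda>t. E (t *\<^sub>R a))"
  have yO: "y t \<in> \<Omega>" if "t \<in> ball 0 \<delta>" for t using EO[OF small[OF that]] by (simp add: y_def)
  have exy: "ex (t *\<^sub>R a) = br (y t)" if "t \<in> ball 0 \<delta>" for t using exEq[OF small[OF that]] by (simp add: y_def)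
  have y0: "y 0 = 0" using E2[of 0] \<rho> by (simp add: y_def)
  have yk: "y t = \<kappa> (ex (t *\<^sub>R a))" if "t \<in> ball 0 \<delta>" for t using exy[OF that] kappa_br[OF yO[OF that]] by simp
  have der0: "(y has_vector_derivative a) (at 0)"
    unfolding has_vector_derivative_def has_derivative_at_alt
  proof (intro conjI allI impI)
    show "bounded_linear (\<lambda>x. x *\<^sub>R a)" by (rule bounded_linear_scaleR_left)
    fix e :: real assume e: "e > 0"
    define D where "D = L * (norm a)\<^sup>2 + 1"
    have D: "D > 0" using L by (simp add: D_def add_nonneg_pos)
    show "\<exists>d>0. \<forall>t. norm (t - 0) < d \<longrightarrow> norm (y t - y 0 - (t - 0) *\<^sub>R a) \<le> e * norm (t - 0)"
    proof (intro exI[of _ "min \<delta> (e / D)"] conjI allI impI)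
      show "0 < min \<delta> (e / D)" using d e D by simp
      fix t :: real assume t: "norm (t - 0) < min \<delta> (e / D)"
      then have tb: "t \<in> ball 0 \<delta>" and "\<bar>t\<bar> < e / D" by auto
      then have "\<bar>t\<bar> * D \<le> e" using D by (simp add: pos_less_divide_eq)
      moreover have "\<bar>t\<bar> * (L * (norm a)\<^sup>2) \<le> \<bar>t\<bar> * D" by (intro mult_left_mono) (auto simp: D_def)
      ultimately have "(\<bar>t\<bar> * (L * (norm a)\<^sup>2)) * \<bar>t\<bar> \<le> e * \<bar>t\<bar>" by (intro mult_right_mono) auto
      moreover have "norm (y t - t *\<^sub>R a) \<le> L * (norm (t *\<^sub>R a))\<^sup>2" unfolding y_def by (rule E2[OF small[OF tb]])
      moreover have "L * (norm (t *\<^sub>R a))\<^sup>2 = (\<bar>t\<bar> * (L * (norm a)\<^sup>2)) * \<bar>t\<bar>"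
        by (simp add: power2_eq_square)
      ultimately have "norm (y t - t *\<^sub>R a) \<le> e * \<bar>t\<bar>" by linarith
      then show "norm (y t - y 0 - (t - 0) *\<^sub>R a) \<le> e * norm (t - 0)" by (simp add: y0)
    qed
  qed
  \<comment> \<open>The left-invariant vector field with value \<open>a\<close> at the unit, in
    coordinates.\<close>
  define V where "V = (\<lambda>x. frechet_derivative \<mu> (at (x, 0)) (0, a))"
  have smV: "smooth_on \<Omega> V" unfolding V_def
    by (rule smooth_on_compose[OF findim_prod[OF fdE fdE] open_Omega open_M _ smooth_on_frechet[OF smooth_mu]])
      (auto intro!: smooth_on_Pair open_Omega smooth_on_const smooth_on_linear[OF bounded_linear_ident] simp: M_left)
  have der: "(y has_vector_derivative V (y t)) (at t)" if t: "t \<in> ball 0 \<delta>" for t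
  proof -
    have "((\<lambda>h. (y t, y h)) has_derivative (\<lambda>h. (0, h *\<^sub>R a))) (at 0)"
      by (rule has_derivative_Pair[OF has_derivative_const der0[unfolded has_vector_derivative_def]])
    moreover have "(\<mu> has_derivative frechet_derivative \<mu> (at (y t, 0))) (at (y t, y 0))"
      unfolding y0 by (rule smooth_on_has_derivative[OF smooth_mu M_left[OF yO[OF t]]])
    ultimately have d1: "((\<lambda>h. \<mu> (y t, y h)) has_derivative (\<lambda>h. frechet_derivative \<mu> (at (y t, 0)) (0, h *\<^sub>R a))) (at 0)"
      by (rule has_derivative_compose)
    have "linear (frechet_derivative \<mu> (at (y t, 0)))"
      by (rule linear_frechet_derivative[OF smooth_on_differentiable[OF smooth_mu M_left[OF yO[OF t]]]])
    then have "frechet_derivative \<mu> (at (y t, 0)) (0, h *\<^sub>R a) = h *\<^sub>R V (y t)" for h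
      using linear_cmul[of "frechet_derivative \<mu> (at (y t, 0))" h "(0, a)"] by (simp add: V_def)
    with d1 have d2: "((\<lambda>h. \<mu> (y t, y h)) has_derivative (\<lambda>h. h *\<^sub>R V (y t))) (at 0)" by simp
    have "((\<lambda>s. s - t) has_derivative (\<lambda>h. h)) (at t)" by (auto intro!: derivative_eq_intros)
    from has_derivative_compose[OF this, of "\<lambda>h. \<mu> (y t, y h)" "\<lambda>h. h *\<^sub>R V (y t)"] d2
    have d3: "((\<lambda>s. \<mu> (y t, y (s - t))) has_derivative (\<lambda>h. h *\<^sub>R V (y t))) (at t)" by simp
    define U where "U = ball 0 \<delta> \<inter> ball t \<delta>"
    show ?thesis unfolding has_vector_derivative_def
    proof (rule has_derivative_transform_within_open[OF d3])
      show "open U" "t \<in> U" using t d by (auto simp: U_def)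
      fix s assume s: "s \<in> U"
      then have s1: "s \<in> ball 0 \<delta>" "s - t \<in> ball 0 \<delta>" by (auto simp: U_def dist_norm)
      have "ex (s *\<^sub>R a) = ex (t *\<^sub>R a) \<otimes> ex ((s - t) *\<^sub>R a)" using ex_add[of t "s - t" a] by simp
      then have "br (y s) = br (y t) \<otimes> br (y (s - t))" using exy s1 t by simp
      then show "\<mu> (y t, y (s - t)) = y s" using kappa_br[OF yO[OF s1(1)]] by (simp add: \<mu>_def)
    qed
  qed
  have "smooth_on (ball 0 \<delta>) y"
    by (rule ode_smooth[OF fdE open_ball open_Omega smV _ der]) (use yO in auto)
  then show ?thesis by (rule that[OF d]) (use yO exy der0 in auto)
qed

text \<open>Smoothness is known near 0; near any other time the curve is a left translate of its
  germ at 0.\<close>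

lemma one_parameter_subgroup_ex: "one_parameter_subgroup G A a (\<lambda>t. ex (t *\<^sub>R a))"
  unfolding one_parameter_subgroup_def
proof (intro conjI allI)
  obtain \<delta> y where d: "\<delta> > 0" and sy: "smooth_on (ball 0 \<delta>) y" and yO: "\<And>t. t \<in> ball 0 \<delta> \<Longrightarrow> y t \<in> \<Omega>"
    and exy: "\<And>t. t \<in> ball 0 \<delta> \<Longrightarrow> ex (t *\<^sub>R a) = br (y t)" and der: "(y has_vector_derivative a) (at 0)"
    by (rule exp_curve_local[of a]) blast
  have "smooth_into (ball 0 \<delta>) A (\<lambda>t. br (y t))"
    by (rule smooth_into_precompose[OF sA smooth_into_br fdE open_ball sy]) (use yO in auto)
  then have loc: "smooth_into (ball 0 \<delta>) A (\<lambda>t. ex (t *\<^sub>R a))"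
    by (rule smooth_into_cong[OF sA]) (use exy in auto)
  have "smooth_into UNIV A (\<lambda>t. ex (t *\<^sub>R a))"
  proof (rule smooth_into_local[OF sA open_UNIV])
    fix s :: real
    have sh: "smooth_on (ball s \<delta>) (\<lambda>t. t - s)"
      using smooth_on_add[OF open_ball smooth_on_linear[OF bounded_linear_ident] smooth_on_const[of _ "- s"]] by simp
    have "smooth_into (ball s \<delta>) A (\<lambda>t. ex ((t - s) *\<^sub>R a))"
      by (rule smooth_into_precompose[OF sA loc findim_real open_ball sh]) (auto simp: dist_norm)
    from smooth_into_compose[OF sA sA this smooth_left[of "ex (s *\<^sub>R a)"]]
    have "smooth_into (ball s \<delta>) A (\<lambda>t. ex (s *\<^sub>R a) \<otimes> ex ((t - s) *\<^sub>R a))" .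
    moreover have "ex (s *\<^sub>R a) \<otimes> ex ((t - s) *\<^sub>R a) = ex (t *\<^sub>R a)" for t
      using ex_add[of s "t - s" a] by simp
    ultimately have "smooth_into (ball s \<delta>) A (\<lambda>t. ex (t *\<^sub>R a))" by simp
    then show "\<exists>T. s \<in> T \<and> smooth_into T A (\<lambda>t. ex (t *\<^sub>R a))"
      by (intro exI[of _ "ball s \<delta>"] conjI) (use d in auto)
  qed
  then show "smooth_map vector_atlas A (\<lambda>t. ex (t *\<^sub>R a))" by (simp add: smooth_into_vector)
  show "ex ((s + t) *\<^sub>R a) = ex (s *\<^sub>R a) \<otimes> ex (t *\<^sub>R a)" for s t by (rule ex_add)
  have "((\<lambda>t. x0 + y t) has_derivative (\<lambda>h. h *\<^sub>R a)) (at 0)"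
    using has_derivative_add[OF has_derivative_const[of x0] der[unfolded has_vector_derivative_def]] by simp
  then have "((snd c0 \<circ> (\<lambda>t. ex (t *\<^sub>R a))) has_derivative (\<lambda>h. h *\<^sub>R a)) (at 0)"
  proof (rule has_derivative_transform_within_open[of _ _ _ _ "ball 0 \<delta>"])
    fix t :: real assume "t \<in> ball 0 \<delta>"
    then show "x0 + y t = (snd c0 \<circ> (\<lambda>t. ex (t *\<^sub>R a))) t"
      using kappa_br[OF yO] exy by (simp add: \<kappa>_def diff_eq_eq add.commute)
  qed (use d in auto)
  then have "frechet_derivative (snd c0 \<circ> (\<lambda>t. ex (t *\<^sub>R a))) (at 0) = (\<lambda>h. h *\<^sub>R a)"
    by (rule frechet_derivative_eqI)
  then show "tangent_map vector_atlas A (\<lambda>t. ex (t *\<^sub>R a)) 0 1 = a"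
    by (simp add: tangent_map_def ex_zero c0_def[symmetric] comp_def)
qed

lemma lie_exp_ex: "lie_exp G A a = ex a"
  using lie_exp_eqI[OF one_parameter_subgroup_ex[of a]] by simp

lemma one_parameter_subgroup_eq_ex: "one_parameter_subgroup G A a \<gamma> \<Longrightarrow> \<gamma> t = ex (t *\<^sub>R a)"
  using one_parameter_subgroup_unique[OF one_parameter_subgroup_ex[of a]] by metis

lemma smooth_ex_curve: "smooth_map vector_atlas A (\<lambda>t. ex (t *\<^sub>R a))"
  using one_parameter_subgroup_ex by (simp add: one_parameter_subgroup_def)

lemma tangent_ex_curve: "tangent_map vector_atlas A (\<lambda>t. ex (t *\<^sub>R a)) 0 1 = a"
  using one_parameter_subgroup_ex by (simp add: one_parameter_subgroup_def)

text \<open>The deviation of \<open>E\<close> from the identity is quadratic, which is the precision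
  demanded here; multiplied with a second such sequence it yields the Trotter product
  formula.\<close>

lemma near_id_ex: "near_id (\<lambda>n. ex (a /\<^sub>R 2 ^ n)) a"
proof -
  obtain E \<rho> L where \<rho>: "\<rho> > 0" and L: "L > 0" and EO: "\<And>a. norm a \<le> \<rho> \<Longrightarrow> E a \<in> \<Omega>" and
    E2: "\<And>a. norm a \<le> \<rho> \<Longrightarrow> norm (E a - a) \<le> L * (norm a)\<^sup>2" and
    E: "\<And>a y. norm a \<le> \<rho> \<Longrightarrow> near_id y a \<Longrightarrow> (\<lambda>n. y n [^] (2 ^ n :: nat)) \<longlonglongrightarrow> br (E a)"
    by (rule exp_small) blast
  have exEq: "ex a = br (E a)" if "norm a \<le> \<rho>" for a using ex_eqI[OF near_id_br E[OF that near_id_br]] .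
  have "\<forall>\<^sub>F n in sequentially. ex (a /\<^sub>R 2 ^ n) \<in> fst c0 \<and>
      norm (\<kappa> (ex (a /\<^sub>R 2 ^ n)) - a /\<^sub>R 2 ^ n) \<le> (L * (norm a)\<^sup>2) / 4 ^ n"
    using eventually_half_less[OF \<rho>, of "norm a"]
  proof eventually_elim
    case (elim n)
    then have n: "norm (a /\<^sub>R 2 ^ n) \<le> \<rho>" unfolding norm_scale_pow2 by simp
    have "L * (norm (a /\<^sub>R 2 ^ n))\<^sup>2 = (L * (norm a)\<^sup>2) / 4 ^ n"
      unfolding norm_scale_pow2 four_power by (simp add: power2_eq_square)
    then show ?case using E2[OF n] EO[OF n] exEq[OF n] by (simp add: br_chart kappa_br)
  qed
  then show ?thesis unfolding near_id_def by blast
qed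

lemma tendsto_trotter:
  "(\<lambda>n. (ex (a /\<^sub>R 2 ^ n) \<otimes> ex (b /\<^sub>R 2 ^ n)) [^] (2 ^ n :: nat)) \<longlonglongrightarrow> ex (a + b)"
  by (rule tendsto_ex[OF near_id_mult[OF near_id_ex near_id_ex]])

lemma lie_algebra_ofD: "\<xi> \<in> lie_algebra_of G A U \<longleftrightarrow> (\<forall>t. ex (t *\<^sub>R \<xi>) \<in> U)"
  by (simp add: lie_algebra_of_def lie_exp_ex)

text \<open>By the Trotter formula the exponential of a sum is a limit of products of elements of
  \<open>U\<close>, and \<open>U\<close> is closed.\<close>

lemma lie_algebra_add:
  assumes "closed U" "subgroup U G" "\<xi> \<in> lie_algebra_of G A U" "\<eta> \<in> lie_algebra_of G A U"
  shows "\<xi> + \<eta> \<in> lie_algebra_of G A U"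
  unfolding lie_algebra_ofD
proof
  fix t :: real
  have "(ex ((t *\<^sub>R \<xi>) /\<^sub>R 2 ^ n) \<otimes> ex ((t *\<^sub>R \<eta>) /\<^sub>R 2 ^ n)) [^] (2 ^ n :: nat) \<in> U" for n
  proof -
    have 1: "ex ((t *\<^sub>R \<xi>) /\<^sub>R 2 ^ n) \<in> U" "ex ((t *\<^sub>R \<eta>) /\<^sub>R 2 ^ n) \<in> U"
      using assms(3,4) unfolding lie_algebra_ofD scaleR_scaleR by blast+
    have "(x [^] (k::nat)) \<in> U" if "x \<in> U" for x k
      using that assms(2) by (induction k) (auto simp: subgroup.one_closed subgroup.m_closed)
    then show ?thesis using subgroup.m_closed[OF assms(2) 1] by blast
  qed
  then have "ex (t *\<^sub>R \<xi> + t *\<^sub>R \<eta>) \<in> U"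
    by (intro closed_sequentially[OF assms(1) _ tendsto_trotter]) auto
  then show "ex (t *\<^sub>R (\<xi> + \<eta>)) \<in> U" by (simp add: scaleR_add_right)
qed

end

section \<open>The adjoint representation\<close>

text \<open>Boundedness of \<open>exp (s A)\<close> for all \<open>s\<close> excludes Jordan blocks and eigenvalues that are not
  imaginary.\<close>

locale bounded_complex_flow =
  fixes j A :: "'e::real_normed_vector \<Rightarrow> 'e" and \<rho> :: "real \<Rightarrow> 'e \<Rightarrow> 'e"
  assumes cs: "complex_structure j" and fd: "findim TYPE('e)" and lA: "linear A" and Aj: "A (j v) = j (A v)"
    and lr: "linear (\<rho> s)" and rj: "\<rho> s (j v) = j (\<rho> s v)" and r0: "\<rho> 0 v = v"
    and der: "((\<lambda>s. \<rho> s v) has_vector_derivative \<rho> s (A v)) (at s)"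
    and bd: "bounded (range (\<lambda>s. \<rho> s v))"
begin

lemmas jD = complex_structureD[OF cs]

text \<open>Multiplication of a vector by a complex scalar, with \<open>j\<close> as the imaginary
  unit. It gives access to complex eigenvalues while the space remains a real one.\<close>

definition cscale :: "complex \<Rightarrow> 'e \<Rightarrow> 'e" where
  "cscale z v = Re z *\<^sub>R v + Im z *\<^sub>R j v"

lemma cscale_0 [simp]: "cscale 0 v = 0" "cscale z 0 = 0"
  by (simp_all add: cscale_def jD)
lemma cscale_1 [simp]: "cscale 1 v = v" by (simp add: cscale_def)
lemma cscale_add: "cscale z (u + v) = cscale z u + cscale z v"
  by (simp add: cscale_def jD algebra_simps)
lemma cscale_diff: "cscale z (u - v) = cscale z u - cscale z v"
  by (simp add: cscale_def jD algebra_simps)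
lemma cscale_scaleR: "cscale z (a *\<^sub>R v) = a *\<^sub>R cscale z v"
  by (simp add: cscale_def jD algebra_simps)
lemma cscale_diff_left: "cscale (y - z) v = cscale y v - cscale z v"
  by (simp add: cscale_def algebra_simps)
lemma cscale_mult: "cscale (y * z) v = cscale y (cscale z v)"
  by (simp add: cscale_def jD algebra_simps)
lemma cscale_minus: "cscale (- z) v = - cscale z v"
  by (simp add: cscale_def algebra_simps)

lemma A_cscale: "A (cscale z v) = cscale z (A v)"
  using lA by (simp add: cscale_def linear_add linear_cmul Aj)

lemma rho_cscale: "\<rho> s (cscale z v) = cscale z (\<rho> s v)"
  using lr[of s] by (simp add: cscale_def linear_add linear_cmul rj)

lemma bounded_linear_j: "bounded_linear j" by (rule linear_findim_bounded_linear[OF fd jD(1)])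

lemma cscale_norm: obtains C where "C > 0" "\<And>z v. norm (cscale z v) \<le> C * norm z * norm v"
proof -
  obtain J where J: "J > 0" "\<And>v. norm (j v) \<le> norm v * J" using bounded_linear.pos_bounded[OF bounded_linear_j] by blast
  have "norm (cscale z v) \<le> (1 + J) * norm z * norm v" for z v
  proof -
    have "norm (cscale z v) \<le> \<bar>Re z\<bar> * norm v + \<bar>Im z\<bar> * norm (j v)"
      unfolding cscale_def by (rule order_trans[OF norm_triangle_ineq]) simp
    also have "\<dots> \<le> norm z * norm v + norm z * (norm v * J)"
      using J abs_Re_le_cmod[of z] abs_Im_le_cmod[of z] by (intro add_mono mult_mono) auto
    finally show ?thesis by (simp add: algebra_simps)
  qed
  then show ?thesis using J by (intro that[of "1 + J"]) auto
qed

lemma cscale_inverse: "z \<noteq> 0 \<Longrightarrow> cscale (inverse z) (cscale z v) = v"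
  by (simp flip: cscale_mult)

lemma cscale_has_vector_derivative:
  assumes "(z has_vector_derivative z') (at s)" "(f has_vector_derivative f') (at s)"
  shows "((\<lambda>s. cscale (z s) (f s)) has_vector_derivative cscale z' (f s) + cscale (z s) f') (at s)"
proof -
  have 1: "((\<lambda>s. Re (z s)) has_field_derivative Re z') (at s)" "((\<lambda>s. Im (z s)) has_field_derivative Im z') (at s)"
    using bounded_linear.has_vector_derivative[OF bounded_linear_Re assms(1)]
      bounded_linear.has_vector_derivative[OF bounded_linear_Im assms(1)]
    by (simp_all add: has_real_derivative_iff_has_vector_derivative)
  have 2: "((\<lambda>s. j (f s)) has_vector_derivative j f') (at s)"
    by (rule bounded_linear.has_vector_derivative[OF bounded_linear_j assms(2)])
  show ?thesis unfolding cscale_def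
    by (rule has_vector_derivative_eq_rhs[OF has_vector_derivative_add[OF has_vector_derivative_scaleR[OF 1(1) assms(2)]
          has_vector_derivative_scaleR[OF 1(2) 2]]]) (simp add: jD algebra_simps)
qed

lemma exp_has_vector_derivative:
  fixes \<nu> :: complex
  shows "((\<lambda>s. exp (- \<nu> * of_real s)) has_vector_derivative (- \<nu> * exp (- \<nu> * of_real s))) (at s)"
  by (rule has_vector_derivative_real_field[of "\<lambda>z. exp (- \<nu> * z)"])
    (auto intro!: derivative_eq_intros)

lemma zero_vector_derivative_constant:
  fixes f :: "real \<Rightarrow> 'e"
  assumes "\<And>s. (f has_vector_derivative 0) (at s)"
  shows "f s = f 0"
proof -
  have "\<exists>c. \<forall>x\<in>UNIV. f x = c"
    by (rule has_derivative_zero_constant) (use assms in \<open>auto simp: has_vector_derivative_def\<close>)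
  then show ?thesis by auto
qed

text \<open>Solves the linear equation on a Jordan block of size at most two: after removing the
  exponential factor, the derivative of the curve is the constant \<open>W\<close>.\<close>

lemma eigen_flow_aux:
  assumes Y: "A Y = cscale \<nu> Y + W" and W: "\<And>s. cscale (exp (- \<nu> * of_real s)) (\<rho> s W) = W"
  shows "cscale (exp (- \<nu> * of_real s)) (\<rho> s Y) = Y + s *\<^sub>R W"
proof -
  define f where "f = (\<lambda>s. cscale (exp (- \<nu> * of_real s)) (\<rho> s Y) - s *\<^sub>R W)"
  have "(f has_vector_derivative 0) (at s)" for s
  proof -
    have "((\<lambda>s. cscale (exp (- \<nu> * of_real s)) (\<rho> s Y)) has_vector_derivative
      cscale (- \<nu> * exp (- \<nu> * of_real s)) (\<rho> s Y) + cscale (exp (- \<nu> * of_real s)) (\<rho> s (A Y))) (at s)"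
      by (rule cscale_has_vector_derivative[OF exp_has_vector_derivative der])
    moreover have "((\<lambda>s. s *\<^sub>R W) has_vector_derivative W) (at s)" by (auto intro!: derivative_eq_intros)
    ultimately have "(f has_vector_derivative
      cscale (- \<nu> * exp (- \<nu> * of_real s)) (\<rho> s Y) + cscale (exp (- \<nu> * of_real s)) (\<rho> s (A Y)) - W) (at s)"
      unfolding f_def by (rule has_vector_derivative_diff)
    moreover have "cscale (exp (- \<nu> * of_real s)) (\<rho> s (A Y)) = cscale (\<nu> * exp (- \<nu> * of_real s)) (\<rho> s Y) + W"
      using linear_add[OF lr[of s]] W[of s]
      by (simp add: Y rho_cscale cscale_add cscale_mult[symmetric] mult.commute)
    ultimately show ?thesis by (simp add: cscale_minus)
  qed
  then have "f s = f 0" by (rule zero_vector_derivative_constant)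
  then show ?thesis by (simp add: f_def r0 algebra_simps)
qed

lemma eigen_flow:
  assumes "A Y = cscale \<nu> Y"
  shows "cscale (exp (- \<nu> * of_real s)) (\<rho> s Y) = Y"
  using eigen_flow_aux[of Y \<nu> 0 s] assms lr by (simp add: linear_0)

text \<open>The explicit solution read backwards: a bound on the flow line of \<open>Y\<close>
  becomes a bound on \<open>Y + s *\<^sub>R W\<close>, with the exponential factor on the other
  side.\<close>

lemma flow_lower_bound:
  assumes ev: "A Y = cscale \<nu> Y + W" "A W = cscale \<nu> W"
  obtains C where "C > 0" "\<And>s. norm (Y + s *\<^sub>R W) \<le> C * exp (- Re \<nu> * s)"
proof -
  obtain C where C: "C > 0" "\<And>z v. norm (cscale z v) \<le> C * norm z * norm v" using cscale_norm by blast
  obtain K where K: "K > 0" "\<And>s. norm (\<rho> s Y) \<le> K" using bd[of Y] by (auto simp: bounded_pos)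
  have "norm (Y + s *\<^sub>R W) \<le> (C * K) * exp (- Re \<nu> * s)" for s
  proof -
    have "norm (Y + s *\<^sub>R W) = norm (cscale (exp (- \<nu> * of_real s)) (\<rho> s Y))"
      using eigen_flow_aux[OF ev(1) eigen_flow[OF ev(2)], of s] by simp
    also have "\<dots> \<le> C * norm (exp (- \<nu> * of_real s)) * norm (\<rho> s Y)" by (rule C(2))
    also have "\<dots> \<le> C * norm (exp (- \<nu> * of_real s)) * K" using C K by (intro mult_left_mono) auto
    also have "norm (exp (- \<nu> * of_real s)) = exp (- Re \<nu> * s)" by simp
    finally show ?thesis by (simp add: algebra_simps)
  qed
  then show ?thesis using C K that[of "C * K"] by simp
qed

text \<open>With \<open>W = 0\<close>, a nonzero real part would bound the fixed number
  \<open>norm Y\<close> by a quantity that tends to 0 as time goes to plus or minus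
  infinity.\<close>

lemma eigenvalue_imaginary:
  assumes "A Y = cscale \<nu> Y" "Y \<noteq> 0"
  shows "Re \<nu> = 0"
proof (rule ccontr)
  assume n: "Re \<nu> \<noteq> 0"
  have A0: "A 0 = cscale \<nu> 0" using lA by (simp add: linear_0)
  obtain C where C: "C > 0" "\<And>s. norm (Y + s *\<^sub>R 0) \<le> C * exp (- Re \<nu> * s)"
    using flow_lower_bound[of Y \<nu> 0] assms(1) A0 by auto
  \<comment> \<open>The time \<open>t / Re \<nu>\<close> treats both signs of the real part at
    once.\<close>
  have "norm Y \<le> C * exp (- t)" for t using C(2)[of "t / Re \<nu>"] n by simp
  then have "norm Y * exp t \<le> C" for t by (simp add: exp_minus field_simps)
  from this[of "C / norm Y"] have "norm Y * exp (C / norm Y) \<le> C" .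
  moreover have "norm Y * (1 + C / norm Y) \<le> norm Y * exp (C / norm Y)"
    by (intro mult_left_mono exp_ge_add_one_self) auto
  moreover have "norm Y * (1 + C / norm Y) = norm Y + C" using assms(2) by (simp add: field_simps)
  ultimately have "norm Y + C \<le> norm Y * exp (C / norm Y)" by simp
  from order_trans[OF this \<open>norm Y * exp (C / norm Y) \<le> C\<close>] show False using assms(2) by simp
qed

text \<open>For an imaginary eigenvalue the exponential factor has modulus 1, so
  \<open>Y + s *\<^sub>R W\<close> would be bounded in \<open>s\<close>, although it grows linearly
  unless \<open>W = 0\<close>.\<close>

lemma eigen_semisimple:
  assumes "A Y = cscale \<nu> Y + W" "A W = cscale \<nu> W"
  shows "W = 0"
proof (rule ccontr)
  assume W: "W \<noteq> 0"
  then have "Re \<nu> = 0" using eigenvalue_imaginary[OF assms(2)] by blast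
  then obtain C where C: "C > 0" "\<And>s. norm (Y + s *\<^sub>R W) \<le> C"
    using flow_lower_bound[OF assms] by auto
  define s where "s = (norm Y + C + 1) / norm W"
  have "norm (s *\<^sub>R W) = norm Y + C + 1" using W C by (simp add: s_def add_nonneg_nonneg)
  moreover have "norm (s *\<^sub>R W) \<le> norm (Y + s *\<^sub>R W) + norm Y"
    using norm_triangle_ineq4[of "Y + s *\<^sub>R W" Y] by simp
  ultimately show False using C(2)[of s] by simp
qed

definition "Eig = {Y. \<exists>\<nu>. A Y = cscale \<nu> Y}"

text \<open>\<open>A - z\<close> is invertible on eigenvectors whose eigenvalue differs from
  \<open>z\<close>, and it kills the others; so on the span of the eigenvectors range and kernel
  together exhaust everything. The preimage is found by dividing by
  \<open>\<nu> - z\<close>.\<close>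

lemma span_Eig_split:
  assumes "w \<in> span Eig"
  shows "\<exists>v\<in>span Eig. \<exists>y. A v - cscale z v = w - y \<and> A y = cscale z y"
  using assms
proof (induction w rule: span_induct_alt)
  case base
  show ?case using lA by (intro bexI[of _ 0] exI[of _ 0]) (auto simp: linear_0 span_zero)
next
  case (step c x y)
  then obtain v y0 where v: "v \<in> span Eig" "A v - cscale z v = y - y0" "A y0 = cscale z y0" by blast
  obtain \<nu> where l: "A x = cscale \<nu> x" using step by (auto simp: Eig_def)
  show ?case
  proof (cases "\<nu> = z")
    case True
    show ?thesis
      by (intro bexI[of _ v] exI[of _ "c *\<^sub>R x + y0"])
        (use v l True lA in \<open>auto simp: linear_add linear_cmul cscale_add cscale_scaleR\<close>)
  next
    case False
    define u where "u = cscale (c / (\<nu> - z)) x"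
    have u: "A u = cscale \<nu> u" by (simp add: u_def A_cscale l cscale_mult[symmetric] mult.commute)
    have "A u - cscale z u = cscale (\<nu> - z) u" by (simp add: u cscale_diff_left)
    also have "\<dots> = cscale ((\<nu> - z) * (c / (\<nu> - z))) x" unfolding u_def by (rule cscale_mult[symmetric])
    also have "\<dots> = c *\<^sub>R x" using False by (simp add: cscale_def)
    finally have "A u - cscale z u = c *\<^sub>R x" .
    moreover have "u \<in> span Eig" using u by (intro span_base) (auto simp: Eig_def)
    moreover have "A (u + v) - cscale z (u + v) = (A u - cscale z u) + (A v - cscale z v)"
      by (simp add: linear_add[OF lA] cscale_add)
    ultimately show ?thesis
      using v by (intro bexI[of _ "u + v"] exI[of _ y0]) (auto simp: span_add)
  qed
qed

text \<open>The polynomial \<open>p\<close> evaluated at \<open>A\<close> and applied to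
  \<open>v\<close>.\<close>

definition actp :: "complex poly \<Rightarrow> 'e \<Rightarrow> 'e" where
  "actp p v = (\<Sum>k\<le>degree p. cscale (coeff p k) ((A ^^ k) v))"

lemma actp_le:
  assumes "degree p \<le> n"
  shows "actp p v = (\<Sum>k\<le>n. cscale (coeff p k) ((A ^^ k) v))"
  unfolding actp_def using assms by (intro sum.mono_neutral_left) (auto simp: coeff_eq_0)

lemma linear_Apow: "linear (A ^^ k)"
proof (induction k)
  case 0
  then show ?case by (simp add: id_def linear_ident)
next
  case (Suc k)
  then show ?case using linear_compose[OF Suc lA] by (simp add: comp_def)
qed

lemma Apow_cscale: "(A ^^ k) (cscale z v) = cscale z ((A ^^ k) v)"
  by (induction k) (auto simp: A_cscale)

lemma actp_factor: "actp ([:- z, 1:] * q) v = actp q (A v - cscale z v)"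
proof -
  define n where "n = degree q"
  have dp: "degree ([:- z, 1:] * q) \<le> Suc n" using degree_mult_le[of "[:- z, 1:]" q] by (simp add: n_def)
  have "actp ([:- z, 1:] * q) v = (\<Sum>k\<le>Suc n. cscale (coeff (pCons 0 q) k - z * coeff q k) ((A ^^ k) v))"
    unfolding actp_le[OF dp] by (simp add: mult_pCons_left)
  also have "\<dots> = (\<Sum>k\<le>Suc n. cscale (coeff (pCons 0 q) k) ((A ^^ k) v)) - (\<Sum>k\<le>Suc n. cscale (z * coeff q k) ((A ^^ k) v))"
    by (simp only: cscale_diff_left sum_subtractf)
  also have "(\<Sum>k\<le>Suc n. cscale (coeff (pCons 0 q) k) ((A ^^ k) v)) = (\<Sum>k\<le>n. cscale (coeff q k) ((A ^^ Suc k) v))"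
    by (subst sum.atMost_Suc_shift) simp
  also have "(\<Sum>k\<le>Suc n. cscale (z * coeff q k) ((A ^^ k) v)) = (\<Sum>k\<le>n. cscale (coeff q k) ((A ^^ k) (cscale z v)))"
    by (simp add: n_def coeff_eq_0 Apow_cscale cscale_mult[symmetric] mult.commute)
  also have "(\<Sum>k\<le>n. cscale (coeff q k) ((A ^^ Suc k) v)) - (\<Sum>k\<le>n. cscale (coeff q k) ((A ^^ k) (cscale z v))) =
      (\<Sum>k\<le>n. cscale (coeff q k) ((A ^^ k) (A v - cscale z v)))"
    by (simp add: sum_subtractf[symmetric] cscale_diff[symmetric] linear_diff[OF linear_Apow] funpow_swap1)
  finally show ?thesis by (simp add: actp_def n_def)
qed

text \<open>Induction on the degree. A root \<open>z\<close> of \<open>p\<close> is split off; then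
  \<open>(A - z) v\<close> is in the span by induction and is matched, up to an element
  \<open>y\<close> of the kernel of \<open>A - z\<close>, by some \<open>u\<close> in the span. The
  remainder \<open>v - u\<close> satisfies \<open>(A - z) (v - u) = y\<close>, and semisimplicity
  forces \<open>y = 0\<close>.\<close>

lemma actp_zero_imp_span: "p \<noteq> 0 \<Longrightarrow> actp p v = 0 \<Longrightarrow> v \<in> span Eig"
proof (induction "degree p" arbitrary: p v)
  case 0
  then have "degree p = 0" by simp
  then obtain c where c: "p = [:c:]" by (rule degree_eq_zeroE)
  then have c0: "c \<noteq> 0" using "0.prems"(1) by auto
  have "cscale c v = 0" using "0.prems"(2) unfolding actp_def c by simp
  then have "v = 0" using cscale_inverse[OF c0, of v] by simp
  then show ?case by (simp add: span_zero)
next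
  case (Suc n)
  have "\<not> constant (poly p)" using Suc by (simp add: constant_degree)
  then obtain z where "poly p z = 0" using fundamental_theorem_of_algebra by blast
  then obtain q where q: "p = [:- z, 1:] * q" by (auto simp: poly_eq_0_iff_dvd)
  have q0: "q \<noteq> 0" using Suc q by auto
  have "degree p = degree [:- z, 1:] + degree q" unfolding q by (rule degree_mult_eq) (use q0 in auto)
  then have dq: "n = degree q" using Suc by simp
  have "actp q (A v - cscale z v) = 0" using Suc.prems q actp_factor by simp
  then have "A v - cscale z v \<in> span Eig" by (rule Suc.hyps(1)[OF dq q0])
  from span_Eig_split[OF this, of z] obtain u y where u: "u \<in> span Eig"
    "A u - cscale z u = (A v - cscale z v) - y" "A y = cscale z y" by blast
  have "A (v - u) = cscale z (v - u) + y" using u(2) by (simp add: linear_diff[OF lA] cscale_diff algebra_simps)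
  moreover from this have "y = 0" using eigen_semisimple u(3) by blast
  ultimately have "v - u \<in> Eig" by (auto simp: Eig_def)
  then have "u + (v - u) \<in> span Eig" by (rule span_add[OF u(1) span_base])
  then show ?case by simp
qed

text \<open>If two iterates of \<open>A\<close> on \<open>v\<close> coincide, the difference of two
  monomials works. Otherwise the iterates form an infinite set, which is linearly dependent, and
  injectivity of the iteration turns the dependence into polynomial coefficients.\<close>

lemma exists_annihilator: "\<exists>p. p \<noteq> 0 \<and> actp p v = 0"
proof (cases "inj (\<lambda>k. (A ^^ k) v)")
  case False
  then obtain m n where mn: "m \<noteq> n" "(A ^^ m) v = (A ^^ n) v" by (auto simp: inj_def)
  let ?p = "monom 1 m - monom (1::complex) n"
  have "coeff ?p m \<noteq> 0" using mn by simp
  then have "?p \<noteq> 0" by (metis coeff_0)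
  moreover have "degree ?p \<le> max m n" by (intro degree_diff_le_max[THEN order_trans]) (auto simp: degree_monom_eq)
  then have "actp ?p v = (\<Sum>k\<le>max m n. cscale (if k = m then 1 else 0) ((A ^^ k) v) - cscale (if k = n then 1 else 0) ((A ^^ k) v))"
    by (subst actp_le) (auto simp: cscale_diff_left intro!: sum.cong)
  then have "actp ?p v = 0" using mn
    by (simp add: sum_subtractf if_distrib[of "\<lambda>c. cscale c _"] cong: if_cong)
  ultimately show ?thesis by blast
next
  case True
  define S where "S = range (\<lambda>k. (A ^^ k) v)"
  have "infinite S" unfolding S_def using True finite_imageD by (metis infinite_UNIV_nat)
  obtain B :: "'e set" where B: "finite B" "span B = UNIV" using fd by (auto simp: findim_def)
  have "dependent S" using independent_span_bound[OF B(1), of S] B(2) \<open>infinite S\<close> by auto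
  then obtain t u w where t: "finite t" "t \<subseteq> S" "(\<Sum>v\<in>t. u v *\<^sub>R v) = 0" "w \<in> t" "u w \<noteq> 0"
    unfolding dependent_explicit by blast
  define K where "K = (\<lambda>k. (A ^^ k) v) -` t"
  have K: "finite K" unfolding K_def using t(1) True by (rule finite_vimageI)
  have im: "(\<lambda>k. (A ^^ k) v) ` K = t" using t(2) by (auto simp: K_def S_def)
  obtain m where m: "m \<in> K" "(A ^^ m) v = w" using im t(4) by blast
  define p where "p = (\<Sum>k\<in>K. monom (complex_of_real (u ((A ^^ k) v))) k)"
  have cp: "coeff p k = (if k \<in> K then complex_of_real (u ((A ^^ k) v)) else 0)" for k
    using K by (simp add: p_def coeff_sum if_distrib cong: if_cong)
  have "p \<noteq> 0" using cp[of m] m t(5) by auto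
  obtain n where n: "degree p \<le> n" "K \<subseteq> {..n}"
  proof -
    obtain n0 where "K \<subseteq> {..n0}" using K by (metis finite_nat_set_iff_bounded_le atMost_iff subsetI)
    then show ?thesis by (intro that[of "max n0 (degree p)"]) auto
  qed
  have "actp p v = (\<Sum>k\<in>K. u ((A ^^ k) v) *\<^sub>R (A ^^ k) v)"
  proof -
    have "actp p v = (\<Sum>k\<le>n. cscale (coeff p k) ((A ^^ k) v))" by (rule actp_le[OF n(1)])
    also have "\<dots> = (\<Sum>k\<in>K. cscale (coeff p k) ((A ^^ k) v))"
      using n(2) by (intro sum.mono_neutral_right) (auto simp: cp)
    finally show ?thesis by (simp add: cp cscale_def)
  qed
  also have "\<dots> = (\<Sum>v\<in>t. u v *\<^sub>R v)"
    unfolding im[symmetric] using True by (subst sum.reindex) (auto intro: inj_on_subset)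
  finally show ?thesis using \<open>p \<noteq> 0\<close> t(3) by auto
qed

lemma span_imaginary_eigenvectors: "span {Y. \<exists>\<theta>. A Y = \<theta> *\<^sub>R j Y} = UNIV"
proof -
  have "Eig \<subseteq> {Y. \<exists>\<theta>. A Y = \<theta> *\<^sub>R j Y}"
  proof
    fix Y assume "Y \<in> Eig"
    then obtain \<nu> where l: "A Y = cscale \<nu> Y" by (auto simp: Eig_def)
    show "Y \<in> {Y. \<exists>\<theta>. A Y = \<theta> *\<^sub>R j Y}"
    proof (cases "Y = 0")
      case True
      then show ?thesis using lA by (auto simp: linear_0 jD)
    next
      case False
      then have "Re \<nu> = 0" by (rule eigenvalue_imaginary[OF l])
      then show ?thesis using l by (auto simp: cscale_def)
    qed
  qed
  moreover have "v \<in> span Eig" for v using exists_annihilator actp_zero_imp_span by blast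
  ultimately show ?thesis using span_mono by blast
qed

end

section \<open>The adjoint action of the group and of its Lie algebra\<close>

context complex_lie
begin

definition Ad :: "'g \<Rightarrow> 'e \<Rightarrow> 'e" where "Ad = lie_Ad G A"

lemma Ad_tangent: "Ad g v = tangent_map A A (\<lambda>h. g \<otimes> h \<otimes> inv g) \<one> v"
  by (simp add: Ad_def lie_Ad_def)

lemma holomorphic_conj: "holomorphic_map j A j A (\<lambda>h. g \<otimes> h \<otimes> inv g)"
  by (rule holomorphic_map_compose[OF sA sA sA holomorphic_left holomorphic_right])

lemma smooth_conj: "smooth_map A A (\<lambda>h. g \<otimes> h \<otimes> inv g)"
  using holomorphic_conj by (simp add: holomorphic_map_def)

lemma linear_Ad: "linear (Ad g)"
  using tangent_map_linear[OF sA sA smooth_conj[of g], of \<one>] by (simp add: Ad_def lie_Ad_def)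

lemma Ad_j: "Ad g (j v) = j (Ad g v)"
  using holomorphic_conj by (simp add: holomorphic_map_def Ad_tangent)

lemma Ad_mult: "Ad (g \<otimes> k) v = Ad g (Ad k v)"
proof -
  have "(\<lambda>h. (g \<otimes> k) \<otimes> h \<otimes> inv (g \<otimes> k)) = (\<lambda>h. g \<otimes> (k \<otimes> h \<otimes> inv k) \<otimes> inv g)"
    by (simp add: inv_mult_group m_assoc)
  then show ?thesis
    using tangent_map_compose[OF sA sA sA smooth_conj[of k] smooth_conj[of g], of \<one> v]
    by (simp add: Ad_tangent)
qed

lemma Ad_one: "Ad \<one> v = v"
  by (simp add: Ad_tangent tangent_map_id[OF sA])

lemma Ad_inv: "Ad (inv g) (Ad g v) = v" "Ad g (Ad (inv g) v) = v"
  by (simp_all add: Ad_mult[symmetric] Ad_one)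

text \<open>A conjugated one-parameter subgroup is again one, with velocity \<open>Ad g v\<close>;
  uniqueness identifies it.\<close>

lemma conj_ex: "g \<otimes> ex v \<otimes> inv g = ex (Ad g v)"
proof -
  have "one_parameter_subgroup G A (Ad g v) (\<lambda>t. g \<otimes> ex (t *\<^sub>R v) \<otimes> inv g)"
    unfolding one_parameter_subgroup_def
  proof (intro conjI allI)
    show "smooth_map vector_atlas A (\<lambda>t. g \<otimes> ex (t *\<^sub>R v) \<otimes> inv g)"
      by (rule smooth_map_compose[OF sV sA sA smooth_ex_curve smooth_conj])
    show "g \<otimes> ex ((s + t) *\<^sub>R v) \<otimes> inv g = (g \<otimes> ex (s *\<^sub>R v) \<otimes> inv g) \<otimes> (g \<otimes> ex (t *\<^sub>R v) \<otimes> inv g)" for s t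
    proof -
      have "inv g \<otimes> (g \<otimes> x) = x" for x by (simp add: m_assoc[symmetric])
      then show ?thesis by (simp add: ex_add m_assoc)
    qed
    show "tangent_map vector_atlas A (\<lambda>t. g \<otimes> ex (t *\<^sub>R v) \<otimes> inv g) 0 1 = Ad g v"
      using tangent_map_compose[OF sV sA sA smooth_ex_curve[of v] smooth_conj[of g], of 0 1]
      by (simp add: Ad_tangent tangent_ex_curve ex_zero)
  qed
  from one_parameter_subgroup_eq_ex[OF this, of 1] show ?thesis by simp
qed

lemma ex_eq_imp_eq:
  assumes "\<And>s. ex (s *\<^sub>R a) = ex (s *\<^sub>R b)"
  shows "a = b"
proof -
  have "(\<lambda>s. ex (s *\<^sub>R a)) = (\<lambda>s. ex (s *\<^sub>R b))" by (rule ext) (rule assms)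
  then show ?thesis using tangent_ex_curve[of a] tangent_ex_curve[of b] by metis
qed

lemma conj_ex_scale: "g \<otimes> ex (s *\<^sub>R v) \<otimes> inv g = ex (s *\<^sub>R Ad g v)"
  using conj_ex[of g "s *\<^sub>R v"] linear_Ad[of g] by (simp add: linear_cmul)

lemma commute_iff_conj: "g \<otimes> h = h \<otimes> g \<longleftrightarrow> g \<otimes> h \<otimes> inv g = h"
proof
  assume "g \<otimes> h = h \<otimes> g"
  then show "g \<otimes> h \<otimes> inv g = h" by (simp add: m_assoc)
next
  assume "g \<otimes> h \<otimes> inv g = h"
  then have "g \<otimes> h \<otimes> inv g \<otimes> g = h \<otimes> g" by simp
  then show "g \<otimes> h = h \<otimes> g" by (simp add: m_assoc)
qed

lemma Ad_fix_iff: "Ad g a = a \<longleftrightarrow> (\<forall>s. g \<otimes> ex (s *\<^sub>R a) = ex (s *\<^sub>R a) \<otimes> g)"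
  by (auto simp: commute_iff_conj conj_ex_scale intro: ex_eq_imp_eq)

text \<open>Conjugation \<open>(g, h) \<mapsto> g h g\<inverse>\<close> in coordinates, with domain
  \<open>N\<close>. Its derivative in the second variable is \<open>Ad\<close>, and its mixed second
  derivative at the origin is the Lie bracket.\<close>

definition "\<Psi> z = \<kappa> (br (fst z) \<otimes> br (snd z) \<otimes> inv (br (fst z)))"
definition "N = (\<Omega> \<times> \<Omega>) \<inter> (\<lambda>z. br (fst z) \<otimes> br (snd z) \<otimes> inv (br (fst z))) -` fst c0"

lemma smooth_into_conj2: "smooth_into (\<Omega> \<times> \<Omega>) A (\<lambda>z. br (fst z) \<otimes> br (snd z) \<otimes> inv (br (fst z)))"
  by (intro smooth_into_mult smooth_into_prod smooth_into_compose[OF sA sA _ smooth_inv]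
      smooth_into_precompose[OF sA smooth_into_br fdE] open_Times open_Omega smooth_on_fst) auto

lemma open_N: "open N" unfolding N_def by (rule open_kappa_vimage[OF smooth_into_conj2])
lemma smooth_Psi: "smooth_on N \<Psi>"
  unfolding \<Psi>_def[abs_def] by (rule smooth_on_kappa[OF smooth_into_conj2 open_N]) (simp add: N_def)
lemma N_left: "x \<in> \<Omega> \<Longrightarrow> (x, 0) \<in> N" by (simp add: N_def zero_Omega br_zero c0)

lemma chart_line_derivative:
  assumes f: "smooth_map A A f" and x: "x \<in> \<Omega>" and fx: "f (br x) \<in> fst c0"
  shows "((\<lambda>t. \<kappa> (f (br (x + t *\<^sub>R v)))) has_vector_derivative chart_deriv c0 c0 f (br x) v) (at 0)"
proof -
  have d: "((snd c0 \<circ> f \<circ> chart_inv c0) has_derivative chart_deriv c0 c0 f (br x)) (at (snd c0 (br x)))"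
    by (rule chart_deriv[OF f c0(1) c0(1) br_chart[OF x] fx])
  have "snd c0 (br x) = x0 + x" using kappa_br[OF x] by (simp add: \<kappa>_def diff_eq_eq add.commute)
  with d have "((snd c0 \<circ> f \<circ> chart_inv c0) has_derivative chart_deriv c0 c0 f (br x)) (at ((x0 + x) + 0 *\<^sub>R v))"
    by simp
  then have "((\<lambda>t. (snd c0 \<circ> f \<circ> chart_inv c0) ((x0 + x) + t *\<^sub>R v)) has_vector_derivative
      chart_deriv c0 c0 f (br x) v) (at 0)"
    by (rule has_vector_derivative_line)
  from has_vector_derivative_diff[OF this has_vector_derivative_const[of x0]]
  show ?thesis by (simp add: \<kappa>_def br_def add.assoc)
qed

lemma frechet_Psi_line:
  assumes "z \<in> N"
  shows "((\<lambda>t. \<Psi> (z + t *\<^sub>R w)) has_vector_derivative frechet_derivative \<Psi> (at z) w) (at 0)"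
proof -
  have "(\<Psi> has_derivative frechet_derivative \<Psi> (at z)) (at (z + 0 *\<^sub>R w))"
    using smooth_on_has_derivative[OF smooth_Psi assms] by simp
  then show ?thesis by (rule has_vector_derivative_line)
qed

lemma Ad_br: "x \<in> \<Omega> \<Longrightarrow> Ad (br x) v = frechet_derivative \<Psi> (at (x, 0)) (0, v)"
proof -
  assume x: "x \<in> \<Omega>"
  have "((\<lambda>t. \<kappa> (br x \<otimes> br (0 + t *\<^sub>R v) \<otimes> inv (br x))) has_vector_derivative
      chart_deriv c0 c0 (\<lambda>h. br x \<otimes> h \<otimes> inv (br x)) (br 0) v) (at 0)"
    by (rule chart_line_derivative[OF smooth_conj zero_Omega]) (simp add: br_zero c0)
  moreover have "chart_deriv c0 c0 (\<lambda>h. br x \<otimes> h \<otimes> inv (br x)) (br 0) v = Ad (br x) v"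
    by (simp add: Ad_tangent tangent_map_chart_deriv c0_def br_zero)
  moreover have "((\<lambda>t. \<kappa> (br x \<otimes> br (0 + t *\<^sub>R v) \<otimes> inv (br x))) has_vector_derivative
      frechet_derivative \<Psi> (at (x, 0)) (0, v)) (at 0)"
    using frechet_Psi_line[OF N_left[OF x], of "(0, v)"] by (simp add: \<Psi>_def)
  ultimately show ?thesis using vector_derivative_unique_at by metis
qed

lemma holomorphic_mult2:
  assumes "holomorphic_map j A j A f" "holomorphic_map j A j A g"
  shows "holomorphic_map j A j A (\<lambda>p. f p \<otimes> g p)"
proof -
  have f: "smooth_map A A f" and g: "smooth_map A A g" using assms by (simp_all add: holomorphic_map_def)
  have jl: "linear j" using complex_structureD(1)[OF cs] .
  show ?thesis
    unfolding holomorphic_map_def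
  proof (intro conjI allI)
    show "smooth_map A A (\<lambda>p. f p \<otimes> g p)" by (rule smooth_map_mult[OF sA f g])
    fix p v
    show "tangent_map A A (\<lambda>p. f p \<otimes> g p) p (j v) = j (tangent_map A A (\<lambda>p. f p \<otimes> g p) p v)"
      unfolding tangent_map_mult[OF sA f g]
      using assms holomorphic_left holomorphic_right linear_add[OF jl] by (simp add: holomorphic_map_def)
  qed
qed

lemma holomorphic_inv: "holomorphic_map j A j A (\<lambda>g. inv g)"
  using clg by (simp add: complex_lie_group_def)

text \<open>For fixed \<open>h\<close> the map \<open>g \<mapsto> g h g\<inverse>\<close> is
  holomorphic, being built from multiplication and inversion.\<close>

lemma frechet_Psi_j:
  assumes z: "z \<in> N"
  shows "frechet_derivative \<Psi> (at z) (j \<xi>, 0) = j (frechet_derivative \<Psi> (at z) (\<xi>, 0))"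
proof -
  obtain x y where xy: "z = (x, y)" by (cases z)
  let ?f = "\<lambda>g. g \<otimes> br y \<otimes> inv g"
  have h: "holomorphic_map j A j A ?f"
    by (rule holomorphic_mult2[OF holomorphic_right holomorphic_inv])
  have x: "x \<in> \<Omega>" and fx: "?f (br x) \<in> fst c0" using z by (auto simp: xy N_def)
  have "frechet_derivative \<Psi> (at z) (v, 0) = chart_deriv c0 c0 ?f (br x) v" for v
  proof -
    have "((\<lambda>t. \<kappa> (?f (br (x + t *\<^sub>R v)))) has_vector_derivative chart_deriv c0 c0 ?f (br x) v) (at 0)"
      by (rule chart_line_derivative[where f = ?f]) (use h x fx in \<open>simp_all add: holomorphic_map_def\<close>)
    moreover have "((\<lambda>t. \<kappa> (?f (br (x + t *\<^sub>R v)))) has_vector_derivative frechet_derivative \<Psi> (at z) (v, 0)) (at 0)"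
      using frechet_Psi_line[OF z, of "(v, 0)"] by (simp add: \<Psi>_def xy)
    ultimately show ?thesis by (rule vector_derivative_unique_at[symmetric])
  qed
  then show ?thesis using holomorphic_chart_deriv[OF cA cA h c0(1) c0(1) br_chart[OF x] fx] by simp
qed

text \<open>The operator \<open>ad \<xi>\<close>, as a mixed second derivative. Compared with the
  derivative of \<open>Ad\<close> along an exponential curve, this form leaves the order of
  differentiation free.\<close>

definition adj :: "'e \<Rightarrow> 'e \<Rightarrow> 'e" where
  "adj \<xi> v = frechet_derivative (\<lambda>z. frechet_derivative \<Psi> (at z) (0, v)) (at (0, 0)) (\<xi>, 0)"

lemma adj_swap: "adj \<xi> v = frechet_derivative (\<lambda>z. frechet_derivative \<Psi> (at z) (\<xi>, 0)) (at (0, 0)) (0, v)"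
  unfolding adj_def by (rule symmetric_second_derivative[OF open_N smooth_Psi N_left[OF zero_Omega]])

text \<open>Complex linearity in the first argument becomes visible after exchanging the two
  derivatives: the derivative of \<open>\<Psi>\<close> in the first variable commutes with
  \<open>j\<close> at every point of \<open>N\<close>, and \<open>j\<close> may be pulled out of the
  remaining derivative. This relates the real part of the eigenvalue problem for
  \<open>j \<eta>\<close> to the imaginary one for \<open>\<eta>\<close>.\<close>

lemma adj_j: "adj (j \<xi>) v = j (adj \<xi> v)"
proof -
  have bl: "bounded_linear j" by (rule linear_findim_bounded_linear[OF fdE complex_structureD(1)[OF cs]])
  have 0: "(0, 0) \<in> N" by (rule N_left[OF zero_Omega])
  have d: "((\<lambda>z. frechet_derivative \<Psi> (at z) (\<xi>, 0)) has_derivative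
      frechet_derivative (\<lambda>z. frechet_derivative \<Psi> (at z) (\<xi>, 0)) (at (0, 0))) (at (0, 0))"
    by (rule smooth_on_has_derivative[OF smooth_on_frechet[OF smooth_Psi] 0])
  have "adj (j \<xi>) v = frechet_derivative (\<lambda>z. j (frechet_derivative \<Psi> (at z) (\<xi>, 0))) (at (0, 0)) (0, v)"
    unfolding adj_swap
    by (rule fun_cong[OF frechet_derivative_cong_open[OF open_N 0]]) (rule frechet_Psi_j)
  also have "\<dots> = j (adj \<xi> v)"
    unfolding adj_swap frechet_derivative_eqI[OF bounded_linear.has_derivative[OF bl d]] ..
  finally show ?thesis .
qed

lemma Ad_ex_derivative_0: "((\<lambda>s. Ad (ex (s *\<^sub>R \<xi>)) v) has_vector_derivative adj \<xi> v) (at 0)"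
proof -
  obtain \<delta> y where d: "\<delta> > 0" and yO: "\<And>t. t \<in> ball 0 \<delta> \<Longrightarrow> y t \<in> \<Omega>"
    and exy: "\<And>t. t \<in> ball 0 \<delta> \<Longrightarrow> ex (t *\<^sub>R \<xi>) = br (y t)" and der: "(y has_vector_derivative \<xi>) (at 0)"
    by (rule exp_curve_local[of \<xi>]) blast
  have b0: "(0::real) \<in> ball 0 \<delta>" using d by simp
  have "br (y 0) = \<one>" using exy[OF b0] by (simp add: ex_zero)
  then have y0: "y 0 = 0" using kappa_br[OF yO[OF b0]] by (simp add: kappa_one)
  let ?Q = "\<lambda>z. frechet_derivative \<Psi> (at z) (0, v)"
  have "((\<lambda>s. (y s, 0::'e)) has_derivative (\<lambda>h. (h *\<^sub>R \<xi>, 0))) (at 0)"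
    by (rule has_derivative_Pair[OF der[unfolded has_vector_derivative_def] has_derivative_const])
  moreover have "(?Q has_derivative frechet_derivative ?Q (at (0, 0))) (at (y 0, 0))"
    unfolding y0 by (rule smooth_on_has_derivative[OF smooth_on_frechet[OF smooth_Psi] N_left[OF zero_Omega]])
  ultimately have d1: "((\<lambda>s. ?Q (y s, 0)) has_derivative (\<lambda>h. frechet_derivative ?Q (at (0, 0)) (h *\<^sub>R \<xi>, 0))) (at 0)"
    by (rule has_derivative_compose)
  have "linear (frechet_derivative ?Q (at (0, 0)))"
    by (rule linear_frechet_derivative[OF smooth_on_differentiable[OF smooth_on_frechet[OF smooth_Psi] N_left[OF zero_Omega]]])
  then have "frechet_derivative ?Q (at (0, 0)) (h *\<^sub>R \<xi>, 0) = h *\<^sub>R adj \<xi> v" for h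
    using linear_cmul[of "frechet_derivative ?Q (at (0, 0))" h "(\<xi>, 0)"] by (simp add: adj_def)
  with d1 have "((\<lambda>s. ?Q (y s, 0)) has_vector_derivative adj \<xi> v) (at 0)"
    by (simp add: has_vector_derivative_def)
  then show ?thesis
    unfolding has_vector_derivative_def
  proof (rule has_derivative_transform_within_open[of _ _ _ _ "ball 0 \<delta>"])
    fix s :: real assume "s \<in> ball 0 \<delta>"
    then show "?Q (y s, 0) = Ad (ex (s *\<^sub>R \<xi>)) v" using exy Ad_br[OF yO] by simp
  qed (use d in auto)
qed

lemma bounded_linear_Ad: "bounded_linear (Ad g)"
  by (rule linear_findim_bounded_linear[OF fdE linear_Ad])

lemma has_vector_derivative_shift:
  assumes "((\<lambda>h. f (s + h)) has_vector_derivative d) (at 0)"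
  shows "(f has_vector_derivative d) (at (s::real))"
proof -
  have "((\<lambda>t. t - s) has_derivative (\<lambda>h. h)) (at s)" by (auto intro!: derivative_eq_intros)
  from has_derivative_compose[OF this, of "\<lambda>h. f (s + h)" "\<lambda>h. h *\<^sub>R d"] assms
  show ?thesis by (simp add: has_vector_derivative_def)
qed

lemma Ad_ex_derivative: "((\<lambda>s. Ad (ex (s *\<^sub>R \<xi>)) v) has_vector_derivative Ad (ex (s *\<^sub>R \<xi>)) (adj \<xi> v)) (at s)"
proof (rule has_vector_derivative_shift)
  have "((\<lambda>h. Ad (ex (s *\<^sub>R \<xi>)) (Ad (ex (h *\<^sub>R \<xi>)) v)) has_vector_derivative Ad (ex (s *\<^sub>R \<xi>)) (adj \<xi> v)) (at 0)"
    by (rule bounded_linear.has_vector_derivative[OF bounded_linear_Ad Ad_ex_derivative_0])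
  then show "((\<lambda>h. Ad (ex ((s + h) *\<^sub>R \<xi>)) v) has_vector_derivative Ad (ex (s *\<^sub>R \<xi>)) (adj \<xi> v)) (at 0)"
    by (simp add: ex_add Ad_mult)
qed

lemma adj_eqI: "((\<lambda>s. Ad (ex (s *\<^sub>R \<xi>)) v) has_vector_derivative d) (at 0) \<Longrightarrow> adj \<xi> v = d"
  using Ad_ex_derivative_0 vector_derivative_unique_at by blast

lemma linear_adj: "linear (adj \<xi>)"
proof (rule linearI)
  fix u v c
  show "adj \<xi> (u + v) = adj \<xi> u + adj \<xi> v"
    by (rule adj_eqI) (use has_vector_derivative_add[OF Ad_ex_derivative_0 Ad_ex_derivative_0, of \<xi> u \<xi> v]
        in \<open>simp add: linear_add[OF linear_Ad]\<close>)
  show "adj \<xi> (c *\<^sub>R v) = c *\<^sub>R adj \<xi> v"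
    by (rule adj_eqI) (use bounded_linear.has_vector_derivative[OF bounded_linear_scaleR_right[of c] Ad_ex_derivative_0, of \<xi> v]
        in \<open>simp add: linear_cmul[OF linear_Ad]\<close>)
qed

lemma adj_right_j: "adj \<xi> (j v) = j (adj \<xi> v)"
proof (rule adj_eqI)
  have bl: "bounded_linear j" by (rule linear_findim_bounded_linear[OF fdE complex_structureD(1)[OF cs]])
  show "((\<lambda>s. Ad (ex (s *\<^sub>R \<xi>)) (j v)) has_vector_derivative j (adj \<xi> v)) (at 0)"
    unfolding Ad_j by (rule bounded_linear.has_vector_derivative[OF bl Ad_ex_derivative_0])
qed

text \<open>The curve multiplied by \<open>exp (- c * s)\<close> has derivative zero.\<close>

lemma Ad_ex_eigenvector:
  assumes "adj \<xi> v = c *\<^sub>R v"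
  shows "Ad (ex (s *\<^sub>R \<xi>)) v = exp (c * s) *\<^sub>R v"
proof -
  define f where "f = (\<lambda>s. exp (- c * s) *\<^sub>R Ad (ex (s *\<^sub>R \<xi>)) v)"
  have "(f has_vector_derivative 0) (at s)" for s
  proof -
    have "((\<lambda>s. exp (- c * s)) has_field_derivative (- c * exp (- c * s))) (at s)"
      by (auto intro!: derivative_eq_intros)
    from has_vector_derivative_scaleR[OF this Ad_ex_derivative[of \<xi> v s]]
    show ?thesis unfolding f_def assms linear_cmul[OF linear_Ad] by (simp add: algebra_simps)
  qed
  then have "\<exists>c. \<forall>x\<in>UNIV. f x = c"
    by (intro has_derivative_zero_constant) (auto simp: has_vector_derivative_def)
  then have "f s = f 0" by auto
  then have "exp (c * s) *\<^sub>R f s = exp (c * s) *\<^sub>R v" by (simp add: f_def ex_zero Ad_one)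
  then show ?thesis by (simp add: f_def exp_add[symmetric])
qed

text \<open>Near the unit \<open>Ad\<close> is a derivative of the smooth map \<open>\<Psi>\<close>;
  left translation by \<open>g\<close> moves continuity to any other point.\<close>

lemma isCont_Ad: "isCont (\<lambda>g. Ad g v) g"
proof -
  let ?Q = "\<lambda>z. frechet_derivative \<Psi> (at z) (0, v)"
  have c: "isCont ?Q (0, 0)"
    using smooth_on_continuous[OF smooth_on_frechet[OF smooth_Psi]] N_left[OF zero_Omega] open_N
    by (simp add: continuous_on_eq_continuous_at)
  have k: "isCont \<kappa> \<one>"
  proof -
    have "isCont (snd c0) \<one>" using c0D(1,3) c0(2) by (simp add: continuous_on_eq_continuous_at)
    then show ?thesis unfolding \<kappa>_def[abs_def] by (intro continuous_intros)
  qed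
  have l: "((\<lambda>h. inv g \<otimes> h) \<longlongrightarrow> \<one>) (at g)"
    using tendsto_mult_group[OF tendsto_const tendsto_ident_at, of "inv g" g UNIV] by simp
  have "((\<lambda>h. (\<kappa> (inv g \<otimes> h), 0::'e)) \<longlongrightarrow> (\<kappa> \<one>, 0)) (at g)"
    by (intro tendsto_Pair tendsto_const isCont_tendsto_compose[OF k l])
  then have "((\<lambda>h. ?Q (\<kappa> (inv g \<otimes> h), 0)) \<longlongrightarrow> ?Q (0, 0)) (at g)"
    unfolding kappa_one by (rule isCont_tendsto_compose[OF c])
  moreover have "\<forall>\<^sub>F h in at g. ?Q (\<kappa> (inv g \<otimes> h), 0) = Ad (inv g \<otimes> h) v"
    using topological_tendstoD[OF l c0D(1) c0(2)]
    by eventually_elim (metis Ad_br br_kappa kappa_Omega)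
  ultimately have "((\<lambda>h. Ad (inv g \<otimes> h) v) \<longlongrightarrow> ?Q (0, 0)) (at g)" by (rule Lim_transform_eventually)
  then have "((\<lambda>h. Ad g (Ad (inv g \<otimes> h) v)) \<longlongrightarrow> Ad g (?Q (0, 0))) (at g)"
    by (rule bounded_linear.tendsto[OF bounded_linear_Ad])
  moreover have "?Q (0, 0) = v" using Ad_br[OF zero_Omega, of v] by (simp add: br_zero Ad_one)
  moreover have "Ad g (Ad (inv g \<otimes> h) v) = Ad h v" for h by (simp add: Ad_mult Ad_inv)
  ultimately show ?thesis by (simp add: isCont_def)
qed

lemma compact_Ad_bounded:
  assumes "compact U"
  shows "bounded ((\<lambda>g. Ad g v) ` U)"
  by (intro compact_imp_bounded compact_continuous_image assms continuous_at_imp_continuous_on ballI isCont_Ad)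

end

section \<open>Parabolic subgroups\<close>

lemma clopen_eq_UNIV:
  assumes "connected (UNIV :: 'a::topological_space set)" "open S" "open (- S)" "x \<in> S"
  shows "S = (UNIV :: 'a set)"
  using connectedD[OF assms(1-3)] assms(4) by auto

section \<open>Products of exponentials near the unit\<close>

context complex_lie
begin

definition exprod :: "('e \<Rightarrow> real) \<Rightarrow> 'e list \<Rightarrow> 'g" where
  "exprod a xs = foldr (\<lambda>x g. ex (a x *\<^sub>R x) \<otimes> g) xs \<one>"

lemma exprod_simps [simp]: "exprod a [] = \<one>" "exprod a (x # xs) = ex (a x *\<^sub>R x) \<otimes> exprod a xs"
  by (simp_all add: exprod_def)

lemma exprod_append: "exprod a (xs @ ys) = exprod a xs \<otimes> exprod a ys"
  by (induction xs) (auto simp: m_assoc)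

lemma exprod_zero: "exprod (\<lambda>x. 0) xs = \<one>"
  by (induction xs) (auto simp: ex_zero)

lemma exprod_in:
  assumes "\<one> \<in> H" "\<And>g h. g \<in> H \<Longrightarrow> h \<in> H \<Longrightarrow> g \<otimes> h \<in> H" "\<And>x c. x \<in> set xs \<Longrightarrow> ex (c *\<^sub>R x) \<in> H"
  shows "exprod a xs \<in> H"
  using assms(3) by (induction xs) (auto simp: assms(1,2))

lemma exprod_curve:
  "smooth_map vector_atlas A (\<lambda>t. exprod (\<lambda>x. t * r x) xs) \<and>
    tangent_map vector_atlas A (\<lambda>t. exprod (\<lambda>x. t * r x) xs) 0 1 = (\<Sum>x\<leftarrow>xs. r x *\<^sub>R x)"
proof (induction xs)
  case Nil
  show ?case by (simp add: smooth_map_const tangent_map_const)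
next
  case (Cons x xs)
  have s: "smooth_map vector_atlas A (\<lambda>t. ex ((t * r x) *\<^sub>R x))" "tangent_map vector_atlas A (\<lambda>t. ex ((t * r x) *\<^sub>R x)) 0 1 = r x *\<^sub>R x"
    using smooth_ex_curve[of "r x *\<^sub>R x"] tangent_ex_curve[of "r x *\<^sub>R x"] by simp_all
  show ?case
    using smooth_map_mult[OF sV s(1) conjunct1[OF Cons]] Cons s
    by (simp add: tangent_map_mult[OF sV s(1) conjunct1[OF Cons]] exprod_zero ex_zero tangent_map_id[OF sA])
qed

lemma smooth_into_exprod:
  assumes "\<And>x. bounded_linear (\<lambda>v. r v x)"
  shows "smooth_into UNIV A (\<lambda>v. exprod (r v) xs)"
proof (induction xs)
  case Nil
  show ?case by (simp add: smooth_into_const)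
next
  case (Cons x xs)
  have "smooth_into UNIV A (\<lambda>t. ex (t *\<^sub>R x))" using smooth_ex_curve by (simp add: smooth_into_vector)
  then have "smooth_into UNIV A (\<lambda>v. ex (r v x *\<^sub>R x))"
    by (rule smooth_into_precompose[OF sA _ findim_real open_UNIV smooth_on_linear[OF assms]]) simp
  from smooth_into_mult[OF this Cons] show ?case by simp
qed

text \<open>Canonical coordinates of the second kind. Velocities of factors add at the unit, so in
  the basis \<open>B\<close> the derivative of the product map at 0 is the identity, and local
  surjectivity applies.\<close>

lemma exprod_neighbourhood:
  assumes B: "finite B" "independent B" "span B = UNIV" and xs: "distinct xs" "set xs = B"
  obtains V where "open V" "\<one> \<in> V" "\<And>g. g \<in> V \<Longrightarrow> \<exists>a. g = exprod a xs"
proof -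
  define F where "F = (\<lambda>v. exprod (representation B v) xs)"
  have sF: "smooth_into UNIV A F" unfolding F_def
    by (rule smooth_into_exprod[OF representation_bounded_linear[OF B]])
  have F0: "F 0 = \<one>"
  proof -
    have "representation B 0 = (\<lambda>x. 0)" by (rule representation_zero)
    then show ?thesis by (simp add: F_def exprod_zero)
  qed
  define T where "T = F -` fst c0"
  define f where "f = (\<lambda>v. \<kappa> (F v))"
  have T: "open T" using open_kappa_vimage[OF sF] by (simp add: T_def)
  have sf: "smooth_on T f" unfolding f_def by (rule smooth_on_kappa[OF sF T]) (simp add: T_def)
  have T0: "0 \<in> T" using F0 c0 by (simp add: T_def)
  have id: "frechet_derivative f (at 0) v = v" for v
  proof -
    have "(f has_derivative frechet_derivative f (at 0)) (at (0 + 0 *\<^sub>R v))"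
      using smooth_on_has_derivative[OF sf T0] by simp
    then have 1: "((\<lambda>t. f (0 + t *\<^sub>R v)) has_vector_derivative frechet_derivative f (at 0) v) (at 0)"
      by (rule has_vector_derivative_line)
    let ?c = "\<lambda>t. exprod (\<lambda>x. t * representation B v x) xs"
    have cF: "?c = (\<lambda>t. F (t *\<^sub>R v))"
      using B by (simp add: F_def representation_scale fun_eq_iff)
    have "(\<Sum>x\<leftarrow>xs. representation B v x *\<^sub>R x) = (\<Sum>x\<in>B. representation B v x *\<^sub>R x)"
      using xs by (simp add: sum_list_distinct_conv_sum_set)
    also have "\<dots> = v" using sum_representation_eq[OF B(2), of v B] B by auto
    finally have t: "tangent_map vector_atlas A ?c 0 1 = v" and s: "smooth_map vector_atlas A ?c"
      using exprod_curve[of "representation B v" xs] by simp_all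
    have c0': "?c 0 = \<one>" by (simp add: exprod_zero)
    have d: "((\<lambda>t. snd c0 (?c t)) has_derivative chart_deriv (UNIV, \<lambda>x. x) c0 ?c 0) (at 0)"
      using chart_deriv[OF s, of "(UNIV, \<lambda>x. x)" c0 0] c0
      by (simp add: vector_atlas_mem comp_def exprod_zero)
    have D1: "chart_deriv (UNIV, \<lambda>x. x) c0 ?c 0 1 = v"
      using t c0' by (simp add: tangent_map_chart_deriv c0_def)
    have "chart_deriv (UNIV, \<lambda>x. x) c0 ?c 0 = (\<lambda>h. h *\<^sub>R v)"
    proof
      fix h :: real
      show "chart_deriv (UNIV, \<lambda>x. x) c0 ?c 0 h = h *\<^sub>R v"
        using linear_cmul[OF has_derivative_linear[OF d], of h 1] unfolding D1 by simp
    qed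
    with d have "((\<lambda>t. snd c0 (?c t)) has_vector_derivative v) (at 0)"
      by (simp add: has_vector_derivative_def)
    from has_vector_derivative_diff[OF this has_vector_derivative_const[of x0]]
    have "((\<lambda>t. f (0 + t *\<^sub>R v)) has_vector_derivative v) (at 0)"
      by (simp add: f_def \<kappa>_def cF[symmetric, THEN fun_cong])
    from vector_derivative_unique_at[OF 1 this] show ?thesis .
  qed
  have f0: "f 0 = 0" by (simp add: f_def F0 kappa_one)
  obtain d where d: "d > 0" "ball 0 d \<subseteq> f ` T"
    using local_surjectivity[OF fdE T sf T0 id] unfolding f0 by blast
  have kc: "continuous_on (fst c0) \<kappa>" unfolding \<kappa>_def[abs_def] by (intro continuous_intros c0D(3))
  show ?thesis
  proof (rule that)
    show "open (fst c0 \<inter> \<kappa> -` ball 0 d)" by (rule continuous_open_preimage[OF kc c0D(1) open_ball])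
    show "\<one> \<in> fst c0 \<inter> \<kappa> -` ball 0 d" using c0 d by (simp add: kappa_one)
    fix g assume g: "g \<in> fst c0 \<inter> \<kappa> -` ball 0 d"
    then obtain v where v: "v \<in> T" "\<kappa> g = f v" using d by auto
    then have "br (\<kappa> g) = br (\<kappa> (F v))" by (simp add: f_def)
    then have "g = F v" using g v(1) by (simp add: br_kappa T_def)
    then show "\<exists>a. g = exprod a xs" unfolding F_def by blast
  qed
qed

text \<open>A basis is chosen inside \<open>S \<union> T\<close> and listed with its elements of
  \<open>S\<close> in front. In the ordered product of exponentials the front part then lies in
  \<open>H\<close> and the rest in \<open>K\<close>.\<close>

lemma factor_neighbourhood:
  assumes sp: "span (S \<union> T) = UNIV"
    and H: "\<one> \<in> H" "\<And>g h. g \<in> H \<Longrightarrow> h \<in> H \<Longrightarrow> g \<otimes> h \<in> H" "\<And>x c. x \<in> S \<Longrightarrow> ex (c *\<^sub>R x) \<in> H"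
    and K: "\<one> \<in> K" "\<And>g h. g \<in> K \<Longrightarrow> h \<in> K \<Longrightarrow> g \<otimes> h \<in> K" "\<And>x c. x \<in> T \<Longrightarrow> ex (c *\<^sub>R x) \<in> K"
  obtains V where "open V" "\<one> \<in> V" "\<And>g. g \<in> V \<Longrightarrow> \<exists>h\<in>H. \<exists>k\<in>K. g = h \<otimes> k"
proof -
  obtain C :: "'e set" where C: "finite C" "span C = UNIV" using fdE by (auto simp: findim_def)
  obtain B where B: "B \<subseteq> S \<union> T" "independent B" "S \<union> T \<subseteq> span B"
    using maximal_independent_subset[of "S \<union> T"] by blast
  have spB: "span B = UNIV" using B sp by (metis span_mono span_span top.extremum_uniqueI)
  have fB: "finite B" using independent_span_bound[OF C(1) B(2)] C(2) by auto
  obtain xs where xs: "distinct xs" "set xs = B \<inter> S" using finite_distinct_list[of "B \<inter> S"] fB by auto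
  obtain ys where ys: "distinct ys" "set ys = B - S" using finite_distinct_list[of "B - S"] fB by auto
  have xy: "distinct (xs @ ys)" "set (xs @ ys) = B" using xs ys by auto
  obtain V where V: "open V" "\<one> \<in> V" "\<And>g. g \<in> V \<Longrightarrow> \<exists>a. g = exprod a (xs @ ys)"
    using exprod_neighbourhood[OF fB B(2) spB xy] by blast
  show ?thesis
  proof (rule that[OF V(1,2)])
    fix g assume "g \<in> V"
    then obtain a where a: "g = exprod a xs \<otimes> exprod a ys" using V(3) exprod_append by metis
    have "exprod a xs \<in> H" by (rule exprod_in[OF H(1,2)]) (use xs H(3) in auto)
    moreover have "exprod a ys \<in> K" by (rule exprod_in[OF K(1,2)]) (use ys K(3) B(1) in auto)
    ultimately show "\<exists>h\<in>H. \<exists>k\<in>K. g = h \<otimes> k" using a by blast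
  qed
qed

lemma open_translate_left: "open V \<Longrightarrow> open {h. inv g \<otimes> h \<in> V}"
  using smooth_map_open_vimage[OF smooth_left[of "inv g"]] by (simp add: vimage_def)

text \<open>Finite products of exponentials form a subgroup containing a neighbourhood of the unit;
  such a subgroup is open together with its complement.\<close>

lemma connected_generated:
  assumes conn: "connected (UNIV :: 'g set)"
  shows "\<exists>xs. g = exprod (\<lambda>x. 1) xs"
proof -
  let ?H = "{g. \<exists>xs. g = exprod (\<lambda>x. 1) xs}"
  have H1: "\<one> \<in> ?H" by (rule CollectI, rule exI[of _ "[]"]) simp
  have Hm: "g \<otimes> h \<in> ?H" if gh: "g \<in> ?H" "h \<in> ?H" for g h
  proof -
    from gh obtain xs ys where "g = exprod (\<lambda>x. 1) xs" "h = exprod (\<lambda>x. 1) ys" by blast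
    then have "g \<otimes> h = exprod (\<lambda>x. 1) (xs @ ys)" by (simp only: exprod_append)
    then show ?thesis by blast
  qed
  have Hx: "ex (c *\<^sub>R x) \<in> ?H" for c x
    by (rule CollectI, rule exI[of _ "[c *\<^sub>R x]"]) simp
  obtain V where V: "open V" "\<one> \<in> V" "\<And>g. g \<in> V \<Longrightarrow> \<exists>h\<in>?H. \<exists>k\<in>?H. g = h \<otimes> k"
    using factor_neighbourhood[of UNIV UNIV ?H ?H] H1 Hm Hx by auto
  have VH: "V \<subseteq> ?H" using V(3) Hm by blast
  have op: "open {h. inv g \<otimes> h \<in> V}" for g by (rule open_translate_left[OF V(1)])
  have cl: "open ?H"
  proof (subst open_subopen, intro ballI)
    fix g assume g: "g \<in> ?H"
    have "{h. inv g \<otimes> h \<in> V} \<subseteq> ?H"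
    proof
      fix h assume "h \<in> {h. inv g \<otimes> h \<in> V}"
      then have "inv g \<otimes> h \<in> ?H" using VH by blast
      then have "g \<otimes> (inv g \<otimes> h) \<in> ?H" by (rule Hm[OF g])
      then show "h \<in> ?H" by (simp add: m_assoc[symmetric])
    qed
    then show "\<exists>T. open T \<and> g \<in> T \<and> T \<subseteq> ?H" using op[of g] V(2) by (intro exI[of _ "{h. inv g \<otimes> h \<in> V}"]) auto
  qed
  have inH: "inv g \<in> ?H" if "g \<in> ?H" for g
  proof -
    from that obtain xs where g: "g = exprod (\<lambda>x. 1) xs" by blast
    have "inv (exprod (\<lambda>x. 1) xs) \<in> ?H" for xs
    proof (induction xs)
      case Nil
      then show ?case using H1 by simp
    next
      case (Cons x xs)
      have "inv (ex (1 *\<^sub>R x)) = ex ((- 1) *\<^sub>R x)" by (simp add: ex_minus)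
      then have "inv (ex (1 *\<^sub>R x)) \<in> ?H" using Hx by metis
      from Hm[OF Cons this] show ?case by (simp add: inv_mult_group)
    qed
    then show ?thesis using g by metis
  qed
  have "open (- ?H)"
  proof (subst open_subopen, intro ballI)
    fix g assume g: "g \<in> - ?H"
    have "{h. inv g \<otimes> h \<in> V} \<subseteq> - ?H"
    proof
      fix h assume "h \<in> {h. inv g \<otimes> h \<in> V}"
      then have h: "inv g \<otimes> h \<in> ?H" using VH by blast
      show "h \<in> - ?H"
      proof
        assume "h \<in> ?H"
        \<comment> \<open>This product is \<open>g\<close>, so a translate of \<open>V\<close> based
          at a point outside the subgroup cannot meet it.\<close>
        then have "h \<otimes> inv (inv g \<otimes> h) \<in> ?H" using Hm inH[OF h] by blast
        then have "g \<in> ?H" by (simp add: inv_mult_group m_assoc[symmetric])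
        then show False using g by blast
      qed
    qed
    then show "\<exists>T. open T \<and> g \<in> T \<and> T \<subseteq> - ?H" using op[of g] V(2) by (intro exI[of _ "{h. inv g \<otimes> h \<in> V}"]) auto
  qed
  then have "?H = UNIV" by (rule clopen_eq_UNIV[OF conn cl _ H1])
  then show ?thesis by blast
qed

text \<open>The filter is a parameter so that the parabolic subgroup, for time to minus infinity,
  and the opposite one, for time to plus infinity, share their lemmas.\<close>

definition conv_set :: "'e \<Rightarrow> real filter \<Rightarrow> 'g set" where
  "conv_set \<beta> F = {g. \<exists>l. ((\<lambda>t. ex (t *\<^sub>R \<beta>) \<otimes> g \<otimes> ex ((- t) *\<^sub>R \<beta>)) \<longlongrightarrow> l) F}"

lemma parabolic_plus_conv_set: "parabolic_plus G A \<beta> = conv_set \<beta> at_bot"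
  by (simp add: parabolic_plus_def conv_set_def lie_exp_ex)

lemma ex_neg_scale: "ex ((- t) *\<^sub>R \<beta>) = inv (ex (t *\<^sub>R \<beta>))"
  by (simp add: ex_minus)

lemma conv_set_one: "\<one> \<in> conv_set \<beta> F"
  unfolding conv_set_def ex_neg_scale by (auto intro!: exI[of _ \<one>])

lemma cancel_left: "inv g \<otimes> (g \<otimes> x) = x" "g \<otimes> (inv g \<otimes> x) = x"
  by (simp_all add: m_assoc[symmetric])

lemma conv_set_mult:
  assumes "g \<in> conv_set \<beta> F" "h \<in> conv_set \<beta> F"
  shows "g \<otimes> h \<in> conv_set \<beta> F"
proof -
  obtain l m where l: "((\<lambda>t. ex (t *\<^sub>R \<beta>) \<otimes> g \<otimes> ex ((- t) *\<^sub>R \<beta>)) \<longlongrightarrow> l) F"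
    and m: "((\<lambda>t. ex (t *\<^sub>R \<beta>) \<otimes> h \<otimes> ex ((- t) *\<^sub>R \<beta>)) \<longlongrightarrow> m) F"
    using assms unfolding conv_set_def by blast
  have "((\<lambda>t. ex (t *\<^sub>R \<beta>) \<otimes> (g \<otimes> h) \<otimes> ex ((- t) *\<^sub>R \<beta>)) \<longlongrightarrow> l \<otimes> m) F"
    using tendsto_mult_group[OF l m] by (simp add: ex_neg_scale m_assoc cancel_left del: scaleR_minus_left)
  then show ?thesis unfolding conv_set_def by blast
qed

lemma conv_set_inv:
  assumes "g \<in> conv_set \<beta> F"
  shows "inv g \<in> conv_set \<beta> F"
proof -
  obtain l where l: "((\<lambda>t. ex (t *\<^sub>R \<beta>) \<otimes> g \<otimes> ex ((- t) *\<^sub>R \<beta>)) \<longlongrightarrow> l) F"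
    using assms unfolding conv_set_def by blast
  have "((\<lambda>t. ex (t *\<^sub>R \<beta>) \<otimes> inv g \<otimes> ex ((- t) *\<^sub>R \<beta>)) \<longlongrightarrow> inv l) F"
    using tendsto_inv_group[OF l] by (simp add: ex_neg_scale inv_mult_group m_assoc del: scaleR_minus_left)
  then show ?thesis unfolding conv_set_def by blast
qed

lemma conv_set_commuting:
  assumes "\<And>t. g \<otimes> ex (t *\<^sub>R \<beta>) = ex (t *\<^sub>R \<beta>) \<otimes> g"
  shows "g \<in> conv_set \<beta> F"
proof -
  have "(\<lambda>t. ex (t *\<^sub>R \<beta>) \<otimes> g \<otimes> ex ((- t) *\<^sub>R \<beta>)) = (\<lambda>t. g)"
    by (simp add: ex_neg_scale assms[symmetric] m_assoc del: scaleR_minus_left)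
  then show ?thesis unfolding conv_set_def by (auto intro!: exI[of _ g])
qed

lemma conv_set_ex: "ex (s *\<^sub>R \<beta>) \<in> conv_set \<beta> F"
  by (rule conv_set_commuting) (simp add: ex_add[symmetric] add.commute)

text \<open>Shifting the time by \<open>s\<close> does not change the limit, yet it conjugates the
  whole family by \<open>ex (s *\<^sub>R \<beta>)\<close>.\<close>

lemma conv_limit_commutes:
  assumes l: "((\<lambda>t. ex (t *\<^sub>R \<beta>) \<otimes> g \<otimes> ex ((- t) *\<^sub>R \<beta>)) \<longlongrightarrow> l) F" and F: "F = at_bot \<or> F = at_top"
  shows "l \<otimes> ex (s *\<^sub>R \<beta>) = ex (s *\<^sub>R \<beta>) \<otimes> l"
proof -
  have fl: "filterlim (\<lambda>t. s + t) F F"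
    using F
  proof
    assume "F = at_top"
    then show ?thesis using filterlim_tendsto_add_at_top[OF tendsto_const filterlim_ident] by simp
  next
    assume "F = at_bot"
    then show ?thesis using filterlim_tendsto_add_at_bot_iff[OF tendsto_const[of s at_bot], of "\<lambda>t. t"]
      by (simp add: filterlim_ident)
  qed
  have 1: "((\<lambda>t. ex ((s + t) *\<^sub>R \<beta>) \<otimes> g \<otimes> ex ((- (s + t)) *\<^sub>R \<beta>)) \<longlongrightarrow> l) F"
    using filterlim_compose[OF l fl] .
  have 2: "((\<lambda>t. ex (s *\<^sub>R \<beta>) \<otimes> (ex (t *\<^sub>R \<beta>) \<otimes> g \<otimes> ex ((- t) *\<^sub>R \<beta>)) \<otimes> inv (ex (s *\<^sub>R \<beta>)))
      \<longlongrightarrow> ex (s *\<^sub>R \<beta>) \<otimes> l \<otimes> inv (ex (s *\<^sub>R \<beta>))) F"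
    by (intro tendsto_mult_group tendsto_const l)
  have 3: "(\<lambda>t. ex ((s + t) *\<^sub>R \<beta>) \<otimes> g \<otimes> ex ((- (s + t)) *\<^sub>R \<beta>)) =
      (\<lambda>t. ex (s *\<^sub>R \<beta>) \<otimes> (ex (t *\<^sub>R \<beta>) \<otimes> g \<otimes> ex ((- t) *\<^sub>R \<beta>)) \<otimes> inv (ex (s *\<^sub>R \<beta>)))"
    unfolding ex_neg_scale ex_add by (simp add: inv_mult_group m_assoc)
  have "F \<noteq> bot"
    using F trivial_limit_at_bot_linorder[where 'a = real] trivial_limit_at_top_linorder[where 'a = real] by metis
  then have "l = ex (s *\<^sub>R \<beta>) \<otimes> l \<otimes> inv (ex (s *\<^sub>R \<beta>))"
    by (rule tendsto_unique[OF _ 1 2[folded 3]])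
  then have "ex (s *\<^sub>R \<beta>) \<otimes> l = l \<otimes> ex (s *\<^sub>R \<beta>)" by (intro commute_iff_conj[THEN iffD2]) (rule sym)
  then show ?thesis by (rule sym)
qed

text \<open>Conjugation by the one-parameter group rescales the exponent by
  \<open>exp (c * t)\<close>, which tends to 0 in the stated direction, or is constantly 1 if
  \<open>c = 0\<close>.\<close>

lemma conv_set_eigenvector:
  assumes X: "adj \<beta> X = c *\<^sub>R X" and F: "(0 \<le> c \<and> F = at_bot) \<or> (c \<le> 0 \<and> F = at_top)"
  shows "ex (a *\<^sub>R X) \<in> conv_set \<beta> F"
proof -
  have e: "ex (t *\<^sub>R \<beta>) \<otimes> ex (a *\<^sub>R X) \<otimes> ex ((- t) *\<^sub>R \<beta>) = ex ((exp (c * t) * a) *\<^sub>R X)" for t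
    unfolding ex_neg_scale conj_ex_scale Ad_ex_eigenvector[OF X] by (simp add: mult.commute)
  have "\<exists>m. ((\<lambda>t. exp (c * t)) \<longlongrightarrow> m) F"
  proof (cases "c = 0")
    case True
    then show ?thesis by (intro exI[of _ 1]) simp
  next
    case False
    have "filterlim (\<lambda>t. c * t) at_bot F"
      using F
    proof
      assume "0 \<le> c \<and> F = at_bot"
      then show ?thesis
        using filterlim_tendsto_pos_mult_at_bot[OF tendsto_const[of c at_bot], of "\<lambda>t. t"] False
        by (simp add: filterlim_ident)
    next
      assume "c \<le> 0 \<and> F = at_top"
      then show ?thesis
        using filterlim_tendsto_neg_mult_at_bot[OF tendsto_const[of c at_top], of "\<lambda>t. t"] False
        by (simp add: filterlim_ident)
    qed
    then show ?thesis using filterlim_compose[OF exp_at_bot] by blast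
  qed
  then obtain m where "((\<lambda>t. exp (c * t)) \<longlongrightarrow> m) F" by blast
  then have "((\<lambda>t. ex ((exp (c * t) * a) *\<^sub>R X)) \<longlongrightarrow> ex ((m * a) *\<^sub>R X)) F"
    by (intro tendsto_ex_compose tendsto_intros)
  then show ?thesis unfolding conv_set_def mem_Collect_eq e by blast
qed

end

section \<open>The compact real form and the parabolic subgroups of its complexification\<close>

locale complexified = complex_lie G j A
  for G :: "'g::{t2_space, second_countable_topology} monoid" (structure)
    and j :: "'e::real_normed_vector \<Rightarrow> 'e" and A :: "('g, 'e) chart set" +
  fixes U :: "'g set"
  assumes cplx: "complexification G j A U"
begin

definition "\<uu> = lie_algebra_of G A U"

lemma subgroup_U: "subgroup U G" and compact_U: "compact U" and connected_U: "connected U"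
  using cplx by (auto simp: complexification_def)

lemma closed_U: "closed U" by (rule compact_imp_closed[OF compact_U])

lemma uu_iff: "\<xi> \<in> \<uu> \<longleftrightarrow> (\<forall>t. ex (t *\<^sub>R \<xi>) \<in> U)" by (simp add: \<uu>_def lie_algebra_ofD)
lemma uu_scale: "\<xi> \<in> \<uu> \<Longrightarrow> c *\<^sub>R \<xi> \<in> \<uu>" by (simp add: uu_iff)
lemma uu_add: "\<xi> \<in> \<uu> \<Longrightarrow> \<eta> \<in> \<uu> \<Longrightarrow> \<xi> + \<eta> \<in> \<uu>"
  unfolding \<uu>_def by (rule lie_algebra_add[OF closed_U subgroup_U])
lemma uu_ex: "\<xi> \<in> \<uu> \<Longrightarrow> ex (t *\<^sub>R \<xi>) \<in> U" by (simp add: uu_iff)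

lemma U_one: "\<one> \<in> U" and U_mult: "g \<in> U \<Longrightarrow> h \<in> U \<Longrightarrow> g \<otimes> h \<in> U" and U_inv: "g \<in> U \<Longrightarrow> inv g \<in> U"
  using subgroup_U by (auto simp: subgroup.one_closed subgroup.m_closed subgroup.m_inv_closed)

lemma uu_Ad: "k \<in> U \<Longrightarrow> \<xi> \<in> \<uu> \<Longrightarrow> Ad k \<xi> \<in> \<uu>"
  unfolding uu_iff conj_ex_scale[symmetric] by (simp add: U_mult U_inv)

lemma decomposition_ex: "\<exists>\<xi>\<in>\<uu>. \<exists>\<eta>\<in>\<uu>. v = \<xi> + j \<eta>"
proof -
  have "\<exists>!(\<xi>, \<eta>). \<xi> \<in> \<uu> \<and> \<eta> \<in> \<uu> \<and> v = \<xi> + j \<eta>"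
    using cplx by (simp add: complexification_def \<uu>_def)
  then show ?thesis by auto
qed

lemma decomposition_unique:
  assumes "\<xi> \<in> \<uu>" "\<eta> \<in> \<uu>" "\<xi>' \<in> \<uu>" "\<eta>' \<in> \<uu>" "\<xi> + j \<eta> = \<xi>' + j \<eta>'"
  shows "\<xi> = \<xi>'" "\<eta> = \<eta>'"
proof -
  have "\<exists>!(\<xi>1, \<eta>1). \<xi>1 \<in> \<uu> \<and> \<eta>1 \<in> \<uu> \<and> \<xi> + j \<eta> = \<xi>1 + j \<eta>1"
    using cplx by (simp add: complexification_def \<uu>_def)
  then have "(\<xi>, \<eta>) = (\<xi>', \<eta>')"
    by (rule ex1E) (use assms in \<open>metis (mono_tags, lifting) case_prodI\<close>)
  then show "\<xi> = \<xi>'" "\<eta> = \<eta>'" by auto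
qed

lemma polar:
  obtains p where "homeomorphism (U \<times> \<uu>) UNIV (\<lambda>(k, \<xi>). k \<otimes> ex (j \<xi>)) p"
  using cplx by (auto simp: complexification_def \<uu>_def lie_exp_ex)

lemma polar_ex: "\<exists>k\<in>U. \<exists>\<xi>\<in>\<uu>. g = k \<otimes> ex (j \<xi>)"
proof -
  obtain p where "homeomorphism (U \<times> \<uu>) UNIV (\<lambda>(k, \<xi>). k \<otimes> ex (j \<xi>)) p" by (rule polar)
  then have "(\<lambda>(k, \<xi>). k \<otimes> ex (j \<xi>)) ` (U \<times> \<uu>) = UNIV" by (simp add: homeomorphism_def)
  then have "g \<in> (\<lambda>(k, \<xi>). k \<otimes> ex (j \<xi>)) ` (U \<times> \<uu>)" by simp
  then show ?thesis by auto
qed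

lemma polar_unique:
  assumes "k \<in> U" "\<xi> \<in> \<uu>" "k' \<in> U" "\<xi>' \<in> \<uu>" "k \<otimes> ex (j \<xi>) = k' \<otimes> ex (j \<xi>')"
  shows "k = k'" "\<xi> = \<xi>'"
proof -
  obtain p where p: "homeomorphism (U \<times> \<uu>) UNIV (\<lambda>(k, \<xi>). k \<otimes> ex (j \<xi>)) p" by (rule polar)
  have "p (k \<otimes> ex (j \<xi>)) = (k, \<xi>)" "p (k' \<otimes> ex (j \<xi>')) = (k', \<xi>')"
    using homeomorphism_apply1[OF p, of "(k, \<xi>)"] homeomorphism_apply1[OF p, of "(k', \<xi>')"] assms by auto
  then have "(k, \<xi>) = (k', \<xi>')" unfolding assms(5) by (rule trans[OF sym])
  then show "k = k'" "\<xi> = \<xi>'" by auto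
qed

text \<open>Through the polar decomposition the group is a continuous image of the product of the
  connected \<open>U\<close> with a linear subspace.\<close>

lemma connected_G: "connected (UNIV :: 'g set)"
proof -
  obtain p where p: "homeomorphism (U \<times> \<uu>) UNIV (\<lambda>(k, \<xi>). k \<otimes> ex (j \<xi>)) p" by (rule polar)
  have "convex \<uu>" by (auto intro!: convexI uu_add uu_scale)
  then have "connected (U \<times> \<uu>)" by (intro connected_Times connected_U convex_connected)
  from connected_continuous_image[OF homeomorphism_cont1[OF p] this] show ?thesis
    using homeomorphism_image1[OF p] by simp
qed

text \<open>The exponentials of multiples of \<open>\<eta>\<close> stay in the compact group
  \<open>U\<close>, on which each orbit of \<open>Ad\<close> is bounded.\<close>

lemma bounded_flow_Ad:
  assumes "\<eta> \<in> \<uu>"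
  shows "bounded_complex_flow j (adj \<eta>) (\<lambda>s. Ad (ex (s *\<^sub>R \<eta>)))"
proof (rule bounded_complex_flow.intro)
    show "complex_structure j" by (rule cs)
    show "findim TYPE('e)" by (rule fdE)
    show "linear (adj \<eta>)" by (rule linear_adj)
    show "adj \<eta> (j v) = j (adj \<eta> v)" for v by (rule adj_right_j)
    show "linear (Ad (ex (s *\<^sub>R \<eta>)))" for s by (rule linear_Ad)
    show "Ad (ex (s *\<^sub>R \<eta>)) (j v) = j (Ad (ex (s *\<^sub>R \<eta>)) v)" for s v by (rule Ad_j)
    show "Ad (ex (0 *\<^sub>R \<eta>)) v = v" for v by (simp add: ex_zero Ad_one)
    show "((\<lambda>s. Ad (ex (s *\<^sub>R \<eta>)) v) has_vector_derivative Ad (ex (s *\<^sub>R \<eta>)) (adj \<eta> v)) (at s)" for s v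
      by (rule Ad_ex_derivative)
    show "bounded (range (\<lambda>s. Ad (ex (s *\<^sub>R \<eta>)) v))" for v
      by (rule bounded_subset[OF compact_Ad_bounded[OF compact_U]]) (use uu_ex[OF assms] in auto)
qed

lemma span_imaginary: "\<eta> \<in> \<uu> \<Longrightarrow> span {Y. \<exists>\<theta>. adj \<eta> Y = \<theta> *\<^sub>R j Y} = UNIV"
  by (rule bounded_complex_flow.span_imaginary_eigenvectors[OF bounded_flow_Ad])

lemma imaginary_eigen_flow:
  assumes "\<eta> \<in> \<uu>" and Y: "adj \<eta> Y = \<theta> *\<^sub>R j Y"
  shows "Ad (ex (s *\<^sub>R \<eta>)) Y = cos (\<theta> * s) *\<^sub>R Y + sin (\<theta> * s) *\<^sub>R j Y"
proof -
  interpret bounded_complex_flow j "adj \<eta>" "\<lambda>s. Ad (ex (s *\<^sub>R \<eta>))"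
    by (rule bounded_flow_Ad[OF assms(1)])
  have "adj \<eta> Y = cscale (\<i> * of_real \<theta>) Y" by (simp add: cscale_def Y)
  from eigen_flow[OF this, of s]
  have "cscale (exp (\<i> * of_real (\<theta> * s))) (cscale (exp (- (\<i> * of_real \<theta>) * of_real s)) (Ad (ex (s *\<^sub>R \<eta>)) Y)) =
      cscale (exp (\<i> * of_real (\<theta> * s))) Y" by simp
  moreover have "exp (\<i> * of_real (\<theta> * s)) * exp (- (\<i> * of_real \<theta>) * of_real s) = (1::complex)"
    by (simp add: exp_add[symmetric])
  ultimately have "Ad (ex (s *\<^sub>R \<eta>)) Y = cscale (exp (\<i> * of_real (\<theta> * s))) Y"
    by (simp add: cscale_mult[symmetric])
  then show "Ad (ex (s *\<^sub>R \<eta>)) Y = cos (\<theta> * s) *\<^sub>R Y + sin (\<theta> * s) *\<^sub>R j Y"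
    by (simp add: cscale_def Re_exp Im_exp)
qed

text \<open>Conjugation of the Lie algebra with respect to \<open>\<uu>\<close> commutes with
  \<open>Ad k\<close> for \<open>k\<close> in \<open>U\<close>, so it sends eigenvectors of
  \<open>ad \<eta>\<close> for the eigenvalue \<open>i \<theta>\<close> to eigenvectors for
  \<open>- i \<theta>\<close>. In the proof this is the comparison of the components in
  \<open>\<uu>\<close> and \<open>j \<uu>\<close> of the rotated vector.\<close>

lemma conjugate_eigenvector:
  assumes eta: "\<eta> \<in> \<uu>" and xi: "\<xi> \<in> \<uu>" and zeta: "\<zeta> \<in> \<uu>"
    and Y: "adj \<eta> (\<xi> + j \<zeta>) = \<theta> *\<^sub>R j (\<xi> + j \<zeta>)"
  shows "adj \<eta> (\<xi> - j \<zeta>) = (- \<theta>) *\<^sub>R j (\<xi> - j \<zeta>)"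
proof (rule adj_eqI)
  note jD = complex_structureD[OF cs]
  have uu_diff: "a - b \<in> \<uu>" if "a \<in> \<uu>" "b \<in> \<uu>" for a b
    using uu_add[OF that(1) uu_scale[OF that(2), of "-1"]] by simp
  have e: "Ad (ex (s *\<^sub>R \<eta>)) (\<xi> - j \<zeta>) = cos (\<theta> * s) *\<^sub>R (\<xi> - j \<zeta>) - sin (\<theta> * s) *\<^sub>R j (\<xi> - j \<zeta>)" for s
  proof -
    let ?k = "ex (s *\<^sub>R \<eta>)" and ?c = "cos (\<theta> * s)" and ?s = "sin (\<theta> * s)"
    have k: "?k \<in> U" by (rule uu_ex[OF eta])
    have "Ad ?k \<xi> + j (Ad ?k \<zeta>) = Ad ?k (\<xi> + j \<zeta>)" by (simp add: linear_add[OF linear_Ad] Ad_j)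
    also have "\<dots> = ?c *\<^sub>R (\<xi> + j \<zeta>) + ?s *\<^sub>R j (\<xi> + j \<zeta>)" by (rule imaginary_eigen_flow[OF eta Y])
    also have "\<dots> = (?c *\<^sub>R \<xi> - ?s *\<^sub>R \<zeta>) + j (?c *\<^sub>R \<zeta> + ?s *\<^sub>R \<xi>)" by (simp add: jD algebra_simps)
    finally have eq: "Ad ?k \<xi> + j (Ad ?k \<zeta>) = (?c *\<^sub>R \<xi> - ?s *\<^sub>R \<zeta>) + j (?c *\<^sub>R \<zeta> + ?s *\<^sub>R \<xi>)" .
    have "Ad ?k \<xi> = ?c *\<^sub>R \<xi> - ?s *\<^sub>R \<zeta>" "Ad ?k \<zeta> = ?c *\<^sub>R \<zeta> + ?s *\<^sub>R \<xi>"
      using decomposition_unique[OF uu_Ad[OF k xi] uu_Ad[OF k zeta] _ _ eq] uu_scale uu_add uu_diff xi zeta by auto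
    then show ?thesis by (simp add: linear_diff[OF linear_Ad] Ad_j jD algebra_simps)
  qed
  let ?Y = "\<xi> - j \<zeta>"
  have "((\<lambda>s. cos (\<theta> * s)) has_field_derivative 0) (at 0)" "((\<lambda>s. sin (\<theta> * s)) has_field_derivative \<theta>) (at 0)"
    by (auto intro!: derivative_eq_intros)
  from has_vector_derivative_diff[OF has_vector_derivative_scaleR[OF this(1) has_vector_derivative_const[of ?Y]]
      has_vector_derivative_scaleR[OF this(2) has_vector_derivative_const[of "j ?Y"]]]
  show "((\<lambda>s. Ad (ex (s *\<^sub>R \<eta>)) ?Y) has_vector_derivative (- \<theta>) *\<^sub>R j ?Y) (at 0)"
    unfolding e by simp
qed

context
  fixes \<eta> assumes eta: "\<eta> \<in> \<uu>"
begin

text \<open>Eigenvectors of \<open>ad \<beta>\<close> with \<open>\<beta> = j \<eta>\<close>,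
  separated by the sign of their real eigenvalue. Both sets contain the centralizer of
  \<open>\<beta>\<close>, where \<open>c = 0\<close>.\<close>

definition "Epos = {X. \<exists>c\<ge>0. adj (j \<eta>) X = c *\<^sub>R X}"
definition "Eneg = {X. \<exists>c\<le>0. adj (j \<eta>) X = c *\<^sub>R X}"

lemma adj_j_imaginary: "adj \<eta> Y = \<theta> *\<^sub>R j Y \<Longrightarrow> adj (j \<eta>) Y = (- \<theta>) *\<^sub>R Y"
  by (simp add: adj_j complex_structureD[OF cs])

text \<open>Multiplication by \<open>j\<close> turns the eigenvalue \<open>i \<theta>\<close> of
  \<open>ad \<eta>\<close> into the real eigenvalue \<open>- \<theta>\<close> of
  \<open>ad (j \<eta>)\<close>.\<close>

lemma span_Eneg_Epos: "span (Eneg \<union> Epos) = UNIV"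
proof -
  have "{Y. \<exists>\<theta>. adj \<eta> Y = \<theta> *\<^sub>R j Y} \<subseteq> Eneg \<union> Epos"
  proof
    fix Y assume "Y \<in> {Y. \<exists>\<theta>. adj \<eta> Y = \<theta> *\<^sub>R j Y}"
    then obtain \<theta> where t: "adj (j \<eta>) Y = (- \<theta>) *\<^sub>R Y" using adj_j_imaginary by blast
    show "Y \<in> Eneg \<union> Epos"
    proof (cases "0 \<le> \<theta>")
      case True
      then have "- \<theta> \<le> 0" by simp
      then show ?thesis using t unfolding Eneg_def by blast
    next
      case False
      then have "0 \<le> - \<theta>" by simp
      then show ?thesis using t unfolding Epos_def by blast
    qed
  qed
  from span_mono[OF this] show ?thesis using span_imaginary[OF eta] by blast
qed

text \<open>A negative eigenvector \<open>Y = \<xi> + j \<zeta>\<close> has a positive conjugate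
  \<open>\<xi> - j \<zeta>\<close>, and \<open>Y\<close> is \<open>2 \<xi>\<close> minus this
  conjugate.\<close>

lemma span_uu_Epos: "span (\<uu> \<union> Epos) = UNIV"
proof -
  have "{Y. \<exists>\<theta>. adj \<eta> Y = \<theta> *\<^sub>R j Y} \<subseteq> span (\<uu> \<union> Epos)"
  proof
    fix Y assume "Y \<in> {Y. \<exists>\<theta>. adj \<eta> Y = \<theta> *\<^sub>R j Y}"
    then obtain \<theta> where t: "adj \<eta> Y = \<theta> *\<^sub>R j Y" by blast
    show "Y \<in> span (\<uu> \<union> Epos)"
    proof (cases "\<theta> \<le> 0")
      case True
      then have "0 \<le> - \<theta>" by simp
      then have "Y \<in> Epos" using adj_j_imaginary[OF t] unfolding Epos_def by blast
      then show ?thesis by (simp add: span_base)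
    next
      case False
      obtain \<xi> \<zeta> where d: "\<xi> \<in> \<uu>" "\<zeta> \<in> \<uu>" "Y = \<xi> + j \<zeta>" using decomposition_ex[of Y] by blast
      have "adj \<eta> (\<xi> - j \<zeta>) = (- \<theta>) *\<^sub>R j (\<xi> - j \<zeta>)"
        by (rule conjugate_eigenvector[OF eta d(1,2)]) (use t d(3) in simp)
      from adj_j_imaginary[OF this] have "adj (j \<eta>) (\<xi> - j \<zeta>) = \<theta> *\<^sub>R (\<xi> - j \<zeta>)" by simp
      moreover have "0 \<le> \<theta>" using False by simp
      ultimately have "\<xi> - j \<zeta> \<in> Epos" unfolding Epos_def by blast
      then have "2 *\<^sub>R \<xi> - (\<xi> - j \<zeta>) \<in> span (\<uu> \<union> Epos)"
        using uu_scale[OF d(1), of 2] by (intro span_diff span_base) auto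
      moreover have "2 *\<^sub>R \<xi> - (\<xi> - j \<zeta>) = Y" by (simp add: d(3) scaleR_2)
      ultimately show ?thesis by simp
    qed
  qed
  then have "span {Y. \<exists>\<theta>. adj \<eta> Y = \<theta> *\<^sub>R j Y} \<subseteq> span (\<uu> \<union> Epos)" by (rule span_minimal[OF _ subspace_span])
  then show ?thesis using span_imaginary[OF eta] by blast
qed

abbreviation "Pp \<equiv> conv_set (j \<eta>) at_bot"
abbreviation "Pm \<equiv> conv_set (j \<eta>) at_top"

lemma ex_Epos: "X \<in> Epos \<Longrightarrow> ex (c *\<^sub>R X) \<in> Pp"
  unfolding Epos_def using conv_set_eigenvector by blast

lemma ex_Eneg: "X \<in> Eneg \<Longrightarrow> ex (c *\<^sub>R X) \<in> Pm"
  unfolding Eneg_def using conv_set_eigenvector by blast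

lemma Pm_Pp_neighbourhood:
  obtains V where "open V" "\<one> \<in> V" "\<And>g. g \<in> V \<Longrightarrow> \<exists>h\<in>Pm. \<exists>k\<in>Pp. g = h \<otimes> k"
  by (rule factor_neighbourhood[OF span_Eneg_Epos, of Pm Pp]) (auto intro: conv_set_one conv_set_mult ex_Eneg ex_Epos)

lemma U_Pp_neighbourhood:
  obtains V where "open V" "\<one> \<in> V" "\<And>g. g \<in> V \<Longrightarrow> \<exists>h\<in>U. \<exists>k\<in>Pp. g = h \<otimes> k"
  by (rule factor_neighbourhood[OF span_uu_Epos, of U Pp])
    (auto intro: conv_set_one conv_set_mult uu_ex ex_Epos U_one U_mult)

text \<open>Complex linearity of \<open>Ad l\<close> converts commutation with the group of
  \<open>j \<eta>\<close> into commutation with the group of \<open>\<eta>\<close>, which lies in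
  \<open>U\<close>. Conjugation by elements of \<open>U\<close> respects polar decompositions, so
  uniqueness makes both polar factors of \<open>l\<close> invariant.\<close>

lemma commuting_polar:
  assumes l: "\<And>s. l \<otimes> ex (s *\<^sub>R j \<eta>) = ex (s *\<^sub>R j \<eta>) \<otimes> l"
  obtains k \<xi> where "k \<in> U" "\<xi> \<in> \<uu>" "l = k \<otimes> ex (j \<xi>)" "Ad k \<eta> = \<eta>"
    "\<And>s t. ex (t *\<^sub>R j \<xi>) \<otimes> ex (s *\<^sub>R j \<eta>) = ex (s *\<^sub>R j \<eta>) \<otimes> ex (t *\<^sub>R j \<xi>)"
proof -
  note jD = complex_structureD[OF cs]
  obtain k \<xi> where k: "k \<in> U" "\<xi> \<in> \<uu>" "l = k \<otimes> ex (j \<xi>)" using polar_ex[of l] by blast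
  have "Ad l (j \<eta>) = j \<eta>" unfolding Ad_fix_iff using l by blast
  then have "j (Ad l \<eta>) = j \<eta>" by (simp add: Ad_j)
  then have "- Ad l \<eta> = - \<eta>" using jD(2) by metis
  then have "Ad l \<eta> = \<eta>" by simp
  then have lc: "l \<otimes> ex (s *\<^sub>R \<eta>) = ex (s *\<^sub>R \<eta>) \<otimes> l" for s unfolding Ad_fix_iff by blast
  have kx: "k \<otimes> ex (s *\<^sub>R \<eta>) = ex (s *\<^sub>R \<eta>) \<otimes> k" "Ad (ex (s *\<^sub>R \<eta>)) \<xi> = \<xi>" for s
  proof -
    let ?e = "ex (s *\<^sub>R \<eta>)"
    have e: "?e \<in> U" by (rule uu_ex[OF eta])
    \<comment> \<open>Two polar decompositions of the same element are set up here: the given one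
      and its conjugate by \<open>?e\<close>.\<close>
    have "k \<otimes> ex (j \<xi>) = ?e \<otimes> l \<otimes> inv ?e" using lc[of s] commute_iff_conj[of ?e l] k(3) by simp
    also have "\<dots> = (?e \<otimes> k \<otimes> inv ?e) \<otimes> (?e \<otimes> ex (j \<xi>) \<otimes> inv ?e)"
      by (simp add: k(3) m_assoc cancel_left)
    also have "?e \<otimes> ex (j \<xi>) \<otimes> inv ?e = ex (j (Ad ?e \<xi>))" by (simp add: conj_ex Ad_j)
    finally have eq: "k \<otimes> ex (j \<xi>) = (?e \<otimes> k \<otimes> inv ?e) \<otimes> ex (j (Ad ?e \<xi>))" .
    have "?e \<otimes> k \<otimes> inv ?e \<in> U" using e k(1) by (simp add: U_mult U_inv)
    note pu = polar_unique[OF k(1,2) this uu_Ad[OF e k(2)] eq]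
    show "k \<otimes> ?e = ?e \<otimes> k" using pu(1) commute_iff_conj[of ?e k] by simp
    show "Ad ?e \<xi> = \<xi>" using pu(2) by simp
  qed
  have 1: "Ad k \<eta> = \<eta>" unfolding Ad_fix_iff using kx(1) by blast
  have 2: "ex (t *\<^sub>R j \<xi>) \<otimes> ex (s *\<^sub>R j \<eta>) = ex (s *\<^sub>R j \<eta>) \<otimes> ex (t *\<^sub>R j \<xi>)" for s t
  proof -
    have "Ad (ex (s *\<^sub>R \<eta>)) (j \<xi>) = j \<xi>" for s by (simp add: Ad_j kx(2))
    then have "ex (s *\<^sub>R \<eta>) \<otimes> ex (t *\<^sub>R j \<xi>) = ex (t *\<^sub>R j \<xi>) \<otimes> ex (s *\<^sub>R \<eta>)" for s t unfolding Ad_fix_iff by blast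
    then have "\<forall>s. ex (t *\<^sub>R j \<xi>) \<otimes> ex (s *\<^sub>R \<eta>) = ex (s *\<^sub>R \<eta>) \<otimes> ex (t *\<^sub>R j \<xi>)" by simp
    then have "Ad (ex (t *\<^sub>R j \<xi>)) \<eta> = \<eta>" unfolding Ad_fix_iff .
    then have "Ad (ex (t *\<^sub>R j \<xi>)) (j \<eta>) = j \<eta>" by (simp add: Ad_j)
    then show ?thesis unfolding Ad_fix_iff by blast
  qed
  show ?thesis by (rule that[OF k 1 2])
qed

end

end

section \<open>The action and the momentum map\<close>

locale kaehler_action = complexified G j A U
  for G :: "'g::{t2_space, second_countable_topology} monoid" (structure)
    and j :: "'e::real_normed_vector \<Rightarrow> 'e" and A :: "('g, 'e) chart set" and U :: "'g set" +
  fixes jZ :: "'f::real_normed_vector \<Rightarrow> 'f"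
    and AZ :: "('z::{t2_space, second_countable_topology}, 'f) chart set"
    and \<omega> :: "'z \<Rightarrow> 'f \<Rightarrow> 'f \<Rightarrow> real"
    and \<phi> :: "'g \<Rightarrow> 'z \<Rightarrow> 'z"
    and mom :: "'z \<Rightarrow> 'e \<Rightarrow> real"
  assumes kaehler: "kaehler_manifold jZ AZ \<omega>"
    and action: "holomorphic_action G j A jZ AZ \<phi>"
    and momentum: "momentum_map G A U AZ \<phi> \<omega> mom"
begin

lemma cZ: "complex_atlas jZ AZ" using kaehler by (simp add: kaehler_manifold_def)
lemma sZ: "smooth_atlas AZ" by (rule complex_atlas_smooth[OF cZ])
lemma csZ: "complex_structure jZ" by (rule complex_atlas_structure[OF cZ])
lemma sAZ: "smooth_atlas (prod_atlas A AZ)" by (rule smooth_atlas_prod[OF sA sZ])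

lemma group_action: "group_action G UNIV \<phi>" using action by (simp add: holomorphic_action_def)

lemma act_one [simp]: "\<phi> \<one> z = z"
  using group_action.id_eq_one[OF group_action] by (metis UNIV_I restrict_apply)

lemma act_mult: "\<phi> (g \<otimes> h) z = \<phi> g (\<phi> h z)"
  using group_action.composition_rule[OF group_action, of z g h] by simp

lemma act_inv: "\<phi> (inv g) (\<phi> g z) = z" "\<phi> g (\<phi> (inv g) z) = z"
  by (simp_all add: act_mult[symmetric])

lemma holomorphic_act: "holomorphic_map (map_prod j jZ) (prod_atlas A AZ) jZ AZ (\<lambda>(g, z). \<phi> g z)"
  using action by (simp add: holomorphic_action_def)

lemma smooth_act: "smooth_map (prod_atlas A AZ) AZ (\<lambda>(g, z). \<phi> g z)"
  using holomorphic_act by (simp add: holomorphic_map_def)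

lemma holomorphic_orbit_map: "holomorphic_map j A jZ AZ (\<lambda>g. \<phi> g z)"
  using holomorphic_map_compose[OF sA sAZ sZ holomorphic_map_Pair_left[OF cA cZ] holomorphic_act] by simp

lemma smooth_orbit_map: "smooth_map A AZ (\<lambda>g. \<phi> g z)"
  using holomorphic_orbit_map by (simp add: holomorphic_map_def)

lemma continuous_act: "continuous_on UNIV (\<lambda>p. \<phi> (fst p) (snd p))"
  using smooth_map_continuous[OF smooth_act] by (simp add: split_beta)

lemma tendsto_act:
  assumes "(f \<longlongrightarrow> g) F" "(h \<longlongrightarrow> z) F"
  shows "((\<lambda>x. \<phi> (f x) (h x)) \<longlongrightarrow> \<phi> g z) F"
proof -
  have "isCont (\<lambda>p. \<phi> (fst p) (snd p)) (g, z)"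
    using continuous_act by (simp add: continuous_on_eq_continuous_at)
  from isCont_tendsto_compose[OF this tendsto_Pair[OF assms]] show ?thesis by simp
qed

lemma continuous_on_act:
  "continuous_on S f \<Longrightarrow> continuous_on S h \<Longrightarrow> continuous_on S (\<lambda>x. \<phi> (f x) (h x))"
  unfolding continuous_on_def by (auto intro: tendsto_act)

definition fld :: "'e \<Rightarrow> 'z \<Rightarrow> 'f" where "fld = fundamental_field G A AZ \<phi>"

lemma fld_curve: "fld \<xi> z = tangent_map vector_atlas AZ (\<lambda>t. \<phi> (ex (t *\<^sub>R \<xi>)) z) 0 1"
  by (simp add: fld_def fundamental_field_def lie_exp_ex)

lemma fld_orbit: "fld \<xi> z = tangent_map A AZ (\<lambda>g. \<phi> g z) \<one> \<xi>"
  unfolding fld_curve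
  by (simp add: tangent_map_compose[OF sV sA sZ smooth_ex_curve smooth_orbit_map] tangent_ex_curve ex_zero)

lemma fld_j: "fld (j \<xi>) z = jZ (fld \<xi> z)"
  using holomorphic_orbit_map by (simp add: fld_orbit holomorphic_map_def)

lemma smooth_flow: "smooth_map vector_atlas AZ (\<lambda>t. \<phi> (ex (t *\<^sub>R \<xi>)) z)"
  by (rule smooth_map_compose[OF sV sA sZ smooth_ex_curve smooth_orbit_map])

lemma tangent_flow: "tangent_map vector_atlas AZ (\<lambda>t. \<phi> (ex (t *\<^sub>R \<xi>)) z) s 1 = fld \<xi> (\<phi> (ex (s *\<^sub>R \<xi>)) z)"
proof -
  have e: "(\<lambda>t. \<phi> (ex (t *\<^sub>R \<xi>)) z) = (\<lambda>t. \<phi> (ex ((t - s) *\<^sub>R \<xi>)) (\<phi> (ex (s *\<^sub>R \<xi>)) z))"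
  proof
    fix t
    have "ex (t *\<^sub>R \<xi>) = ex ((t - s) *\<^sub>R \<xi>) \<otimes> ex (s *\<^sub>R \<xi>)" using ex_add[of "t - s" s \<xi>] by simp
    then show "\<phi> (ex (t *\<^sub>R \<xi>)) z = \<phi> (ex ((t - s) *\<^sub>R \<xi>)) (\<phi> (ex (s *\<^sub>R \<xi>)) z)" by (simp only: act_mult)
  qed
  show ?thesis
    unfolding e
    using tangent_map_compose[OF sV sV sZ smooth_shift[of s] smooth_flow[of \<xi> "\<phi> (ex (s *\<^sub>R \<xi>)) z"], of s 1]
    by (simp add: tangent_map_vector frechet_shift fld_curve)
qed

lemma omega_bilinear: "bilinear (\<omega> z)" and omega_self: "\<omega> z v v = 0"
  using kaehler by (auto simp: kaehler_manifold_def smooth_2form_def)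

lemma omega_simps:
  "\<omega> z (v + w) x = \<omega> z v x + \<omega> z w x" "\<omega> z x (v + w) = \<omega> z x v + \<omega> z x w"
  "\<omega> z (- v) x = - \<omega> z v x" "\<omega> z x (- v) = - \<omega> z x v" "\<omega> z 0 x = 0" "\<omega> z x 0 = 0"
  using omega_bilinear
  by (simp_all add: bilinear_ladd bilinear_radd bilinear_lneg bilinear_rneg bilinear_lzero bilinear_rzero)

lemma omega_antisym: "\<omega> z v w = - \<omega> z w v"
proof -
  have "\<omega> z (v + w) (v + w) = \<omega> z v w + \<omega> z w v"
    unfolding omega_simps(1,2) by (simp add: omega_self)
  then show ?thesis using omega_self[of z "v + w"] by simp
qed

lemma omega_sym: "\<omega> z v (jZ w) = \<omega> z w (jZ v)"
  using kaehler by (simp add: kaehler_manifold_def)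

lemma omega_pos: "v \<noteq> 0 \<Longrightarrow> \<omega> z v (jZ v) > 0"
  using kaehler by (simp add: kaehler_manifold_def)

lemma omega_nonneg: "\<omega> z v (jZ v) \<ge> 0"
  using omega_pos[of v z] by (cases "v = 0") (auto simp: omega_simps)

lemma omega_j_left: "\<omega> z (jZ v) w = - \<omega> z v (jZ w)"
  using omega_sym[of z v w] omega_antisym[of z "jZ v" w] by simp

lemma omega_jj: "\<omega> z (jZ v) (jZ w) = \<omega> z v w"
  by (simp add: omega_j_left complex_structureD(2)[OF csZ] omega_simps)

lemma mom_smooth: "\<xi> \<in> \<uu> \<Longrightarrow> smooth_map AZ vector_atlas (\<lambda>z. mom z \<xi>)"
  and mom_equivariant: "k \<in> U \<Longrightarrow> \<xi> \<in> \<uu> \<Longrightarrow> mom (\<phi> k z) \<xi> = mom z (Ad (inv k) \<xi>)"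
  and mom_tangent: "\<xi> \<in> \<uu> \<Longrightarrow> tangent_map AZ vector_atlas (\<lambda>z. mom z \<xi>) z v = \<omega> z (fld \<xi> z) v"
  using momentum by (auto simp: momentum_map_def Let_def \<uu>_def Ad_def fld_def)

section \<open>The momentum component along \<eta> and its gradient flow\<close>

context
  fixes \<eta> :: 'e
  assumes eta: "\<eta> \<in> \<uu>"
begin

abbreviation "m z \<equiv> mom z \<eta>"
abbreviation "gam t \<equiv> ex (t *\<^sub>R j \<eta>)"

lemma continuous_m: "continuous_on S m"
  using smooth_map_continuous[OF mom_smooth[OF eta]] continuous_on_subset by blast

text \<open>The momentum equation combined with the chain rule. The parameter space is arbitrary
  because the lemma serves both single curves and three-parameter families.\<close>

lemma frechet_m:
  fixes c :: "'a::{real_normed_vector, second_countable_topology} \<Rightarrow> 'z"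
  assumes fd: "findim TYPE('a)" and c: "smooth_map vector_atlas AZ c"
  shows "smooth_on UNIV (\<lambda>t. m (c t))"
    and "frechet_derivative (\<lambda>t. m (c t)) (at t) v = \<omega> (c t) (fld \<eta> (c t)) (tangent_map vector_atlas AZ c t v)"
proof -
  note Va = smooth_atlas_vector[OF fd]
  show "smooth_on UNIV (\<lambda>t. m (c t))"
    using smooth_map_compose[OF Va sZ sV c mom_smooth[OF eta]] by (simp add: smooth_map_vector)
  show "frechet_derivative (\<lambda>t. m (c t)) (at t) v = \<omega> (c t) (fld \<eta> (c t)) (tangent_map vector_atlas AZ c t v)"
    using tangent_map_compose[OF Va sZ sV c mom_smooth[OF eta], of t v] mom_tangent[OF eta]
    by (simp add: tangent_map_vector)
qed

lemma m_curve_derivative: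
  assumes c: "smooth_map vector_atlas AZ c"
  shows "((\<lambda>t. m (c t)) has_real_derivative \<omega> (c t) (fld \<eta> (c t)) (tangent_map vector_atlas AZ c t 1)) (at t)"
proof -
  have d: "((\<lambda>t. m (c t)) has_derivative frechet_derivative (\<lambda>t. m (c t)) (at t)) (at t)"
    by (rule smooth_on_has_derivative[OF frechet_m(1)[OF findim_real c]]) simp
  have "frechet_derivative (\<lambda>t. m (c t)) (at t) h = frechet_derivative (\<lambda>t. m (c t)) (at t) 1 * h" for h
    using linear_cmul[OF has_derivative_linear[OF d], of h 1] by simp
  then have "frechet_derivative (\<lambda>t. m (c t)) (at t) = times (frechet_derivative (\<lambda>t. m (c t)) (at t) 1)" by (rule ext)
  then show ?thesis using d unfolding has_field_derivative_def frechet_m(2)[OF findim_real c] by metis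
qed

text \<open>\<open>jZ (fld \<eta> z)\<close> is the gradient of \<open>m\<close> for the Kaehler
  metric and also the velocity of the flow of \<open>gam\<close>; the derivative is its squared
  length.\<close>

lemma m_flow_derivative:
  "((\<lambda>t. m (\<phi> (gam t) z)) has_real_derivative
    \<omega> (\<phi> (gam t) z) (fld \<eta> (\<phi> (gam t) z)) (jZ (fld \<eta> (\<phi> (gam t) z)))) (at t)"
  using m_curve_derivative[OF smooth_flow[of "j \<eta>" z], of t] by (simp add: tangent_flow fld_j)

lemma m_flow_mono: "s \<le> t \<Longrightarrow> m (\<phi> (gam s) z) \<le> m (\<phi> (gam t) z)"
  by (rule DERIV_nonneg_imp_nondecreasing) (use m_flow_derivative omega_nonneg in blast)+

definition "gfix z \<longleftrightarrow> (\<forall>t. \<phi> (gam t) z = z)"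

lemma gam_add: "gam (s + t) = gam s \<otimes> gam t" by (rule ex_add)

lemma gfix_fld: "gfix z \<Longrightarrow> fld \<eta> z = 0"
proof -
  assume "gfix z"
  then have "(\<lambda>t. \<phi> (gam t) z) = (\<lambda>t. z)" by (auto simp: gfix_def)
  then have "fld (j \<eta>) z = 0" by (simp add: fld_curve tangent_map_const)
  then show ?thesis by (simp add: fld_j complex_structureD(8)[OF csZ])
qed

text \<open>Monotonicity makes \<open>m\<close> constant along the flow between the two times, so
  the velocity vanishes there and the flow line is constant on an interval. By the group law the
  elements of \<open>gam\<close> for all small times then fix \<open>z\<close>, and they generate
  the rest.\<close>

lemma m_constant_imp_gfix:
  assumes st: "s < t" and eq: "m (\<phi> (gam s) z) = m (\<phi> (gam t) z)"
  shows "gfix z"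
proof -
  let ?I = "{s<..<t}"
  have const: "m (\<phi> (gam r) z) = m (\<phi> (gam s) z)" if "r \<in> ?I" for r
    using m_flow_mono[of s r z] m_flow_mono[of r t z] that eq by auto
  have zero: "tangent_map vector_atlas AZ (\<lambda>t. \<phi> (gam t) z) r 1 = 0" if r: "r \<in> ?I" for r
  proof -
    let ?y = "\<phi> (gam r) z"
    have "((\<lambda>r. m (\<phi> (gam s) z)) has_real_derivative \<omega> ?y (fld \<eta> ?y) (jZ (fld \<eta> ?y))) (at r)"
      by (rule has_field_derivative_transform_within_open[OF m_flow_derivative open_greaterThanLessThan r]) (rule const)
    then have "\<omega> ?y (fld \<eta> ?y) (jZ (fld \<eta> ?y)) = 0" using DERIV_unique DERIV_const by blast
    then have "fld \<eta> ?y = 0" using omega_pos[of "fld \<eta> ?y" ?y] by force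
    then show ?thesis by (simp add: tangent_flow fld_j complex_structureD[OF csZ])
  qed
  define a where "a = (s + t) / 2"
  define d where "d = (t - s) / 2"
  have d: "d > 0" using st by (simp add: d_def)
  have small: "\<phi> (gam h) z = z" if "\<bar>h\<bar> < d" for h
  proof -
    have "\<phi> (gam (a + h)) z = \<phi> (gam a) z"
      by (rule smooth_curve_constant[OF sZ smooth_flow open_greaterThanLessThan connected_Ioo zero])
        (use that st in \<open>auto simp: a_def d_def abs_less_iff field_simps\<close>)
    then have "\<phi> (gam a) (\<phi> (gam h) z) = \<phi> (gam a) z" by (simp only: gam_add act_mult)
    then show ?thesis using act_inv(1) by metis
  qed
  have it: "\<phi> (gam (real n * h)) z = z" if "\<bar>h\<bar> < d" for n h
  proof (induction n)
    case 0
    then show ?case by (simp add: ex_zero)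
  next
    case (Suc n)
    have "real (Suc n) * h = h + real n * h" by (simp add: algebra_simps)
    then show ?case using Suc small[OF that] by (simp only: gam_add act_mult)
  qed
  show ?thesis
    unfolding gfix_def
  proof
    fix r :: real
    \<comment> \<open>Any time is an \<open>n\<close>-fold multiple of one below the threshold
      \<open>d\<close>.\<close>
    obtain n where n: "\<bar>r\<bar> / d < real n" using reals_Archimedean2 by blast
    then have n0: "real n > 0" using d by (smt (verit) divide_nonneg_pos abs_ge_zero)
    have "\<bar>r / real n\<bar> < d" using n n0 d by (simp add: field_simps)
    from it[OF this, of n] show "\<phi> (gam r) z = z" using n0 by simp
  qed
qed

lemma gfix_commuting:
  assumes l: "\<And>s. l \<otimes> gam s = gam s \<otimes> l" and p: "gfix p"
  shows "gfix (\<phi> l p)"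
  unfolding gfix_def using p l act_mult unfolding gfix_def by metis

text \<open>Both polar factors of \<open>l\<close> are harmless. Along
  \<open>ex (t *\<^sub>R j \<xi>)\<close> the point stays fixed by the flow, so the field of
  \<open>\<eta>\<close>, and with it the differential of \<open>m\<close>, vanishes; the factor in
  \<open>U\<close> fixes \<open>\<eta>\<close> and equivariance applies.\<close>

lemma m_commuting:
  assumes l: "\<And>s. l \<otimes> gam s = gam s \<otimes> l" and p: "gfix p"
  shows "m (\<phi> l p) = m p"
proof -
  obtain k \<xi> where k: "k \<in> U" and xi: "\<xi> \<in> \<uu>" and lk: "l = k \<otimes> ex (j \<xi>)" and Adk: "Ad k \<eta> = \<eta>"
    and comm: "\<And>s t. ex (t *\<^sub>R j \<xi>) \<otimes> gam s = gam s \<otimes> ex (t *\<^sub>R j \<xi>)"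
    using commuting_polar[OF eta l] by blast
  let ?c = "\<lambda>t. \<phi> (ex (t *\<^sub>R j \<xi>)) p"
  have "gfix (?c t)" for t by (rule gfix_commuting[OF comm p])
  then have "((\<lambda>t. m (?c t)) has_real_derivative 0) (at t)" for t
    using m_curve_derivative[OF smooth_flow[of "j \<xi>" p], of t] by (simp add: gfix_fld omega_simps)
  then have "m (?c 1) = m (?c 0)" using DERIV_isconst_all[of "\<lambda>t. m (?c t)"] by blast
  then have 1: "m (\<phi> (ex (j \<xi>)) p) = m p" by (simp add: ex_zero)
  have "Ad (inv k) \<eta> = \<eta>" using Ad_inv(1)[of k \<eta>] Adk by simp
  then show ?thesis using mom_equivariant[OF k eta, of "\<phi> (ex (j \<xi>)) p"] 1 by (simp add: lk act_mult)
qed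

end

end

section \<open>Differentiating a two-form along maps\<close>

lemma bilinear_eq_sum_representation:
  fixes h :: "'f::real_vector \<Rightarrow> 'f \<Rightarrow> real"
  assumes B: "finite B" "independent B" "span B = UNIV" and h: "bilinear h"
  shows "h v w = (\<Sum>a\<in>B. \<Sum>b\<in>B. representation B v a * representation B w b * h a b)"
proof -
  have "h v w = (\<Sum>a\<in>B. representation B v a *\<^sub>R h a w)"
    by (rule linear_eq_sum_representation[OF B, of "\<lambda>v. h v w"]) (use h in \<open>simp add: bilinear_def\<close>)
  also have "\<dots> = (\<Sum>a\<in>B. representation B v a * (\<Sum>b\<in>B. representation B w b *\<^sub>R h a b))"
  proof (rule sum.cong[OF refl])
    fix a
    have "h a w = (\<Sum>b\<in>B. representation B w b *\<^sub>R h a b)"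
      by (rule linear_eq_sum_representation[OF B]) (use h in \<open>simp add: bilinear_def\<close>)
    then show "representation B v a *\<^sub>R h a w = representation B v a * (\<Sum>b\<in>B. representation B w b *\<^sub>R h a b)" by simp
  qed
  finally show ?thesis by (simp add: sum_distrib_left mult.assoc)
qed

text \<open>Leibniz rule for a form evaluated on two varying vectors at a varying point, obtained by
  expansion in a basis. The last term differentiates the coefficients of the form with the vectors
  held fixed.\<close>

lemma smooth_form_product:
  fixes \<theta> :: "'f::real_normed_vector \<Rightarrow> 'f \<Rightarrow> 'f \<Rightarrow> real" and g :: "'a::real_normed_vector \<Rightarrow> 'f"
  assumes fd: "findim TYPE('f)" and W: "open W" and Ob: "open Ob"
    and bil: "\<And>x. x \<in> Ob \<Longrightarrow> bilinear (\<theta> x)" and sm: "\<And>a b. smooth_on Ob (\<lambda>x. \<theta> x a b)"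
    and g: "smooth_on W g" "g ` W \<subseteq> Ob" and X: "smooth_on W X" and Y: "smooth_on W Y"
  shows "smooth_on W (\<lambda>u. \<theta> (g u) (X u) (Y u))"
    and "u \<in> W \<Longrightarrow> frechet_derivative (\<lambda>u. \<theta> (g u) (X u) (Y u)) (at u) h =
      \<theta> (g u) (frechet_derivative X (at u) h) (Y u) + \<theta> (g u) (X u) (frechet_derivative Y (at u) h) +
      frechet_derivative (\<lambda>x. \<theta> x (X u) (Y u)) (at (g u)) (frechet_derivative g (at u) h)"
proof -
  obtain B :: "'f set" where B: "finite B" "independent B" "span B = UNIV"
    using findim_basis[OF fd] .
  note bl = representation_bounded_linear[OF B]
  let ?q = "\<lambda>u. \<Sum>a\<in>B. \<Sum>b\<in>B. representation B (X u) a * representation B (Y u) b * \<theta> (g u) a b"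
  have eq: "\<theta> (g u) (X u) (Y u) = ?q u" if "u \<in> W" for u
    by (rule bilinear_eq_sum_representation[OF B bil]) (use g that in auto)
  have sc: "smooth_on W (\<lambda>u. representation B (Z u) a)" if "smooth_on W Z" for Z a
    using that Ck_on_linear_compose[OF bl W] by (auto simp: smooth_on_def)
  have st: "smooth_on W (\<lambda>u. \<theta> (g u) a b)" for a b
    by (rule smooth_on_compose[OF fd W Ob g(1) sm g(2)])
  have "smooth_on W (\<lambda>u. \<Sum>a\<in>B. \<Sum>b\<in>B. representation B (X u) a *\<^sub>R (representation B (Y u) b *\<^sub>R \<theta> (g u) a b))"
    by (intro smooth_on_sum smooth_on_scaleR W sc X Y st)
  then show "smooth_on W (\<lambda>u. \<theta> (g u) (X u) (Y u))"
    by (rule smooth_on_cong[OF W, rotated]) (simp add: eq mult.assoc)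
  assume u: "u \<in> W"
  let ?r = "\<lambda>v a. representation B v a"
  have dX: "((\<lambda>u. ?r (X u) a) has_derivative (\<lambda>h. ?r (frechet_derivative X (at u) h) a)) (at u)" for a
    by (rule bounded_linear.has_derivative[OF bl smooth_on_has_derivative[OF X u]])
  have dY: "((\<lambda>u. ?r (Y u) a) has_derivative (\<lambda>h. ?r (frechet_derivative Y (at u) h) a)) (at u)" for a
    by (rule bounded_linear.has_derivative[OF bl smooth_on_has_derivative[OF Y u]])
  have gu: "g u \<in> Ob" using g(2) u by auto
  have dt: "((\<lambda>u. \<theta> (g u) a b) has_derivative
      (\<lambda>h. frechet_derivative (\<lambda>x. \<theta> x a b) (at (g u)) (frechet_derivative g (at u) h))) (at u)" for a b
    by (rule has_derivative_compose[OF smooth_on_has_derivative[OF g(1) u] smooth_on_has_derivative[OF sm gu]])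
  let ?d1 = "\<lambda>h a b. ?r (frechet_derivative X (at u) h) a * ?r (Y u) b * \<theta> (g u) a b"
  let ?d2 = "\<lambda>h a b. ?r (X u) a * ?r (frechet_derivative Y (at u) h) b * \<theta> (g u) a b"
  let ?d3 = "\<lambda>k a b. ?r (X u) a * ?r (Y u) b * frechet_derivative (\<lambda>x. \<theta> x a b) (at (g u)) k"
  have "((\<lambda>u. ?r (X u) a * ?r (Y u) b * \<theta> (g u) a b) has_derivative
      (\<lambda>h. ?d1 h a b + ?d2 h a b + ?d3 (frechet_derivative g (at u) h) a b)) (at u)" for a b
    by (rule has_derivative_eq_rhs[OF has_derivative_mult[OF has_derivative_mult[OF dX dY] dt]])
      (simp add: fun_eq_iff algebra_simps)
  then have "(?q has_derivative (\<lambda>h. \<Sum>a\<in>B. \<Sum>b\<in>B. ?d1 h a b + ?d2 h a b + ?d3 (frechet_derivative g (at u) h) a b)) (at u)"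
    by (intro has_derivative_sum)
  then have "((\<lambda>u. \<theta> (g u) (X u) (Y u)) has_derivative
      (\<lambda>h. \<Sum>a\<in>B. \<Sum>b\<in>B. ?d1 h a b + ?d2 h a b + ?d3 (frechet_derivative g (at u) h) a b)) (at u)"
    by (rule has_derivative_transform_within_open[OF _ W u]) (simp add: eq)
  then have "frechet_derivative (\<lambda>u. \<theta> (g u) (X u) (Y u)) (at u) h =
      (\<Sum>a\<in>B. \<Sum>b\<in>B. ?d1 h a b + ?d2 h a b + ?d3 (frechet_derivative g (at u) h) a b)"
    by (simp add: frechet_derivative_eqI)
  also have "\<dots> = (\<Sum>a\<in>B. \<Sum>b\<in>B. ?d1 h a b) + (\<Sum>a\<in>B. \<Sum>b\<in>B. ?d2 h a b) +
      (\<Sum>a\<in>B. \<Sum>b\<in>B. ?d3 (frechet_derivative g (at u) h) a b)"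
    by (simp add: sum.distrib)
  also have "(\<Sum>a\<in>B. \<Sum>b\<in>B. ?d1 h a b) = \<theta> (g u) (frechet_derivative X (at u) h) (Y u)"
    by (rule bilinear_eq_sum_representation[OF B bil[OF gu], symmetric])
  also have "(\<Sum>a\<in>B. \<Sum>b\<in>B. ?d2 h a b) = \<theta> (g u) (X u) (frechet_derivative Y (at u) h)"
    by (rule bilinear_eq_sum_representation[OF B bil[OF gu], symmetric])
  also have "(\<Sum>a\<in>B. \<Sum>b\<in>B. ?d3 k a b) = frechet_derivative (\<lambda>x. \<theta> x (X u) (Y u)) (at (g u)) k" for k
  proof -
    have "((\<lambda>x. \<Sum>a\<in>B. \<Sum>b\<in>B. ?r (X u) a * ?r (Y u) b * \<theta> x a b) has_derivative
        (\<lambda>k. \<Sum>a\<in>B. \<Sum>b\<in>B. ?d3 k a b)) (at (g u))"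
      by (intro has_derivative_sum has_derivative_mult_right smooth_on_has_derivative[OF sm gu])
    then have "((\<lambda>x. \<theta> x (X u) (Y u)) has_derivative (\<lambda>k. \<Sum>a\<in>B. \<Sum>b\<in>B. ?d3 k a b)) (at (g u))"
      by (rule has_derivative_transform_within_open[OF _ Ob gu])
        (simp add: bilinear_eq_sum_representation[OF B bil, of _ "X u" "Y u"])
    from frechet_derivative_eqI[OF this] show ?thesis by simp
  qed
  finally show "frechet_derivative (\<lambda>u. \<theta> (g u) (X u) (Y u)) (at u) h =
      \<theta> (g u) (frechet_derivative X (at u) h) (Y u) + \<theta> (g u) (X u) (frechet_derivative Y (at u) h) +
      frechet_derivative (\<lambda>x. \<theta> x (X u) (Y u)) (at (g u)) (frechet_derivative g (at u) h)" .
qed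

section \<open>The maximum principle along holomorphic curves\<close>

text \<open>In a chart, the terms with second derivatives of the map cancel in the cyclic sum.\<close>

lemma pullback_closed:
  fixes f :: "'a::{real_normed_vector, second_countable_topology} \<Rightarrow> 'p::{t2_space, second_countable_topology}"
    and AZ :: "('p, 'f::real_normed_vector) chart set"
  assumes fda: "findim TYPE('a)" and sZ: "smooth_atlas AZ"
    and \<omega>: "smooth_2form AZ \<omega>" "closed_2form AZ \<omega>" and f: "smooth_map vector_atlas AZ f"
  defines "pb \<equiv> \<lambda>v w u. \<omega> (f u) (tangent_map vector_atlas AZ f u v) (tangent_map vector_atlas AZ f u w)"
  shows "smooth_on UNIV (pb v w)"
    and "frechet_derivative (pb v w) (at u0) k + frechet_derivative (pb w k) (at u0) v +
      frechet_derivative (pb k v) (at u0) w = 0"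
proof -
  note Va = smooth_atlas_vector[OF fda]
  have fdf: "findim TYPE('f)" by (rule smooth_atlas_findim[OF sZ])
  have bil: "bilinear (\<omega> p)" and self: "\<omega> p x x = 0" for p x using \<omega>(1) by (auto simp: smooth_2form_def)
  have anti: "\<omega> p x y = - \<omega> p y x" for p x y
  proof -
    have "\<omega> p (x + y) (x + y) = \<omega> p x y + \<omega> p y x"
      unfolding bilinear_ladd[OF bil] bilinear_radd[OF bil] by (simp add: self)
    then show ?thesis using self[of p "x + y"] by simp
  qed
  have loc: "\<exists>W. open W \<and> u0 \<in> W \<and> smooth_on W (pb v w) \<and>
      frechet_derivative (pb v w) (at u0) k + frechet_derivative (pb w k) (at u0) v +
      frechet_derivative (pb k v) (at u0) w = 0" for u0 v w k
  proof -
    define d where "d = chart_at AZ (f u0)"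
    have d: "d \<in> AZ" "f u0 \<in> fst d" using chart_at[OF sZ] by (auto simp: d_def)
    note dD = smooth_atlasD[OF sZ d(1)]
    define W where "W = f -` fst d"
    have W: "open W" unfolding W_def by (rule smooth_map_open_vimage[OF f dD(1)])
    have u0: "u0 \<in> W" using d by (simp add: W_def)
    define g where "g = snd d \<circ> f"
    have sg: "smooth_on W g"
      using smooth_map_chart[OF f _ d(1), of "(UNIV, \<lambda>x. x)"] by (simp add: vector_atlas_mem g_def W_def comp_def)
    let ?O = "snd d ` fst d"
    define \<theta> where "\<theta> = form_in_chart AZ \<omega> d"
    have gO: "g ` W \<subseteq> ?O" by (auto simp: g_def W_def)
    have th: "\<theta> x v w = \<omega> (chart_inv d x) (chart_deriv d (chart_at AZ (chart_inv d x)) (\<lambda>p. p) (chart_inv d x) v)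
        (chart_deriv d (chart_at AZ (chart_inv d x)) (\<lambda>p. p) (chart_inv d x) w)" if "x \<in> ?O" for x v w
      using dD(6)[OF that] by (simp add: \<theta>_def form_in_chart_def Let_def chart_deriv_def comp_def)
    have lin: "linear (chart_deriv d (chart_at AZ (chart_inv d x)) (\<lambda>p. p) (chart_inv d x))" if "x \<in> ?O" for x
      by (rule chart_deriv_linear[OF smooth_map_id[OF sZ]]) (use d dD(7)[OF that] chart_at[OF sZ] in auto)
    have bilt: "bilinear (\<theta> x)" if x: "x \<in> ?O" for x
      using bil[of "chart_inv d x"] lin[OF x]
      unfolding bilinear_def th[OF x] by (auto intro: linear_compose[unfolded comp_def])
    have antit: "\<theta> x v w = - \<theta> x w v" if x: "x \<in> ?O" for x v w unfolding th[OF x] by (rule anti)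
    have smt: "smooth_on ?O (\<lambda>x. \<theta> x v w)" for v w using \<omega>(1) d by (simp add: smooth_2form_def \<theta>_def)
    have clo: "frechet_derivative (\<lambda>x. \<theta> x v w) (at x) k + frechet_derivative (\<lambda>x. \<theta> x w k) (at x) v +
        frechet_derivative (\<lambda>x. \<theta> x k v) (at x) w = 0" if "x \<in> ?O" for x k v w
      using \<omega>(2) d(1) that unfolding closed_2form_def \<theta>_def by blast
    let ?D = "\<lambda>v u. frechet_derivative g (at u) v"
    \<comment> \<open>The definition of \<open>pb\<close> refers to the preferred chart at
      \<open>f u\<close>, which changes with \<open>u\<close>. On \<open>W\<close> everything is
      rewritten in the single chart \<open>d\<close>, where derivatives may be taken.\<close>
    have pbe: "pb v w u = \<theta> (g u) (?D v u) (?D w u)" if u: "u \<in> W" for u v w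
    proof -
      have fu: "f u \<in> fst d" using u by (simp add: W_def)
      have gu: "g u \<in> ?O" "chart_inv d (g u) = f u" using gO u dD(5)[OF fu] by (auto simp: g_def)
      have "tangent_map vector_atlas AZ f u v = chart_deriv d (chart_at AZ (f u)) (\<lambda>p. p) (f u) (?D v u)" for v
      proof -
        have "chart_deriv (UNIV, \<lambda>x. x) (chart_at AZ (f u)) f u v =
            chart_deriv d (chart_at AZ (f u)) (\<lambda>p. p) (f u) (chart_deriv (UNIV, \<lambda>x. x) d f u v)"
          by (rule chart_deriv_compose[OF Va sZ sZ f smooth_map_id[OF sZ]])
            (use d fu chart_at[OF sZ] in \<open>auto simp: vector_atlas_mem\<close>)
        moreover have "chart_deriv (UNIV, \<lambda>x. x) d f u v = ?D v u" by (simp add: chart_deriv_def g_def comp_def)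
        ultimately show ?thesis by (simp add: tangent_map_chart_deriv)
      qed
      then show ?thesis unfolding pb_def th[OF gu(1)] gu(2) by simp
    qed
    note sD = smooth_on_frechet[OF sg]
    have sfp1: "smooth_on W (\<lambda>u. \<theta> (g u) (?D v u) (?D w u))" for v w
      by (rule smooth_form_product(1)[OF fdf W dD(2) bilt smt sg gO sD sD])
    have sfp2: "frechet_derivative (\<lambda>u. \<theta> (g u) (?D v u) (?D w u)) (at u0) k =
        \<theta> (g u0) (frechet_derivative (?D v) (at u0) k) (?D w u0) + \<theta> (g u0) (?D v u0) (frechet_derivative (?D w) (at u0) k) +
        frechet_derivative (\<lambda>x. \<theta> x (?D v u0) (?D w u0)) (at (g u0)) (?D k u0)" for v w k
      by (rule smooth_form_product(2)[OF fdf W dD(2) bilt smt sg gO sD sD]) (use u0 in auto)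
    have 1: "smooth_on W (pb v w)" by (rule smooth_on_cong[OF W _ sfp1]) (simp add: pbe)
    let ?DD = "\<lambda>v k. frechet_derivative (?D v) (at u0) k"
    have der: "frechet_derivative (pb v w) (at u0) k = \<theta> (g u0) (?DD v k) (?D w u0) + \<theta> (g u0) (?D v u0) (?DD w k) +
        frechet_derivative (\<lambda>x. \<theta> x (?D v u0) (?D w u0)) (at (g u0)) (?D k u0)" for v w k
      using frechet_derivative_cong_open[OF W u0, of "pb v w" "\<lambda>u. \<theta> (g u) (?D v u) (?D w u)"] pbe sfp2
      by simp
    have sym: "?DD v k = ?DD k v" for v k by (rule symmetric_second_derivative[OF W sg u0])
    have gu0: "g u0 \<in> ?O" using gO u0 by auto
    have "frechet_derivative (pb v w) (at u0) k + frechet_derivative (pb w k) (at u0) v +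
      frechet_derivative (pb k v) (at u0) w = 0"
      unfolding der
      using clo[OF gu0, of "?D v u0" "?D w u0" "?D k u0"] sym[of v k] sym[of w k] sym[of v w]
        antit[OF gu0, of "?D v u0" "?DD w k"] antit[OF gu0, of "?D w u0" "?DD k v"] antit[OF gu0, of "?D k u0" "?DD v w"]
      by simp
    then show ?thesis using W u0 1 by blast
  qed
  show "smooth_on UNIV (pb v w)" by (rule smooth_on_local) (use loc in blast)
  show "frechet_derivative (pb v w) (at u0) k + frechet_derivative (pb w k) (at u0) v +
      frechet_derivative (pb k v) (at u0) w = 0" using loc by blast
qed

text \<open>If the second derivative were positive, the first one would be positive just to the
  right of its zero \<open>x0\<close>, and the mean value theorem would give larger values of
  \<open>g\<close> there.\<close>

lemma second_derivative_local_max: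
  fixes g :: "real \<Rightarrow> real"
  assumes d: "d > 0" and g: "\<And>x. \<bar>x - x0\<bar> < d \<Longrightarrow> (g has_real_derivative g' x) (at x)"
    and g': "(g' has_real_derivative D) (at x0)" and mx: "\<And>x. \<bar>x - x0\<bar> < d \<Longrightarrow> g x \<le> g x0"
  shows "D \<le> 0"
proof (rule ccontr)
  assume "\<not> D \<le> 0"
  then have D: "D > 0" by simp
  have "g' x0 = 0"
    by (rule DERIV_local_max[OF g d]) (use d mx in \<open>auto simp: abs_minus_commute\<close>)
  obtain e where e: "e > 0" "\<And>h. 0 < h \<Longrightarrow> h < e \<Longrightarrow> g' x0 < g' (x0 + h)"
    using DERIV_pos_inc_right[OF g' D] by blast
  define h where "h = min d e / 2"
  have h: "0 < h" "h < d" "h < e" using d e by (auto simp: h_def min_def)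
  have "\<exists>z. x0 < z \<and> z < x0 + h \<and> g (x0 + h) - g x0 = (x0 + h - x0) * g' z"
    by (rule MVT2) (use h g in auto)
  then obtain z where z: "x0 < z" "z < x0 + h" "g (x0 + h) - g x0 = h * g' z" by auto
  have "g' z > 0" using e(2)[of "z - x0"] z h \<open>g' x0 = 0\<close> by simp
  then have "g (x0 + h) > g x0" using z h by (smt (verit) mult_pos_pos)
  then show False using mx[of "x0 + h"] h by simp
qed

text \<open>\<open>h s x y\<close> is the value of \<open>m\<close> after time \<open>s\<close> at the point \<open>(x, y)\<close> of a holomorphic curve, and \<open>E\<close> is
  the pullback of the Kaehler form, a density with respect to \<open>dx dy\<close>. As \<open>E\<close> is nonnegative, its
  evolution bounds the Laplacian of the time integral of \<open>h\<close> from below.\<close>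

locale laplace_flow =
  fixes h hx hxx hy hyy E :: "real \<Rightarrow> real \<Rightarrow> real \<Rightarrow> real"
  assumes hx: "((\<lambda>x. h s x y) has_real_derivative hx s x y) (at x)"
    and hxx: "((\<lambda>x. hx s x y) has_real_derivative hxx s x y) (at x)"
    and hy: "((\<lambda>y. h s x y) has_real_derivative hy s x y) (at y)"
    and hyy: "((\<lambda>y. hy s x y) has_real_derivative hyy s x y) (at y)"
    and E: "((\<lambda>s. E s x y) has_real_derivative hxx s x y + hyy s x y) (at s)"
    and E0: "E s x y \<ge> 0"
    and cont: "continuous_on UNIV (\<lambda>(s, x, y). h s x y)"
      "continuous_on UNIV (\<lambda>(s, x, y). hx s x y)" "continuous_on UNIV (\<lambda>(s, x, y). hxx s x y)"
      "continuous_on UNIV (\<lambda>(s, x, y). hy s x y)" "continuous_on UNIV (\<lambda>(s, x, y). hyy s x y)"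
      "continuous_on UNIV (\<lambda>(s, x, y). E s x y)"
begin

lemma cont3:
  fixes f :: "real \<Rightarrow> real \<Rightarrow> real \<Rightarrow> real" and a b c :: "'u::topological_space \<Rightarrow> real"
  assumes "continuous_on UNIV (\<lambda>(s, x, y). f s x y)"
    and "continuous_on S a" "continuous_on S b" "continuous_on S c"
  shows "continuous_on S (\<lambda>u. f (a u) (b u) (c u))"
proof -
  have "continuous_on S (\<lambda>u. (\<lambda>(s, x, y). f s x y) (a u, b u, c u))"
    by (rule continuous_on_compose2[OF assms(1)]) (use assms in \<open>auto intro: continuous_on_Pair\<close>)
  then show ?thesis by simp
qed

lemma int1:
  fixes f :: "real \<Rightarrow> real \<Rightarrow> real \<Rightarrow> real"
  assumes "continuous_on UNIV (\<lambda>(s, x, y). f s x y)"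
  shows "(\<lambda>s. f s x y) integrable_on {0..t}"
  by (rule integrable_continuous_interval)
    (rule cont3[OF assms continuous_on_id continuous_on_const continuous_on_const])

definition "F t x y = integral (cbox 0 t) (\<lambda>s. h s x y)"
definition "Fx t x y = integral (cbox 0 t) (\<lambda>s. hx s x y)"
definition "Fxx t x y = integral (cbox 0 t) (\<lambda>s. hxx s x y)"
definition "Fy t x y = integral (cbox 0 t) (\<lambda>s. hy s x y)"
definition "Fyy t x y = integral (cbox 0 t) (\<lambda>s. hyy s x y)"

lemma Fx: "((\<lambda>x. F t x y) has_real_derivative Fx t x y) (at x)"
  unfolding F_def Fx_def
  by (rule leibniz_rule_field_derivative[where U = UNIV])
    (auto intro!: hx int1 cont cont3[OF cont(2)] continuous_intros simp: split_beta)

lemma Fxx: "((\<lambda>x. Fx t x y) has_real_derivative Fxx t x y) (at x)"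
  unfolding Fx_def Fxx_def
  by (rule leibniz_rule_field_derivative[where U = UNIV])
    (auto intro!: hxx int1 cont cont3[OF cont(3)] continuous_intros simp: split_beta)

lemma Fy: "((\<lambda>y. F t x y) has_real_derivative Fy t x y) (at y)"
  unfolding F_def Fy_def
  by (rule leibniz_rule_field_derivative[where U = UNIV])
    (auto intro!: hy int1 cont cont3[OF cont(4)] continuous_intros simp: split_beta)

lemma Fyy: "((\<lambda>y. Fy t x y) has_real_derivative Fyy t x y) (at y)"
  unfolding Fy_def Fyy_def
  by (rule leibniz_rule_field_derivative[where U = UNIV])
    (auto intro!: hyy int1 cont cont3[OF cont(5)] continuous_intros simp: split_beta)

text \<open>The evolution equation of \<open>E\<close> is integrated over time. Since
  \<open>E t\<close> is nonnegative, the Laplacian of \<open>F t\<close> is at least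
  \<open>- E 0\<close>, a bound free of \<open>t\<close>.\<close>

lemma laplace_F: "0 \<le> t \<Longrightarrow> Fxx t x y + Fyy t x y = E t x y - E 0 x y"
proof -
  assume t: "0 \<le> t"
  have "Fxx t x y + Fyy t x y = integral (cbox 0 t) (\<lambda>s. hxx s x y + hyy s x y)"
    unfolding Fxx_def Fyy_def by (rule integral_add[symmetric]) (auto intro: int1 cont)
  moreover have "((\<lambda>s. hxx s x y + hyy s x y) has_integral (E t x y - E 0 x y)) {0..t}"
  proof (rule fundamental_theorem_of_calculus[OF t])
    fix s
    show "((\<lambda>s. E s x y) has_vector_derivative hxx s x y + hyy s x y) (at s within {0..t})"
      using E[of x y s] has_vector_derivative_at_within
      unfolding has_real_derivative_iff_has_vector_derivative by blast
  qed
  ultimately show ?thesis by (simp add: integral_unique)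
qed

lemma continuous_F: "continuous_on S (\<lambda>u. F t (fst u) (snd u))"
  unfolding F_def
  by (rule integral_continuous_on_param) (auto intro!: cont3[OF cont(1)] continuous_intros simp: split_beta)

text \<open>The constant \<open>c\<close> stands for the squared distance in the other coordinate.
  The second derivatives in the two directions add up to zero, as the logarithm of the distance is
  harmonic in the plane.\<close>

lemma log_second_derivative:
  fixes x x1 c :: real
  assumes "(x - x1)\<^sup>2 + c > 0"
  shows "((\<lambda>x. ln ((x - x1)\<^sup>2 + c)) has_real_derivative 2 * (x - x1) / ((x - x1)\<^sup>2 + c)) (at x)"
    and "((\<lambda>x. 2 * (x - x1) / ((x - x1)\<^sup>2 + c)) has_real_derivative
      2 / ((x - x1)\<^sup>2 + c) - 4 * (x - x1)\<^sup>2 / ((x - x1)\<^sup>2 + c)\<^sup>2) (at x)"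
proof -
  show "((\<lambda>x. ln ((x - x1)\<^sup>2 + c)) has_real_derivative 2 * (x - x1) / ((x - x1)\<^sup>2 + c)) (at x)"
    using assms by (auto intro!: derivative_eq_intros)
  have d: "((\<lambda>x. 2 * (x - x1) / ((x - x1)\<^sup>2 + c)) has_real_derivative
      (2 * ((x - x1)\<^sup>2 + c) - 2 * (x - x1) * (2 * (x - x1))) / (((x - x1)\<^sup>2 + c) * ((x - x1)\<^sup>2 + c))) (at x)"
    using assms by (auto intro!: derivative_eq_intros)
  have eq: "(2 * q - 2 * z * (2 * z)) / (q * q) = 2 / q - 4 * z\<^sup>2 / q\<^sup>2" if "q \<noteq> 0" for q z :: real
    using that by (simp add: power2_eq_square diff_divide_distrib)
  show "((\<lambda>x. 2 * (x - x1) / ((x - x1)\<^sup>2 + c)) has_real_derivative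
      2 / ((x - x1)\<^sup>2 + c) - 4 * (x - x1)\<^sup>2 / ((x - x1)\<^sup>2 + c)\<^sup>2) (at x)"
    by (rule DERIV_cong[OF d eq]) (use assms in simp)
qed

text \<open>The barrier for the maximum principle: \<open>F t\<close>, made strictly subharmonic by a quadratic term,
  plus a harmonic function with a pole at the centre of a disc missing the basin.\<close>

definition "barrier t K0 K x1 y1 x y =
  F t x y + K0 / 4 * ((x - x1)\<^sup>2 + (y - y1)\<^sup>2) - K / 2 * ln ((x - x1)\<^sup>2 + (y - y1)\<^sup>2)"

text \<open>The Laplacian of the barrier is \<open>E t - E 0 + K0\<close>: the quadratic term
  contributes \<open>K0\<close> and the logarithm nothing. It is positive, whereas at a local
  maximum neither pure second derivative is.\<close>

lemma barrier_no_local_max: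
  assumes t: "0 \<le> t" and q: "(x - x1)\<^sup>2 + (y - y1)\<^sup>2 > 0" and K0: "E 0 x y < K0"
    and d: "d > 0" and mx: "\<And>x' y'. dist (x', y') (x, y) < d \<Longrightarrow> barrier t K0 K x1 y1 x' y' \<le> barrier t K0 K x1 y1 x y"
    and qd: "\<And>x' y'. dist (x', y') (x, y) < d \<Longrightarrow> (x' - x1)\<^sup>2 + (y' - y1)\<^sup>2 > 0"
  shows False
proof -
  let ?q = "(x - x1)\<^sup>2 + (y - y1)\<^sup>2"
  have "Fxx t x y + K0 / 4 * 2 - K / 2 * (2 / ?q - 4 * (x - x1)\<^sup>2 / ?q\<^sup>2) \<le> 0"
  proof (rule second_derivative_local_max[OF d])
    fix x' assume "\<bar>x' - x\<bar> < d"
    then have dd: "dist (x', y) (x, y) < d" by (simp add: dist_Pair_Pair dist_real_def)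
    show "((\<lambda>x. barrier t K0 K x1 y1 x y) has_real_derivative
        Fx t x' y + K0 / 4 * (2 * (x' - x1)) - K / 2 * (2 * (x' - x1) / ((x' - x1)\<^sup>2 + (y - y1)\<^sup>2))) (at x')"
      unfolding barrier_def
      by (intro DERIV_diff DERIV_add Fx DERIV_cmult log_second_derivative(1) qd dd)
        (auto intro!: derivative_eq_intros)
    show "barrier t K0 K x1 y1 x' y \<le> barrier t K0 K x1 y1 x y" by (rule mx[OF dd])
  next
    show "((\<lambda>x'. Fx t x' y + K0 / 4 * (2 * (x' - x1)) - K / 2 * (2 * (x' - x1) / ((x' - x1)\<^sup>2 + (y - y1)\<^sup>2)))
        has_real_derivative Fxx t x y + K0 / 4 * 2 - K / 2 * (2 / ?q - 4 * (x - x1)\<^sup>2 / ?q\<^sup>2)) (at x)"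
      by (intro DERIV_diff DERIV_add Fxx DERIV_cmult log_second_derivative(2) q)
        (auto intro!: derivative_eq_intros)
  qed
  moreover have "Fyy t x y + K0 / 4 * 2 - K / 2 * (2 / ?q - 4 * (y - y1)\<^sup>2 / ?q\<^sup>2) \<le> 0"
  proof (rule second_derivative_local_max[OF d])
    have sw: "barrier t K0 K x1 y1 x y = F t x y + K0 / 4 * ((y - y1)\<^sup>2 + (x - x1)\<^sup>2) - K / 2 * ln ((y - y1)\<^sup>2 + (x - x1)\<^sup>2)" for y
      by (simp add: barrier_def add.commute)
    fix y' assume "\<bar>y' - y\<bar> < d"
    then have dd: "dist (x, y') (x, y) < d" by (simp add: dist_Pair_Pair dist_real_def)
    have q': "(y' - y1)\<^sup>2 + (x - x1)\<^sup>2 > 0" using qd[OF dd] by (simp add: add.commute)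
    show "((\<lambda>y. barrier t K0 K x1 y1 x y) has_real_derivative
        Fy t x y' + K0 / 4 * (2 * (y' - y1)) - K / 2 * (2 * (y' - y1) / ((y' - y1)\<^sup>2 + (x - x1)\<^sup>2))) (at y')"
      unfolding sw
      by (intro DERIV_diff DERIV_add Fy DERIV_cmult log_second_derivative(1) q')
        (auto intro!: derivative_eq_intros)
    show "barrier t K0 K x1 y1 x y' \<le> barrier t K0 K x1 y1 x y" by (rule mx[OF dd])
  next
    have q': "(y - y1)\<^sup>2 + (x - x1)\<^sup>2 > 0" "?q = (y - y1)\<^sup>2 + (x - x1)\<^sup>2" using q by (simp_all add: add.commute)
    show "((\<lambda>y'. Fy t x y' + K0 / 4 * (2 * (y' - y1)) - K / 2 * (2 * (y' - y1) / ((y' - y1)\<^sup>2 + (x - x1)\<^sup>2)))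
        has_real_derivative Fyy t x y + K0 / 4 * 2 - K / 2 * (2 / ?q - 4 * (y - y1)\<^sup>2 / ?q\<^sup>2)) (at y)"
      unfolding q'(2)
      by (intro DERIV_diff DERIV_add Fyy DERIV_cmult log_second_derivative(2) q'(1))
        (auto intro!: derivative_eq_intros)
  qed
  \<comment> \<open>Harmonicity of the logarithm away from its pole.\<close>
  moreover have "(2 / ?q - 4 * (x - x1)\<^sup>2 / ?q\<^sup>2) + (2 / ?q - 4 * (y - y1)\<^sup>2 / ?q\<^sup>2) = 0"
  proof -
    have gen: "4 * Q / Q\<^sup>2 = 4 / Q" if "Q \<noteq> 0" for Q :: real using that by (simp add: power2_eq_square)
    have "4 * (x - x1)\<^sup>2 / ?q\<^sup>2 + 4 * (y - y1)\<^sup>2 / ?q\<^sup>2 = 4 * ?q / ?q\<^sup>2" by (simp add: add_divide_distrib[symmetric])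
    also have "\<dots> = 4 / ?q" by (rule gen) (use q in linarith)
    finally show ?thesis by simp
  qed
  then have "K / 2 * (2 / ?q - 4 * (x - x1)\<^sup>2 / ?q\<^sup>2) + K / 2 * (2 / ?q - 4 * (y - y1)\<^sup>2 / ?q\<^sup>2) = 0"
    by (simp only: distrib_left[symmetric] mult_zero_right)
  ultimately have "E t x y - E 0 x y + K0 \<le> 0" using laplace_F[OF t, of x y] by linarith
  then show False using E0[of t x y] K0 by linarith
qed

text \<open>Suppose a disc around \<open>u1\<close> misses the closure of \<open>V\<close>. The
  barrier with pole at \<open>u1\<close> attains its maximum over the closure of
  \<open>V \<inter> ball u1 R\<close>. Inside this contradicts subharmonicity, and on both parts of
  the boundary the constants \<open>K\<close> and \<open>t\<close> make the barrier smaller than at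
  \<open>p0\<close>.\<close>

theorem basin_dense:
  fixes V :: "(real \<times> real) set"
  assumes V: "open V" and p0: "p0 \<in> V" and hp: "\<And>s. 0 \<le> s \<Longrightarrow> h s (fst p0) (snd p0) = a"
    and le: "\<And>u s. u \<in> closure V \<Longrightarrow> 0 \<le> s \<Longrightarrow> h s (fst u) (snd u) \<le> a"
    and fr: "\<And>u s. u \<in> frontier V \<Longrightarrow> 0 \<le> s \<Longrightarrow> h s (fst u) (snd u) \<le> a - \<delta>" and \<delta>: "\<delta> > 0"
  shows "closure V = UNIV"
proof (rule ccontr)
  assume "closure V \<noteq> UNIV"
  then obtain u1 where u1: "u1 \<in> - closure V" by blast
  then obtain r where r: "r > 0" "ball u1 r \<subseteq> - closure V" using openE[of "- closure V" u1] by auto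
  obtain x1 y1 where xy1: "u1 = (x1, y1)" by (cases u1)
  define D where "D = dist p0 u1"
  have p0c: "p0 \<in> closure V" using p0 closure_subset by blast
  have "p0 \<notin> ball u1 r" using r p0c by blast
  then have D: "D \<ge> r" by (simp add: D_def dist_commute)
  define R where "R = D + 1"
  have R: "R > 0" "D < R" "r < R" using D r by (auto simp: R_def)
  have q_dist: "(x - x1)\<^sup>2 + (y - y1)\<^sup>2 = (dist (x, y) u1)\<^sup>2" for x y
    by (simp add: xy1 dist_Pair_Pair dist_real_def)
  have "continuous_on (cball u1 R) (\<lambda>u. E 0 (fst u) (snd u))"
    by (intro cont3[OF cont(6)] continuous_intros)
  then have "bounded ((\<lambda>u. E 0 (fst u) (snd u)) ` cball u1 R)"
    by (intro compact_imp_bounded compact_continuous_image) auto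
  then obtain K0 where K0: "K0 > 0" "\<And>u. u \<in> cball u1 R \<Longrightarrow> \<bar>E 0 (fst u) (snd u)\<bar> < K0"
  proof -
    obtain b where b: "b > 0" "\<forall>v\<in>(\<lambda>u. E 0 (fst u) (snd u)) ` cball u1 R. norm v < b"
      using \<open>bounded _\<close> unfolding bounded_pos_less by blast
    show thesis by (rule that[OF b(1)]) (use b(2) in force)
  qed
  have lRD: "ln (R / D) > 0" using R D r by (intro ln_gt_zero) (simp add: less_divide_eq_1_pos)
  \<comment> \<open>The gain of the logarithm at \<open>p0\<close>, compared with the circle of
    radius \<open>R\<close>, exceeds the largest possible quadratic term by 1. \<open>R > D\<close>
    makes the logarithm in the denominator positive.\<close>
  define K where "K = (K0 * R\<^sup>2 / 4 + 1) / ln (R / D)"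
  have K: "K > 0" "K * ln (R / D) = K0 * R\<^sup>2 / 4 + 1" using lRD K0 R by (auto simp: K_def add_nonneg_pos)
  \<comment> \<open>The deficit \<open>t * \<delta>\<close> on the frontier of \<open>V\<close>
    compensates the largest excess of the logarithm there, as the frontier has distance at least
    \<open>r\<close> from the pole.\<close>
  define t where "t = K * ln (R / r) / \<delta>"
  have lRr: "ln (R / r) > 0" using R r by (intro ln_gt_zero) (simp add: less_divide_eq_1_pos)
  have t: "0 \<le> t" "t * \<delta> = K * ln (R / r)" using K \<delta> lRr by (auto simp: t_def)
  let ?f = "\<lambda>u. barrier t K0 K x1 y1 (fst u) (snd u)"
  have f_eq: "?f u = F t (fst u) (snd u) + K0 / 4 * (dist u u1)\<^sup>2 - K * ln (dist u u1)" if "u \<noteq> u1" for u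
    using that q_dist[of "fst u" "snd u"] by (simp add: barrier_def ln_realpow)
  define W where "W = V \<inter> ball u1 R"
  have W: "open W" using V by (simp add: W_def open_Int)
  have clW: "closure W \<subseteq> closure V \<inter> cball u1 R"
    by (intro Int_greatest closure_mono closure_minimal) (auto simp: W_def)
  have far: "dist u u1 \<ge> r" if "u \<in> closure V" for u
  proof -
    have "u \<notin> ball u1 r" using r that by blast
    then show ?thesis by (simp add: dist_commute)
  qed
  have ne: "u \<noteq> u1" if "u \<in> closure V" for u using far[OF that] r by auto
  have "bounded (closure W)" by (rule bounded_subset[OF bounded_cball]) (use clW in blast)
  then have compW: "compact (closure W)" by (simp add: compact_eq_bounded_closed)
  have p0W: "p0 \<in> W" using p0 R by (simp add: W_def D_def dist_commute)
  have "continuous_on (closure W) (\<lambda>u. F t (fst u) (snd u) + K0 / 4 * (dist u u1)\<^sup>2 - K * ln (dist u u1))"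
    using ne clW by (intro continuous_intros continuous_F) auto
  then have "continuous_on (closure W) ?f"
    by (rule continuous_on_eq) (use f_eq ne clW in auto)
  from continuous_attains_sup[OF compW _ this] obtain w where w: "w \<in> closure W" "\<And>u. u \<in> closure W \<Longrightarrow> ?f u \<le> ?f w"
    using p0W closure_subset by blast
  have Fle: "F t (fst u) (snd u) \<le> t * b" if "\<And>s. 0 \<le> s \<Longrightarrow> h s (fst u) (snd u) \<le> b" for u b
  proof -
    have "F t (fst u) (snd u) \<le> integral (cbox 0 t) (\<lambda>s. b)"
      unfolding F_def by (rule integral_le) (use that in \<open>auto intro: int1 cont integrable_const\<close>)
    then show ?thesis using t by simp
  qed
  have "F t (fst p0) (snd p0) = integral (cbox 0 t) (\<lambda>s. a)"
    unfolding F_def by (rule integral_cong) (simp add: hp)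
  then have Fp: "F t (fst p0) (snd p0) = t * a" using t by simp
  have "?f p0 = t * a + K0 / 4 * D\<^sup>2 - K * ln D" using f_eq[OF ne[OF p0c]] Fp by (simp add: D_def)
  moreover have "K * ln (R / D) = K * ln R - K * ln D" using R D r by (simp add: ln_div right_diff_distrib)
  moreover have "0 \<le> K0 / 4 * D\<^sup>2" using K0(1) by simp
  ultimately have fp0: "?f p0 \<ge> t * a + K0 * R\<^sup>2 / 4 + 1 - K * ln R" using K(2) by linarith
  have wV: "w \<in> closure V" "dist w u1 \<le> R" using w(1) clW by (auto simp: dist_commute)
  have dw: "dist w u1 > 0" using ne[OF wV(1)] by simp
  have quad: "K0 / 4 * (dist w u1)\<^sup>2 \<le> K0 * R\<^sup>2 / 4"
    using mult_left_mono[OF power_mono[OF wV(2) zero_le_dist, of 2], of "K0 / 4"] K0 by simp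
  have fw: "?f w \<ge> t * a + K0 * R\<^sup>2 / 4 + 1 - K * ln R"
    using w(2)[of p0] p0W closure_subset fp0 by (meson order_trans subsetD)
  have fwe: "?f w = F t (fst w) (snd w) + K0 / 4 * (dist w u1)\<^sup>2 - K * ln (dist w u1)" by (rule f_eq[OF ne[OF wV(1)]])
  \<comment> \<open>The maximum is in the interior, on the frontier of \<open>V\<close>, or on the
    outer circle.\<close>
  consider "w \<in> W" | "w \<notin> W" "dist w u1 < R" | "dist w u1 = R" using wV(2) by linarith
  then show False
  proof cases
    case 1
    obtain d where d: "d > 0" "ball w d \<subseteq> W" using W 1 openE by blast
    have q0: "(x' - x1)\<^sup>2 + (y' - y1)\<^sup>2 > 0" if "(x', y') \<in> W" for x' y'
    proof -
      have "(x', y') \<in> closure V" using that closure_subset by (auto simp: W_def)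
      then show ?thesis unfolding q_dist using ne by simp
    qed
    show False
    proof (rule barrier_no_local_max[OF t(1) _ _ d(1)])
      show "(fst w - x1)\<^sup>2 + (snd w - y1)\<^sup>2 > 0" using q0[of "fst w" "snd w"] 1 by simp
      show "E 0 (fst w) (snd w) < K0" using K0(2)[of w] wV(2) by (simp add: dist_commute)
      fix x' y' assume "dist (x', y') (fst w, snd w) < d"
      then have in1: "(x', y') \<in> W" using d(2) by (auto simp: dist_commute)
      then show "barrier t K0 K x1 y1 x' y' \<le> barrier t K0 K x1 y1 (fst w) (snd w)"
        using w(2)[of "(x', y')"] closure_subset by auto
      show "(x' - x1)\<^sup>2 + (y' - y1)\<^sup>2 > 0" by (rule q0[OF in1])
    qed
  next
    case 2
    then have "w \<notin> V" by (simp add: W_def dist_commute)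
    then have "w \<in> frontier V" using wV(1) V by (simp add: frontier_def interior_open)
    then have "F t (fst w) (snd w) \<le> t * (a - \<delta>)" by (intro Fle fr)
    moreover have "K * ln r \<le> K * ln (dist w u1)" using far[OF wV(1)] r K
      by (intro mult_left_mono ln_mono) auto
    moreover have "K * ln (R / r) = K * ln R - K * ln r" using R r by (simp add: ln_div right_diff_distrib)
    ultimately show False using fw fwe quad t(2) by (simp add: right_diff_distrib)
  next
    case 3
    have "F t (fst w) (snd w) \<le> t * a" by (intro Fle le wV(1))
    then show False using fw fwe quad 3 by simp
  qed
qed

end

section \<open>Holomorphic curves in the group, with an extra parameter for the flow time\<close>

type_synonym r3 = "real \<times> real \<times> real"

lemma findim_r3: "findim TYPE(r3)"
  by (intro findim_prod findim_real)

lemma sV3: "smooth_atlas (vector_atlas :: (r3, r3) chart set)"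
  by (rule smooth_atlas_vector[OF findim_r3])

context complex_lie
begin

text \<open>The triple is \<open>(s, x, y)\<close>; complex linearity is demanded in the plane of
  \<open>x\<close> and \<open>y\<close> only, and \<open>s\<close> is a real parameter.\<close>

definition hol_r3 :: "(r3 \<Rightarrow> 'g) \<Rightarrow> bool" where
  "hol_r3 f \<longleftrightarrow> smooth_map vector_atlas A f \<and>
    (\<forall>u. tangent_map vector_atlas A f u (0, 0, 1) = j (tangent_map vector_atlas A f u (0, 1, 0)))"

lemma hol_r3_mult:
  assumes "hol_r3 f" "hol_r3 g"
  shows "hol_r3 (\<lambda>u. f u \<otimes> g u)"
proof -
  have f: "smooth_map vector_atlas A f" and g: "smooth_map vector_atlas A g"
    using assms by (auto simp: hol_r3_def)
  show ?thesis
    unfolding hol_r3_def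
    using smooth_map_mult[OF sV3 f g] assms holomorphic_left holomorphic_right
    by (auto simp: hol_r3_def tangent_map_mult[OF sV3 f g] holomorphic_map_def complex_structureD(5)[OF cs])
qed

lemma hol_r3_const: "hol_r3 (\<lambda>u. g)"
  by (simp add: hol_r3_def smooth_map_const tangent_map_const complex_structureD(3)[OF cs])

text \<open>An exponential commutes with the others on the same line, so its velocity is both a left
  and a right translate of \<open>a\<close>. The product of two exponentials needs one form for each
  factor.\<close>

lemma tangent_ex_left:
  "tangent_map vector_atlas A (\<lambda>t. ex (t *\<^sub>R a)) t 1 = tangent_map A A (\<lambda>h. ex (t *\<^sub>R a) \<otimes> h) \<one> a"
  and tangent_ex_right:
  "tangent_map vector_atlas A (\<lambda>t. ex (t *\<^sub>R a)) t 1 = tangent_map A A (\<lambda>h. h \<otimes> ex (t *\<^sub>R a)) \<one> a"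
proof -
  note sh = smooth_shift[of t] and fsh = frechet_shift[of t]
  have s: "smooth_map vector_atlas A (\<lambda>s. ex ((s - t) *\<^sub>R a))"
    by (rule smooth_map_compose[OF sV sV sA sh smooth_ex_curve])
  have T: "tangent_map vector_atlas A (\<lambda>s. ex ((s - t) *\<^sub>R a)) t 1 = a"
    using tangent_map_compose[OF sV sV sA sh smooth_ex_curve[of a], of t 1]
    by (simp add: tangent_map_vector fsh tangent_ex_curve)
  have "(\<lambda>s. ex (s *\<^sub>R a)) = (\<lambda>s. ex (t *\<^sub>R a) \<otimes> ex ((s - t) *\<^sub>R a))"
    by (simp add: ex_add[symmetric])
  then show "tangent_map vector_atlas A (\<lambda>t. ex (t *\<^sub>R a)) t 1 = tangent_map A A (\<lambda>h. ex (t *\<^sub>R a) \<otimes> h) \<one> a"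
    using tangent_map_compose[OF sV sA sA s smooth_left[of "ex (t *\<^sub>R a)"], of t 1] T by (simp add: ex_zero)
  have "(\<lambda>s. ex (s *\<^sub>R a)) = (\<lambda>s. ex ((s - t) *\<^sub>R a) \<otimes> ex (t *\<^sub>R a))"
    by (simp add: ex_add[symmetric])
  then show "tangent_map vector_atlas A (\<lambda>t. ex (t *\<^sub>R a)) t 1 = tangent_map A A (\<lambda>h. h \<otimes> ex (t *\<^sub>R a)) \<one> a"
    using tangent_map_compose[OF sV sA sA s smooth_right[of "ex (t *\<^sub>R a)"], of t 1] T by (simp add: ex_zero)
qed

lemma tangent_ex_linear:
  fixes L :: "r3 \<Rightarrow> real"
  assumes L: "bounded_linear L"
  shows "smooth_map vector_atlas A (\<lambda>u. ex (L u *\<^sub>R a))"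
    and "tangent_map vector_atlas A (\<lambda>u. ex (L u *\<^sub>R a)) u v =
      L v *\<^sub>R tangent_map vector_atlas A (\<lambda>t. ex (t *\<^sub>R a)) (L u) 1"
proof -
  have sL: "smooth_map vector_atlas vector_atlas L" by (rule smooth_map_linear[OF L])
  show "smooth_map vector_atlas A (\<lambda>u. ex (L u *\<^sub>R a))"
    by (rule smooth_map_compose[OF sV3 sV sA sL smooth_ex_curve])
  have "frechet_derivative L (at u) = L"
    by (rule frechet_derivative_eqI[OF bounded_linear_imp_has_derivative[OF L]])
  then have "tangent_map vector_atlas A (\<lambda>u. ex (L u *\<^sub>R a)) u v = tangent_map vector_atlas A (\<lambda>t. ex (t *\<^sub>R a)) (L u) (L v)"
    using tangent_map_compose[OF sV3 sV sA sL smooth_ex_curve[of a], of u v] by (simp add: tangent_map_vector)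
  also have "\<dots> = L v *\<^sub>R tangent_map vector_atlas A (\<lambda>t. ex (t *\<^sub>R a)) (L u) 1"
    using linear_cmul[OF tangent_map_linear[OF sV sA smooth_ex_curve[of a]], of "L u" "L v" 1] by simp
  finally show "tangent_map vector_atlas A (\<lambda>u. ex (L u *\<^sub>R a)) u v =
      L v *\<^sub>R tangent_map vector_atlas A (\<lambda>t. ex (t *\<^sub>R a)) (L u) 1" .
qed

lemma bounded_linear_r3: "bounded_linear (fst :: r3 \<Rightarrow> real)" "bounded_linear (\<lambda>u::r3. fst (snd u))"
  "bounded_linear (\<lambda>u::r3. snd (snd u))"
  by (intro bounded_linear_fst bounded_linear_snd bounded_linear_compose[OF bounded_linear_fst bounded_linear_snd]
      bounded_linear_compose[OF bounded_linear_snd bounded_linear_snd])+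

text \<open>The group is generated by exponentials, so any point of an orbit is reached from any other by
  a holomorphic curve that is a product of such curves. The first coordinate is kept for the time of the
  flow.\<close>

definition plane_exp :: "'e \<Rightarrow> r3 \<Rightarrow> 'g" where
  "plane_exp a u = ex (fst (snd u) *\<^sub>R a) \<otimes> ex (snd (snd u) *\<^sub>R j a)"

lemma hol_r3_plane_exp: "hol_r3 (plane_exp a)"
  unfolding hol_r3_def plane_exp_def[abs_def]
proof (intro conjI allI)
  note s1 = tangent_ex_linear[OF bounded_linear_r3(2), of a]
    and s2 = tangent_ex_linear[OF bounded_linear_r3(3), of "j a"]
  show "smooth_map vector_atlas A (\<lambda>u::r3. ex (fst (snd u) *\<^sub>R a) \<otimes> ex (snd (snd u) *\<^sub>R j a))"
    by (rule smooth_map_mult[OF sV3 s1(1) s2(1)])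
  fix u :: r3
  let ?g = "ex (fst (snd u) *\<^sub>R a)" and ?h = "ex (snd (snd u) *\<^sub>R j a)"
  note T = tangent_map_mult[OF sV3 s1(1) s2(1), of u]
  have l0: "tangent_map A A (\<lambda>q. q \<otimes> ?h) ?g 0 = 0" "tangent_map A A (\<lambda>r. ?g \<otimes> r) ?h 0 = 0"
    by (intro linear_0 tangent_map_linear sA smooth_left smooth_right)+
  have 1: "tangent_map vector_atlas A (\<lambda>u. ex (fst (snd u) *\<^sub>R a) \<otimes> ex (snd (snd u) *\<^sub>R j a)) u (0, 1, 0) =
      tangent_map A A (\<lambda>q. q \<otimes> ?h) ?g (tangent_map A A (\<lambda>x. ?g \<otimes> x) \<one> a)"
    by (simp add: T s1(2) s2(2) l0 tangent_ex_left)
  also have "\<dots> = tangent_map A A (\<lambda>x. (?g \<otimes> x) \<otimes> ?h) \<one> a"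
    using tangent_map_compose[OF sA sA sA smooth_left[of ?g] smooth_right[of ?h], of \<one> a] by simp
  finally have 1: "tangent_map vector_atlas A (\<lambda>u. ex (fst (snd u) *\<^sub>R a) \<otimes> ex (snd (snd u) *\<^sub>R j a)) u (0, 1, 0) =
      tangent_map A A (\<lambda>x. (?g \<otimes> x) \<otimes> ?h) \<one> a" .
  have "tangent_map vector_atlas A (\<lambda>u. ex (fst (snd u) *\<^sub>R a) \<otimes> ex (snd (snd u) *\<^sub>R j a)) u (0, 0, 1) =
      tangent_map A A (\<lambda>r. ?g \<otimes> r) ?h (tangent_map A A (\<lambda>x. x \<otimes> ?h) \<one> (j a))"
    by (simp add: T s1(2) s2(2) l0 tangent_ex_right)
  also have "\<dots> = tangent_map A A (\<lambda>x. ?g \<otimes> (x \<otimes> ?h)) \<one> (j a)"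
    using tangent_map_compose[OF sA sA sA smooth_right[of ?h] smooth_left[of ?g], of \<one> "j a"] by simp
  \<comment> \<open>By associativity both partial velocities are images of \<open>a\<close> and
    \<open>j a\<close> under the same map \<open>x \<mapsto> ?g x ?h\<close>, which is
    holomorphic.\<close>
  also have "(\<lambda>x. ?g \<otimes> (x \<otimes> ?h)) = (\<lambda>x. (?g \<otimes> x) \<otimes> ?h)" by (simp add: m_assoc)
  also have "tangent_map A A (\<lambda>x. (?g \<otimes> x) \<otimes> ?h) \<one> (j a) = j (tangent_map A A (\<lambda>x. (?g \<otimes> x) \<otimes> ?h) \<one> a)"
    using holomorphic_map_compose[OF sA sA sA holomorphic_left holomorphic_right, of ?g ?h]
    by (simp add: holomorphic_map_def)
  finally show "tangent_map vector_atlas A (\<lambda>u. ex (fst (snd u) *\<^sub>R a) \<otimes> ex (snd (snd u) *\<^sub>R j a)) u (0, 0, 1) =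
      j (tangent_map vector_atlas A (\<lambda>u. ex (fst (snd u) *\<^sub>R a) \<otimes> ex (snd (snd u) *\<^sub>R j a)) u (0, 1, 0))"
    by (simp add: 1)
qed

definition plane_prod :: "'e list \<Rightarrow> r3 \<Rightarrow> 'g" where
  "plane_prod xs u = foldr (\<lambda>a g. plane_exp a u \<otimes> g) xs \<one>"

lemma hol_r3_plane_prod: "hol_r3 (plane_prod xs)"
proof (induction xs)
  case Nil
  have "plane_prod [] = (\<lambda>u. \<one>)" by (simp add: plane_prod_def[abs_def])
  then show ?case by (simp add: hol_r3_const)
next
  case (Cons a xs)
  have "plane_prod (a # xs) = (\<lambda>u. plane_exp a u \<otimes> plane_prod xs u)" by (simp add: plane_prod_def[abs_def])
  then show ?case using hol_r3_mult[OF hol_r3_plane_exp Cons] by simp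
qed

lemma plane_prod_zero: "plane_prod xs (s, 0, 0) = \<one>"
  and plane_prod_one: "plane_prod xs (s, 1, 0) = exprod (\<lambda>x. 1) xs"
  and plane_prod_time: "plane_prod xs (s, u) = plane_prod xs (0, u)"
  by (induction xs) (simp_all add: plane_prod_def plane_exp_def ex_zero)

end

context kaehler_action
begin

context
  fixes \<eta> :: 'e
  assumes eta: "\<eta> \<in> \<uu>"
begin

text \<open>The holomorphic curve through \<open>p\<close>, carried along for time \<open>s\<close>
  by the flow of \<open>\<beta> = j \<eta>\<close>. Time zero gives back the curve itself.\<close>

definition flow_prod :: "'e list \<Rightarrow> 'z \<Rightarrow> r3 \<Rightarrow> 'z" where
  "flow_prod xs p u = \<phi> (gam \<eta> (fst u)) (\<phi> (plane_prod xs u) p)"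

lemma smooth_flow_prod: "smooth_map vector_atlas AZ (flow_prod xs p)"
  and flow_prod_y: "tangent_map vector_atlas AZ (flow_prod xs p) u (0, 0, 1) =
    jZ (tangent_map vector_atlas AZ (flow_prod xs p) u (0, 1, 0))"
proof -
  have t: "hol_r3 (\<lambda>u. gam \<eta> (fst u))"
  proof -
    note s1 = tangent_ex_linear[OF bounded_linear_r3(1), of "j \<eta>"]
    show ?thesis unfolding hol_r3_def using s1(1) by (simp add: s1(2) complex_structureD[OF cs])
  qed
  have h: "hol_r3 (\<lambda>u. gam \<eta> (fst u) \<otimes> plane_prod xs u)"
    by (rule hol_r3_mult[OF t hol_r3_plane_prod])
  then have s: "smooth_map vector_atlas A (\<lambda>u. gam \<eta> (fst u) \<otimes> plane_prod xs u)" by (simp add: hol_r3_def)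
  have e: "flow_prod xs p = (\<lambda>u. \<phi> (gam \<eta> (fst u) \<otimes> plane_prod xs u) p)"
    by (simp add: flow_prod_def[abs_def] act_mult)
  show "smooth_map vector_atlas AZ (flow_prod xs p)"
    unfolding e by (rule smooth_map_compose[OF sV3 sA sZ s smooth_orbit_map])
  show "tangent_map vector_atlas AZ (flow_prod xs p) u (0, 0, 1) =
    jZ (tangent_map vector_atlas AZ (flow_prod xs p) u (0, 1, 0))"
  proof -
    have 1: "tangent_map vector_atlas A (\<lambda>u. gam \<eta> (fst u) \<otimes> plane_prod xs u) u (0, 0, 1) =
        j (tangent_map vector_atlas A (\<lambda>u. gam \<eta> (fst u) \<otimes> plane_prod xs u) u (0, 1, 0))"
      using h unfolding hol_r3_def by blast
    have 2: "tangent_map A AZ (\<lambda>g. \<phi> g p) q (j v) = jZ (tangent_map A AZ (\<lambda>g. \<phi> g p) q v)" for q v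
      using holomorphic_orbit_map unfolding holomorphic_map_def by blast
    show ?thesis unfolding e tangent_map_compose[OF sV3 sA sZ s smooth_orbit_map] 1 2 ..
  qed
qed

text \<open>The curve in the group is independent of the first coordinate, so moving that coordinate
  alone follows a flow line of \<open>j \<eta>\<close>.\<close>

lemma flow_prod_s: "tangent_map vector_atlas AZ (flow_prod xs p) u (1, 0, 0) = jZ (fld \<eta> (flow_prod xs p u))"
proof -
  define w where "w = (\<lambda>s::real. (s, snd u))"
  have we: "w = (\<lambda>s. s *\<^sub>R (1, 0, 0) + (0, snd u))" by (cases "snd u") (simp add: w_def)
  have bl: "bounded_linear (\<lambda>s::real. s *\<^sub>R (1::real, 0::real, 0::real))" by (rule bounded_linear_scaleR_left)
  have "smooth_on UNIV w" unfolding we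
    by (rule smooth_on_add[OF open_UNIV smooth_on_linear[OF bl] smooth_on_const])
  then have sw: "smooth_map vector_atlas vector_atlas w" by (simp add: smooth_map_vector)
  have "(w has_derivative (\<lambda>s. s *\<^sub>R (1, 0, 0) + 0)) (at (fst u))" unfolding we
    by (rule has_derivative_add[OF bounded_linear_imp_has_derivative[OF bl] has_derivative_const])
  then have "frechet_derivative w (at (fst u)) 1 = (1, 0, 0)" by (simp add: frechet_derivative_eqI zero_prod_def)
  then have "tangent_map vector_atlas AZ (\<lambda>s. flow_prod xs p (w s)) (fst u) 1 =
      tangent_map vector_atlas AZ (flow_prod xs p) u (1, 0, 0)"
    using tangent_map_compose[OF sV sV3 sZ sw smooth_flow_prod, of xs p "fst u" 1]
    by (simp add: tangent_map_vector w_def)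
  moreover have "(\<lambda>s. flow_prod xs p (w s)) = (\<lambda>s. \<phi> (gam \<eta> s) (\<phi> (plane_prod xs (0, snd u)) p))"
  proof
    fix s
    show "flow_prod xs p (w s) = \<phi> (gam \<eta> s) (\<phi> (plane_prod xs (0, snd u)) p)"
      unfolding flow_prod_def w_def fst_conv by (subst plane_prod_time) (rule refl)
  qed
  moreover have "flow_prod xs p u = \<phi> (gam \<eta> (fst u)) (\<phi> (plane_prod xs (0, snd u)) p)"
  proof -
    have "plane_prod xs u = plane_prod xs (0, snd u)"
      using plane_prod_time[of xs "fst u" "snd u"] unfolding prod.collapse .
    then show ?thesis by (simp only: flow_prod_def)
  qed
  ultimately show ?thesis by (simp add: tangent_flow fld_j)
qed

lemma smooth_on_partial:
  fixes f :: "r3 \<Rightarrow> real"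
  assumes f: "smooth_on UNIV f"
  shows "((\<lambda>t. f (s, t, y)) has_real_derivative frechet_derivative f (at (s, t, y)) (0, 1, 0)) (at t)"
    and "((\<lambda>t. f (s, x, t)) has_real_derivative frechet_derivative f (at (s, x, t)) (0, 0, 1)) (at t)"
    and "((\<lambda>t. f (t, x, y)) has_real_derivative frechet_derivative f (at (t, x, y)) (1, 0, 0)) (at t)"
proof -
  have "((\<lambda>t. f (a + t *\<^sub>R v)) has_real_derivative frechet_derivative f (at (a + t *\<^sub>R v)) v) (at t)" for a v t
    unfolding has_real_derivative_iff_has_vector_derivative
    by (rule has_vector_derivative_line[OF smooth_on_has_derivative[OF f]]) simp
  from this[of "(s, 0, y)" "(0, 1, 0)" t] this[of "(s, x, 0)" "(0, 0, 1)" t] this[of "(0, x, y)" "(1, 0, 0)" t]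
  show "((\<lambda>t. f (s, t, y)) has_real_derivative frechet_derivative f (at (s, t, y)) (0, 1, 0)) (at t)"
    and "((\<lambda>t. f (s, x, t)) has_real_derivative frechet_derivative f (at (s, x, t)) (0, 0, 1)) (at t)"
    and "((\<lambda>t. f (t, x, y)) has_real_derivative frechet_derivative f (at (t, x, y)) (1, 0, 0)) (at t)"
    by simp_all
qed

text \<open>The energy density of the translated curve has the Laplacian of the Hamiltonian as its
  derivative along the flow; this is the infinitesimal form of the fact that the flow changes the
  Kaehler form by \<open>dd\<^sup>c\<close> of the Hamiltonian.\<close>

lemma laplace_flow_prod:
  fixes xs :: "'e list" and p :: 'z
  defines "\<Phi> \<equiv> flow_prod xs p"
  defines "hh \<equiv> \<lambda>u. m \<eta> (\<Phi> u)"
  defines "T \<equiv> \<lambda>u v. tangent_map vector_atlas AZ \<Phi> u v"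
  defines "EE \<equiv> \<lambda>u. \<omega> (\<Phi> u) (T u (0, 1, 0)) (T u (0, 0, 1))"
  defines "D \<equiv> \<lambda>f v u. frechet_derivative f (at u) (v :: r3) :: real"
  shows "laplace_flow (\<lambda>s x y. hh (s, x, y)) (\<lambda>s x y. D hh (0, 1, 0) (s, x, y))
    (\<lambda>s x y. D (D hh (0, 1, 0)) (0, 1, 0) (s, x, y)) (\<lambda>s x y. D hh (0, 0, 1) (s, x, y))
    (\<lambda>s x y. D (D hh (0, 0, 1)) (0, 0, 1) (s, x, y)) (\<lambda>s x y. EE (s, x, y))"
proof -
  have sP: "smooth_map vector_atlas AZ \<Phi>" unfolding \<Phi>_def by (rule smooth_flow_prod)
  have Ty: "T u (0, 0, 1) = jZ (T u (0, 1, 0))" for u unfolding T_def \<Phi>_def by (rule flow_prod_y)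
  have Ts: "T u (1, 0, 0) = jZ (fld \<eta> (\<Phi> u))" for u unfolding T_def \<Phi>_def by (rule flow_prod_s)
  have sh: "smooth_on UNIV hh" unfolding hh_def by (rule frechet_m(1)[OF eta findim_r3 sP])
  have Dh: "D hh v u = \<omega> (\<Phi> u) (fld \<eta> (\<Phi> u)) (T u v)" for u v
    unfolding D_def hh_def T_def by (rule frechet_m(2)[OF eta findim_r3 sP])
  define pb where "pb = (\<lambda>v w u. \<omega> (\<Phi> u) (T u v) (T u w))"
  have w2: "smooth_2form AZ \<omega>" "closed_2form AZ \<omega>" using kaehler by (auto simp: kaehler_manifold_def)
  have pbc1: "smooth_on UNIV (pb v w)" for v w
    unfolding pb_def T_def by (rule pullback_closed(1)[OF findim_r3 sZ w2 sP])
  have pbc2: "frechet_derivative (pb v w) (at u) k + frechet_derivative (pb w k) (at u) v +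
      frechet_derivative (pb k v) (at u) w = 0" for u v w k
    unfolding pb_def T_def by (rule pullback_closed(2)[OF findim_r3 sZ w2 sP])
  have fldT: "fld \<eta> (\<Phi> u) = - jZ (T u (1, 0, 0))" for u
    by (simp add: Ts complex_structureD(2)[OF csZ])
  \<comment> \<open>The gradient relation writes the differential of \<open>m\<close> through the
    time velocity: with holomorphy in \<open>(x, y)\<close>, the first partial derivatives of
    \<open>m\<close> become the components \<open>(s, y)\<close> and \<open>(x, s)\<close> of the
    pulled back form.\<close>
  have hx: "D hh (0, 1, 0) = pb (1, 0, 0) (0, 0, 1)"
    by (rule ext) (simp add: Dh pb_def fldT Ty omega_simps omega_j_left)
  have hy: "D hh (0, 0, 1) = pb (0, 1, 0) (1, 0, 0)"
  proof (rule ext)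
    fix u
    show "D hh (0, 0, 1) u = pb (0, 1, 0) (1, 0, 0) u"
      using omega_antisym[of "\<Phi> u" "T u (0, 1, 0)" "T u (1, 0, 0)"]
      by (simp add: Dh pb_def fldT Ty omega_simps omega_jj)
  qed
  have EEpb: "EE = pb (0, 1, 0) (0, 0, 1)" by (simp add: EE_def pb_def)
  have sE: "smooth_on UNIV EE" unfolding EEpb by (rule pbc1)
  have shx: "smooth_on UNIV (D hh (0, 1, 0))" unfolding hx by (rule pbc1)
  have shy: "smooth_on UNIV (D hh (0, 0, 1))" unfolding hy by (rule pbc1)
  have pbneg: "pb v w = (\<lambda>u. - pb w v u)" for v w
    unfolding pb_def using omega_antisym by (rule ext)
  \<comment> \<open>The closedness of the pulled back form in the directions \<open>x\<close>,
    \<open>y\<close>, \<open>s\<close>; antisymmetry turns the two mixed terms into the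
    Laplacian.\<close>
  have key: "D EE (1, 0, 0) u = D (D hh (0, 1, 0)) (0, 1, 0) u + D (D hh (0, 0, 1)) (0, 0, 1) u" for u
  proof -
    have "D (pb (0, 1, 0) (0, 0, 1)) (1, 0, 0) u + D (pb (0, 0, 1) (1, 0, 0)) (0, 1, 0) u +
        D (pb (1, 0, 0) (0, 1, 0)) (0, 0, 1) u = 0"
      unfolding D_def by (rule pbc2)
    moreover have "D (pb v w) k u = - D (pb w v) k u" for v w k
    proof -
      have "((\<lambda>u. - pb w v u) has_derivative (\<lambda>k. - frechet_derivative (pb w v) (at u) k)) (at u)"
        by (rule has_derivative_minus[OF smooth_on_has_derivative[OF pbc1]]) simp
      from frechet_derivative_eqI[OF this] show ?thesis unfolding D_def by (subst pbneg) simp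
    qed
    ultimately show ?thesis unfolding EEpb hx hy by (smt (verit))
  qed
  have cont: "continuous_on UNIV (\<lambda>(s, x, y). f (s, x, y))" if "smooth_on UNIV f" for f :: "r3 \<Rightarrow> real"
    using smooth_on_continuous[OF that] by (simp add: split_beta)
  have sD: "smooth_on UNIV (D f v)" if "smooth_on UNIV f" for f v
    unfolding D_def by (rule smooth_on_frechet[OF that])
  show ?thesis
  proof (rule laplace_flow.intro)
    fix s x y
    show "((\<lambda>x. hh (s, x, y)) has_real_derivative D hh (0, 1, 0) (s, x, y)) (at x)"
      unfolding D_def by (rule smooth_on_partial[OF sh])
    show "((\<lambda>x. D hh (0, 1, 0) (s, x, y)) has_real_derivative D (D hh (0, 1, 0)) (0, 1, 0) (s, x, y)) (at x)"
      using smooth_on_partial(1)[OF shx, of s y x] by (simp add: D_def)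
    show "((\<lambda>y. hh (s, x, y)) has_real_derivative D hh (0, 0, 1) (s, x, y)) (at y)"
      unfolding D_def by (rule smooth_on_partial[OF sh])
    show "((\<lambda>y. D hh (0, 0, 1) (s, x, y)) has_real_derivative D (D hh (0, 0, 1)) (0, 0, 1) (s, x, y)) (at y)"
      using smooth_on_partial(2)[OF shy, of s x y] by (simp add: D_def)
    show "((\<lambda>s. EE (s, x, y)) has_real_derivative
        D (D hh (0, 1, 0)) (0, 1, 0) (s, x, y) + D (D hh (0, 0, 1)) (0, 0, 1) (s, x, y)) (at s)"
      unfolding key[symmetric] using smooth_on_partial(3)[OF sE, of x y s] by (simp add: D_def)
    show "0 \<le> EE (s, x, y)" by (simp add: EE_def Ty omega_nonneg)
  qed (intro cont sh shx shy sE sD)+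
qed

end

end

section \<open>Compact orbits\<close>

lemma Hausdorff_space_t2: "Hausdorff_space (euclidean :: 'a::t2_space topology)"
  unfolding Hausdorff_space_def by (auto simp: disjnt_def) (metis hausdorff)

lemma compact_separation:
  fixes S T :: "'a::t2_space set"
  assumes "compact S" "compact T" "S \<inter> T = {}"
  obtains M Nb where "open M" "open Nb" "S \<subseteq> M" "T \<subseteq> Nb" "M \<inter> Nb = {}"
  using Hausdorff_space_compact_separation[OF Hausdorff_space_t2, of S T] assms
  by (auto simp: disjnt_def)

text \<open>A compact Hausdorff space is locally compact and regular, hence a Baire space. If every
  member of the cover had empty interior relative to \<open>T\<close>, then so would their union,
  which is \<open>T\<close>.\<close>

lemma compact_Baire:
  fixes T :: "'a::t2_space set"
  assumes T: "compact T" "T \<noteq> {}" and C: "countable C" "\<And>K. K \<in> C \<Longrightarrow> compact K \<and> K \<subseteq> T" "T \<subseteq> \<Union>C"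
  obtains K W where "K \<in> C" "open W" "W \<inter> T \<noteq> {}" "W \<inter> T \<subseteq> K"
proof (rule ccontr)
  assume no: "\<not> thesis"
  let ?X = "top_of_set T"
  have cs: "compact_space ?X" using T by (simp add: compact_space_subtopology)
  have H: "Hausdorff_space ?X" by (rule Hausdorff_space_subtopology[OF Hausdorff_space_t2])
  have lc: "locally_compact_space ?X \<and> regular_space ?X"
    using compact_imp_locally_compact_space[OF cs] compact_Hausdorff_imp_regular_space[OF cs H] by simp
  have "?X interior_of \<Union>C = {}"
  proof (rule Baire_category_alt)
    show "completely_metrizable_space ?X \<or> locally_compact_space ?X \<and> regular_space ?X" using lc by blast
    show "countable C" by (rule C(1))
    fix K assume K: "K \<in> C"
    have "closed K" using C(2)[OF K] compact_imp_closed by blast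
    then have "closedin ?X K" using C(2)[OF K] closed_subset by blast
    moreover have "?X interior_of K = {}"
    proof (rule ccontr)
      assume "?X interior_of K \<noteq> {}"
      moreover have "openin ?X (?X interior_of K)" by simp
      then obtain W where W: "open W" "?X interior_of K = T \<inter> W" unfolding openin_open by blast
      ultimately have "W \<inter> T \<noteq> {}" "W \<inter> T \<subseteq> K" using interior_of_subset[of ?X K] by auto
      then show False using no that[OF K W(1)] by blast
    qed
    ultimately show "closedin ?X K \<and> ?X interior_of K = {}" ..
  qed
  moreover have "\<Union>C = T" using C(2,3) by blast
  ultimately show False using T(2) interior_of_topspace[of ?X] by simp
qed

context complex_lie
begin

lemma compact_neighbourhood:
  assumes W: "open W" "\<one> \<in> W"
  obtains K Nb where "compact K" "open Nb" "\<one> \<in> Nb" "Nb \<subseteq> K" "K \<subseteq> W"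
proof -
  have "open (\<Omega> \<inter> br -` W)" by (rule smooth_into_open_vimage[OF smooth_into_br W(1)])
  moreover have "0 \<in> \<Omega> \<inter> br -` W" using W zero_Omega by (simp add: br_zero)
  ultimately obtain r where r: "r > 0" "cball 0 r \<subseteq> \<Omega> \<inter> br -` W" using open_contains_cball by blast
  have kc: "continuous_on (fst c0) \<kappa>" unfolding \<kappa>_def[abs_def] by (intro continuous_intros c0D(3))
  show ?thesis
  proof (rule that)
    show "compact (br ` cball 0 r)"
      by (intro compact_continuous_image compact_cball_findim[OF fdE] continuous_on_subset[OF continuous_on_br]) (use r in auto)
    show "open (fst c0 \<inter> \<kappa> -` ball 0 r)" by (rule continuous_open_preimage[OF kc c0D(1) open_ball])
    show "\<one> \<in> fst c0 \<inter> \<kappa> -` ball 0 r" using c0 r by (simp add: kappa_one)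
    show "fst c0 \<inter> \<kappa> -` ball 0 r \<subseteq> br ` cball 0 r"
    proof
      fix g assume "g \<in> fst c0 \<inter> \<kappa> -` ball 0 r"
      then have "g = br (\<kappa> g)" "\<kappa> g \<in> cball 0 r" by (auto simp: br_kappa)
      then show "g \<in> br ` cball 0 r" by blast
    qed
    show "br ` cball 0 r \<subseteq> W" using r by auto
  qed
qed

text \<open>Continuity of \<open>(a, b) \<mapsto> a\<inverse> b\<close> at the pair of
  units.\<close>

lemma difference_neighbourhood:
  assumes V: "open V" "\<one> \<in> V"
  obtains W where "open W" "\<one> \<in> W" "\<And>a b. a \<in> W \<Longrightarrow> b \<in> W \<Longrightarrow> inv a \<otimes> b \<in> V"
proof -
  have "continuous_on UNIV (\<lambda>z. inv (fst z) \<otimes> snd z)"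
    by (intro continuous_on_mult_group continuous_on_inv_group continuous_intros)
  then have "open ((\<lambda>z. inv (fst z) \<otimes> snd z) -` V)" using V(1) by (rule open_vimage[rotated])
  moreover have "(\<one>, \<one>) \<in> (\<lambda>z. inv (fst z) \<otimes> snd z) -` V" using V(2) by simp
  ultimately obtain B C where BC: "open B" "open C" "(\<one>, \<one>) \<in> B \<times> C" "B \<times> C \<subseteq> (\<lambda>z. inv (fst z) \<otimes> snd z) -` V"
    by (rule open_prod_elim)
  show ?thesis by (rule that[of "B \<inter> C"]) (use BC in \<open>auto simp: open_Int\<close>)
qed

end

context kaehler_action
begin

lemma continuous_act_point: "continuous_on S (\<lambda>g. \<phi> g z)"
  by (intro continuous_on_act continuous_on_id continuous_on_const)

lemma continuous_act_elt: "continuous_on S (\<phi> g)"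
  using continuous_on_act[of S "\<lambda>z. g" "\<lambda>z. z"] by (simp add: continuous_on_const continuous_on_id)

text \<open>By Baire's theorem, some translate of a compact neighbourhood of the unit is mapped onto a set
  with interior points in the orbit.\<close>

lemma orbit_map_open:
  assumes T: "T = range (\<lambda>g. \<phi> g p)" "compact T" and V: "open V" "\<one> \<in> V"
  obtains Q where "open Q" "p \<in> Q" "\<And>z. z \<in> Q \<Longrightarrow> z \<in> T \<Longrightarrow> \<exists>g\<in>V. z = \<phi> g p"
proof -
  obtain W where W: "open W" "\<one> \<in> W" "\<And>a b. a \<in> W \<Longrightarrow> b \<in> W \<Longrightarrow> inv a \<otimes> b \<in> V"
    by (rule difference_neighbourhood[OF V]) blast
  obtain K Nb where K: "compact K" "open Nb" "\<one> \<in> Nb" "Nb \<subseteq> K" "K \<subseteq> W"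
    by (rule compact_neighbourhood[OF W(1,2)])
  define \<F> where "\<F> = range (\<lambda>g. {h. inv g \<otimes> h \<in> Nb})"
  have opF: "open S" if "S \<in> \<F>" for S using that open_translate_left[OF K(2)] by (auto simp: \<F>_def)
  \<comment> \<open>Second countability reduces the cover of the group by translates of
    \<open>Nb\<close> to a countable one, so that the orbit is a countable union of compact
    translates of \<open>K p\<close>.\<close>
  obtain \<F>' where F': "\<F>' \<subseteq> \<F>" "countable \<F>'" "\<Union>\<F>' = \<Union>\<F>" using Lindelof[OF opF] by blast
  have "\<forall>S\<in>\<F>'. \<exists>g. S = {h. inv g \<otimes> h \<in> Nb}" using F'(1) by (auto simp: \<F>_def)
  then obtain cc where cc: "\<And>S. S \<in> \<F>' \<Longrightarrow> S = {h. inv (cc S) \<otimes> h \<in> Nb}" by metis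
  define C where "C = (\<lambda>g. \<phi> g ` (\<lambda>k. \<phi> k p) ` K) ` (cc ` \<F>')"
  have cK: "compact ((\<lambda>k. \<phi> k p) ` K)" by (intro compact_continuous_image continuous_act_point K)
  have tr: "\<phi> g z \<in> T" if z: "z \<in> T" for g z
  proof -
    from z obtain h where "z = \<phi> h p" using T(1) by auto
    then have "\<phi> g z = \<phi> (g \<otimes> h) p" by (simp only: act_mult)
    then show ?thesis using T(1) by blast
  qed
  have pT: "p \<in> T" unfolding T(1) using act_one by (metis rangeI)
  have "\<exists>K W. K \<in> C \<and> open W \<and> W \<inter> T \<noteq> {} \<and> W \<inter> T \<subseteq> K"
  proof (rule compact_Baire[OF T(2)])
    show "T \<noteq> {}" using pT by blast
    show "countable C" unfolding C_def using F'(2) by (intro countable_image)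
    show "compact L \<and> L \<subseteq> T" if LC: "L \<in> C" for L
    proof
      obtain g where g: "L = \<phi> g ` (\<lambda>k. \<phi> k p) ` K" using LC by (auto simp: C_def)
      show "compact L" unfolding g by (rule compact_continuous_image[OF continuous_act_elt cK])
      show "L \<subseteq> T" unfolding g using tr T(1) by auto
    qed
    show "T \<subseteq> \<Union>C"
    proof
      fix z assume "z \<in> T"
      then obtain h where h: "z = \<phi> h p" using T(1) by auto
      have "h \<in> \<Union>\<F>" using K(3) by (auto simp: \<F>_def intro!: exI[of _ h])
      then obtain S where S: "S \<in> \<F>'" "h \<in> S" using F'(3) by blast
      then have "inv (cc S) \<otimes> h \<in> K" using cc[OF S(1)] K(4) by blast
      moreover have "z = \<phi> (cc S) (\<phi> (inv (cc S) \<otimes> h) p)" by (simp add: h act_mult act_inv)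
      ultimately show "z \<in> \<Union>C" unfolding C_def using S(1) by blast
    qed
  qed blast
  then obtain g Q where Q: "open Q" "Q \<inter> T \<noteq> {}" "Q \<inter> T \<subseteq> \<phi> g ` (\<lambda>k. \<phi> k p) ` K"
    by (auto simp: C_def)
  then obtain k where k: "k \<in> K" "\<phi> g (\<phi> k p) \<in> Q" by blast
  \<comment> \<open>The point \<open>g k p\<close> is an interior point of the translated piece;
    moving it back to \<open>p\<close> replaces an element \<open>k'\<close> of \<open>K\<close> by
    \<open>k\<inverse> k'\<close>, which lies in \<open>V\<close> by the choice of
    \<open>W\<close>.\<close>
  define Q' where "Q' = {z. \<phi> (g \<otimes> k) z \<in> Q}"
  show ?thesis
  proof (rule that)
    show "open Q'" using open_vimage[OF Q(1) continuous_act_elt[of UNIV "g \<otimes> k"]] by (simp add: Q'_def vimage_def)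
    show "p \<in> Q'" using k by (simp add: Q'_def act_mult)
    fix z assume "z \<in> Q'" "z \<in> T"
    then have "\<phi> (g \<otimes> k) z \<in> Q \<inter> T" using tr by (simp add: Q'_def)
    then obtain k' where k': "k' \<in> K" "\<phi> (g \<otimes> k) z = \<phi> g (\<phi> k' p)" using Q(3) by blast
    then have "\<phi> (inv g) (\<phi> g (\<phi> k z)) = \<phi> (inv g) (\<phi> g (\<phi> k' p))" by (simp add: act_mult)
    then have "\<phi> (inv k) (\<phi> k z) = \<phi> (inv k) (\<phi> k' p)" by (simp add: act_inv)
    then have "z = \<phi> (inv k \<otimes> k') p" by (simp add: act_inv act_mult)
    moreover have "inv k \<otimes> k' \<in> V" using W(3) K(5) k(1) k'(1) by blast
    ultimately show "\<exists>g\<in>V. z = \<phi> g p" by blast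
  qed
qed

section \<open>From local to global maxima on a compact orbit\<close>

context
  fixes \<eta> :: 'e
  assumes eta: "\<eta> \<in> \<uu>"
begin

lemma continuous_m_flow: "continuous_on S f \<Longrightarrow> continuous_on S (\<lambda>x. m \<eta> (\<phi> (gam \<eta> t) (f x)))"
  using continuous_on_compose2[OF continuous_m[OF eta, of UNIV], of S "\<lambda>x. \<phi> (gam \<eta> t) (f x)"]
  by (simp add: continuous_on_act continuous_on_const)

lemma continuous_flow: "continuous_on S (\<lambda>t. \<phi> (gam \<eta> t) z)"
  using smooth_map_continuous[OF smooth_flow[of "j \<eta>" z]] continuous_on_subset by blast

lemma flow_flow: "\<phi> (gam \<eta> s) (\<phi> (gam \<eta> t) z) = \<phi> (gam \<eta> (s + t)) z"
  by (simp only: ex_add act_mult)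

text \<open>A flow line meeting \<open>Nb\<close> and its complement at nonnegative times would
  cross the frontier, where \<open>m\<close> is at most \<open>a - \<delta>\<close>; but
  \<open>m\<close> starts above this value and never decreases.\<close>

lemma flow_stays:
  assumes TT: "\<And>g z. z \<in> T \<Longrightarrow> \<phi> g z \<in> T" and fr: "\<And>z. z \<in> T \<Longrightarrow> z \<in> frontier Nb \<Longrightarrow> m \<eta> z \<le> a - \<delta>"
    and z: "z \<in> T" "m \<eta> z > a - \<delta>" and s: "0 \<le> s" and t: "0 \<le> t" "\<phi> (gam \<eta> t) z \<in> Nb"
  shows "\<phi> (gam \<eta> s) z \<in> Nb"
proof (rule ccontr)
  assume n: "\<phi> (gam \<eta> s) z \<notin> Nb"
  let ?P = "(\<lambda>t. \<phi> (gam \<eta> t) z) ` {0..}"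
  have "connected ?P" by (intro connected_continuous_image continuous_flow connected_Ici)
  moreover have "?P \<inter> Nb \<noteq> {}" "?P - Nb \<noteq> {}" using s t n by auto
  ultimately have "?P \<inter> frontier Nb \<noteq> {}" by (rule connected_Int_frontier)
  then obtain r where r: "0 \<le> r" "\<phi> (gam \<eta> r) z \<in> frontier Nb" by auto
  have "m \<eta> (\<phi> (gam \<eta> r) z) \<le> a - \<delta>" by (rule fr[OF TT[OF z(1)] r(2)])
  moreover have "m \<eta> (\<phi> (gam \<eta> 0) z) \<le> m \<eta> (\<phi> (gam \<eta> r) z)" by (rule m_flow_mono[OF eta r(1)])
  ultimately show False using z(2) by (simp add: ex_zero)
qed

text \<open>The basin of \<open>S\<close> under the flow is dense along every holomorphic curve through \<open>p\<close>, and \<open>m\<close> is at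
  most \<open>a\<close> on the basin.\<close>

lemma local_max_global:
  assumes T: "T = range (\<lambda>g. \<phi> g p)" "compact T" and S: "compact S" "S \<subseteq> T" "p \<in> S"
    and p: "gfix \<eta> p" "m \<eta> p = a" and Sa: "\<And>s. s \<in> S \<Longrightarrow> m \<eta> s = a"
    and Q: "open Q" "S \<subseteq> Q" "\<And>z. z \<in> Q \<Longrightarrow> z \<in> T \<Longrightarrow> m \<eta> z \<le> a" "\<And>z. z \<in> Q \<Longrightarrow> z \<in> T \<Longrightarrow> m \<eta> z = a \<Longrightarrow> z \<in> S"
    and q: "q \<in> T"
  shows "m \<eta> q \<le> a" "m \<eta> q = a \<Longrightarrow> q \<in> S"
proof -
  have TT: "\<phi> g z \<in> T" if z: "z \<in> T" for g z
  proof -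
    from z obtain h where "z = \<phi> h p" using T(1) by auto
    then have "\<phi> g z = \<phi> (g \<otimes> h) p" by (simp only: act_mult)
    then show ?thesis using T(1) by blast
  qed
  have clT: "closed T" by (rule compact_imp_closed[OF T(2)])
  have "compact (T - Q)" using T(2) Q(1) by (simp add: compact_diff)
  \<comment> \<open>Separating \<open>S\<close> from the compact set \<open>T - Q\<close> gives a
    neighbourhood \<open>Nb\<close> of \<open>S\<close> whose closure meets \<open>T\<close> only
    inside \<open>Q\<close>.\<close>
  then obtain Nb Nb' where Nb: "open Nb" "open Nb'" "S \<subseteq> Nb" "T - Q \<subseteq> Nb'" "Nb \<inter> Nb' = {}"
    using compact_separation[OF S(1), of "T - Q"] Q(2) by blast
  have "Nb' \<inter> closure Nb = {}" using open_Int_closure_eq_empty[OF Nb(2), of Nb] Nb(5) by blast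
  then have clN: "closure Nb \<inter> T \<subseteq> Q" using Nb(4) by blast
  have frS: "frontier Nb \<inter> S = {}" using Nb(1,3) by (auto simp: frontier_def interior_open)
  have lt: "m \<eta> z < a" if "z \<in> T \<inter> frontier Nb" for z
  proof -
    have "z \<in> Q" "z \<in> T" "z \<notin> S" using that clN frS by (auto simp: frontier_def)
    then show ?thesis using Q(3)[of z] Q(4)[of z] by force
  qed
  \<comment> \<open>The gap is attained on the compact part of the frontier in \<open>T\<close>; if
    that part is empty, any positive number will do.\<close>
  obtain \<delta> where \<delta>: "\<delta> > 0" "\<And>z. z \<in> T \<Longrightarrow> z \<in> frontier Nb \<Longrightarrow> m \<eta> z \<le> a - \<delta>"
  proof (cases "T \<inter> frontier Nb = {}")
    case True
    then show ?thesis using that[of 1] by auto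
  next
    case False
    have "compact (T \<inter> frontier Nb)" by (intro compact_Int_closed T(2) frontier_closed)
    from continuous_attains_sup[OF this False continuous_m[OF eta]]
    obtain w where w: "w \<in> T \<inter> frontier Nb" "\<And>z. z \<in> T \<inter> frontier Nb \<Longrightarrow> m \<eta> z \<le> m \<eta> w" by blast
    show ?thesis by (rule that[of "a - m \<eta> w"]) (use lt[OF w(1)] w(2) in auto)
  qed
  have NQ: "z \<in> Nb \<Longrightarrow> z \<in> T \<Longrightarrow> z \<in> Q" for z using clN closure_subset by blast
  \<comment> \<open>The basin: points that reach \<open>Nb\<close> at a moment when \<open>m\<close>
    already exceeds \<open>a - \<delta>\<close>, after which they are trapped in \<open>Nb\<close>.
    An existential condition on one time makes the basin visibly open.\<close>
  define W where "W = {z. \<exists>t\<ge>0. \<phi> (gam \<eta> t) z \<in> Nb \<and> m \<eta> (\<phi> (gam \<eta> t) z) > a - \<delta>}"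
  have W_le: "m \<eta> z \<le> a" if "z \<in> W" "z \<in> T" for z
  proof -
    obtain t where t: "0 \<le> t" "\<phi> (gam \<eta> t) z \<in> Nb" using \<open>z \<in> W\<close> by (auto simp: W_def)
    have "m \<eta> (\<phi> (gam \<eta> 0) z) \<le> m \<eta> (\<phi> (gam \<eta> t) z)" by (rule m_flow_mono[OF eta t(1)])
    also have "\<dots> \<le> a" using NQ[OF t(2) TT] TT \<open>z \<in> T\<close> Q(3) by blast
    finally show ?thesis by (simp add: ex_zero)
  qed
  have W_fwd: "\<phi> (gam \<eta> s) z \<in> W" if z: "z \<in> W" "z \<in> T" and s: "0 \<le> s" for z s
  proof -
    obtain t where t: "0 \<le> t" "\<phi> (gam \<eta> t) z \<in> Nb" "m \<eta> (\<phi> (gam \<eta> t) z) > a - \<delta>" using z by (auto simp: W_def)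
    let ?y = "\<phi> (gam \<eta> t) z"
    have y0: "\<phi> (gam \<eta> 0) ?y \<in> Nb" using t by (simp add: ex_zero)
    have "\<phi> (gam \<eta> s) ?y \<in> Nb" by (rule flow_stays[OF TT \<delta>(2) TT[OF z(2)] t(3) s order_refl y0])
    moreover have "m \<eta> (\<phi> (gam \<eta> 0) ?y) \<le> m \<eta> (\<phi> (gam \<eta> s) ?y)" by (rule m_flow_mono[OF eta s])
    then have "m \<eta> (\<phi> (gam \<eta> s) ?y) > a - \<delta>" using t(3) by (simp add: ex_zero)
    moreover have "\<phi> (gam \<eta> t) (\<phi> (gam \<eta> s) z) = \<phi> (gam \<eta> s) ?y" by (simp add: flow_flow add.commute)
    ultimately show ?thesis unfolding W_def using t(1) by auto
  qed
  have W_N: "z \<in> Nb" if z: "z \<in> W" "z \<in> T" "m \<eta> z > a - \<delta>" for z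
  proof -
    obtain t where t: "0 \<le> t" "\<phi> (gam \<eta> t) z \<in> Nb" using z by (auto simp: W_def)
    have "\<phi> (gam \<eta> 0) z \<in> Nb" by (rule flow_stays[OF TT \<delta>(2) z(2,3) order_refl t])
    then show ?thesis by (simp add: ex_zero)
  qed
  have W_open: "open W"
  proof -
    have "W = (\<Union>t\<in>{0..}. (\<phi> (gam \<eta> t) -` Nb) \<inter> {z. m \<eta> (\<phi> (gam \<eta> t) z) > a - \<delta>})" by (auto simp: W_def)
    moreover have "open ((\<phi> (gam \<eta> t) -` Nb) \<inter> {z. m \<eta> (\<phi> (gam \<eta> t) z) > a - \<delta>})" for t
      by (intro open_Int open_vimage[OF Nb(1) continuous_act_elt] open_Collect_less continuous_on_const
          continuous_m_flow continuous_on_id)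
    ultimately show ?thesis by (simp add: open_UN)
  qed
  obtain g where g: "q = \<phi> g p" using q T(1) by auto
  obtain xs where xs: "g = exprod (\<lambda>x. 1) xs" using connected_generated[OF connected_G] by blast
  \<comment> \<open>A holomorphic curve in \<open>T\<close> with \<open>c (0, 0) = p\<close> and
    \<open>c (1, 0) = q\<close>.\<close>
  define c where "c = (\<lambda>u. flow_prod \<eta> xs p (0, u))"
  have c_eq: "c u = \<phi> (plane_prod xs (0, u)) p" for u by (simp add: c_def flow_prod_def[OF eta] ex_zero)
  have flow_c: "flow_prod \<eta> xs p (s, u) = \<phi> (gam \<eta> s) (c u)" for s u
    unfolding c_eq flow_prod_def[OF eta] fst_conv by (subst plane_prod_time) (rule refl)
  have cT: "c u \<in> T" for u unfolding c_eq T(1) by blast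
  have cont_c: "continuous_on R c" for R
    unfolding c_def
    by (rule continuous_on_compose2[OF smooth_map_continuous[OF smooth_flow_prod[OF eta]]]) (auto intro!: continuous_intros)
  have c00: "c (0, 0) = p" by (simp add: c_eq plane_prod_zero)
  have c1: "c (1, 0) = q" by (simp add: c_eq plane_prod_one g xs)
  define V where "V = c -` W"
  have pW: "p \<in> W" unfolding W_def using S(3) Nb(3) p(2) \<delta>(1) by (auto intro!: exI[of _ 0] simp: ex_zero)
  let ?h = "\<lambda>s u. m \<eta> (\<phi> (gam \<eta> s) (c u))"
  have cont_h: "continuous_on UNIV (?h s)" for s by (rule continuous_m_flow[OF cont_c])
  have h_le: "?h s u \<le> a" if "u \<in> closure V" "0 \<le> s" for u s
  proof -
    have "closed {u. ?h s u \<le> a}" by (intro closed_Collect_le cont_h continuous_on_const)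
    moreover have "V \<subseteq> {u. ?h s u \<le> a}"
      using W_le[OF W_fwd[OF _ cT that(2)] TT[OF cT]] by (auto simp: V_def)
    ultimately show ?thesis using closure_minimal that(1) by blast
  qed
  \<comment> \<open>For points of \<open>V\<close> this is the trapping property. In the limit only
    membership in the closure of \<open>Nb\<close> survives, and the strict inequality for
    \<open>m\<close> excludes the frontier.\<close>
  have h_N: "\<phi> (gam \<eta> s) (c u) \<in> Nb" if u: "u \<in> closure V" and s: "0 \<le> s" and gt: "?h s u > a - \<delta>" for u s
  proof -
    let ?V' = "V \<inter> {u. a - \<delta> < ?h s u}"
    have op: "open {u. a - \<delta> < ?h s u}" by (intro open_Collect_less cont_h continuous_on_const)
    have "u \<in> closure ?V'"
      using open_Int_closure_subset[OF op, of V] u gt by (auto simp: Int_commute)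
    moreover have "?V' \<subseteq> (\<lambda>u. \<phi> (gam \<eta> s) (c u)) -` closure Nb"
      proof
      fix v assume "v \<in> ?V'"
      then have "\<phi> (gam \<eta> s) (c v) \<in> Nb" using W_N[OF W_fwd[OF _ cT s] TT[OF cT]] by (simp add: V_def)
      then show "v \<in> (\<lambda>u. \<phi> (gam \<eta> s) (c u)) -` closure Nb" using closure_subset by blast
    qed
    moreover have "closed ((\<lambda>u. \<phi> (gam \<eta> s) (c u)) -` closure Nb)"
      by (intro closed_vimage closed_closure continuous_on_act continuous_on_const cont_c)
    ultimately have "\<phi> (gam \<eta> s) (c u) \<in> closure Nb" using closure_minimal by blast
    moreover have "\<phi> (gam \<eta> s) (c u) \<notin> frontier Nb" using \<delta>(2)[OF TT[OF cT, of "gam \<eta> s" u]] gt by linarith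
    ultimately show ?thesis using Nb(1) by (simp add: frontier_def interior_open)
  qed
  have "closure V = UNIV"
  proof (rule laplace_flow.basin_dense[OF laplace_flow_prod[OF eta, of xs p], where ?p0.0 = "(0, 0)" and a = a and \<delta> = \<delta>])
    show "open V" unfolding V_def by (rule open_vimage[OF W_open cont_c])
    show "(0, 0) \<in> V" using pW by (simp add: V_def c00)
    show "0 < \<delta>" by (rule \<delta>(1))
    show "m \<eta> (flow_prod \<eta> xs p (s, fst (0, 0), snd (0, 0))) = a" if "0 \<le> s" for s
      using p by (simp add: flow_c c00 gfix_def[OF eta])
    show "m \<eta> (flow_prod \<eta> xs p (s, fst u, snd u)) \<le> a" if "u \<in> closure V" "0 \<le> s" for u s
      using h_le[OF that] by (simp add: flow_c)
    show "m \<eta> (flow_prod \<eta> xs p (s, fst u, snd u)) \<le> a - \<delta>" if u: "u \<in> frontier V" and s: "0 \<le> s" for u s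
    proof (rule ccontr)
      assume "\<not> ?thesis"
      then have gt: "?h s u > a - \<delta>" by (simp add: flow_c)
      have "u \<in> closure V" using u by (simp add: frontier_def)
      \<comment> \<open>A point of the closure with large \<open>m\<close> at some time is itself in
        the open basin, so it cannot be a frontier point.\<close>
      from h_N[OF this s gt] have "c u \<in> W" unfolding W_def using s gt by blast
      then have "u \<in> interior V" unfolding V_def using open_vimage[OF W_open cont_c] by (simp add: interior_open)
      then show False using u by (simp add: frontier_def)
    qed
  qed
  then have u: "(1, 0) \<in> closure V" by simp
  show "m \<eta> q \<le> a" using h_le[OF u order_refl] by (simp add: c1 ex_zero)
  show "q \<in> S" if "m \<eta> q = a"
  proof -
    have "q \<in> Nb" using h_N[OF u order_refl] that \<delta>(1) by (simp add: c1 ex_zero)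
    then show ?thesis using Q(4)[OF NQ[OF _ q] q that] by blast
  qed
qed

end

section \<open>Limits of the flow at translates of fixed points\<close>

lemma orbit_invariant: "z \<in> range (\<lambda>g. \<phi> g p) \<Longrightarrow> \<phi> g z \<in> range (\<lambda>g. \<phi> g p)"
  by (auto simp: act_mult[symmetric])

lemma orbit_rebase:
  assumes "q \<in> range (\<lambda>g. \<phi> g p)"
  shows "range (\<lambda>g. \<phi> g p) = range (\<lambda>g. \<phi> g q)"
proof -
  obtain h where h: "q = \<phi> h p" using assms by auto
  show ?thesis
  proof
    show "range (\<lambda>g. \<phi> g p) \<subseteq> range (\<lambda>g. \<phi> g q)"
    proof
      fix z assume "z \<in> range (\<lambda>g. \<phi> g p)"
      then obtain g where "z = \<phi> g p" by auto
      then have "z = \<phi> (g \<otimes> inv h) q" by (simp add: h act_mult act_inv)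
      then show "z \<in> range (\<lambda>g. \<phi> g q)" by blast
    qed
    show "range (\<lambda>g. \<phi> g q) \<subseteq> range (\<lambda>g. \<phi> g p)" using orbit_invariant[OF assms] by auto
  qed
qed

context
  fixes \<eta> :: 'e
  assumes eta: "\<eta> \<in> \<uu>"
begin

text \<open>As \<open>p\<close> is fixed, inserting \<open>gam \<eta> (- t)\<close> before it
  changes nothing, so the flow line of \<open>\<phi> g p\<close> is a family of conjugates of
  \<open>g\<close> applied to \<open>p\<close>. The limit \<open>l\<close> centralizes the flow and
  therefore preserves the value of \<open>m\<close>.\<close>

lemma conv_limit_gfix:
  assumes g: "g \<in> conv_set (j \<eta>) F" and F: "F = at_bot \<or> F = at_top" and p: "gfix \<eta> p"
  obtains l where "\<And>s. l \<otimes> gam \<eta> s = gam \<eta> s \<otimes> l" "((\<lambda>t. \<phi> (gam \<eta> t) (\<phi> g p)) \<longlongrightarrow> \<phi> l p) F"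
    "m \<eta> (\<phi> l p) = m \<eta> p"
proof -
  obtain l where l: "((\<lambda>t. gam \<eta> t \<otimes> g \<otimes> gam \<eta> (- t)) \<longlongrightarrow> l) F"
    using g unfolding conv_set_def by blast
  have c: "l \<otimes> gam \<eta> s = gam \<eta> s \<otimes> l" for s by (rule conv_limit_commutes[OF l F])
  show ?thesis
  proof (rule that[OF c])
    have "\<phi> (gam \<eta> t \<otimes> g \<otimes> gam \<eta> (- t)) p = \<phi> (gam \<eta> t) (\<phi> g p)" for t
      using p unfolding act_mult gfix_def[OF eta] by metis
    with tendsto_act[OF l tendsto_const[of p]]
    show "((\<lambda>t. \<phi> (gam \<eta> t) (\<phi> g p)) \<longlongrightarrow> \<phi> l p) F" by simp
    show "m \<eta> (\<phi> l p) = m \<eta> p" by (rule m_commuting[OF eta c p])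
  qed
qed

text \<open>The flow line is constant, so it agrees with its limit: among fixed points, a translate
  by the parabolic subgroup is already a translate by the centralizer.\<close>

lemma gfix_conv:
  assumes "g \<in> conv_set (j \<eta>) F" and F: "F = at_bot \<or> F = at_top" and p: "gfix \<eta> p" and gp: "gfix \<eta> (\<phi> g p)"
  obtains l where "\<And>s. l \<otimes> gam \<eta> s = gam \<eta> s \<otimes> l" "\<phi> g p = \<phi> l p" "m \<eta> (\<phi> g p) = m \<eta> p"
proof -
  obtain l where l: "\<And>s. l \<otimes> gam \<eta> s = gam \<eta> s \<otimes> l" "((\<lambda>t. \<phi> (gam \<eta> t) (\<phi> g p)) \<longlongrightarrow> \<phi> l p) F"
      "m \<eta> (\<phi> l p) = m \<eta> p"
    using conv_limit_gfix[OF assms(1) F p] by blast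
  have "(\<lambda>t. \<phi> (gam \<eta> t) (\<phi> g p)) = (\<lambda>t. \<phi> g p)" using gp by (simp add: gfix_def[OF eta])
  moreover have "F \<noteq> bot"
    using F trivial_limit_at_bot_linorder[where 'a = real] trivial_limit_at_top_linorder[where 'a = real] by metis
  ultimately have "\<phi> g p = \<phi> l p" using l(2) tendsto_const_iff by metis
  then show ?thesis using that l(1,3) by metis
qed

lemma tendsto_m: "(f \<longlongrightarrow> z) F \<Longrightarrow> ((\<lambda>x. m \<eta> (f x)) \<longlongrightarrow> m \<eta> z) F"
  by (rule isCont_tendsto_compose[of z "m \<eta>"])
    (use continuous_m[OF eta, of UNIV] in \<open>simp_all add: continuous_on_eq_continuous_at\<close>)

text \<open>In forward time the flow line of \<open>\<phi> h p\<close> climbs to a point where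
  \<open>m\<close> has the value \<open>m \<eta> p\<close>.\<close>

lemma m_Pm_le:
  assumes h: "h \<in> Pm \<eta>" and p: "gfix \<eta> p"
  shows "m \<eta> (\<phi> h p) \<le> m \<eta> p"
proof -
  obtain l where l: "((\<lambda>t. \<phi> (gam \<eta> t) (\<phi> h p)) \<longlongrightarrow> \<phi> l p) at_top" "m \<eta> (\<phi> l p) = m \<eta> p"
    using conv_limit_gfix[OF h _ p] by blast
  have "m \<eta> (\<phi> (gam \<eta> 0) (\<phi> h p)) \<le> m \<eta> (\<phi> l p)"
    by (rule tendsto_lowerbound[OF tendsto_m[OF l(1)] eventually_mono[OF eventually_ge_at_top[of 0]]])
      (simp_all only: m_flow_mono[OF eta] trivial_limit_at_top_linorder not_False_eq_True)
  then show ?thesis by (simp add: ex_zero l(2))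
qed

text \<open>The time-reversed counterpart: in backward time the flow line descends to the value at
  \<open>p\<close>.\<close>

lemma m_Pp_ge:
  assumes h: "h \<in> Pp \<eta>" and p: "gfix \<eta> p"
  shows "m \<eta> p \<le> m \<eta> (\<phi> h p)"
proof -
  obtain l where l: "((\<lambda>t. \<phi> (gam \<eta> t) (\<phi> h p)) \<longlongrightarrow> \<phi> l p) at_bot" "m \<eta> (\<phi> l p) = m \<eta> p"
    using conv_limit_gfix[OF h _ p] by blast
  have "m \<eta> (\<phi> l p) \<le> m \<eta> (\<phi> (gam \<eta> 0) (\<phi> h p))"
    by (rule tendsto_upperbound[OF tendsto_m[OF l(1)] eventually_mono[OF eventually_le_at_bot[of 0]]])
      (simp_all only: m_flow_mono[OF eta] trivial_limit_at_bot_linorder not_False_eq_True)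
  then show ?thesis by (simp add: ex_zero l(2))
qed

lemma Pp_orbit_invariant: "z \<in> (\<lambda>g. \<phi> g x) ` Pp \<eta> \<Longrightarrow> g \<in> Pp \<eta> \<Longrightarrow> \<phi> g z \<in> (\<lambda>g. \<phi> g x) ` Pp \<eta>"
  using conv_set_mult by (auto simp: act_mult[symmetric])

lemma Pp_orbit_base: "x \<in> (\<lambda>g. \<phi> g x) ` Pp \<eta>"
  using conv_set_one act_one[of x] by (metis imageI)

lemma Pp_orbit_rebase:
  assumes "y \<in> (\<lambda>g. \<phi> g x) ` Pp \<eta>"
  shows "(\<lambda>g. \<phi> g x) ` Pp \<eta> = (\<lambda>g. \<phi> g y) ` Pp \<eta>"
proof -
  obtain h where h: "y = \<phi> h x" "h \<in> Pp \<eta>" using assms by auto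
  show ?thesis
  proof
    show "(\<lambda>g. \<phi> g x) ` Pp \<eta> \<subseteq> (\<lambda>g. \<phi> g y) ` Pp \<eta>"
    proof
      fix z assume "z \<in> (\<lambda>g. \<phi> g x) ` Pp \<eta>"
      then obtain g where g: "z = \<phi> g x" "g \<in> Pp \<eta>" by auto
      then have "z = \<phi> (g \<otimes> inv h) y" by (simp add: h act_mult act_inv)
      then show "z \<in> (\<lambda>g. \<phi> g y) ` Pp \<eta>" using conv_set_mult[OF g(2) conv_set_inv[OF h(2)]] by blast
    qed
    show "(\<lambda>g. \<phi> g y) ` Pp \<eta> \<subseteq> (\<lambda>g. \<phi> g x) ` Pp \<eta>" using Pp_orbit_invariant[OF assms] by auto
  qed
qed

text \<open>The orbit is invariant under the flow, which belongs to the parabolic subgroup. A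
  minimum and a maximum of \<open>m\<close> on it must then be fixed points, and fixed points in one
  orbit have equal \<open>m\<close>; so \<open>m\<close> is constant and no point moves.\<close>

lemma compact_Pp_orbit_fixed:
  assumes S: "S = (\<lambda>g. \<phi> g x) ` Pp \<eta>" "compact S" and s: "s \<in> S"
  shows "gfix \<eta> s" "m \<eta> s = m \<eta> x"
proof -
  have ne: "S \<noteq> {}" using s by blast
  obtain a where a: "a \<in> S" "\<And>z. z \<in> S \<Longrightarrow> m \<eta> a \<le> m \<eta> z"
    using continuous_attains_inf[OF S(2) ne continuous_m[OF eta]] by blast
  obtain b where b: "b \<in> S" "\<And>z. z \<in> S \<Longrightarrow> m \<eta> z \<le> m \<eta> b"
    using continuous_attains_sup[OF S(2) ne continuous_m[OF eta]] by blast
  have gS: "\<phi> (gam \<eta> t) z \<in> S" if "z \<in> S" for t z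
    using Pp_orbit_invariant conv_set_ex that unfolding S(1) by blast
  have fixed: "gfix \<eta> z" if "m \<eta> (\<phi> (gam \<eta> (- 1)) z) = m \<eta> (\<phi> (gam \<eta> 0) z) \<or> m \<eta> (\<phi> (gam \<eta> 0) z) = m \<eta> (\<phi> (gam \<eta> 1) z)" for z
    using that m_constant_imp_gfix[OF eta, of "-1" 0 z] m_constant_imp_gfix[OF eta, of 0 1 z] by auto
  have le: "m \<eta> (\<phi> (gam \<eta> (- 1)) z) \<le> m \<eta> (\<phi> (gam \<eta> 0) z)" "m \<eta> (\<phi> (gam \<eta> 0) z) \<le> m \<eta> (\<phi> (gam \<eta> 1) z)" for z
    by (rule m_flow_mono[OF eta], simp)+
  have z0: "\<phi> (gam \<eta> 0) z = z" for z by (simp add: ex_zero)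
  \<comment> \<open>Flowing backwards cannot lower \<open>m\<close> below the minimum; for the
    maximum \<open>b\<close> the same is said about flowing forwards.\<close>
  have fa: "gfix \<eta> a" by (rule fixed) (use a(2)[OF gS[OF a(1)], of "-1"] le(1)[of a] z0[of a] in auto)
  have fb: "gfix \<eta> b" by (rule fixed) (use b(2)[OF gS[OF b(1)], of 1] le(2)[of b] z0[of b] in auto)
  have "b \<in> (\<lambda>g. \<phi> g a) ` Pp \<eta>" using b(1) a(1) Pp_orbit_rebase S(1) by blast
  then obtain g where g: "b = \<phi> g a" "g \<in> Pp \<eta>" by blast
  have "m \<eta> b = m \<eta> a" using gfix_conv[OF g(2) _ fa] fb g(1) by metis
  then have const: "m \<eta> z = m \<eta> a" if "z \<in> S" for z using a(2)[OF that] b(2)[OF that] by linarith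
  show "gfix \<eta> s" by (rule fixed) (use const[OF gS[OF s, of 1]] const[OF s] z0[of s] in auto)
  have "x \<in> S" unfolding S(1) by (rule Pp_orbit_base)
  from const[OF this] const[OF s] show "m \<eta> s = m \<eta> x" by simp
qed

text \<open>The set \<open>K = U S\<close> is compact, so the elements carrying \<open>x\<close>
  into \<open>K\<close> form a closed set. This set is also open, because \<open>U P\<close> is a
  neighbourhood of the unit and \<open>S\<close> is \<open>P\<close>-invariant; connectedness of the
  group concludes.\<close>

lemma compact_Pp_orbit_saturation:
  assumes S: "S = (\<lambda>g. \<phi> g x) ` Pp \<eta>" "compact S"
  shows "compact (range (\<lambda>g. \<phi> g x))"
proof -
  define K where "K = (\<lambda>p. \<phi> (fst p) (snd p)) ` (U \<times> S)"
  have K: "compact K"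
    unfolding K_def
    by (intro compact_continuous_image continuous_on_act continuous_on_fst continuous_on_snd continuous_on_id
        compact_Times compact_U S(2))
  have UK: "\<phi> u z \<in> K" if u: "u \<in> U" and z: "z \<in> K" for u z
  proof -
    obtain v s where v: "v \<in> U" "s \<in> S" "z = \<phi> v s" using z by (auto simp: K_def)
    then have "\<phi> u z = \<phi> (u \<otimes> v) s" by (simp add: act_mult)
    then show ?thesis unfolding K_def using U_mult[OF u v(1)] v(2) by force
  qed
  have xS: "x \<in> S" unfolding S(1) by (rule Pp_orbit_base)
  have SK: "S \<subseteq> K" unfolding K_def using U_one act_one by force
  obtain V where V: "open V" "\<one> \<in> V" "\<And>g. g \<in> V \<Longrightarrow> \<exists>h\<in>U. \<exists>k\<in>Pp \<eta>. g = h \<otimes> k"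
    by (rule U_Pp_neighbourhood[OF eta]) blast
  have VK: "\<phi> g s \<in> K" if g: "g \<in> V" and s: "s \<in> S" for g s
  proof -
    obtain h k where hk: "h \<in> U" "k \<in> Pp \<eta>" "g = h \<otimes> k" using V(3)[OF g] by blast
    have "\<phi> k s \<in> S" using Pp_orbit_invariant hk(2) s unfolding S(1) by blast
    then show ?thesis using UK[OF hk(1)] SK by (auto simp: hk(3) act_mult)
  qed
  let ?H = "{g. \<phi> g x \<in> K}"
  have cl: "closed ?H"
    using closed_vimage[OF compact_imp_closed[OF K] continuous_act_point[of UNIV x]] by (simp add: vimage_def)
  have op: "open ?H"
  proof (subst open_subopen, intro ballI)
    fix g assume "g \<in> ?H"
    then obtain u s where u: "u \<in> U" "s \<in> S" "\<phi> g x = \<phi> u s" by (auto simp: K_def)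
    \<comment> \<open>With \<open>\<phi> g x = \<phi> u s\<close>, the point
      \<open>\<phi> h x\<close> equals \<open>u (u\<inverse> h g\<inverse> u) s\<close>, and the
      bracket is close to the unit when \<open>h\<close> is close to \<open>g\<close>.\<close>
    let ?W = "{h. inv u \<otimes> (h \<otimes> inv g) \<otimes> u \<in> V}"
    have "continuous_on UNIV (\<lambda>h. inv u \<otimes> (h \<otimes> inv g) \<otimes> u)"
      by (intro continuous_on_mult_group continuous_on_const continuous_on_id)
    from open_vimage[OF V(1) this] have "open ?W" by (simp add: vimage_def)
    moreover have "g \<in> ?W" using V(2) by simp
    moreover have "?W \<subseteq> ?H"
    proof
      fix h assume "h \<in> ?W"
      then have "\<phi> (inv u \<otimes> (h \<otimes> inv g) \<otimes> u) s \<in> K" using VK u(2) by blast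
      then have "\<phi> u (\<phi> (inv u) (\<phi> h (\<phi> (inv g) (\<phi> u s)))) \<in> K" using UK[OF u(1)] by (simp add: act_mult)
      then show "h \<in> ?H" by (simp add: act_inv u(3)[symmetric])
    qed
    ultimately show "\<exists>T. open T \<and> g \<in> T \<and> T \<subseteq> ?H" by blast
  qed
  have "\<one> \<in> ?H" using xS SK by auto
  moreover have "open (- ?H)" using cl by (simp add: open_Compl)
  ultimately have H: "?H = UNIV" using clopen_eq_UNIV[OF connected_G op] by blast
  have "K \<subseteq> range (\<lambda>g. \<phi> g x)" unfolding K_def S(1) by (auto simp: act_mult[symmetric])
  then have "range (\<lambda>g. \<phi> g x) = K" using H by auto
  then show ?thesis using K by simp
qed

text \<open>A point of \<open>T\<close> near \<open>S\<close> is \<open>h s'\<close> with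
  \<open>h\<close> in the opposite parabolic subgroup and \<open>s'\<close> a fixed point in
  \<open>S\<close>. Hence \<open>m\<close> is at most its value on \<open>S\<close>, and equality
  forces a fixed point reached from \<open>s'\<close> by the centralizer, that is a point of
  \<open>S\<close>. This is the local statement that the basin argument makes global.\<close>

lemma compact_Pp_orbit_max:
  assumes S: "S = (\<lambda>g. \<phi> g x) ` Pp \<eta>" "compact S"
  defines "T \<equiv> range (\<lambda>g. \<phi> g x)"
  shows "compact T" "S = {q \<in> T. \<forall>z\<in>T. m \<eta> z \<le> m \<eta> q}"
proof -
  show T: "compact T" unfolding T_def by (rule compact_Pp_orbit_saturation[OF S])
  have ST: "S \<subseteq> T" unfolding S(1) T_def by blast
  have xS: "x \<in> S" unfolding S(1) by (rule Pp_orbit_base)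
  note fixed = compact_Pp_orbit_fixed[OF S]
  \<comment> \<open>Goodness passes to unions, so neighbourhoods of the single points of
    \<open>S\<close> can be merged into one of all of \<open>S\<close>.\<close>
  let ?good = "\<lambda>Q. open Q \<and> (\<forall>z\<in>Q \<inter> T. m \<eta> z \<le> m \<eta> x \<and> (m \<eta> z = m \<eta> x \<longrightarrow> z \<in> S))"
  obtain V where V: "open V" "\<one> \<in> V" "\<And>g. g \<in> V \<Longrightarrow> \<exists>h\<in>Pm \<eta>. \<exists>k\<in>Pp \<eta>. g = h \<otimes> k"
    by (rule Pm_Pp_neighbourhood[OF eta]) blast
  have nbhd: "\<exists>Q. ?good Q \<and> s \<in> Q" if s: "s \<in> S" for s
  proof -
    have Ts: "T = range (\<lambda>g. \<phi> g s)" unfolding T_def using s ST by (intro orbit_rebase) (auto simp: T_def)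
    obtain Q where Q: "open Q" "s \<in> Q" "\<And>z. z \<in> Q \<Longrightarrow> z \<in> T \<Longrightarrow> \<exists>g\<in>V. z = \<phi> g s"
      by (rule orbit_map_open[OF Ts T V(1,2)]) blast
    have "m \<eta> z \<le> m \<eta> x \<and> (m \<eta> z = m \<eta> x \<longrightarrow> z \<in> S)" if z: "z \<in> Q \<inter> T" for z
    proof -
      obtain g where g: "g \<in> V" "z = \<phi> g s" using Q(3) z by blast
      obtain h k where hk: "h \<in> Pm \<eta>" "k \<in> Pp \<eta>" "g = h \<otimes> k" using V(3)[OF g(1)] by blast
      define s' where "s' = \<phi> k s"
      have s': "s' \<in> S" using Pp_orbit_invariant s hk(2) unfolding S(1) s'_def by blast
      have zs: "z = \<phi> h s'" by (simp add: g(2) hk(3) act_mult s'_def)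
      \<comment> \<open>Stated for all \<open>f\<close> in the opposite subgroup: the unit bounds
        \<open>m\<close> at \<open>z\<close>, and \<open>gam \<eta> 1\<close> bounds it at the point
        to which \<open>z\<close> flows in time 1.\<close>
      have le: "m \<eta> (\<phi> f z) \<le> m \<eta> x" if "f \<in> Pm \<eta>" for f
        using m_Pm_le[OF conv_set_mult[OF that hk(1)] fixed(1)[OF s']] fixed(2)[OF s'] by (simp add: zs act_mult)
      have 1: "m \<eta> z \<le> m \<eta> x" using le[OF conv_set_one] by simp
      have 2: "z \<in> S" if eq: "m \<eta> z = m \<eta> x"
      proof -
        have "m \<eta> (\<phi> (gam \<eta> 0) z) \<le> m \<eta> (\<phi> (gam \<eta> 1) z)" by (rule m_flow_mono[OF eta]) simp
        then have "m \<eta> (\<phi> (gam \<eta> 0) z) = m \<eta> (\<phi> (gam \<eta> 1) z)"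
          using le[OF conv_set_ex[of 1]] eq by (simp add: ex_zero)
        from m_constant_imp_gfix[OF eta _ this] have "gfix \<eta> z" by simp
        then obtain l where l: "\<And>s. l \<otimes> gam \<eta> s = gam \<eta> s \<otimes> l" "z = \<phi> l s'"
          using gfix_conv[OF hk(1) _ fixed(1)[OF s']] zs by metis
        show "z \<in> S" using Pp_orbit_invariant[OF s'[unfolded S(1)] conv_set_commuting[OF l(1)]] l(2) S(1) by simp
      qed
      show ?thesis using 1 2 by blast
    qed
    then show ?thesis using Q(1,2) by blast
  qed
  from nbhd have "\<forall>s\<in>S. \<exists>Q. ?good Q \<and> s \<in> Q" by (rule ballI)
  then obtain Qf where Qf: "\<forall>s\<in>S. ?good (Qf s) \<and> s \<in> Qf s" by (rule bchoice[THEN exE])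
  define Q where "Q = (\<Union>s\<in>S. Qf s)"
  have opQ: "open Q" unfolding Q_def using Qf by (intro open_UN) simp
  have SQ: "S \<subseteq> Q" unfolding Q_def using Qf by fast
  have Q: "m \<eta> z \<le> m \<eta> x" "m \<eta> z = m \<eta> x \<Longrightarrow> z \<in> S" if z: "z \<in> Q" "z \<in> T" for z
  proof -
    obtain s where "s \<in> S" "z \<in> Qf s" using z(1) unfolding Q_def by (rule UN_E)
    then show "m \<eta> z \<le> m \<eta> x" "m \<eta> z = m \<eta> x \<Longrightarrow> z \<in> S" using Qf z(2) by simp_all
  qed
  have Tx: "T = range (\<lambda>g. \<phi> g x)" by (rule T_def[THEN meta_eq_to_obj_eq])
  have max: "m \<eta> q \<le> m \<eta> x" "m \<eta> q = m \<eta> x \<Longrightarrow> q \<in> S" if q: "q \<in> T" for q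
  proof -
    note Q' = eta Tx T S(2) ST xS fixed(1)[OF xS] refl opQ SQ
    show "m \<eta> q \<le> m \<eta> x"
      by (rule local_max_global(1)[OF Q'(1-8) _ Q'(9,10) _ _ q]) (rule fixed(2) Q; assumption)+
    show "q \<in> S" if "m \<eta> q = m \<eta> x"
      by (rule local_max_global(2)[OF Q'(1-8) _ Q'(9,10) _ _ q that]) (rule fixed(2) Q; assumption)+
  qed
  show "S = {q \<in> T. \<forall>z\<in>T. m \<eta> z \<le> m \<eta> q}"
  proof (rule equalityI; rule subsetI)
    fix q assume q: "q \<in> S"
    then show "q \<in> {q \<in> T. \<forall>z\<in>T. m \<eta> z \<le> m \<eta> q}" using max(1) ST fixed(2)[OF q] by auto
  next
    fix q assume q: "q \<in> {q \<in> T. \<forall>z\<in>T. m \<eta> z \<le> m \<eta> q}"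
    then have "m \<eta> x \<le> m \<eta> q" using xS ST by blast
    then show "q \<in> S" using max(1)[of q] max(2)[of q] q by simp
  qed
qed

text \<open>The maximum set \<open>M'\<close> is compact and \<open>P\<close>-invariant. Its
  \<open>P\<close>-orbits are relatively open: between nearby fixed points the factor in the
  opposite subgroup may be replaced by its limit in the centralizer, which belongs to
  \<open>P\<close>. An orbit is closed because the other orbits cover its complement in
  \<open>M'\<close>.\<close>

lemma compact_orbit_contains_Pp_orbit:
  assumes T: "T = range (\<lambda>g. \<phi> g x)" "compact T"
  obtains p where "p \<in> T" "compact ((\<lambda>g. \<phi> g p) ` Pp \<eta>)"
proof -
  have TT: "\<phi> g z \<in> T" if "z \<in> T" for g z using orbit_invariant that unfolding T(1) .
  have ne: "T \<noteq> {}" using T(1) by blast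
  obtain p where p: "p \<in> T" "\<And>z. z \<in> T \<Longrightarrow> m \<eta> z \<le> m \<eta> p"
    using continuous_attains_sup[OF T(2) ne continuous_m[OF eta]] by blast
  define M' where "M' = {z \<in> T. m \<eta> z = m \<eta> p}"
  have "closed {z. m \<eta> z = m \<eta> p}" by (intro closed_Collect_eq continuous_m[OF eta] continuous_on_const)
  then have M': "compact M'" using compact_Int_closed[OF T(2)] by (simp add: M'_def Collect_conj_eq)
  have fixed: "gfix \<eta> z" if z: "z \<in> M'" for z
  proof (rule m_constant_imp_gfix[OF eta])
    show "m \<eta> (\<phi> (gam \<eta> 0) z) = m \<eta> (\<phi> (gam \<eta> 1) z)"
      using m_flow_mono[OF eta, of 0 1 z] p(2)[OF TT, of z "gam \<eta> 1"] z by (simp add: ex_zero M'_def)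
  qed simp
  \<comment> \<open>\<open>P\<close> cannot lower \<open>m\<close> at a fixed point, and the maximum
    cannot be exceeded.\<close>
  have inv_M: "\<phi> g z \<in> M'" if g: "g \<in> Pp \<eta>" and z: "z \<in> M'" for g z
    using m_Pp_ge[OF g fixed[OF z]] p(2)[OF TT, of z g] TT z by (simp add: M'_def)
  let ?S = "(\<lambda>g. \<phi> g p) ` Pp \<eta>"
  have pM: "p \<in> M'" using p(1) by (simp add: M'_def)
  have SM: "?S \<subseteq> M'" using inv_M pM by blast
  obtain V where V: "open V" "\<one> \<in> V" "\<And>g. g \<in> V \<Longrightarrow> \<exists>h\<in>Pm \<eta>. \<exists>k\<in>Pp \<eta>. g = h \<otimes> k"
    by (rule Pm_Pp_neighbourhood[OF eta]) blast
  \<comment> \<open>The neighbourhood is taken at a point \<open>q\<close> of another orbit; if it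
    met \<open>?S\<close>, the element \<open>l \<otimes> k\<close> of \<open>P\<close> would carry
    \<open>q\<close> into \<open>?S\<close>.\<close>
  have nbhd: "\<exists>Q. (open Q \<and> Q \<inter> ?S = {}) \<and> q \<in> Q" if q: "q \<in> M' - ?S" for q
  proof -
    have Tq: "T = range (\<lambda>g. \<phi> g q)" unfolding T(1) using q by (intro orbit_rebase) (auto simp: M'_def T(1))
    obtain Q where Q: "open Q" "q \<in> Q" "\<And>z. z \<in> Q \<Longrightarrow> z \<in> T \<Longrightarrow> \<exists>g\<in>V. z = \<phi> g q"
      by (rule orbit_map_open[OF Tq T(2) V(1,2)]) blast
    have False if z: "z \<in> Q" "z \<in> ?S" for z
    proof -
      have zM: "z \<in> M'" using SM z(2) by blast
      then obtain g where g: "g \<in> V" "z = \<phi> g q" using Q(3)[OF z(1)] by (auto simp: M'_def)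
      obtain h k where hk: "h \<in> Pm \<eta>" "k \<in> Pp \<eta>" "g = h \<otimes> k" using V(3)[OF g(1)] by blast
      have kq: "gfix \<eta> (\<phi> k q)" using fixed inv_M[OF hk(2)] q by blast
      have zh: "z = \<phi> h (\<phi> k q)" by (simp add: g(2) hk(3) act_mult)
      obtain l where l: "\<And>s. l \<otimes> gam \<eta> s = gam \<eta> s \<otimes> l" "z = \<phi> l (\<phi> k q)"
        using gfix_conv[OF hk(1) _ kq] fixed[OF zM] zh by metis
      have "inv (l \<otimes> k) \<in> Pp \<eta>" by (rule conv_set_inv[OF conv_set_mult[OF conv_set_commuting[OF l(1)] hk(2)]])
      from Pp_orbit_invariant[OF z(2) this] have "\<phi> (inv (l \<otimes> k)) (\<phi> (l \<otimes> k) q) \<in> ?S"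
        by (simp only: l(2) act_mult[of l k])
      then show False using q by (simp add: act_inv)
    qed
    then show ?thesis using Q(1,2) by blast
  qed
  let ?W = "\<Union>{Q. open Q \<and> Q \<inter> ?S = {}}"
  have "open ?W" by (rule open_Union) blast
  then have "compact (M' - ?W)" by (rule compact_diff[OF M'])
  moreover have "M' - ?W = ?S" using nbhd SM by blast
  ultimately show ?thesis using that p(1) by simp
qed

text \<open>The bijection sends a compact orbit of the group to its maximum set. This set contains a
  compact \<open>P\<close>-orbit, which in turn is the whole maximum set of its saturation, so the
  two agree. The records \<open>H\<close> and \<open>H'\<close> have arbitrary extensions and enter
  through their carriers, which lets \<open>G\<close> with a changed carrier stand for
  \<open>P\<close>.\<close>

lemma compact_orbits_correspondence:
  fixes H :: "('g, 'x) monoid_scheme" and H' :: "('g, 'y) monoid_scheme"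
  assumes H: "carrier H = Pp \<eta>" and H': "carrier H' = UNIV"
  shows "compact_orbits H \<phi> \<approx> compact_orbits H' \<phi>"
    and "S \<in> compact_orbits H \<phi> \<Longrightarrow> \<exists>T\<in>compact_orbits H' \<phi>. S = {q \<in> T. \<forall>z\<in>T. m \<eta> z \<le> m \<eta> q}"
proof -
  have oH: "S \<in> compact_orbits H \<phi> \<longleftrightarrow> (\<exists>x. S = (\<lambda>g. \<phi> g x) ` Pp \<eta>) \<and> compact S" for S
    by (auto simp: compact_orbits_def orbits_def orbit_def H image_def Bex_def conj_commute)
  have oH': "T \<in> compact_orbits H' \<phi> \<longleftrightarrow> (\<exists>x. T = range (\<lambda>g. \<phi> g x)) \<and> compact T" for T
    by (auto simp: compact_orbits_def orbits_def orbit_def H' image_def)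
  define mx where "mx = (\<lambda>T. {q \<in> T. \<forall>z\<in>T. m \<eta> z \<le> m \<eta> q})"
  have lower: "\<exists>T\<in>compact_orbits H' \<phi>. S = mx T" if S: "S \<in> compact_orbits H \<phi>" for S
  proof -
    obtain x where x: "S = (\<lambda>g. \<phi> g x) ` Pp \<eta>" "compact S" using S oH by blast
    show ?thesis
    proof
      show "S = mx (range (\<lambda>g. \<phi> g x))" unfolding mx_def by (rule compact_Pp_orbit_max(2)[OF x])
      show "range (\<lambda>g. \<phi> g x) \<in> compact_orbits H' \<phi>" using oH' compact_Pp_orbit_max(1)[OF x] by blast
    qed
  qed
  have upper: "mx T \<in> compact_orbits H \<phi>" if T: "T \<in> compact_orbits H' \<phi>" for T
  proof -
    obtain x where x: "T = range (\<lambda>g. \<phi> g x)" "compact T" using T oH' by blast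
    obtain p where p: "p \<in> T" "compact ((\<lambda>g. \<phi> g p) ` Pp \<eta>)" by (rule compact_orbit_contains_Pp_orbit[OF x])
    have "T = range (\<lambda>g. \<phi> g p)" using orbit_rebase p(1) unfolding x(1) .
    with compact_Pp_orbit_max(2)[OF refl p(2)] have "(\<lambda>g. \<phi> g p) ` Pp \<eta> = mx T" by (simp add: mx_def)
    with p(2) show ?thesis unfolding oH by auto
  qed
  \<comment> \<open>Orbits with the same maximum set share a point, as a maximum set is a
    \<open>P\<close>-orbit and therefore nonempty.\<close>
  have inj: "inj_on mx (compact_orbits H' \<phi>)"
  proof (rule inj_onI)
    fix T T' assume TT: "T \<in> compact_orbits H' \<phi>" "T' \<in> compact_orbits H' \<phi>" "mx T = mx T'"
    obtain w where "mx T = (\<lambda>g. \<phi> g w) ` Pp \<eta>" using upper[OF TT(1)] oH by blast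
    then have w: "w \<in> mx T" using Pp_orbit_base by simp
    have sub: "mx T \<subseteq> T" for T unfolding mx_def by (rule Collect_restrict)
    have p: "w \<in> T" "w \<in> T'" by (rule subsetD[OF sub w], rule subsetD[OF sub w[unfolded TT(3)]])
    obtain x where x: "T = range (\<lambda>g. \<phi> g x)" using TT(1)[unfolded oH'] by (elim conjE exE)
    obtain y where y: "T' = range (\<lambda>g. \<phi> g y)" using TT(2)[unfolded oH'] by (elim conjE exE)
    show "T = T'"
      unfolding x y using orbit_rebase[OF p(1)[unfolded x]] orbit_rebase[OF p(2)[unfolded y]] by (rule trans[OF _ sym])
  qed
  have "mx ` compact_orbits H' \<phi> = compact_orbits H \<phi>" using lower upper by blast
  with inj have "bij_betw mx (compact_orbits H' \<phi>) (compact_orbits H \<phi>)" by (simp add: bij_betw_def)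
  then show "compact_orbits H \<phi> \<approx> compact_orbits H' \<phi>" using eqpoll_sym unfolding eqpoll_def by blast
  show "S \<in> compact_orbits H \<phi> \<Longrightarrow> \<exists>T\<in>compact_orbits H' \<phi>. S = {q \<in> T. \<forall>z\<in>T. m \<eta> z \<le> m \<eta> q}"
    using lower unfolding mx_def .
qed

end

end

theorem corollary1p0p1:
  fixes G :: "'g::{t2_space, second_countable_topology} monoid"
    and jG :: "'e::real_normed_vector \<Rightarrow> 'e"
    and AG :: "('g, 'e) chart set"
    and U :: "'g set"
    and jZ :: "'f::real_normed_vector \<Rightarrow> 'f"
    and AZ :: "('z::{t2_space, second_countable_topology}, 'f) chart set"
    and \<omega> :: "'z \<Rightarrow> 'f \<Rightarrow> 'f \<Rightarrow> real"
    and \<phi> :: "'g \<Rightarrow> 'z \<Rightarrow> 'z"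
    and \<mu> :: "'z \<Rightarrow> 'e \<Rightarrow> real"
    and \<beta> :: 'e
  assumes "complexification G jG AG U"
    and "kaehler_manifold jZ AZ \<omega>"
    and "holomorphic_action G jG AG jZ AZ \<phi>"
    and "invariant_form U AZ \<phi> \<omega>"
    and "momentum_map G AG U AZ \<phi> \<omega> \<mu>"
    and "\<beta> \<in> jG ` lie_algebra_of G AG U"
  shows "compact_orbits (G\<lparr>carrier := parabolic_plus G AG \<beta>\<rparr>) \<phi> \<approx> compact_orbits G \<phi> \<and>
    (\<forall>S \<in> compact_orbits (G\<lparr>carrier := parabolic_plus G AG \<beta>\<rparr>) \<phi>.
       \<exists>T \<in> compact_orbits G \<phi>. S = max_set jG \<mu> T \<beta>)"
proof -
  have clg: "complex_lie_group G jG AG" using assms(1) by (simp add: complexification_def)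
  interpret K: kaehler_action G jG AG U jZ AZ \<omega> \<phi> \<mu>
    by unfold_locales (use assms clg in auto)
  obtain \<eta> where eta: "\<eta> \<in> lie_algebra_of G AG U" and beta: "\<beta> = jG \<eta>" using assms(6) by blast
  have eta': "\<eta> \<in> K.\<uu>" using eta by (simp add: K.\<uu>_def)
  have 1: "carrier (G\<lparr>carrier := parabolic_plus G AG \<beta>\<rparr>) = K.conv_set (jG \<eta>) at_bot"
    by (simp add: K.parabolic_plus_conv_set beta)
  have 2: "carrier G = UNIV" using clg by (simp add: complex_lie_group_def)
  \<comment> \<open>For \<open>\<beta> = i\<eta>\<close> the vector \<open>- i\<beta>\<close> is
    \<open>\<eta>\<close> itself.\<close>
  have 3: "max_set jG \<mu> T \<beta> = {q \<in> T. \<forall>z\<in>T. \<mu> z \<eta> \<le> \<mu> q \<eta>}" for T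
    by (simp add: max_set_def beta complex_structureD(2)[OF K.cs])
  show ?thesis
    unfolding 3
    using K.compact_orbits_correspondence[OF eta' 1 2] by blast
qed

end
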